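(* Let $\mathbf{k}$ be an algebraically closed field of characteristic $p>2$, let $\mathcal{C}$ be a symmetric fusion category over $\mathbf{k}$ with Verlinde fiber functor $F:\mathcal{C}\to\mathrm{Ver}_p$, let $X\in\mathcal{C}$, and write $F(X)=\bigoplus_{r=1}^{p-1}a_rL_r$ with multiplicities $a_r\in\mathbb{Z}_{\ge 0}$. Then for $1\le r\le p-1$ $$a_r=\frac{1}{2p}\mathrm{Tr}\left((q^{-r}-q^r)(q-q^{-1})\left(\mathrm{FPdim}(X)-(-1)^r\mathrm{SFPdim}(X)\right)\right).$$ In other words, for $r$ odd $$a_r=\frac1p\mathrm{Tr}\left((q^{-r}-q^r)(q-q^{-1})d_+(X)\right),$$ and for $r$ even $$a_r=\frac1p\mathrm{Tr}\left((q^{-r}-q^r)(q-q^{-1})d_-(X)\right).$$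
   Context: A symmetric fusion category over $\mathbf{k}$ is a semisimple $\mathbf{k}$-linear rigid symmetric monoidal abelian category with finitely many simple objects, finite dimensional Hom spaces, bilinear tensor product, and $\mathrm{End}(\mathbf{1})=\mathbf{k}$. $\mathrm{FPdim}$ denotes Frobenius-Perron dimension. The Verlinde category $\mathrm{Ver}_p$ is the quotient of $\mathrm{Rep}_{\mathbf{k}}(\mathbb{Z}/p\mathbb{Z})$ by the tensor ideal of negligible morphisms (those $f:X\to Y$ with $\mathrm{Tr}(fg)=0$ for all $g:Y\to X$). It is a symmetric fusion category with simple objects $\mathbf{1}=L_1,\dots,L_{p-1}$ ($L_r$ is the image of the indecomposable representation of dimension $r$), and $L_r\otimes L_s\cong\bigoplus_{i=1}^{\min(r,s,p-r,p-s)}L_{|r-s|+2i-1}$. $\mathrm{Ver}_p^+$ (resp. $\mathrm{Ver}_p^-$) is the full abelian subcategory of direct sums of $L_i$ with $i$ odd (resp. even). The Verlinde fiber functor $F$ is a symmetric tensor functor $\mathcal{C}\to\mathrm{Ver}_p$; it exists and is unique up to isomorphism. Write $F(X)=F(X)^+\oplus F(X)^-$ with $F(X)^\pm\in\mathrm{Ver}_p^\pm$, and set $d_\pm(X)=\mathrm{FPdim}(F(X)^\pm)$ and $\mathrm{SFPdim}(X)=d_+(X)-d_-(X)$ (the super Frobenius-Perron dimension). Let $q=e^{\pi i/p}$ and $K=\mathbb{Q}(q)\cap\mathbb{R}$; all the dimensions above lie in $K$. $\mathrm{Tr}:K\to\mathbb{Q}$ is the field trace, $\mathrm{Tr}(x)=\sum_{s=0}^{(p-3)/2}g_s(x)$,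 where $g_s$ is the restriction to $K$ of the automorphism of $\mathbb{Q}(q)$ sending $q$ to $q^{2s+1}$. *)

theory Defs
  imports
    "HOL-Algebra.Elementary_Groups"
    "Jordan_Normal_Form.Jordan_Normal_Form_Existence"
begin

section \<open>Linear symmetric monoidal categories\<close>

text \<open>Arrows carry their domain and codomain.  \<open>assoc x y z\<close> goes from \<open>(x \<boxtimes> y) \<boxtimes> z\<close> to
  \<open>x \<boxtimes> (y \<boxtimes> z)\<close>, \<open>lunit x\<close> and \<open>runit x\<close> go from \<open>\<I> \<boxtimes> x\<close> and \<open>x \<boxtimes> \<I>\<close> to \<open>x\<close>, and
  \<open>g \<cdot> f\<close> is ``\<open>g\<close> after \<open>f\<close>''.\<close>

record ('o, 'm, 'k) lin_mon_cat =
  obj :: "'o set"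
  arr :: "'m set"
  src :: "'m \<Rightarrow> 'o"
  trg :: "'m \<Rightarrow> 'o"
  idt :: "'o \<Rightarrow> 'm"
  cmp :: "'m \<Rightarrow> 'm \<Rightarrow> 'm" (infixr "\<cdot>\<index>" 70)
  nul :: "'o \<Rightarrow> 'o \<Rightarrow> 'm"
  plu :: "'m \<Rightarrow> 'm \<Rightarrow> 'm" (infixl "\<boxplus>\<index>" 65)
  scl :: "'k \<Rightarrow> 'm \<Rightarrow> 'm" (infixr "\<triangleright>\<index>" 75)
  unt :: "'o" ("\<I>\<index>")
  tno :: "'o \<Rightarrow> 'o \<Rightarrow> 'o" (infixr "\<boxtimes>\<index>" 80)
  tnm :: "'m \<Rightarrow> 'm \<Rightarrow> 'm" (infixr "\<star>\<index>" 80)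
  assoc :: "'o \<Rightarrow> 'o \<Rightarrow> 'o \<Rightarrow> 'm"
  lunit :: "'o \<Rightarrow> 'm"
  runit :: "'o \<Rightarrow> 'm"
  braid :: "'o \<Rightarrow> 'o \<Rightarrow> 'm"

definition Hom :: "('o, 'm, 'k) lin_mon_cat \<Rightarrow> 'o \<Rightarrow> 'o \<Rightarrow> 'm set" where
  "Hom C x y = {f \<in> arr C. src C f = x \<and> trg C f = y}"

definition lincomb_sum :: "('o, 'm, 'k) lin_mon_cat \<Rightarrow> 'o \<Rightarrow> 'o \<Rightarrow> 'm list \<Rightarrow> 'm" where
  "lincomb_sum C x y fs = foldr (plu C) fs (nul C x y)"

definition inverse_arrows :: "('o, 'm, 'k) lin_mon_cat \<Rightarrow> 'm \<Rightarrow> 'm \<Rightarrow> bool" where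
  "inverse_arrows C f g \<longleftrightarrow> f \<in> arr C \<and> g \<in> Hom C (trg C f) (src C f) \<and>
     cmp C g f = idt C (src C f) \<and> cmp C f g = idt C (trg C f)"

definition is_iso :: "('o, 'm, 'k) lin_mon_cat \<Rightarrow> 'm \<Rightarrow> bool" where
  "is_iso C f \<longleftrightarrow> (\<exists>g. inverse_arrows C f g)"

definition isomorphic :: "('o, 'm, 'k) lin_mon_cat \<Rightarrow> 'o \<Rightarrow> 'o \<Rightarrow> bool" where
  "isomorphic C x y \<longleftrightarrow> (\<exists>f \<in> Hom C x y. is_iso C f)"

definition zero_obj :: "('o, 'm, 'k) lin_mon_cat \<Rightarrow> 'o \<Rightarrow> bool" where
  "zero_obj C x \<longleftrightarrow> x \<in> obj C \<and> idt C x = nul C x x"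

text \<open>\<open>x\<close> is a direct sum of the objects in the list \<open>xs\<close>; for \<open>xs = []\<close> this says that \<open>x\<close>
  is a zero object.\<close>

definition is_direct_sum :: "('o, 'm, 'k) lin_mon_cat \<Rightarrow> 'o \<Rightarrow> 'o list \<Rightarrow> bool" where
  "is_direct_sum C x xs \<longleftrightarrow> x \<in> obj C \<and> set xs \<subseteq> obj C \<and>
     (\<exists>is ps. length is = length xs \<and> length ps = length xs \<and>
        (\<forall>i < length xs. is ! i \<in> Hom C (xs ! i) x \<and> ps ! i \<in> Hom C x (xs ! i)) \<and>
        (\<forall>i < length xs. \<forall>j < length xs. cmp C (ps ! i) (is ! j) =
           (if i = j then idt C (xs ! i) else nul C (xs ! j) (xs ! i))) \<and>
        lincomb_sum C x x (map2 (cmp C) is ps) = idt C x)"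

definition is_mono :: "('o, 'm, 'k) lin_mon_cat \<Rightarrow> 'm \<Rightarrow> bool" where
  "is_mono C f \<longleftrightarrow> f \<in> arr C \<and>
     (\<forall>w. \<forall>g \<in> Hom C w (src C f). \<forall>h \<in> Hom C w (src C f). cmp C f g = cmp C f h \<longrightarrow> g = h)"

definition is_epi :: "('o, 'm, 'k) lin_mon_cat \<Rightarrow> 'm \<Rightarrow> bool" where
  "is_epi C f \<longleftrightarrow> f \<in> arr C \<and>
     (\<forall>w. \<forall>g \<in> Hom C (trg C f) w. \<forall>h \<in> Hom C (trg C f) w. cmp C g f = cmp C h f \<longrightarrow> g = h)"

definition is_kernel :: "('o, 'm, 'k) lin_mon_cat \<Rightarrow> 'm \<Rightarrow> 'm \<Rightarrow> bool" where
  "is_kernel C k f \<longleftrightarrow> k \<in> arr C \<and> f \<in> arr C \<and> trg C k = src C f \<and>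
     cmp C f k = nul C (src C k) (trg C f) \<and>
     (\<forall>w. \<forall>h \<in> Hom C w (src C f). cmp C f h = nul C w (trg C f) \<longrightarrow>
        (\<exists>!u. u \<in> Hom C w (src C k) \<and> cmp C k u = h))"

definition is_cokernel :: "('o, 'm, 'k) lin_mon_cat \<Rightarrow> 'm \<Rightarrow> 'm \<Rightarrow> bool" where
  "is_cokernel C c f \<longleftrightarrow> c \<in> arr C \<and> f \<in> arr C \<and> src C c = trg C f \<and>
     cmp C c f = nul C (src C f) (trg C c) \<and>
     (\<forall>w. \<forall>h \<in> Hom C (trg C f) w. cmp C h f = nul C (src C f) w \<longrightarrow>
        (\<exists>!u. u \<in> Hom C (trg C c) w \<and> cmp C u c = h))"

definition simple_obj :: "('o, 'm, 'k) lin_mon_cat \<Rightarrow> 'o \<Rightarrow> bool" where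
  "simple_obj C x \<longleftrightarrow> x \<in> obj C \<and> \<not> zero_obj C x \<and>
     (\<forall>f. is_mono C f \<and> trg C f = x \<longrightarrow> zero_obj C (src C f) \<or> is_iso C f)"

definition indecomposable_obj :: "('o, 'm, 'k) lin_mon_cat \<Rightarrow> 'o \<Rightarrow> bool" where
  "indecomposable_obj C x \<longleftrightarrow> x \<in> obj C \<and> \<not> zero_obj C x \<and>
     (\<forall>y z. is_direct_sum C x [y, z] \<longrightarrow> zero_obj C y \<or> zero_obj C z)"

definition left_dual ::
    "('o, 'm, 'k) lin_mon_cat \<Rightarrow> 'o \<Rightarrow> 'o \<Rightarrow> bool" where
  "left_dual C d x \<longleftrightarrow> d \<in> obj C \<and> x \<in> obj C \<and>
     (\<exists>ev \<in> Hom C (tno C d x) (unt C). \<exists>coev \<in> Hom C (unt C) (tno C x d).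
        cmp C (runit C x) (cmp C (tnm C (idt C x) ev)
          (cmp C (assoc C x d x) (tnm C coev (idt C x)))) = lunit C x \<and>
        (\<exists>a. inverse_arrows C (assoc C d x d) a \<and>
           cmp C (lunit C d) (cmp C (tnm C ev (idt C d))
             (cmp C a (tnm C (idt C d) coev))) = runit C d))"

locale linear_category =
  fixes C :: "('o, 'm, 'k :: field) lin_mon_cat" (structure)
  assumes src_obj: "f \<in> arr C \<Longrightarrow> src C f \<in> obj C"
    and trg_obj: "f \<in> arr C \<Longrightarrow> trg C f \<in> obj C"
    and idt_hom: "x \<in> obj C \<Longrightarrow> idt C x \<in> Hom C x x"
    and cmp_hom: "f \<in> Hom C x y \<Longrightarrow> g \<in> Hom C y z \<Longrightarrow> g \<cdot> f \<in> Hom C x z"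
    and cmp_idt: "f \<in> Hom C x y \<Longrightarrow> f \<cdot> idt C x = f"
    and idt_cmp: "f \<in> Hom C x y \<Longrightarrow> idt C y \<cdot> f = f"
    and cmp_assoc: "f \<in> Hom C w x \<Longrightarrow> g \<in> Hom C x y \<Longrightarrow> h \<in> Hom C y z \<Longrightarrow>
      (h \<cdot> g) \<cdot> f = h \<cdot> (g \<cdot> f)"
    and nul_hom: "x \<in> obj C \<Longrightarrow> y \<in> obj C \<Longrightarrow> nul C x y \<in> Hom C x y"
    and plu_hom: "f \<in> Hom C x y \<Longrightarrow> g \<in> Hom C x y \<Longrightarrow> f \<boxplus> g \<in> Hom C x y"
    and scl_hom: "f \<in> Hom C x y \<Longrightarrow> c \<triangleright> f \<in> Hom C x y"
    and plu_assoc: "f \<in> Hom C x y \<Longrightarrow> g \<in> Hom C x y \<Longrightarrow> h \<in> Hom C x y \<Longrightarrow>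
      (f \<boxplus> g) \<boxplus> h = f \<boxplus> (g \<boxplus> h)"
    and plu_comm: "f \<in> Hom C x y \<Longrightarrow> g \<in> Hom C x y \<Longrightarrow> f \<boxplus> g = g \<boxplus> f"
    and plu_nul: "f \<in> Hom C x y \<Longrightarrow> f \<boxplus> nul C x y = f"
    and plu_inverse: "f \<in> Hom C x y \<Longrightarrow> \<exists>g \<in> Hom C x y. f \<boxplus> g = nul C x y"
    and scl_one: "f \<in> Hom C x y \<Longrightarrow> 1 \<triangleright> f = f"
    and scl_scl: "f \<in> Hom C x y \<Longrightarrow> (a * b) \<triangleright> f = a \<triangleright> (b \<triangleright> f)"
    and scl_plu: "f \<in> Hom C x y \<Longrightarrow> g \<in> Hom C x y \<Longrightarrow>
      a \<triangleright> (f \<boxplus> g) = (a \<triangleright> f) \<boxplus> (a \<triangleright> g)"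
    and plus_scl: "f \<in> Hom C x y \<Longrightarrow> (a + b) \<triangleright> f = (a \<triangleright> f) \<boxplus> (b \<triangleright> f)"
    and cmp_plu: "f \<in> Hom C x y \<Longrightarrow> f' \<in> Hom C x y \<Longrightarrow> g \<in> Hom C y z \<Longrightarrow>
      g \<cdot> (f \<boxplus> f') = (g \<cdot> f) \<boxplus> (g \<cdot> f')"
    and plu_cmp: "f \<in> Hom C x y \<Longrightarrow> g \<in> Hom C y z \<Longrightarrow> g' \<in> Hom C y z \<Longrightarrow>
      (g \<boxplus> g') \<cdot> f = (g \<cdot> f) \<boxplus> (g' \<cdot> f)"
    and cmp_scl: "f \<in> Hom C x y \<Longrightarrow> g \<in> Hom C y z \<Longrightarrow> g \<cdot> (a \<triangleright> f) = a \<triangleright> (g \<cdot> f)"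
    and scl_cmp: "f \<in> Hom C x y \<Longrightarrow> g \<in> Hom C y z \<Longrightarrow> (a \<triangleright> g) \<cdot> f = a \<triangleright> (g \<cdot> f)"

locale linear_abelian_category = linear_category +
  assumes ex_zero_obj: "\<exists>x. zero_obj C x"
    and ex_biproduct: "x \<in> obj C \<Longrightarrow> y \<in> obj C \<Longrightarrow> \<exists>s. is_direct_sum C s [x, y]"
    and ex_kernel: "f \<in> arr C \<Longrightarrow> \<exists>k. is_kernel C k f"
    and ex_cokernel: "f \<in> arr C \<Longrightarrow> \<exists>c. is_cokernel C c f"
    and mono_normal: "is_mono C f \<Longrightarrow> \<exists>g. is_kernel C f g"
    and epi_normal: "is_epi C f \<Longrightarrow> \<exists>g. is_cokernel C f g"

locale bilinear_symmetric_monoidal_category = linear_category +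
  assumes unt_obj: "\<I> \<in> obj C"
    and tno_obj: "x \<in> obj C \<Longrightarrow> y \<in> obj C \<Longrightarrow> x \<boxtimes> y \<in> obj C"
    and tnm_hom: "f \<in> Hom C x y \<Longrightarrow> f' \<in> Hom C x' y' \<Longrightarrow>
      f \<star> f' \<in> Hom C (x \<boxtimes> x') (y \<boxtimes> y')"
    and tnm_idt: "x \<in> obj C \<Longrightarrow> y \<in> obj C \<Longrightarrow> idt C x \<star> idt C y = idt C (x \<boxtimes> y)"
    and tnm_cmp: "f \<in> Hom C x y \<Longrightarrow> g \<in> Hom C y z \<Longrightarrow>
      f' \<in> Hom C x' y' \<Longrightarrow> g' \<in> Hom C y' z' \<Longrightarrow>
      (g \<cdot> f) \<star> (g' \<cdot> f') = (g \<star> g') \<cdot> (f \<star> f')"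
    and tnm_plu: "f \<in> Hom C x y \<Longrightarrow> g \<in> Hom C x' y' \<Longrightarrow> h \<in> Hom C x' y' \<Longrightarrow>
      f \<star> (g \<boxplus> h) = (f \<star> g) \<boxplus> (f \<star> h)"
    and plu_tnm: "f \<in> Hom C x y \<Longrightarrow> g \<in> Hom C x y \<Longrightarrow> h \<in> Hom C x' y' \<Longrightarrow>
      (f \<boxplus> g) \<star> h = (f \<star> h) \<boxplus> (g \<star> h)"
    and tnm_scl: "f \<in> Hom C x y \<Longrightarrow> g \<in> Hom C x' y' \<Longrightarrow> f \<star> (a \<triangleright> g) = a \<triangleright> (f \<star> g)"
    and scl_tnm: "f \<in> Hom C x y \<Longrightarrow> g \<in> Hom C x' y' \<Longrightarrow> (a \<triangleright> f) \<star> g = a \<triangleright> (f \<star> g)"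
    and assoc_hom: "x \<in> obj C \<Longrightarrow> y \<in> obj C \<Longrightarrow> z \<in> obj C \<Longrightarrow>
      assoc C x y z \<in> Hom C ((x \<boxtimes> y) \<boxtimes> z) (x \<boxtimes> (y \<boxtimes> z))"
    and assoc_iso: "x \<in> obj C \<Longrightarrow> y \<in> obj C \<Longrightarrow> z \<in> obj C \<Longrightarrow> is_iso C (assoc C x y z)"
    and assoc_natural: "f \<in> Hom C x x' \<Longrightarrow> g \<in> Hom C y y' \<Longrightarrow> h \<in> Hom C z z' \<Longrightarrow>
      assoc C x' y' z' \<cdot> ((f \<star> g) \<star> h) = (f \<star> (g \<star> h)) \<cdot> assoc C x y z"
    and lunit_hom: "x \<in> obj C \<Longrightarrow> lunit C x \<in> Hom C (\<I> \<boxtimes> x) x"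
    and lunit_iso: "x \<in> obj C \<Longrightarrow> is_iso C (lunit C x)"
    and lunit_natural: "f \<in> Hom C x y \<Longrightarrow> lunit C y \<cdot> (idt C \<I> \<star> f) = f \<cdot> lunit C x"
    and runit_hom: "x \<in> obj C \<Longrightarrow> runit C x \<in> Hom C (x \<boxtimes> \<I>) x"
    and runit_iso: "x \<in> obj C \<Longrightarrow> is_iso C (runit C x)"
    and runit_natural: "f \<in> Hom C x y \<Longrightarrow> runit C y \<cdot> (f \<star> idt C \<I>) = f \<cdot> runit C x"
    and braid_hom: "x \<in> obj C \<Longrightarrow> y \<in> obj C \<Longrightarrow> braid C x y \<in> Hom C (x \<boxtimes> y) (y \<boxtimes> x)"
    and braid_natural: "f \<in> Hom C x x' \<Longrightarrow> g \<in> Hom C y y' \<Longrightarrow>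
      braid C x' y' \<cdot> (f \<star> g) = (g \<star> f) \<cdot> braid C x y"
    and braid_symmetric: "x \<in> obj C \<Longrightarrow> y \<in> obj C \<Longrightarrow>
      braid C y x \<cdot> braid C x y = idt C (x \<boxtimes> y)"
    and pentagon: "w \<in> obj C \<Longrightarrow> x \<in> obj C \<Longrightarrow> y \<in> obj C \<Longrightarrow> z \<in> obj C \<Longrightarrow>
      assoc C w x (y \<boxtimes> z) \<cdot> assoc C (w \<boxtimes> x) y z =
      (idt C w \<star> assoc C x y z) \<cdot> assoc C w (x \<boxtimes> y) z \<cdot> (assoc C w x y \<star> idt C z)"
    and triangle: "x \<in> obj C \<Longrightarrow> y \<in> obj C \<Longrightarrow>
      (idt C x \<star> lunit C y) \<cdot> assoc C x \<I> y = runit C x \<star> idt C y"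
    and hexagon: "x \<in> obj C \<Longrightarrow> y \<in> obj C \<Longrightarrow> z \<in> obj C \<Longrightarrow>
      assoc C y z x \<cdot> braid C x (y \<boxtimes> z) \<cdot> assoc C x y z =
      (idt C y \<star> braid C x z) \<cdot> assoc C y x z \<cdot> (braid C x y \<star> idt C z)"

locale symmetric_fusion_category =
  linear_abelian_category C + bilinear_symmetric_monoidal_category C
  for C :: "('o, 'm, 'k :: field) lin_mon_cat" (structure) +
  assumes rigid: "x \<in> obj C \<Longrightarrow> (\<exists>d. left_dual C d x) \<and> (\<exists>d. left_dual C x d)"
    and semisimple: "x \<in> obj C \<Longrightarrow> \<exists>xs. (\<forall>s \<in> set xs. simple_obj C s) \<and> is_direct_sum C x xs"
    and finitely_many_simples:
      "\<exists>ss. finite ss \<and> (\<forall>x. simple_obj C x \<longrightarrow> (\<exists>s \<in> ss. simple_obj C s \<and> isomorphic C x s))"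
    and finite_dim_hom: "x \<in> obj C \<Longrightarrow> y \<in> obj C \<Longrightarrow>
      \<exists>bs. set bs \<subseteq> Hom C x y \<and> (\<forall>f \<in> Hom C x y. \<exists>cs. length cs = length bs \<and>
        f = lincomb_sum C x y (map2 (scl C) cs bs))"
    and End_unit: "bij_betw (\<lambda>c. c \<triangleright> idt C \<I>) UNIV (Hom C \<I> \<I>)"

locale symmetric_tensor_functor =
  C: symmetric_fusion_category C
  for C :: "('o, 'm, 'k :: field) lin_mon_cat"
    and D :: "('o2, 'm2, 'k) lin_mon_cat"
    and Fo :: "'o \<Rightarrow> 'o2" and Fm :: "'m \<Rightarrow> 'm2"
    and J :: "'o \<Rightarrow> 'o \<Rightarrow> 'm2" and \<epsilon> :: 'm2 +
  assumes Fo_obj: "x \<in> obj C \<Longrightarrow> Fo x \<in> obj D"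
    and Fm_hom: "f \<in> Hom C x y \<Longrightarrow> Fm f \<in> Hom D (Fo x) (Fo y)"
    and Fm_idt: "x \<in> obj C \<Longrightarrow> Fm (idt C x) = idt D (Fo x)"
    and Fm_cmp: "f \<in> Hom C x y \<Longrightarrow> g \<in> Hom C y z \<Longrightarrow>
      Fm (g \<cdot>\<^bsub>C\<^esub> f) = Fm g \<cdot>\<^bsub>D\<^esub> Fm f"
    and Fm_plu: "f \<in> Hom C x y \<Longrightarrow> g \<in> Hom C x y \<Longrightarrow>
      Fm (f \<boxplus>\<^bsub>C\<^esub> g) = Fm f \<boxplus>\<^bsub>D\<^esub> Fm g"
    and Fm_scl: "f \<in> Hom C x y \<Longrightarrow> Fm (c \<triangleright>\<^bsub>C\<^esub> f) = c \<triangleright>\<^bsub>D\<^esub> Fm f"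
    and faithful: "x \<in> obj C \<Longrightarrow> y \<in> obj C \<Longrightarrow> inj_on Fm (Hom C x y)"
    and left_exact: "is_kernel C k f \<Longrightarrow> is_kernel D (Fm k) (Fm f)"
    and right_exact: "is_cokernel C h f \<Longrightarrow> is_cokernel D (Fm h) (Fm f)"
    and J_hom: "x \<in> obj C \<Longrightarrow> y \<in> obj C \<Longrightarrow>
      J x y \<in> Hom D (Fo x \<boxtimes>\<^bsub>D\<^esub> Fo y) (Fo (x \<boxtimes>\<^bsub>C\<^esub> y))"
    and J_iso: "x \<in> obj C \<Longrightarrow> y \<in> obj C \<Longrightarrow> is_iso D (J x y)"
    and J_natural: "f \<in> Hom C x x' \<Longrightarrow> g \<in> Hom C y y' \<Longrightarrow>
      Fm (f \<star>\<^bsub>C\<^esub> g) \<cdot>\<^bsub>D\<^esub> J x y = J x' y' \<cdot>\<^bsub>D\<^esub> (Fm f \<star>\<^bsub>D\<^esub> Fm g)"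
    and \<epsilon>_hom: "\<epsilon> \<in> Hom D \<I>\<^bsub>D\<^esub> (Fo \<I>\<^bsub>C\<^esub>)"
    and \<epsilon>_iso: "is_iso D \<epsilon>"
    and J_assoc: "x \<in> obj C \<Longrightarrow> y \<in> obj C \<Longrightarrow> z \<in> obj C \<Longrightarrow>
      Fm (assoc C x y z) \<cdot>\<^bsub>D\<^esub> J (x \<boxtimes>\<^bsub>C\<^esub> y) z \<cdot>\<^bsub>D\<^esub> (J x y \<star>\<^bsub>D\<^esub> idt D (Fo z)) =
      J x (y \<boxtimes>\<^bsub>C\<^esub> z) \<cdot>\<^bsub>D\<^esub> (idt D (Fo x) \<star>\<^bsub>D\<^esub> J y z) \<cdot>\<^bsub>D\<^esub> assoc D (Fo x) (Fo y) (Fo z)"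
    and J_lunit: "x \<in> obj C \<Longrightarrow>
      Fm (lunit C x) \<cdot>\<^bsub>D\<^esub> J \<I>\<^bsub>C\<^esub> x \<cdot>\<^bsub>D\<^esub> (\<epsilon> \<star>\<^bsub>D\<^esub> idt D (Fo x)) = lunit D (Fo x)"
    and J_runit: "x \<in> obj C \<Longrightarrow>
      Fm (runit C x) \<cdot>\<^bsub>D\<^esub> J x \<I>\<^bsub>C\<^esub> \<cdot>\<^bsub>D\<^esub> (idt D (Fo x) \<star>\<^bsub>D\<^esub> \<epsilon>) = runit D (Fo x)"
    and J_braid: "x \<in> obj C \<Longrightarrow> y \<in> obj C \<Longrightarrow>
      Fm (braid C x y) \<cdot>\<^bsub>D\<^esub> J x y = J y x \<cdot>\<^bsub>D\<^esub> braid D (Fo x) (Fo y)"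

section \<open>Frobenius-Perron dimension\<close>

text \<open>Multiplicity of the simple object \<open>s\<close> in the semisimple object \<open>x\<close>.\<close>

definition multiplicity_of :: "('o, 'm, 'k) lin_mon_cat \<Rightarrow> 'o \<Rightarrow> 'o \<Rightarrow> nat" where
  "multiplicity_of C s x = (THE n. \<exists>xs. (\<forall>t \<in> set xs. simple_obj C t) \<and> is_direct_sum C x xs \<and>
     n = length (filter (isomorphic C s) xs))"

definition simple_reps :: "('o, 'm, 'k) lin_mon_cat \<Rightarrow> 'o list" where
  "simple_reps C = (SOME ss. (\<forall>s \<in> set ss. simple_obj C s) \<and>
     (\<forall>i < length ss. \<forall>j < length ss. isomorphic C (ss ! i) (ss ! j) \<longrightarrow> i = j) \<and>
     (\<forall>x. simple_obj C x \<longrightarrow> (\<exists>s \<in> set ss. isomorphic C x s)))"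

text \<open>The matrix of multiplication by \<open>[x]\<close> on the Grothendieck ring, in the basis of
  classes of simple objects: column \<open>j\<close> is the expansion of \<open>[x] [s\<^sub>j]\<close>.\<close>

definition mult_matrix :: "('o, 'm, 'k) lin_mon_cat \<Rightarrow> 'o \<Rightarrow> real mat" where
  "mult_matrix C x = (let ss = simple_reps C in
     mat (length ss) (length ss) (\<lambda>(i, j). of_nat (multiplicity_of C (ss ! i) (tno C x (ss ! j)))))"

definition FPdim :: "('o, 'm, 'k) lin_mon_cat \<Rightarrow> 'o \<Rightarrow> real" where
  "FPdim C x = Max {e. 0 \<le> e \<and> eigenvalue (mult_matrix C x) e}"

section \<open>The category of representations of a group\<close>

text \<open>A representation on \<open>k\<^sup>n\<close> is a pair \<open>(n, \<rho>)\<close>, and an arrow is a triple of its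
  domain, its codomain and its matrix.  Tensor products are Kronecker products, which are
  strictly associative and unital.\<close>

type_synonym ('g, 'k) rep = "nat \<times> ('g \<Rightarrow> 'k mat)"
type_synonym ('g, 'k) rep_arr = "('g, 'k) rep \<times> ('g, 'k) rep \<times> 'k mat"

definition kronecker :: "'k :: semiring_0 mat \<Rightarrow> 'k mat \<Rightarrow> 'k mat" where
  "kronecker A B = mat (dim_row A * dim_row B) (dim_col A * dim_col B)
     (\<lambda>(i, j). A $$ (i div dim_row B, j div dim_col B) * B $$ (i mod dim_row B, j mod dim_col B))"

text \<open>The matrix of the flip of \<open>k\<^sup>m \<otimes> k\<^sup>n\<close>, where \<open>e\<^sub>a \<otimes> e\<^sub>b\<close> has index \<open>a * n + b\<close>.\<close>

definition flip_mat :: "nat \<Rightarrow> nat \<Rightarrow> 'k :: semiring_1 mat" where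
  "flip_mat m n = mat (n * m) (m * n)
     (\<lambda>(i, j). if i div m = j mod n \<and> i mod m = j div n then 1 else 0)"

definition mat_trace :: "'k :: comm_monoid_add mat \<Rightarrow> 'k" where
  "mat_trace A = (\<Sum>i < dim_row A. A $$ (i, i))"

definition reps :: "'g monoid \<Rightarrow> ('g, 'k :: field) rep set" where
  "reps G = {(n, \<rho>). \<rho> \<in> hom G (units_of (ring_mat TYPE('k) n ())) \<and> \<rho> \<in> extensional (carrier G)}"

definition rep_arrs :: "'g monoid \<Rightarrow> ('g, 'k :: field) rep_arr set" where
  "rep_arrs G = {(V, W, A). V \<in> reps G \<and> W \<in> reps G \<and> A \<in> carrier_mat (fst W) (fst V) \<and>
     (\<forall>g \<in> carrier G. A * snd V g = snd W g * A)}"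

definition rep_tensor :: "'g monoid \<Rightarrow> ('g, 'k :: field) rep \<Rightarrow> ('g, 'k) rep \<Rightarrow> ('g, 'k) rep" where
  "rep_tensor G V W =
     (fst V * fst W, restrict (\<lambda>g. kronecker (snd V g) (snd W g)) (carrier G))"

definition rep_unit :: "'g monoid \<Rightarrow> ('g, 'k :: field) rep" where
  "rep_unit G = (1, restrict (\<lambda>g. 1\<^sub>m 1) (carrier G))"

definition Rep :: "'g monoid \<Rightarrow> (('g, 'k :: field) rep, ('g, 'k) rep_arr, 'k) lin_mon_cat" where
  "Rep G = \<lparr>
     obj = reps G,
     arr = rep_arrs G,
     src = (\<lambda>(V, W, A). V),
     trg = (\<lambda>(V, W, A). W),
     idt = (\<lambda>V. (V, V, 1\<^sub>m (fst V))),
     cmp = (\<lambda>(V', W', B) (V, W, A). (V, W', B * A)),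
     nul = (\<lambda>V W. (V, W, 0\<^sub>m (fst W) (fst V))),
     plu = (\<lambda>(V, W, A) (V', W', B). (V, W, A + B)),
     scl = (\<lambda>c (V, W, A). (V, W, c \<cdot>\<^sub>m A)),
     unt = rep_unit G,
     tno = rep_tensor G,
     tnm = (\<lambda>(V, W, A) (V', W', B). (rep_tensor G V V', rep_tensor G W W', kronecker A B)),
     assoc = (\<lambda>U V W. (rep_tensor G (rep_tensor G U V) W, rep_tensor G U (rep_tensor G V W),
                       1\<^sub>m (fst U * fst V * fst W))),
     lunit = (\<lambda>V. (rep_tensor G (rep_unit G) V, V, 1\<^sub>m (fst V))),
     runit = (\<lambda>V. (rep_tensor G V (rep_unit G), V, 1\<^sub>m (fst V))),
     braid = (\<lambda>V W. (rep_tensor G V W, rep_tensor G W V, flip_mat (fst V) (fst W))) \<rparr>"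

definition negligible :: "'g monoid \<Rightarrow> ('g, 'k :: field) rep_arr \<Rightarrow> bool" where
  "negligible G f \<longleftrightarrow> f \<in> arr (Rep G) \<and>
     (\<forall>g \<in> Hom (Rep G) (trg (Rep G) f) (src (Rep G) f). mat_trace (snd (snd (cmp (Rep G) f g))) = 0)"

section \<open>The Verlinde category\<close>

text \<open>The quotient of a category by a tensor ideal \<open>N\<close>: an arrow is a congruence class of
  arrows, and all operations are computed on representatives.\<close>

definition ideal_class :: "('o, 'm, 'k :: field) lin_mon_cat \<Rightarrow> ('m \<Rightarrow> bool) \<Rightarrow> 'm \<Rightarrow> 'm set" where
  "ideal_class C N f = {g \<in> Hom C (src C f) (trg C f). N (plu C g (scl C (- 1) f))}"

definition class_rep :: "'m set \<Rightarrow> 'm" where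
  "class_rep F = (SOME f. f \<in> F)"

definition quotient_cat ::
    "('o, 'm, 'k :: field) lin_mon_cat \<Rightarrow> ('m \<Rightarrow> bool) \<Rightarrow> ('o, 'm set, 'k) lin_mon_cat" where
  "quotient_cat C N = \<lparr>
     obj = obj C,
     arr = ideal_class C N ` arr C,
     src = (\<lambda>F. src C (class_rep F)),
     trg = (\<lambda>F. trg C (class_rep F)),
     idt = (\<lambda>x. ideal_class C N (idt C x)),
     cmp = (\<lambda>G F. ideal_class C N (cmp C (class_rep G) (class_rep F))),
     nul = (\<lambda>x y. ideal_class C N (nul C x y)),
     plu = (\<lambda>F G. ideal_class C N (plu C (class_rep F) (class_rep G))),
     scl = (\<lambda>c F. ideal_class C N (scl C c (class_rep F))),
     unt = unt C,
     tno = tno C,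
     tnm = (\<lambda>F G. ideal_class C N (tnm C (class_rep F) (class_rep G))),
     assoc = (\<lambda>x y z. ideal_class C N (assoc C x y z)),
     lunit = (\<lambda>x. ideal_class C N (lunit C x)),
     runit = (\<lambda>x. ideal_class C N (runit C x)),
     braid = (\<lambda>x y. ideal_class C N (braid C x y)) \<rparr>"

type_synonym 'k ver_obj = "(int, 'k) rep"
type_synonym 'k ver_arr = "(int, 'k) rep_arr set"

definition Ver :: "nat \<Rightarrow> ('k :: field ver_obj, 'k ver_arr, 'k) lin_mon_cat" where
  "Ver p = quotient_cat (Rep (integer_mod_group p)) (negligible (integer_mod_group p))"

text \<open>In characteristic \<open>p\<close> there is, up to isomorphism, exactly one indecomposable representation
  of \<open>\<int>/p\<int>\<close> of each dimension \<open>r\<close> from \<open>1\<close> to \<open>p\<close> (a generator acts by a unipotent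
  Jordan block), so the choice made here is immaterial.\<close>

definition Ver_L :: "nat \<Rightarrow> nat \<Rightarrow> 'k :: field ver_obj" where
  "Ver_L p r = (SOME V. indecomposable_obj (Rep (integer_mod_group p)) V \<and> fst V = r)"

definition Ver_plus :: "nat \<Rightarrow> 'k :: field ver_obj set" where
  "Ver_plus p = {Y. \<exists>rs. set rs \<subseteq> {r \<in> {1..p - 1}. odd r} \<and> is_direct_sum (Ver p) Y (map (Ver_L p) rs)}"

definition Ver_minus :: "nat \<Rightarrow> 'k :: field ver_obj set" where
  "Ver_minus p = {Y. \<exists>rs. set rs \<subseteq> {r \<in> {1..p - 1}. even r} \<and> is_direct_sum (Ver p) Y (map (Ver_L p) rs)}"

text \<open>A decomposition of \<open>Y\<close> into its parts in \<open>Ver\<^sub>p\<^sup>+\<close> and \<open>Ver\<^sub>p\<^sup>-\<close>, which is unique up to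
  isomorphism.\<close>

definition Ver_parts :: "nat \<Rightarrow> 'k :: field ver_obj \<Rightarrow> 'k ver_obj \<times> 'k ver_obj" where
  "Ver_parts p Y = (SOME (Y1, Y2). Y1 \<in> Ver_plus p \<and> Y2 \<in> Ver_minus p \<and>
     is_direct_sum (Ver p) Y [Y1, Y2])"

definition d_plus :: "nat \<Rightarrow> ('o \<Rightarrow> 'k :: field ver_obj) \<Rightarrow> 'o \<Rightarrow> real" where
  "d_plus p Fo X = FPdim (Ver p) (fst (Ver_parts p (Fo X)))"

definition d_minus :: "nat \<Rightarrow> ('o \<Rightarrow> 'k :: field ver_obj) \<Rightarrow> 'o \<Rightarrow> real" where
  "d_minus p Fo X = FPdim (Ver p) (snd (Ver_parts p (Fo X)))"

definition SFPdim :: "nat \<Rightarrow> ('o \<Rightarrow> 'k :: field ver_obj) \<Rightarrow> 'o \<Rightarrow> real" where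
  "SFPdim p Fo X = d_plus p Fo X - d_minus p Fo X"

section \<open>The field trace\<close>

definition root_q :: "nat \<Rightarrow> complex" where
  "root_q p = exp (of_real pi * \<i> / of_nat p)"

definition rat_adjoin :: "complex \<Rightarrow> complex set" where
  "rat_adjoin z = {poly f z / poly g z | f g.
     (\<forall>i. coeff f i \<in> \<rat>) \<and> (\<forall>i. coeff g i \<in> \<rat>) \<and> poly g z \<noteq> 0}"

definition field_K :: "nat \<Rightarrow> complex set" where
  "field_K p = rat_adjoin (root_q p) \<inter> \<real>"

definition field_auts :: "complex set \<Rightarrow> (complex \<Rightarrow> complex) set" where
  "field_auts A = {\<sigma> \<in> extensional A. bij_betw \<sigma> A A \<and>
     (\<forall>x \<in> A. \<forall>y \<in> A. \<sigma> (x + y) = \<sigma> x + \<sigma> y \<and> \<sigma> (x * y) = \<sigma> x * \<sigma> y)}"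

definition galois_g :: "nat \<Rightarrow> nat \<Rightarrow> complex \<Rightarrow> complex" where
  "galois_g p s = restrict
     (THE \<sigma>. \<sigma> \<in> field_auts (rat_adjoin (root_q p)) \<and> \<sigma> (root_q p) = root_q p ^ (2 * s + 1))
     (field_K p)"

definition Tr_K :: "nat \<Rightarrow> complex \<Rightarrow> complex" where
  "Tr_K p x = (\<Sum>s = 0..(p - 3) div 2. galois_g p s x)"

end

theory Submission
  imports Defs "HOL-Combinatorics.List_Permutation" "HOL-Number_Theory.Cong"
begin

text \<open>Put \<open>[m] = sin (\<pi> m / p) / sin (\<pi> / p) = (q\<^sup>m - q\<^bsup>-m\<^esup>) / (q - q\<^sup>-\<^sup>1)\<close>.  The Frobenius-Perron dimension of \<open>L\<^sub>m\<close> is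
  \<open>[m]\<close>, so \<open>d\<^sub>+\<close> and \<open>d\<^sub>-\<close> of \<open>X\<close> are the sums of \<open>a\<^sub>m [m]\<close> over odd and even \<open>m\<close>, and \<open>FPdim X = d\<^sub>+ + d\<^sub>-\<close>.
  Multiplication by \<open>(q\<^bsup>-r\<^esup> - q\<^sup>r) (q - q\<^sup>-\<^sup>1)\<close> turns \<open>[m]\<close> into \<open>(q\<^bsup>-r\<^esup> - q\<^sup>r) (q\<^sup>m - q\<^bsup>-m\<^esup>)\<close>.  For \<open>m\<close> of the same parity
  as \<open>r\<close> this is a combination of \<open>p\<close>-th roots of unity, and its trace is \<open>p\<close> if \<open>m = r\<close> and \<open>0\<close> otherwise.  So the
  trace form reads off \<open>a\<^sub>r\<close> (\<open>trace_orthogonality\<close>).  For the trace to be the expected sum over odd powers of \<open>q\<close>, the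
  automorphisms \<open>q \<mapsto> q\<^bsup>2s+1\<^esup>\<close> must exist.  They do because the cyclotomic polynomial of order \<open>p\<close> is irreducible by
  Eisenstein's criterion (\<open>root_of_unity_conjugate\<close>).

  It remains to compute the Frobenius-Perron dimensions.  A real-valued function on objects that is additive,
  multiplicative and positive on simple objects yields a positive left eigenvector of every multiplication matrix, with
  the value at \<open>x\<close> as eigenvalue.  A nonnegative matrix has no larger real eigenvalue, so the function is the
  Frobenius-Perron dimension (\<open>FPdim_eq_character\<close>).  The function to be used on \<open>Ver\<^sub>p\<close> is the quantum dimension
  \<open>qdim V = \<Sum> [m] \<cdot> (multiplicity of L\<^sub>m in V)\<close>, and on the fusion category it is \<open>qdim \<circ> F\<close>
  (\<open>FPdim_Ver\<close>, \<open>FPdim_fiber_functor\<close>).  Additivity is the theorem of Krull and Schmidt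
  (\<open>multiplicity_le\<close>), and positivity holds because \<open>[m] > 0\<close> for \<open>0 < m < p\<close>.

  Multiplicativity rests on the Clebsch-Gordan rule \<open>J\<^sub>2 \<otimes> J\<^sub>r = J\<^sub>r\<^sub>+\<^sub>1 \<oplus> J\<^sub>r\<^sub>-\<^sub>1\<close> for the unipotent Jordan blocks of
  \<open>\<int>/p\<int>\<close> (\<open>J2_tensor_J\<close>).  It matches the recursion \<open>[2] [r] = [r + 1] + [r - 1]\<close>, and thereby determines the quantum
  dimension of all tensor products by induction.

  That \<open>Ver\<^sub>p\<close> is semisimple with simple objects \<open>J\<^sub>1, \<dots>, J\<^sub>p\<^sub>-\<^sub>1\<close> comes from a look at arrows between Jordan blocks.  An
  arrow commutes with a nilpotent shift, which makes its matrix upper triangular and constant along diagonals.  Between blocks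
  of different sizes every trace vanishes, and the trace of an endomorphism of \<open>J\<^sub>n\<close> is \<open>n\<close> times its diagonal entry.
  Hence modulo negligible arrows there are no arrows between different blocks, the endomorphisms of \<open>J\<^sub>n\<close> are the scalars
  for \<open>n < p\<close>, and \<open>J\<^sub>p\<close> becomes zero (\<open>J_arrow_negligible\<close>, \<open>J_endo_negligible_iff\<close>).\<close>

section \<open>Finite sums of arrows and direct sums\<close>

context linear_category
begin

lemma Hom_obj:
  assumes "f \<in> Hom C x y"
  shows "x \<in> obj C" "y \<in> obj C"
  using assms src_obj trg_obj by (auto simp: Hom_def)

lemma zero_scl: 
  assumes f: "f \<in> Hom C x y"
  shows "0 \<triangleright> f = nul C x y"
proof -
  have z: "0 \<triangleright> f \<in> Hom C x y" by (rule scl_hom[OF f])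
  obtain g where g: "g \<in> Hom C x y" "0 \<triangleright> f \<boxplus> g = nul C x y" using plu_inverse[OF z] by blast
  have "0 \<triangleright> f \<boxplus> 0 \<triangleright> f = 0 \<triangleright> f" using plus_scl[OF f, of 0 0] by simp
  hence "(0 \<triangleright> f \<boxplus> 0 \<triangleright> f) \<boxplus> g = nul C x y" using g by simp
  hence "0 \<triangleright> f \<boxplus> nul C x y = nul C x y" using plu_assoc[OF z z g(1)] g(2) by simp
  thus ?thesis using plu_nul[OF z] by simp
qed

lemma scl_nul: "x \<in> obj C \<Longrightarrow> y \<in> obj C \<Longrightarrow> c \<triangleright> nul C x y = nul C x y"
  using zero_scl[OF nul_hom] scl_scl[OF nul_hom, of x y c 0] by simp

lemma nul_cmp: 
  assumes "f \<in> Hom C x y" "z \<in> obj C" 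
  shows "nul C y z \<cdot> f = nul C x z"
proof -
  have n: "nul C y z \<in> Hom C y z" using assms Hom_obj nul_hom by blast
  have "(0 \<triangleright> nul C y z) \<cdot> f = 0 \<triangleright> (nul C y z \<cdot> f)" using scl_cmp[OF assms(1) n] .
  thus ?thesis using zero_scl[OF n] zero_scl[OF cmp_hom[OF assms(1) n]] by simp
qed

lemma cmp_nul: 
  assumes "f \<in> Hom C x y" "w \<in> obj C"
  shows "f \<cdot> nul C w x = nul C w y"
proof -
  have n: "nul C w x \<in> Hom C w x" using assms Hom_obj nul_hom by blast
  have "f \<cdot> (0 \<triangleright> nul C w x) = 0 \<triangleright> (f \<cdot> nul C w x)" using cmp_scl[OF n assms(1)] .
  thus ?thesis using zero_scl[OF n] zero_scl[OF cmp_hom[OF n assms(1)]] by simp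
qed

lemma plu_neg:
  assumes f: "f \<in> Hom C x y"
  shows "f \<boxplus> (- 1) \<triangleright> f = nul C x y" "(- 1) \<triangleright> f \<boxplus> f = nul C x y"
  using plus_scl[OF f, of 1 "- 1"] plus_scl[OF f, of "- 1" 1] scl_one[OF f] zero_scl[OF f] by auto

lemma nul_plu: "f \<in> Hom C x y \<Longrightarrow> nul C x y \<boxplus> f = f"
  using plu_comm plu_nul nul_hom Hom_obj by metis

lemma eq_if_diff_nul:
  assumes f: "f \<in> Hom C x y" and g: "g \<in> Hom C x y" and "f \<boxplus> (- 1) \<triangleright> g = nul C x y"
  shows "f = g"
proof -
  have "(f \<boxplus> (- 1) \<triangleright> g) \<boxplus> g = f \<boxplus> ((- 1) \<triangleright> g \<boxplus> g)"
    by (rule plu_assoc[OF f scl_hom[OF g] g])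
  thus ?thesis using assms plu_neg[OF g] plu_nul[OF f] nul_plu[OF g] by simp
qed

text \<open>Hom sets as commutative monoids, so that the finite products of the library serve as sums of arrows.\<close>

definition hom_monoid :: "'o \<Rightarrow> 'o \<Rightarrow> 'm monoid" where
  "hom_monoid x y = \<lparr>carrier = Hom C x y, monoid.mult = plu C, one = nul C x y\<rparr>"

lemma comm_monoid_hom_monoid:
  "x \<in> obj C \<Longrightarrow> y \<in> obj C \<Longrightarrow> comm_monoid (hom_monoid x y)"
  by (rule comm_monoidI)
     (auto simp: hom_monoid_def plu_hom nul_hom plu_assoc nul_plu intro: plu_comm)

definition hsum :: "'o \<Rightarrow> 'o \<Rightarrow> ('i \<Rightarrow> 'm) \<Rightarrow> 'i set \<Rightarrow> 'm" where
  "hsum x y f A = finprod (hom_monoid x y) f A"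

context
  fixes x y
  assumes xy: "x \<in> obj C" "y \<in> obj C"
begin

interpretation M: comm_monoid "hom_monoid x y" by (rule comm_monoid_hom_monoid[OF xy])

lemma hsum_empty: "hsum x y f {} = nul C x y"
  using M.finprod_empty by (simp add: hsum_def) (simp add: hom_monoid_def)

lemma hsum_insert:
  "finite A \<Longrightarrow> a \<notin> A \<Longrightarrow> (\<And>b. b \<in> insert a A \<Longrightarrow> f b \<in> Hom C x y) \<Longrightarrow>
   hsum x y f (insert a A) = f a \<boxplus> hsum x y f A"
  unfolding hsum_def by (subst M.finprod_insert) (auto simp: hom_monoid_def)

lemma hsum_hom: "(\<And>b. b \<in> A \<Longrightarrow> f b \<in> Hom C x y) \<Longrightarrow> hsum x y f A \<in> Hom C x y"
  using M.finprod_closed[of f A] by (auto simp: hsum_def hom_monoid_def)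

lemma hsum_cong:
  assumes "A = B" "\<And>b. b \<in> B \<Longrightarrow> f b = g b" "\<And>b. b \<in> B \<Longrightarrow> g b \<in> Hom C x y"
  shows "hsum x y f A = hsum x y g B"
  unfolding hsum_def using assms by (intro M.finprod_cong') (auto simp: hom_monoid_def)

lemma hsum_infinite: "\<not> finite A \<Longrightarrow> hsum x y f A = nul C x y"
  by (simp add: hsum_def hom_monoid_def finprod_def)

lemma hsum_nul:
  assumes "\<And>b. b \<in> A \<Longrightarrow> f b = nul C x y"
  shows "hsum x y f A = nul C x y"
proof -
  have "hsum x y f A = hsum x y (\<lambda>_. nul C x y) A" using assms xy by (intro hsum_cong) (auto intro: nul_hom)
  also have "\<dots> = nul C x y" 
    using M.finprod_one[of A] by (simp add: hsum_def hom_monoid_def)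
  finally show ?thesis .
qed

lemma hsum_delta:
  assumes "finite A" "a \<in> A" "f a \<in> Hom C x y" "\<And>b. b \<in> A \<Longrightarrow> b \<noteq> a \<Longrightarrow> f b = nul C x y"
  shows "hsum x y f A = f a"
proof -
  have h: "f b \<in> Hom C x y" if "b \<in> A" for b using assms that nul_hom[OF xy] by (cases "b = a") auto
  have "hsum x y f (insert a (A - {a})) = f a \<boxplus> hsum x y f (A - {a})"
    using assms h by (intro hsum_insert) auto
  also have "hsum x y f (A - {a}) = nul C x y" using assms by (intro hsum_nul) auto
  finally show ?thesis using assms plu_nul by (simp add: insert_absorb)
qed

lemma hsum_reindex:
  assumes "bij_betw h A B" "\<And>b. b \<in> B \<Longrightarrow> f b \<in> Hom C x y"
  shows "hsum x y f B = hsum x y (\<lambda>a. f (h a)) A"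
  unfolding hsum_def using assms M.finprod_reindex[of f h A] 
  by (auto simp: bij_betw_def hom_monoid_def)

lemma foldr_plu_eq_hsum:
  "distinct l \<Longrightarrow> (\<And>b. b \<in> set l \<Longrightarrow> f b \<in> Hom C x y) \<Longrightarrow>
   foldr (plu C) (map f l) (nul C x y) = hsum x y f (set l)"
proof (induction l)
  case (Cons a l)
  hence "hsum x y f (insert a (set l)) = f a \<boxplus> hsum x y f (set l)" by (intro hsum_insert) auto
  thus ?case using Cons by simp
qed (simp add: hsum_empty)

text \<open>Connects the sums over lists in the definition of a direct sum with sums over index sets, which can be reindexed.\<close>

lemma lincomb_sum_eq_hsum:
  "(\<And>b. b < n \<Longrightarrow> f b \<in> Hom C x y) \<Longrightarrow>
   lincomb_sum C x y (map f [0..<n]) = hsum x y f {..<n}"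
  unfolding lincomb_sum_def by (subst foldr_plu_eq_hsum) (auto simp: atLeast0LessThan)

lemma hsum_scl:
  assumes f: "f \<in> Hom C x y"
  shows "hsum x y (\<lambda>a. c a \<triangleright> f) A = (\<Sum>a\<in>A. c a) \<triangleright> f"
proof (induction A rule: infinite_finite_induct)
  case (insert a A)
  thus ?case using f by (subst hsum_insert) (auto simp: plus_scl scl_hom)
qed (auto simp: hsum_infinite hsum_empty zero_scl[OF f])

end

lemma cmp_hsum:
  assumes g: "g \<in> Hom C y z" and x: "x \<in> obj C" and f: "\<And>a. a \<in> A \<Longrightarrow> f a \<in> Hom C x y"
  shows "g \<cdot> hsum x y f A = hsum x z (\<lambda>a. g \<cdot> f a) A"
  using f
proof (induction A rule: infinite_finite_induct)
  case (insert a A)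
  have "hsum x y f A \<in> Hom C x y" using insert.prems x Hom_obj[OF g] by (intro hsum_hom) auto
  moreover have "hsum x y f (insert a A) = f a \<boxplus> hsum x y f A"
    using insert x Hom_obj[OF g] by (intro hsum_insert) auto
  moreover have "hsum x z (\<lambda>a. g \<cdot> f a) (insert a A) = g \<cdot> f a \<boxplus> hsum x z (\<lambda>a. g \<cdot> f a) A"
    using insert x Hom_obj[OF g] cmp_hom[OF _ g] by (intro hsum_insert) auto
  moreover have "f a \<in> Hom C x y" using insert.prems by simp
  ultimately show ?case using insert cmp_plu[OF _ _ g, of "f a" x "hsum x y f A"] by simp
qed (use g x Hom_obj[OF g] in \<open>auto simp: hsum_infinite hsum_empty cmp_nul\<close>)

lemma hsum_cmp:
  assumes g: "g \<in> Hom C w x" and y: "y \<in> obj C" and f: "\<And>a. a \<in> A \<Longrightarrow> f a \<in> Hom C x y"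
  shows "hsum x y f A \<cdot> g = hsum w y (\<lambda>a. f a \<cdot> g) A"
  using f
proof (induction A rule: infinite_finite_induct)
  case (insert a A)
  have "hsum x y f A \<in> Hom C x y" using insert.prems y Hom_obj[OF g] by (intro hsum_hom) auto
  moreover have "hsum x y f (insert a A) = f a \<boxplus> hsum x y f A"
    using insert y Hom_obj[OF g] by (intro hsum_insert) auto
  moreover have "hsum w y (\<lambda>a. f a \<cdot> g) (insert a A) = f a \<cdot> g \<boxplus> hsum w y (\<lambda>a. f a \<cdot> g) A"
    using insert y Hom_obj[OF g] cmp_hom[OF g] by (intro hsum_insert) auto
  moreover have "f a \<in> Hom C x y" using insert.prems by simp
  ultimately show ?case using insert plu_cmp[OF g, of "f a" y "hsum x y f A"] by simp
qed (use g y Hom_obj[OF g] in \<open>auto simp: hsum_infinite hsum_empty nul_cmp\<close>)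

text \<open>The injections \<open>I\<close> and projections \<open>P\<close> are functions on indices instead of lists, so that permuting,
  splitting and substituting summands amounts to composing index functions.\<close>

definition biproduct :: "'o \<Rightarrow> 'o list \<Rightarrow> (nat \<Rightarrow> 'm) \<Rightarrow> (nat \<Rightarrow> 'm) \<Rightarrow> bool" where
  "biproduct x xs I P \<longleftrightarrow> x \<in> obj C \<and> set xs \<subseteq> obj C \<and>
     (\<forall>a < length xs. I a \<in> Hom C (xs ! a) x \<and> P a \<in> Hom C x (xs ! a)) \<and>
     (\<forall>a < length xs. \<forall>b < length xs. P a \<cdot> I b =
        (if a = b then idt C (xs ! a) else nul C (xs ! b) (xs ! a))) \<and>
     hsum x x (\<lambda>a. I a \<cdot> P a) {..<length xs} = idt C x"

lemma is_direct_sum_iff_biproduct: "is_direct_sum C x xs \<longleftrightarrow> (\<exists>I P. biproduct x xs I P)"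
proof
  assume "is_direct_sum C x xs"
  then obtain js ps where x: "x \<in> obj C" "set xs \<subseteq> obj C"
    and l: "length js = length xs" "length ps = length xs"
    and h: "\<forall>i < length xs. js ! i \<in> Hom C (xs ! i) x \<and> ps ! i \<in> Hom C x (xs ! i)"
    and o: "\<forall>i < length xs. \<forall>j < length xs. ps ! i \<cdot> js ! j =
           (if i = j then idt C (xs ! i) else nul C (xs ! j) (xs ! i))"
    and s: "lincomb_sum C x x (map2 (cmp C) js ps) = idt C x"
    unfolding is_direct_sum_def by blast
  have "map2 (cmp C) js ps = map (\<lambda>a. js ! a \<cdot> ps ! a) [0..<length xs]"
    using l by (intro nth_equalityI) auto
  moreover have "js ! b \<cdot> ps ! b \<in> Hom C x x" if "b < length xs" for b
    using h that cmp_hom by blast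
  ultimately have "hsum x x (\<lambda>a. js ! a \<cdot> ps ! a) {..<length xs} = idt C x" 
    using s lincomb_sum_eq_hsum[OF x(1) x(1), of "length xs" "\<lambda>a. js ! a \<cdot> ps ! a"] by simp
  thus "\<exists>I P. biproduct x xs I P" unfolding biproduct_def using x h o by blast
next
  assume "\<exists>I P. biproduct x xs I P"
  then obtain I P where b: "biproduct x xs I P" by blast
  let ?js = "map I [0..<length xs]" and ?ps = "map P [0..<length xs]"
  have "map2 (cmp C) ?js ?ps = map (\<lambda>a. I a \<cdot> P a) [0..<length xs]"
    by (intro nth_equalityI) auto
  moreover have "I a \<cdot> P a \<in> Hom C x x" if "a < length xs" for a
    using b that cmp_hom unfolding biproduct_def by blast
  ultimately have "lincomb_sum C x x (map2 (cmp C) ?js ?ps) = idt C x"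
    using b lincomb_sum_eq_hsum[of x x "length xs" "\<lambda>a. I a \<cdot> P a"] unfolding biproduct_def by simp
  moreover have "\<forall>i < length xs. ?js ! i \<in> Hom C (xs ! i) x \<and> ?ps ! i \<in> Hom C x (xs ! i)"
    using b by (simp add: biproduct_def)
  moreover have "\<forall>i < length xs. \<forall>j < length xs. ?ps ! i \<cdot> ?js ! j =
      (if i = j then idt C (xs ! i) else nul C (xs ! j) (xs ! i))"
    using b by (simp add: biproduct_def)
  moreover have "x \<in> obj C" "set xs \<subseteq> obj C" "length ?js = length xs" "length ?ps = length xs"
    using b by (simp_all add: biproduct_def)
  ultimately show "is_direct_sum C x xs" unfolding is_direct_sum_def by blast
qed

lemma biproductD:
  assumes "biproduct x xs I P"
  shows "x \<in> obj C" "set xs \<subseteq> obj C" "a < length xs \<Longrightarrow> xs ! a \<in> obj C"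
    "a < length xs \<Longrightarrow> I a \<in> Hom C (xs ! a) x" "a < length xs \<Longrightarrow> P a \<in> Hom C x (xs ! a)"
    "a < length xs \<Longrightarrow> P a \<cdot> I a = idt C (xs ! a)"
    "a < length xs \<Longrightarrow> b < length xs \<Longrightarrow> a \<noteq> b \<Longrightarrow> P a \<cdot> I b = nul C (xs ! b) (xs ! a)"
    "hsum x x (\<lambda>a. I a \<cdot> P a) {..<length xs} = idt C x"
  using assms by (auto simp: biproduct_def)

lemma biproduct_expand:
  assumes b: "biproduct x xs I P" and f: "f \<in> Hom C w x"
  shows "f = hsum w x (\<lambda>a. I a \<cdot> (P a \<cdot> f)) {..<length xs}"
proof -
  note B = biproductD[OF b]
  have "f = hsum x x (\<lambda>a. I a \<cdot> P a) {..<length xs} \<cdot> f" using B(8) idt_cmp[OF f] by simp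
  also have "\<dots> = hsum w x (\<lambda>a. (I a \<cdot> P a) \<cdot> f) {..<length xs}"
    using B(1) cmp_hom[OF B(5) B(4)] by (intro hsum_cmp[OF f]) auto
  also have "\<dots> = hsum w x (\<lambda>a. I a \<cdot> (P a \<cdot> f)) {..<length xs}"
    using B Hom_obj[OF f] cmp_hom[OF cmp_hom[OF f B(5)] B(4)] cmp_assoc[OF f B(5) B(4)] 
    by (intro hsum_cong) auto
  finally show ?thesis .
qed

lemma biproduct_ext:
  assumes b: "biproduct x xs I P" and f: "f \<in> Hom C w x" and g: "g \<in> Hom C w x"
    and eq: "\<And>a. a < length xs \<Longrightarrow> P a \<cdot> f = P a \<cdot> g"
  shows "f = g"
proof -
  have "hsum w x (\<lambda>a. I a \<cdot> (P a \<cdot> f)) {..<length xs} = hsum w x (\<lambda>a. I a \<cdot> (P a \<cdot> g)) {..<length xs}"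
    using Hom_obj[OF f] eq cmp_hom[OF cmp_hom[OF g biproductD(5)[OF b]] biproductD(4)[OF b]]
    by (intro hsum_cong) auto
  thus ?thesis using biproduct_expand[OF b f] biproduct_expand[OF b g] by simp
qed

text \<open>The condition that the projections are jointly monic replaces the sum \<open>\<Sum> I a \<cdot> P a = id\<close>: composing with
  each \<open>P b\<close> shows that both sides agree.  This is what makes the manipulations of direct sums below free of sums.\<close>

lemma biproductI:
  assumes x: "x \<in> obj C" "set xs \<subseteq> obj C" 
    and I: "\<And>a. a < length xs \<Longrightarrow> I a \<in> Hom C (xs ! a) x"
    and P: "\<And>a. a < length xs \<Longrightarrow> P a \<in> Hom C x (xs ! a)"
    and o: "\<And>a. a < length xs \<Longrightarrow> P a \<cdot> I a = idt C (xs ! a)"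
    and n: "\<And>a b. a < length xs \<Longrightarrow> b < length xs \<Longrightarrow> a \<noteq> b \<Longrightarrow> P a \<cdot> I b = nul C (xs ! b) (xs ! a)"
    and ext: "\<And>f g. f \<in> Hom C x x \<Longrightarrow> g \<in> Hom C x x \<Longrightarrow>
      (\<And>a. a < length xs \<Longrightarrow> P a \<cdot> f = P a \<cdot> g) \<Longrightarrow> f = g"
  shows "biproduct x xs I P"
proof -
  have IP: "I a \<cdot> P a \<in> Hom C x x" if "a < length xs" for a using I P that cmp_hom by blast
  let ?s = "hsum x x (\<lambda>a. I a \<cdot> P a) {..<length xs}"
  have "?s = idt C x"
  proof (rule ext)
    show "?s \<in> Hom C x x" using IP x by (intro hsum_hom) auto
    show "idt C x \<in> Hom C x x" using x by (rule_tac idt_hom)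
    fix b assume b: "b < length xs"
    have xb: "xs ! b \<in> obj C" using b x by auto
    have "P b \<cdot> ?s = hsum x (xs ! b) (\<lambda>a. P b \<cdot> (I a \<cdot> P a)) {..<length xs}"
      using IP by (intro cmp_hsum[OF P[OF b] x(1)]) auto
    also have "\<dots> = P b \<cdot> (I b \<cdot> P b)"
    proof (rule hsum_delta)
      fix a assume a: "a \<in> {..<length xs}" "a \<noteq> b"
      have "P b \<cdot> (I a \<cdot> P a) = (P b \<cdot> I a) \<cdot> P a"
        using a cmp_assoc[OF P I P[OF b]] by simp
      thus "P b \<cdot> (I a \<cdot> P a) = nul C x (xs ! b)" using a b n nul_cmp[OF P xb] by simp
    qed (use b x xb cmp_hom[OF IP P] in auto)
    also have "\<dots> = P b \<cdot> idt C x" 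
      using cmp_assoc[OF P[OF b] I[OF b] P[OF b]] b o idt_cmp[OF P] cmp_idt[OF P] by simp
    finally show "P b \<cdot> ?s = P b \<cdot> idt C x" .
  qed
  thus ?thesis unfolding biproduct_def using assms by auto
qed

lemma biproduct_lift:
  assumes b: "biproduct x xs I P" and w: "w \<in> obj C"
    and f: "\<And>a. a < length xs \<Longrightarrow> f a \<in> Hom C w (xs ! a)"
  obtains g where "g \<in> Hom C w x" "\<And>a. a < length xs \<Longrightarrow> P a \<cdot> g = f a"
proof
  note B = biproductD[OF b]
  let ?g = "hsum w x (\<lambda>a. I a \<cdot> f a) {..<length xs}"
  have h: "I a \<cdot> f a \<in> Hom C w x" if "a < length xs" for a using cmp_hom[OF f[OF that] B(4)[OF that]] .
  show "?g \<in> Hom C w x" using h w B by (intro hsum_hom) auto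
  fix a assume a: "a < length xs"
  have "P a \<cdot> ?g = hsum w (xs ! a) (\<lambda>c. P a \<cdot> (I c \<cdot> f c)) {..<length xs}"
    using h by (intro cmp_hsum[OF B(5)[OF a] w]) auto
  also have "\<dots> = P a \<cdot> (I a \<cdot> f a)"
  proof (rule hsum_delta)
    fix c assume c: "c \<in> {..<length xs}" "c \<noteq> a"
    have "P a \<cdot> (I c \<cdot> f c) = (P a \<cdot> I c) \<cdot> f c"
      using c cmp_assoc[OF f B(4) B(5)[OF a]] by simp
    thus "P a \<cdot> (I c \<cdot> f c) = nul C w (xs ! a)" using a c B nul_cmp[OF f] by simp
  qed (use a w B cmp_hom[OF h B(5)] in auto)
  also have "\<dots> = f a" using cmp_assoc[OF f[OF a] B(4)[OF a] B(5)[OF a]] a B(6) idt_cmp[OF f] by simp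
  finally show "P a \<cdot> ?g = f a" .
qed

lemma is_direct_sum_obj: "is_direct_sum C x xs \<Longrightarrow> x \<in> obj C" "is_direct_sum C x xs \<Longrightarrow> set xs \<subseteq> obj C"
  by (auto simp: is_direct_sum_def)

lemma isomorphicE:
  assumes "isomorphic C x y"
  obtains f g where "f \<in> Hom C x y" "g \<in> Hom C y x" "g \<cdot> f = idt C x" "f \<cdot> g = idt C y"
  using assms by (auto simp: isomorphic_def is_iso_def inverse_arrows_def Hom_def)

lemma is_isoI:
  assumes "f \<in> Hom C x y" "g \<in> Hom C y x" "g \<cdot> f = idt C x" "f \<cdot> g = idt C y"
  shows "is_iso C f"
  using assms by (auto simp: is_iso_def inverse_arrows_def Hom_def)

lemma isomorphicI:
  assumes "f \<in> Hom C x y" "g \<in> Hom C y x" "g \<cdot> f = idt C x" "f \<cdot> g = idt C y"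
  shows "isomorphic C x y"
  using is_isoI[OF assms] assms(1) by (auto simp: isomorphic_def)

lemma isomorphic_refl: "x \<in> obj C \<Longrightarrow> isomorphic C x x"
  by (rule isomorphicI[of "idt C x" _ _ "idt C x"]) (auto simp: idt_hom idt_cmp[OF idt_hom])

lemma isomorphic_sym: "isomorphic C x y \<Longrightarrow> isomorphic C y x"
  by (elim isomorphicE, rule isomorphicI)

lemma isomorphic_trans:
  assumes "isomorphic C x y" "isomorphic C y z"
  shows "isomorphic C x z"
proof -
  obtain f g where f: "f \<in> Hom C x y" "g \<in> Hom C y x" "g \<cdot> f = idt C x" "f \<cdot> g = idt C y"
    using assms(1) by (rule isomorphicE)
  obtain f' g' where f': "f' \<in> Hom C y z" "g' \<in> Hom C z y" "g' \<cdot> f' = idt C y" "f' \<cdot> g' = idt C z"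
    using assms(2) by (rule isomorphicE)
  have "(g \<cdot> g') \<cdot> (f' \<cdot> f) = g \<cdot> ((g' \<cdot> f') \<cdot> f)"
    using cmp_assoc[OF cmp_hom[OF f(1) f'(1)] f'(2) f(2)] cmp_assoc[OF f(1) f'(1) f'(2)] by simp
  moreover have "(f' \<cdot> f) \<cdot> (g \<cdot> g') = f' \<cdot> ((f \<cdot> g) \<cdot> g')"
    using cmp_assoc[OF cmp_hom[OF f'(2) f(2)] f(1) f'(1)] cmp_assoc[OF f'(2) f(2) f(1)] by simp
  ultimately show ?thesis using f f' idt_cmp[OF f(1)] idt_cmp[OF f'(2)]
    by (intro isomorphicI[OF cmp_hom[OF f(1) f'(1)] cmp_hom[OF f'(2) f(2)]]) auto
qed

lemma is_direct_sum_singleton: "is_direct_sum C x [y] \<longleftrightarrow> isomorphic C x y"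
proof
  assume "isomorphic C x y"
  then obtain f g where f: "f \<in> Hom C x y" "g \<in> Hom C y x" "g \<cdot> f = idt C x" "f \<cdot> g = idt C y"
    by (rule isomorphicE)
  have "biproduct x [y] (\<lambda>_. g) (\<lambda>_. f)"
  proof (rule biproductI)
    fix h k assume h: "h \<in> Hom C x x" "k \<in> Hom C x x" "\<And>a. a < length [y] \<Longrightarrow> f \<cdot> h = f \<cdot> k"
    hence "g \<cdot> (f \<cdot> h) = g \<cdot> (f \<cdot> k)" by simp
    thus "h = k" using cmp_assoc[OF h(1) f(1) f(2)] cmp_assoc[OF h(2) f(1) f(2)] f(3) h idt_cmp by simp
  qed (use f Hom_obj[OF f(1)] in auto)
  thus "is_direct_sum C x [y]" using is_direct_sum_iff_biproduct by blast
next
  assume "is_direct_sum C x [y]"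
  then obtain I P where b: "biproduct x [y] I P" using is_direct_sum_iff_biproduct by blast
  note B = biproductD[OF b]
  have "hsum x x (\<lambda>a. I a \<cdot> P a) {..<length [y]} = I 0 \<cdot> P 0"
    using B(1) B(5) B(4) cmp_hom by (intro hsum_delta) fastforce+
  thus "isomorphic C x y" using B(4,5,6)[of 0] B(8)
    by (intro isomorphicI[of "P 0" _ _ "I 0"]) auto
qed

lemma is_direct_sum_Nil: "is_direct_sum C x [] \<longleftrightarrow> zero_obj C x"
  by (auto simp: is_direct_sum_def lincomb_sum_def zero_obj_def)

text \<open>Associativity of direct sums: a summand may be replaced by a decomposition of it.  The case \<open>ys = []\<close> removes a
  zero object, and the case of a singleton replaces a summand by an isomorphic object.\<close>

lemma is_direct_sum_replace:
  assumes x: "is_direct_sum C x (y # zs)" and y: "is_direct_sum C y ys"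
  shows "is_direct_sum C x (ys @ zs)"
proof -
  obtain I P where b: "biproduct x (y # zs) I P" using x is_direct_sum_iff_biproduct by blast
  obtain I' P' where b': "biproduct y ys I' P'" using y is_direct_sum_iff_biproduct by blast
  note B = biproductD[OF b] and B' = biproductD[OF b']
  define m where "m = length ys"
  define I2 where "I2 a = (if a < m then I 0 \<cdot> I' a else I (Suc (a - m)))" for a
  define P2 where "P2 a = (if a < m then P' a \<cdot> P 0 else P (Suc (a - m)))" for a
  have nth: "(ys @ zs) ! a = (if a < m then ys ! a else (y # zs) ! Suc (a - m))" for a
    by (auto simp: nth_append m_def)
  have 0: "I 0 \<in> Hom C y x" "P 0 \<in> Hom C x y" "P 0 \<cdot> I 0 = idt C y" using B(4,5,6)[of 0] by auto
  have n: "Suc (a - m) < length (y # zs)" if "a < length (ys @ zs)" "\<not> a < m" for a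
    using that by (auto simp: m_def)
  have m: "a < length ys" if "a < m" for a using that by (simp add: m_def)
  have "biproduct x (ys @ zs) I2 P2"
  proof (rule biproductI)
    show "x \<in> obj C" "set (ys @ zs) \<subseteq> obj C" using B B' by auto
    fix a assume a: "a < length (ys @ zs)"
    show "I2 a \<in> Hom C ((ys @ zs) ! a) x"
      unfolding nth I2_def using cmp_hom[OF B'(4)[OF m] 0(1)] B(4)[OF n[OF a]] by simp
    show P2: "P2 a \<in> Hom C x ((ys @ zs) ! a)"
      unfolding nth P2_def using cmp_hom[OF 0(2) B'(5)[OF m]] B(5)[OF n[OF a]] by simp
    show "P2 a \<cdot> I2 a = idt C ((ys @ zs) ! a)"
    proof (cases "a < m")
      case True
      note a' = m[OF True]
      have "(P' a \<cdot> P 0) \<cdot> (I 0 \<cdot> I' a) = P' a \<cdot> ((P 0 \<cdot> I 0) \<cdot> I' a)"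
        using cmp_assoc[OF cmp_hom[OF B'(4)[OF a'] 0(1)] 0(2) B'(5)[OF a']]
          cmp_assoc[OF B'(4)[OF a'] 0(1) 0(2)] by simp
      thus ?thesis using True B'(6)[OF a'] 0(3) idt_cmp[OF B'(4)[OF a']] by (simp add: nth I2_def P2_def)
    next
      case False
      thus ?thesis using B(6)[OF n[OF a]] by (simp add: nth I2_def P2_def)
    qed
    fix c assume c: "c < length (ys @ zs)" and ac: "a \<noteq> c"
    show "P2 a \<cdot> I2 c = nul C ((ys @ zs) ! c) ((ys @ zs) ! a)"
    proof (cases "a < m"; cases "c < m")
      assume t: "a < m" "c < m"
      note a' = m[OF t(1)] and c' = m[OF t(2)]
      have "(P' a \<cdot> P 0) \<cdot> (I 0 \<cdot> I' c) = P' a \<cdot> ((P 0 \<cdot> I 0) \<cdot> I' c)"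
        using cmp_assoc[OF cmp_hom[OF B'(4)[OF c'] 0(1)] 0(2) B'(5)[OF a']]
          cmp_assoc[OF B'(4)[OF c'] 0(1) 0(2)] by simp
      thus ?thesis using t ac B'(7)[OF a' c' ac] 0(3) idt_cmp[OF B'(4)[OF c']] by (simp add: nth I2_def P2_def)
    next
      assume t: "a < m" "\<not> c < m"
      note a' = m[OF t(1)] and c' = n[OF c t(2)]
      have z: "P 0 \<cdot> I (Suc (c - m)) = nul C ((y # zs) ! Suc (c - m)) y" 
        using B(7)[OF _ c', of 0] by simp
      have "(P' a \<cdot> P 0) \<cdot> I (Suc (c - m)) = P' a \<cdot> (P 0 \<cdot> I (Suc (c - m)))"
        using cmp_assoc[OF B(4)[OF c'] 0(2) B'(5)[OF a']] by simp
      also have "\<dots> = nul C ((y # zs) ! Suc (c - m)) (ys ! a)"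
        unfolding z using cmp_nul[OF B'(5)[OF a']] B(3)[OF c'] by simp
      finally show ?thesis using t by (simp add: nth I2_def P2_def)
    next
      assume t: "\<not> a < m" "c < m"
      note a' = n[OF a t(1)] and c' = m[OF t(2)]
      have z: "P (Suc (a - m)) \<cdot> I 0 = nul C y ((y # zs) ! Suc (a - m))" 
        using B(7)[OF a', of 0] by simp
      have "P (Suc (a - m)) \<cdot> (I 0 \<cdot> I' c) = (P (Suc (a - m)) \<cdot> I 0) \<cdot> I' c"
        using cmp_assoc[OF B'(4)[OF c'] 0(1) B(5)[OF a']] by simp
      also have "\<dots> = nul C (ys ! c) ((y # zs) ! Suc (a - m))"
        unfolding z using nul_cmp[OF B'(4)[OF c']] B(3)[OF a'] by simp
      finally show ?thesis using t by (simp add: nth I2_def P2_def)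
    next
      assume t: "\<not> a < m" "\<not> c < m"
      hence "Suc (a - m) \<noteq> Suc (c - m)" using ac by auto
      thus ?thesis using B(7)[OF n[OF a t(1)] n[OF c t(2)]] t by (simp add: nth I2_def P2_def)
    qed
  next
    fix f g assume f: "f \<in> Hom C x x" and g: "g \<in> Hom C x x"
      and eq: "\<And>a. a < length (ys @ zs) \<Longrightarrow> P2 a \<cdot> f = P2 a \<cdot> g"
    show "f = g"
    proof (rule biproduct_ext[OF b f g])
      fix a assume a: "a < length (y # zs)"
      show "P a \<cdot> f = P a \<cdot> g"
      proof (cases a)
        case 0
        have "P 0 \<cdot> f = P 0 \<cdot> g"
        proof (rule biproduct_ext[OF b'])
          show "P 0 \<cdot> f \<in> Hom C x y" "P 0 \<cdot> g \<in> Hom C x y"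
            using f g \<open>P 0 \<in> Hom C x y\<close> cmp_hom by blast+
          fix c assume c: "c < length ys"
          have "P2 c \<cdot> f = P2 c \<cdot> g" using eq c by simp
          thus "P' c \<cdot> P 0 \<cdot> f = P' c \<cdot> P 0 \<cdot> g"
            using c cmp_assoc[OF f _ B'(5)[OF c], of "P 0"] cmp_assoc[OF g _ B'(5)[OF c], of "P 0"] \<open>P 0 \<in> Hom C x y\<close>
            by (simp add: P2_def m_def)
        qed
        thus ?thesis using 0 by simp
      next
        case (Suc c)
        thus ?thesis using eq[of "m + c"] a by (simp add: P2_def m_def)
      qed
    qed
  qed
  thus ?thesis using is_direct_sum_iff_biproduct by blast
qed

lemma is_direct_sum_perm:
  assumes x: "is_direct_sum C x xs" and p: "mset xs = mset ys"
  shows "is_direct_sum C x ys"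
proof -
  obtain I P where b: "biproduct x xs I P" using x is_direct_sum_iff_biproduct by blast
  note B = biproductD[OF b]
  obtain f where f: "bij_betw f {..<length ys} {..<length xs}" "\<And>i. i < length ys \<Longrightarrow> ys ! i = xs ! f i"
    using permutation_Ex_bij[of ys xs] p by auto
  have fl: "f a < length xs" if "a < length ys" for a using f(1) that by (auto simp: bij_betw_def)
  have "biproduct x ys (\<lambda>a. I (f a)) (\<lambda>a. P (f a))"
  proof (rule biproductI)
    show "set ys \<subseteq> obj C" using B(2) p by (metis set_mset_mset)
    fix a c assume "a < length ys" "c < length ys" "a \<noteq> c"
    moreover from this have "f a \<noteq> f c" using f(1) by (auto simp: bij_betw_def inj_on_def)
    ultimately show "P (f a) \<cdot> I (f c) = nul C (ys ! c) (ys ! a)" using B(7) fl f(2) by simp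
  next
    fix g h assume g: "g \<in> Hom C x x" "h \<in> Hom C x x" "\<And>a. a < length ys \<Longrightarrow> P (f a) \<cdot> g = P (f a) \<cdot> h"
    show "g = h"
    proof (rule biproduct_ext[OF b g(1,2)])
      fix a assume "a < length xs"
      then obtain c where "c < length ys" "a = f c" using f(1) by (auto simp: bij_betw_def)
      thus "P a \<cdot> g = P a \<cdot> h" using g(3) by simp
    qed
  qed (use B fl f(2) in auto)
  thus ?thesis using is_direct_sum_iff_biproduct by blast
qed

lemma is_direct_sum_concat:
  assumes "is_direct_sum C x xs" "list_all2 (is_direct_sum C) xs yss"
  shows "is_direct_sum C x (concat yss)"
proof -
  have "is_direct_sum C x (xs @ zs) \<Longrightarrow> is_direct_sum C x (concat yss @ zs)" for zs
    using assms(2)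
  proof (induction arbitrary: zs rule: list_all2_induct)
    case (Cons y xs ys yss)
    have "is_direct_sum C x (ys @ (xs @ zs))" using is_direct_sum_replace[OF _ Cons.hyps(1)] Cons.prems by simp
    hence "is_direct_sum C x (xs @ (zs @ ys))" by (rule is_direct_sum_perm) simp
    from Cons.IH[OF this] show ?case by (rule is_direct_sum_perm) simp
  qed simp
  from this[of "[]"] show ?thesis using assms(1) by simp
qed

lemma is_direct_sum_append:
  assumes "is_direct_sum C x [y, z]" "is_direct_sum C y ys" "is_direct_sum C z zs"
  shows "is_direct_sum C x (ys @ zs)"
  using is_direct_sum_concat[of x "[y, z]" "[ys, zs]"] assms by simp

lemma is_direct_sum_iso:
  "isomorphic C x y \<Longrightarrow> is_direct_sum C y ys \<Longrightarrow> is_direct_sum C x ys"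
  using is_direct_sum_replace[of x y "[]" ys] is_direct_sum_singleton by simp

lemma is_direct_sum_iso_summands:
  assumes "is_direct_sum C x xs" "list_all2 (isomorphic C) xs ys"
  shows "is_direct_sum C x ys"
proof -
  have "list_all2 (is_direct_sum C) xs (map (\<lambda>y. [y]) ys)"
    using assms(2) by (simp add: list_all2_map2 is_direct_sum_singleton)
  from is_direct_sum_concat[OF assms(1) this] show ?thesis by simp
qed

text \<open>Each projection family lifts through the other one; the two lifts are inverse to each other because the
  projections are jointly monic.\<close>

lemma is_direct_sum_unique:
  assumes x: "is_direct_sum C x xs" and y: "is_direct_sum C y xs"
  shows "isomorphic C x y"
proof -
  obtain I P where b: "biproduct x xs I P" using x is_direct_sum_iff_biproduct by blast
  obtain I' P' where b': "biproduct y xs I' P'" using y is_direct_sum_iff_biproduct by blast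
  note B = biproductD[OF b] and B' = biproductD[OF b']
  obtain f where f: "f \<in> Hom C x y" "\<And>a. a < length xs \<Longrightarrow> P' a \<cdot> f = P a"
    using biproduct_lift[OF b' B(1), of P] B(5) by blast
  obtain g where g: "g \<in> Hom C y x" "\<And>a. a < length xs \<Longrightarrow> P a \<cdot> g = P' a"
    using biproduct_lift[OF b B'(1), of P'] B'(5) by blast
  have "g \<cdot> f = idt C x"
    using f g cmp_assoc[OF f(1) g(1) B(5)] cmp_idt[OF B(5)]
    by (intro biproduct_ext[OF b cmp_hom[OF f(1) g(1)] idt_hom[OF B(1)]]) auto
  moreover have "f \<cdot> g = idt C y"
    using f g cmp_assoc[OF g(1) f(1) B'(5)] cmp_idt[OF B'(5)]
    by (intro biproduct_ext[OF b' cmp_hom[OF g(1) f(1)] idt_hom[OF B'(1)]]) auto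
  ultimately show ?thesis using f(1) g(1) by (rule_tac isomorphicI)
qed

lemma hom_zero_obj: "zero_obj C y \<Longrightarrow> f \<in> Hom C x y \<Longrightarrow> f = nul C x y"
  using idt_cmp nul_cmp Hom_obj unfolding zero_obj_def by metis

end

text \<open>Direct sums and isomorphisms are transported by linearity alone.  Besides the fiber functor, the projection to a
  quotient and tensoring with a fixed representation are of this kind.\<close>

locale linear_functor = C: linear_category C + D: linear_category D
  for C :: "('o, 'm, 'k :: field) lin_mon_cat" and D :: "('o2, 'm2, 'k) lin_mon_cat" +
  fixes Fo :: "'o \<Rightarrow> 'o2" and Fm :: "'m \<Rightarrow> 'm2"
  assumes Fo_obj: "x \<in> obj C \<Longrightarrow> Fo x \<in> obj D"
    and Fm_hom: "f \<in> Hom C x y \<Longrightarrow> Fm f \<in> Hom D (Fo x) (Fo y)"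
    and Fm_idt: "x \<in> obj C \<Longrightarrow> Fm (idt C x) = idt D (Fo x)"
    and Fm_cmp: "f \<in> Hom C x y \<Longrightarrow> g \<in> Hom C y z \<Longrightarrow> Fm (g \<cdot>\<^bsub>C\<^esub> f) = Fm g \<cdot>\<^bsub>D\<^esub> Fm f"
    and Fm_plu: "f \<in> Hom C x y \<Longrightarrow> g \<in> Hom C x y \<Longrightarrow> Fm (f \<boxplus>\<^bsub>C\<^esub> g) = Fm f \<boxplus>\<^bsub>D\<^esub> Fm g"
    and Fm_scl: "f \<in> Hom C x y \<Longrightarrow> Fm (c \<triangleright>\<^bsub>C\<^esub> f) = c \<triangleright>\<^bsub>D\<^esub> Fm f"
begin

lemma Fm_nul: 
  assumes "x \<in> obj C" "y \<in> obj C" 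
  shows "Fm (nul C x y) = nul D (Fo x) (Fo y)"
  using Fm_scl[OF C.nul_hom[OF assms], of 0] C.zero_scl[OF C.nul_hom[OF assms]]
    D.zero_scl[OF Fm_hom[OF C.nul_hom[OF assms]]] by simp

lemma Fm_hsum:
  assumes "x \<in> obj C" "y \<in> obj C" "\<And>a. a \<in> A \<Longrightarrow> f a \<in> Hom C x y"
  shows "Fm (C.hsum x y f A) = D.hsum (Fo x) (Fo y) (\<lambda>a. Fm (f a)) A"
  using assms(3)
proof (induction A rule: infinite_finite_induct)
  case (insert a A)
  have "C.hsum x y f A \<in> Hom C x y" using insert.prems assms(1,2) by (intro C.hsum_hom) auto
  moreover have "C.hsum x y f (insert a A) = f a \<boxplus>\<^bsub>C\<^esub> C.hsum x y f A"
    using insert assms(1,2) by (intro C.hsum_insert) auto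
  moreover have "D.hsum (Fo x) (Fo y) (\<lambda>a. Fm (f a)) (insert a A) =
      Fm (f a) \<boxplus>\<^bsub>D\<^esub> D.hsum (Fo x) (Fo y) (\<lambda>a. Fm (f a)) A"
    using insert assms(1,2) Fm_hom Fo_obj by (intro D.hsum_insert) auto
  moreover have "f a \<in> Hom C x y" using insert.prems by simp
  ultimately show ?case using insert Fm_plu[of "f a" x y "C.hsum x y f A"] by simp
qed (use assms in \<open>auto simp: C.hsum_infinite D.hsum_infinite C.hsum_empty D.hsum_empty Fm_nul Fo_obj\<close>)

lemma is_direct_sum_map:
  assumes "is_direct_sum C x xs"
  shows "is_direct_sum D (Fo x) (map Fo xs)"
proof -
  obtain I P where b: "C.biproduct x xs I P" using assms C.is_direct_sum_iff_biproduct by blast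
  note B = C.biproductD[OF b]
  have "D.biproduct (Fo x) (map Fo xs) (\<lambda>a. Fm (I a)) (\<lambda>a. Fm (P a))"
    unfolding D.biproduct_def length_map
  proof (intro conjI allI impI)
    show "D.hsum (Fo x) (Fo x) (\<lambda>a. Fm (I a) \<cdot>\<^bsub>D\<^esub> Fm (P a)) {..<length xs} = idt D (Fo x)"
    proof -
      have "Fm (C.hsum x x (\<lambda>a. I a \<cdot>\<^bsub>C\<^esub> P a) {..<length xs}) =
            D.hsum (Fo x) (Fo x) (\<lambda>a. Fm (I a \<cdot>\<^bsub>C\<^esub> P a)) {..<length xs}"
        using B(1) C.cmp_hom[OF B(5) B(4)] by (intro Fm_hsum) auto
      also have "\<dots> = D.hsum (Fo x) (Fo x) (\<lambda>a. Fm (I a) \<cdot>\<^bsub>D\<^esub> Fm (P a)) {..<length xs}"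
        using B Fo_obj Fm_cmp[OF B(5) B(4)] D.cmp_hom[OF Fm_hom[OF B(5)] Fm_hom[OF B(4)]]
        by (intro D.hsum_cong) auto
      finally show ?thesis using B Fm_idt by simp
    qed
  next
    fix a c assume a: "a < length xs" and c: "c < length xs"
    show "Fm (P a) \<cdot>\<^bsub>D\<^esub> Fm (I c) = (if a = c then idt D (map Fo xs ! a) else nul D (map Fo xs ! c) (map Fo xs ! a))"
      using Fm_cmp[OF B(4)[OF c] B(5)[OF a]] B(6)[OF a] B(7)[OF a c] a c Fm_idt[OF B(3)[OF a]] 
        Fm_nul[OF B(3)[OF c] B(3)[OF a]] by (cases "a = c") auto
  qed (use B Fo_obj Fm_hom in auto)
  thus ?thesis using D.is_direct_sum_iff_biproduct by blast
qed

lemma isomorphic_map: "isomorphic C x y \<Longrightarrow> isomorphic D (Fo x) (Fo y)"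
  using is_direct_sum_map[of x "[y]"] by (simp add: C.is_direct_sum_singleton D.is_direct_sum_singleton)

end

section \<open>Multiplicities of simple objects\<close>

text \<open>A matrix with a right inverse has at most as many rows as columns: otherwise pad both factors by zeros to square
  matrices; the product of the padded matrices is still the identity, but the first one kills a unit vector.
  Multiplicities and fixed spaces are both counted through it.\<close>

lemma card_le_of_right_inverse:
  fixes A :: "'a \<Rightarrow> 'b \<Rightarrow> 'k :: field"
  assumes "finite I" "finite J"
    and inv: "\<And>a a'. a \<in> I \<Longrightarrow> a' \<in> I \<Longrightarrow> (\<Sum>b\<in>J. A a b * B b a') = (if a = a' then 1 else 0)"
  shows "card I \<le> card J"
proof (rule ccontr)
  define m where "m = card I"
  define n where "n = card J"
  assume "\<not> card I \<le> card J"
  hence nm: "n < m" by (simp add: m_def n_def)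
  obtain f where f: "bij_betw f {0..<m} I" using ex_bij_betw_nat_finite[OF assms(1)] m_def by blast
  obtain g where g: "bij_betw g {0..<n} J" using ex_bij_betw_nat_finite[OF assms(2)] n_def by blast
  \<comment> \<open>padding with zero columns and zero rows makes both factors square\<close>
  define MA where "MA = mat m m (\<lambda>(i, j). if j < n then A (f i) (g j) else 0)"
  define MB where "MB = mat m m (\<lambda>(i, j). if i < n then B (g i) (f j) else 0)"
  have c: "MA \<in> carrier_mat m m" "MB \<in> carrier_mat m m" by (auto simp: MA_def MB_def)
  have "MA * MB = 1\<^sub>m m"
  proof (rule eq_matI)
    fix i j assume ij: "i < dim_row (1\<^sub>m m :: 'k mat)" "j < dim_col (1\<^sub>m m :: 'k mat)"
    have "(MA * MB) $$ (i, j) = (\<Sum>k = 0..<m. MA $$ (i, k) * MB $$ (k, j))"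
      using ij c by (simp add: scalar_prod_def)
    also have "\<dots> = (\<Sum>k = 0..<n. A (f i) (g k) * B (g k) (f j))"
      using ij nm by (intro sum.mono_neutral_cong_right) (auto simp: MA_def MB_def)
    also have "\<dots> = (\<Sum>b\<in>J. A (f i) b * B b (f j))"
      using sum.reindex_bij_betw[OF g, of "\<lambda>b. A (f i) b * B b (f j)"] .
    also have "\<dots> = (if f i = f j then 1 else 0)"
      using ij f by (intro inv) (auto simp: bij_betw_def)
    also have "\<dots> = 1\<^sub>m m $$ (i, j)"
      using ij f by (auto simp: bij_betw_def inj_on_def)
    finally show "(MA * MB) $$ (i, j) = 1\<^sub>m m $$ (i, j)" .
  qed (use c in auto)
  hence "det MA * det MB = 1" using det_mult[OF c] by simp
  moreover have "det MA = 0"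
    unfolding det_0_iff_vec_prod_zero_field[OF c(1)]
  proof (intro exI conjI)
    show "unit_vec m n \<in> carrier_vec m" by simp
    show "unit_vec m n \<noteq> 0\<^sub>v m" using nm by (metis index_unit_vec(1) index_zero_vec(1) zero_neq_one)
    show "MA *\<^sub>v unit_vec m n = 0\<^sub>v m"
      using nm by (intro eq_vecI) (auto simp: MA_def)
  qed
  ultimately show False by simp
qed

text \<open>What semisimplicity over an algebraically closed field provides.  Both a symmetric fusion category and the
  Verlinde category are shown to be of this kind, so that multiplicities and Frobenius-Perron dimensions are
  treated once for both.\<close>

locale schur_category = linear_category C for C :: "('o, 'm, 'k :: field) lin_mon_cat" (structure) +
  assumes schur: "simple_obj C s \<Longrightarrow> simple_obj C t \<Longrightarrow> f \<in> Hom C s t \<Longrightarrow> f = nul C s t \<or> is_iso C f"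
    and schur_End: "simple_obj C s \<Longrightarrow> f \<in> Hom C s s \<Longrightarrow> \<exists>c. f = c \<triangleright> idt C s"
    and semisimple_decomposition: "x \<in> obj C \<Longrightarrow> \<exists>xs. (\<forall>s \<in> set xs. simple_obj C s) \<and> is_direct_sum C x xs"
begin

lemma simple_idt:
  assumes "simple_obj C s"
  shows "s \<in> obj C" "idt C s \<noteq> nul C s s"
  using assms by (auto simp: simple_obj_def zero_obj_def)

lemma simple_scl_eq:
  assumes s: "simple_obj C s" and eq: "c \<triangleright> idt C s = c' \<triangleright> idt C s"
  shows "c = c'"
proof (rule ccontr)
  assume ne: "c \<noteq> c'"
  have i: "idt C s \<in> Hom C s s" using idt_hom simple_idt(1)[OF s] .
  have "(c + (- c')) \<triangleright> idt C s = (c' + (- c')) \<triangleright> idt C s" 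
    unfolding plus_scl[OF i] eq by (rule refl)
  hence "inverse (c - c') \<triangleright> ((c - c') \<triangleright> idt C s) = inverse (c - c') \<triangleright> nul C s s" 
    using zero_scl[OF i] by simp
  hence "idt C s = nul C s s"
    using ne scl_scl[OF i, of "inverse (c - c')" "c - c'"] scl_one[OF i] scl_nul simple_idt(1)[OF s] by simp
  thus False using simple_idt(2)[OF s] by simp
qed

definition coef :: "'o \<Rightarrow> 'm \<Rightarrow> 'k" where
  "coef s f = (SOME c. f = c \<triangleright> idt C s)"

lemma coef: "simple_obj C s \<Longrightarrow> f \<in> Hom C s s \<Longrightarrow> f = coef s f \<triangleright> idt C s"
  unfolding coef_def using schur_End by (rule someI_ex)

text \<open>Krull-Schmidt for semisimple objects.  Compare two decompositions of \<open>x\<close> through the maps \<open>s \<rightarrow> x \<rightarrow> s\<close>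
  that pass through the summands isomorphic to \<open>s\<close>.  By Schur's lemma the other summands contribute zero, so
  the scalars of the composites form two matrices with product the identity, and
  \<open>card_le_of_right_inverse\<close> compares the numbers of summands.\<close>

lemma multiplicity_le:
  assumes s: "simple_obj C s"
    and xs: "\<And>t. t \<in> set xs \<Longrightarrow> simple_obj C t" "is_direct_sum C x xs"
    and ys: "\<And>t. t \<in> set ys \<Longrightarrow> simple_obj C t" "is_direct_sum C x ys"
  shows "length (filter (isomorphic C s) xs) \<le> length (filter (isomorphic C s) ys)"
proof -
  obtain I P where b: "biproduct x xs I P" using xs(2) is_direct_sum_iff_biproduct by blast
  obtain I' P' where b': "biproduct x ys I' P'" using ys(2) is_direct_sum_iff_biproduct by blast
  note X = biproductD[OF b] and Y = biproductD[OF b']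
  have so: "s \<in> obj C" using s simple_idt by blast
  have ih: "idt C s \<in> Hom C s s" using idt_hom so .
  define S where "S = {a. a < length xs \<and> isomorphic C s (xs ! a)}"
  define T where "T = {a. a < length ys \<and> isomorphic C s (ys ! a)}"
  have "\<forall>a\<in>S. \<exists>u v. u \<in> Hom C s (xs ! a) \<and> v \<in> Hom C (xs ! a) s \<and> v \<cdot> u = idt C s \<and> u \<cdot> v = idt C (xs ! a)"
    using S_def isomorphicE by (smt (verit, best) mem_Collect_eq)
  then obtain \<phi> \<psi> where iso: "\<And>a. a \<in> S \<Longrightarrow> \<phi> a \<in> Hom C s (xs ! a)" "\<And>a. a \<in> S \<Longrightarrow> \<psi> a \<in> Hom C (xs ! a) s"
    "\<And>a. a \<in> S \<Longrightarrow> \<psi> a \<cdot> \<phi> a = idt C s" by metis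
  have "\<forall>a\<in>T. \<exists>u v. u \<in> Hom C s (ys ! a) \<and> v \<in> Hom C (ys ! a) s \<and> v \<cdot> u = idt C s \<and> u \<cdot> v = idt C (ys ! a)"
    using T_def isomorphicE by (smt (verit, best) mem_Collect_eq)
  then obtain \<phi>' \<psi>' where iso': "\<And>a. a \<in> T \<Longrightarrow> \<phi>' a \<in> Hom C s (ys ! a)" "\<And>a. a \<in> T \<Longrightarrow> \<psi>' a \<in> Hom C (ys ! a) s"
    "\<And>a. a \<in> T \<Longrightarrow> \<phi>' a \<cdot> \<psi>' a = idt C (ys ! a)" by metis
  define u where "u a = I a \<cdot> \<phi> a" for a
  define v where "v a = \<psi> a \<cdot> P a" for a
  define u' where "u' a = I' a \<cdot> \<phi>' a" for a
  define v' where "v' a = \<psi>' a \<cdot> P' a" for a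
  have u: "u a \<in> Hom C s x" if "a \<in> S" for a
    using cmp_hom[OF iso(1)[OF that] X(4)] that by (simp add: u_def S_def)
  have v: "v a \<in> Hom C x s" if "a \<in> S" for a
    using cmp_hom[OF X(5) iso(2)[OF that]] that by (simp add: v_def S_def)
  have u': "u' a \<in> Hom C s x" if "a \<in> T" for a
    using cmp_hom[OF iso'(1)[OF that] Y(4)] that by (simp add: u'_def T_def)
  have v': "v' a \<in> Hom C x s" if "a \<in> T" for a
    using cmp_hom[OF Y(5) iso'(2)[OF that]] that by (simp add: v'_def T_def)
  have vu: "v a \<cdot> u a' = (if a = a' then idt C s else nul C s s)" if a: "a \<in> S" "a' \<in> S" for a a'
  proof -
    have l: "a < length xs" "a' < length xs" using a by (auto simp: S_def)
    have "v a \<cdot> u a' = \<psi> a \<cdot> (P a \<cdot> (I a' \<cdot> \<phi> a'))"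
      unfolding v_def u_def using cmp_assoc[OF cmp_hom[OF iso(1)[OF a(2)] X(4)[OF l(2)]] X(5)[OF l(1)] iso(2)[OF a(1)]] .
    also have "P a \<cdot> (I a' \<cdot> \<phi> a') = (P a \<cdot> I a') \<cdot> \<phi> a'"
      using cmp_assoc[OF iso(1)[OF a(2)] X(4)[OF l(2)] X(5)[OF l(1)]] by simp
    finally show ?thesis
      using a l X(6)[OF l(1)] X(7)[OF l] iso(3)[OF a(1)] idt_cmp[OF iso(1)[OF a(1)]] 
        nul_cmp[OF iso(1)[OF a(2)] X(3)[OF l(1)]] cmp_nul[OF iso(2)[OF a(1)] so] by auto
  qed
  define A where "A a b = coef s (v a \<cdot> u' b)" for a b
  define B where "B b a = coef s (v' b \<cdot> u a)" for a b
  have main: "(\<Sum>b\<in>T. A a b * B b a') = (if a = a' then 1 else 0)" if a: "a \<in> S" "a' \<in> S" for a a'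
  proof -
    note ua = u[OF a(2)] and va = v[OF a(1)]
    let ?h = "\<lambda>b. v a \<cdot> (I' b \<cdot> (P' b \<cdot> u a'))"
    have hh: "I' b \<cdot> (P' b \<cdot> u a') \<in> Hom C s x" if "b < length ys" for b
      using cmp_hom[OF cmp_hom[OF ua Y(5)[OF that]] Y(4)[OF that]] .
    have h: "?h b = (if b \<in> T then A a b * B b a' else 0) \<triangleright> idt C s" if bl: "b < length ys" for b
    proof (cases "b \<in> T")
      case True
      \<comment> \<open>a summand isomorphic to \<open>s\<close>: the composite \<open>s \<rightarrow> ys ! b \<rightarrow> s\<close> is the product of two scalars\<close>
      note P'b = Y(5)[OF bl] and I'b = Y(4)[OF bl] and f = iso'(1)[OF True] and g = iso'(2)[OF True]
      have "v' b \<cdot> u a' = \<psi>' b \<cdot> (P' b \<cdot> u a')" unfolding v'_def using cmp_assoc[OF ua P'b g] .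
      hence "\<phi>' b \<cdot> (v' b \<cdot> u a') = (\<phi>' b \<cdot> \<psi>' b) \<cdot> (P' b \<cdot> u a')" 
        using cmp_assoc[OF cmp_hom[OF ua P'b] g f] by simp
      hence "P' b \<cdot> u a' = \<phi>' b \<cdot> (v' b \<cdot> u a')" 
        using iso'(3)[OF True] idt_cmp[OF cmp_hom[OF ua P'b]] by simp
      also have "v' b \<cdot> u a' = B b a' \<triangleright> idt C s" 
        unfolding B_def by (rule coef[OF s cmp_hom[OF ua v'[OF True]]])
      also have "\<phi>' b \<cdot> (B b a' \<triangleright> idt C s) = B b a' \<triangleright> \<phi>' b"
        using cmp_scl[OF ih f] cmp_idt[OF f] by simp
      finally have "?h b = v a \<cdot> (B b a' \<triangleright> u' b)" using cmp_scl[OF f I'b] by (simp add: u'_def)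
      also have "\<dots> = B b a' \<triangleright> (v a \<cdot> u' b)" using cmp_scl[OF u'[OF True] va] .
      also have "v a \<cdot> u' b = A a b \<triangleright> idt C s"
        unfolding A_def by (rule coef[OF s cmp_hom[OF u'[OF True] va]])
      finally show ?thesis using True scl_scl[OF ih, of "B b a'" "A a b"] by (simp add: mult.commute)
    next
      case False
      \<comment> \<open>any other summand admits no nonzero arrow from \<open>s\<close>\<close>
      have "P' b \<cdot> u a' \<in> Hom C s (ys ! b)" using cmp_hom[OF ua Y(5)[OF bl]] .
      moreover have "\<not> isomorphic C s (ys ! b)" using False bl by (simp add: T_def)
      ultimately have "P' b \<cdot> u a' = nul C s (ys ! b)"
        using schur[OF s ys(1)[OF nth_mem[OF bl]], of "P' b \<cdot> u a'"] unfolding isomorphic_def by blast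
      thus ?thesis using False cmp_nul[OF Y(4)[OF bl] so] cmp_nul[OF va so] zero_scl[OF ih] by simp
    qed
    have "v a \<cdot> u a' = v a \<cdot> hsum s x (\<lambda>b. I' b \<cdot> (P' b \<cdot> u a')) {..<length ys}"
      using biproduct_expand[OF b' ua] by simp
    also have "\<dots> = hsum s s ?h {..<length ys}"
      using hh by (intro cmp_hsum[OF va so]) auto
    also have "\<dots> = hsum s s (\<lambda>b. (if b \<in> T then A a b * B b a' else 0) \<triangleright> idt C s) {..<length ys}"
      using h scl_hom[OF ih] by (intro hsum_cong[OF so so]) auto
    also have "\<dots> = (\<Sum>b<length ys. if b \<in> T then A a b * B b a' else 0) \<triangleright> idt C s"
      by (rule hsum_scl[OF so so ih])
    also have "(\<Sum>b<length ys. if b \<in> T then A a b * B b a' else 0) = (\<Sum>b\<in>T. A a b * B b a')"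
      by (intro sum.mono_neutral_cong_right) (auto simp: T_def)
    finally have "(\<Sum>b\<in>T. A a b * B b a') \<triangleright> idt C s = (if a = a' then 1 else 0) \<triangleright> idt C s"
      using vu[OF a] scl_one[OF ih] zero_scl[OF ih] by auto
    thus ?thesis by (rule simple_scl_eq[OF s])
  qed
  have "card S \<le> card T" by (rule card_le_of_right_inverse[OF _ _ main]) (auto simp: S_def T_def)
  thus ?thesis by (simp add: length_filter_conv_card S_def T_def)
qed

lemma multiplicity_of_eq:
  assumes s: "simple_obj C s"
    and xs: "\<And>t. t \<in> set xs \<Longrightarrow> simple_obj C t" "is_direct_sum C x xs"
  shows "multiplicity_of C s x = length (filter (isomorphic C s) xs)"
  unfolding multiplicity_of_def
proof (rule the_equality)
  fix n assume "\<exists>ys. (\<forall>t \<in> set ys. simple_obj C t) \<and> is_direct_sum C x ys \<and>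
     n = length (filter (isomorphic C s) ys)"
  then obtain ys where ys: "\<And>t. t \<in> set ys \<Longrightarrow> simple_obj C t" "is_direct_sum C x ys" 
    "n = length (filter (isomorphic C s) ys)" by blast
  thus "n = length (filter (isomorphic C s) xs)"
    using multiplicity_le[OF s xs ys(1,2)] multiplicity_le[OF s ys(1,2) xs] by simp
qed (use xs in blast)

end

section \<open>Frobenius-Perron dimension and characters\<close>

text \<open>The easy half of the Perron-Frobenius theorem: if \<open>M w = e w\<close>, pairing \<open>e |w| \<le> M |w|\<close> with the positive left
  eigenvector \<open>v\<close> gives \<open>e \<le> l\<close>.\<close>

lemma spectrum_le_of_positive_left_eigenvector:
  fixes M :: "real mat"
  assumes M: "M \<in> carrier_mat n n" and pos: "\<And>i j. i < n \<Longrightarrow> j < n \<Longrightarrow> M $$ (i, j) \<ge> 0"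
    and v: "\<And>i. i < n \<Longrightarrow> v i > 0"
    and ev: "\<And>j. j < n \<Longrightarrow> (\<Sum>i<n. v i * M $$ (i, j)) = l * v j"
    and e: "eigenvalue M e" "e \<ge> 0"
  shows "e \<le> l"
proof -
  obtain w where w: "w \<in> carrier_vec n" "w \<noteq> 0\<^sub>v n" "M *\<^sub>v w = e \<cdot>\<^sub>v w"
    using e M unfolding eigenvalue_def eigenvector_def by auto
  obtain k where k: "k < n" "w $ k \<noteq> 0" using w by (metis eq_vecI carrier_vecD index_zero_vec)
  have row: "e * w $ i = (\<Sum>j<n. M $$ (i, j) * w $ j)" if "i < n" for i
  proof -
    have "(M *\<^sub>v w) $ i = (\<Sum>j<n. M $$ (i, j) * w $ j)"
      using that M w(1) by (simp add: scalar_prod_def atLeast0LessThan)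
    thus ?thesis using w that by simp
  qed
  have "e * (\<Sum>i<n. v i * \<bar>w $ i\<bar>) = (\<Sum>i<n. v i * \<bar>e * w $ i\<bar>)"
    using e by (simp add: sum_distrib_left abs_mult ac_simps)
  also have "\<dots> \<le> (\<Sum>i<n. v i * (\<Sum>j<n. M $$ (i, j) * \<bar>w $ j\<bar>))"
  proof (intro sum_mono mult_left_mono)
    fix i assume i: "i \<in> {..<n}"
    have "\<bar>e * w $ i\<bar> = \<bar>\<Sum>j<n. M $$ (i, j) * w $ j\<bar>" using row i by simp
    also have "\<dots> \<le> (\<Sum>j<n. \<bar>M $$ (i, j) * w $ j\<bar>)" by (rule sum_abs)
    also have "\<dots> = (\<Sum>j<n. M $$ (i, j) * \<bar>w $ j\<bar>)" using i pos by (intro sum.cong) (auto simp: abs_mult)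
    finally show "\<bar>e * w $ i\<bar> \<le> (\<Sum>j<n. M $$ (i, j) * \<bar>w $ j\<bar>)" .
  qed (use v in \<open>auto intro: less_imp_le\<close>)
  also have "\<dots> = (\<Sum>j<n. (\<Sum>i<n. v i * M $$ (i, j)) * \<bar>w $ j\<bar>)"
    unfolding sum_distrib_left sum_distrib_right by (subst sum.swap) (simp add: ac_simps)
  also have "\<dots> = l * (\<Sum>j<n. v j * \<bar>w $ j\<bar>)"
    using ev by (simp add: sum_distrib_left ac_simps)
  finally have "e * (\<Sum>i<n. v i * \<bar>w $ i\<bar>) \<le> l * (\<Sum>i<n. v i * \<bar>w $ i\<bar>)" .
  moreover have "(\<Sum>i<n. v i * \<bar>w $ i\<bar>) > 0"
    using k v by (intro sum_pos2[of _ k]) (simp_all add: less_imp_le)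
  ultimately show ?thesis by simp
qed

context schur_category
begin

text \<open>A finite set meeting all isomorphism classes can be thinned out to a list of representatives, so the choice in
  the definition of the list succeeds.\<close>

lemma simple_reps:
  assumes fin: "\<exists>ss. finite ss \<and> (\<forall>x. simple_obj C x \<longrightarrow> (\<exists>s \<in> ss. simple_obj C s \<and> isomorphic C x s))"
  shows "\<And>s. s \<in> set (simple_reps C) \<Longrightarrow> simple_obj C s"
    "\<And>i j. i < length (simple_reps C) \<Longrightarrow> j < length (simple_reps C) \<Longrightarrow>
       isomorphic C (simple_reps C ! i) (simple_reps C ! j) \<Longrightarrow> i = j"
    "\<And>x. simple_obj C x \<Longrightarrow> \<exists>s \<in> set (simple_reps C). isomorphic C x s"
proof -
  obtain ss where ss: "finite ss" "\<And>x. simple_obj C x \<Longrightarrow> \<exists>s \<in> ss. simple_obj C s \<and> isomorphic C x s"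
    using fin by blast
  define r where "r x = (SOME s. s \<in> ss \<and> simple_obj C s \<and> isomorphic C x s)" for x
  have r: "r x \<in> ss \<and> simple_obj C (r x) \<and> isomorphic C x (r x)" if "simple_obj C x" for x
    unfolding r_def by (rule someI_ex) (use ss(2)[OF that] in blast)
  have req: "r x = r y" if "isomorphic C x y" for x y
  proof -
    have "isomorphic C x s \<longleftrightarrow> isomorphic C y s" for s 
      using that isomorphic_trans isomorphic_sym by blast
    thus ?thesis by (simp add: r_def)
  qed
  define R where "R = r ` {s. simple_obj C s}"
  have "finite R" using r ss(1) by (rule_tac finite_subset[of _ ss]) (auto simp: R_def)
  then obtain l where l: "set l = R" "distinct l" using finite_distinct_list by blast
  have rr: "r s = s" if "s \<in> R" for s
    using that r req isomorphic_sym by (auto simp: R_def)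
  have "(\<forall>s \<in> set l. simple_obj C s) \<and>
     (\<forall>i < length l. \<forall>j < length l. isomorphic C (l ! i) (l ! j) \<longrightarrow> i = j) \<and>
     (\<forall>x. simple_obj C x \<longrightarrow> (\<exists>s \<in> set l. isomorphic C x s))"
  proof (intro conjI allI impI ballI)
    fix i j assume ij: "i < length l" "j < length l" "isomorphic C (l ! i) (l ! j)"
    have "l ! i = r (l ! i)" using rr[of "l ! i"] nth_mem[OF ij(1)] l(1) by simp
    also have "\<dots> = r (l ! j)" by (rule req[OF ij(3)])
    also have "\<dots> = l ! j" using rr[of "l ! j"] nth_mem[OF ij(2)] l(1) by simp
    finally show "i = j" using ij l(2) by (simp add: nth_eq_iff_index_eq)
  qed (use r l(1) in \<open>auto simp: R_def\<close>)
  hence *: "(\<forall>s \<in> set (simple_reps C). simple_obj C s) \<and>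
     (\<forall>i < length (simple_reps C). \<forall>j < length (simple_reps C). 
        isomorphic C (simple_reps C ! i) (simple_reps C ! j) \<longrightarrow> i = j) \<and>
     (\<forall>x. simple_obj C x \<longrightarrow> (\<exists>s \<in> set (simple_reps C). isomorphic C x s))"
    unfolding simple_reps_def by (rule someI)
  show "\<And>s. s \<in> set (simple_reps C) \<Longrightarrow> simple_obj C s"
    "\<And>i j. i < length (simple_reps C) \<Longrightarrow> j < length (simple_reps C) \<Longrightarrow>
       isomorphic C (simple_reps C ! i) (simple_reps C ! j) \<Longrightarrow> i = j"
    "\<And>x. simple_obj C x \<Longrightarrow> \<exists>s \<in> set (simple_reps C). isomorphic C x s"
    using * by blast+
qed

text \<open>An additive and multiplicative function \<open>d\<close> that is positive on simple objects is the Frobenius-Perron dimension.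
  Its values on the simple objects are a positive left eigenvector of the multiplication matrix of \<open>x\<close>, with
  eigenvalue \<open>d x\<close>, because \<open>\<Sum>\<^sub>i d s\<^sub>i [x \<otimes> s\<^sub>j : s\<^sub>i] = d (x \<otimes> s\<^sub>j) = d x d s\<^sub>j\<close>; and a nonnegative matrix has no
  nonnegative eigenvalue above that of a positive left eigenvector.\<close>

theorem FPdim_eq_character:
  fixes d :: "'o \<Rightarrow> real"
  assumes fin: "\<exists>ss. finite ss \<and> (\<forall>x. simple_obj C x \<longrightarrow> (\<exists>s \<in> ss. simple_obj C s \<and> isomorphic C x s))"
    and ne: "\<exists>s. simple_obj C s"
    and tno_obj: "\<And>x y. x \<in> obj C \<Longrightarrow> y \<in> obj C \<Longrightarrow> tno C x y \<in> obj C"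
    and add: "\<And>x xs. is_direct_sum C x xs \<Longrightarrow> d x = sum_list (map d xs)"
    and mult: "\<And>x y. x \<in> obj C \<Longrightarrow> y \<in> obj C \<Longrightarrow> d (tno C x y) = d x * d y"
    and pos: "\<And>s. simple_obj C s \<Longrightarrow> d s > 0"
    and x: "x \<in> obj C"
  shows "FPdim C x = d x"
proof -
  define ss where "ss = simple_reps C"
  define n where "n = length ss"
  note R = simple_reps[OF fin, folded ss_def]
  have n: "n > 0" using R(3) ne by (auto simp: n_def)
  have s: "simple_obj C (ss ! i)" if "i < n" for i using R(1) that by (auto simp: n_def)
  have d_iso: "d t = d u" if "isomorphic C t u" for t u
    using add[of t "[u]"] that is_direct_sum_singleton by simp
  have d_nonneg: "d y \<ge> 0" if "y \<in> obj C" for y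
  proof -
    obtain ys where ys: "\<forall>s \<in> set ys. simple_obj C s" "is_direct_sum C y ys" 
      using semisimple_decomposition[OF \<open>y \<in> obj C\<close>] by blast
    have "sum_list (map d ys) \<ge> 0" using ys(1) pos by (intro sum_list_nonneg) (auto intro: less_imp_le)
    thus ?thesis using add[OF ys(2)] by simp
  qed
  have count: "(\<Sum>i<n. d (ss ! i) * multiplicity_of C (ss ! i) y) = d y" if y: "y \<in> obj C" for y
  proof -
    obtain ys where ys: "\<forall>s \<in> set ys. simple_obj C s" "is_direct_sum C y ys" 
      using semisimple_decomposition[OF y] by blast
    have "(\<Sum>i<n. d (ss ! i) * length (filter (isomorphic C (ss ! i)) ys)) = sum_list (map d ys)"
      using ys(1)
    proof (induction ys)
      case (Cons t ys)
      obtain u where u: "u \<in> set ss" "isomorphic C t u" using R(3) Cons.prems by auto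
      then obtain k where k: "k < n" "isomorphic C t (ss ! k)" unfolding n_def by (metis in_set_conv_nth)
      have iff: "isomorphic C (ss ! i) t \<longleftrightarrow> i = k" if "i < n" for i
        using R(2)[of i k] k that isomorphic_trans isomorphic_sym unfolding n_def by blast
      have "(\<Sum>i<n. d (ss ! i) * length (filter (isomorphic C (ss ! i)) (t # ys))) =
            (\<Sum>i<n. (if i = k then d (ss ! i) else 0) + d (ss ! i) * length (filter (isomorphic C (ss ! i)) ys))"
        using iff by (intro sum.cong) (auto simp: algebra_simps)
      also have "\<dots> = d (ss ! k) + sum_list (map d ys)"
        using Cons k(1) by (simp add: sum.distrib sum.delta)
      finally show ?case using d_iso[OF k(2)] by simp
    qed simp
    moreover have "multiplicity_of C (ss ! i) y = length (filter (isomorphic C (ss ! i)) ys)" if "i < n" for i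
      using multiplicity_of_eq[OF s[OF that]] ys by blast
    ultimately show ?thesis using add[OF ys(2)] by simp
  qed
  define M where "M = mult_matrix C x"
  have M: "M \<in> carrier_mat n n" 
    by (auto simp: M_def mult_matrix_def Let_def ss_def n_def)
  have Mij: "M $$ (i, j) = multiplicity_of C (ss ! i) (tno C x (ss ! j))" if "i < n" "j < n" for i j
    using that by (simp add: M_def mult_matrix_def Let_def ss_def n_def)
  have ev: "(\<Sum>i<n. d (ss ! i) * M $$ (i, j)) = d x * d (ss ! j)" if j: "j < n" for j
    using count[OF tno_obj[OF x simple_idt(1)[OF s[OF j]]]] mult[OF x simple_idt(1)[OF s[OF j]]] j Mij by simp
  have "eigenvalue (transpose_mat M) (d x)"
    unfolding eigenvalue_def eigenvector_def
  proof (intro exI[of _ "vec n (\<lambda>i. d (ss ! i))"] conjI)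
    show "vec n (\<lambda>i. d (ss ! i)) \<noteq> 0\<^sub>v (dim_row M\<^sup>T)"
    proof
      assume "vec n (\<lambda>i. d (ss ! i)) = 0\<^sub>v (dim_row M\<^sup>T)"
      hence "vec n (\<lambda>i. d (ss ! i)) $ 0 = 0\<^sub>v (dim_row M\<^sup>T) $ 0" by simp
      thus False using n M pos[OF s[OF n]] by simp
    qed
    show "M\<^sup>T *\<^sub>v vec n (\<lambda>i. d (ss ! i)) = d x \<cdot>\<^sub>v vec n (\<lambda>i. d (ss ! i))"
      using M ev by (intro eq_vecI) (auto simp: scalar_prod_def atLeast0LessThan mult.commute)
  qed (use M in auto)
  hence e1: "eigenvalue M (d x)"
    using M eigenvalue_root_char_poly[OF M] eigenvalue_root_char_poly[of "M\<^sup>T" n] char_poly_transpose_mat[OF M]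
    by simp
  have "finite {e. eigenvalue M e}"
  proof -
    have "char_poly M \<noteq> 0" using degree_monic_char_poly[OF M] by auto
    thus ?thesis unfolding eigenvalue_root_char_poly[OF M] by (rule poly_roots_finite)
  qed
  hence "finite {e. 0 \<le> e \<and> eigenvalue M e}" by (rule rev_finite_subset) auto
  moreover have "e \<le> d x" if "e \<in> {e. 0 \<le> e \<and> eigenvalue M e}" for e
    using spectrum_le_of_positive_left_eigenvector[OF M _ _ ev, of e] Mij pos[OF s] that by auto
  ultimately show ?thesis
    unfolding FPdim_def M_def[symmetric] using e1 d_nonneg[OF x] by (intro Max_eqI) auto
qed

end

section \<open>Schur's lemma\<close>

text \<open>The kernel of \<open>f\<close> is a subobject of a simple object.  If it is everything then \<open>f = 0\<close>; if it is zero then \<open>f\<close> is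
  a monomorphism into a simple object, hence invertible.\<close>

lemma (in linear_abelian_category) schur_abelian:
  assumes s: "simple_obj C s" and t: "simple_obj C t" and f: "f \<in> Hom C s t"
  shows "f = nul C s t \<or> is_iso C f"
proof -
  have fa: "f \<in> arr C" "src C f = s" "trg C f = t" using f by (auto simp: Hom_def)
  obtain k where k: "is_kernel C k f" using ex_kernel[OF fa(1)] by blast
  define z where "z = src C k"
  have kh: "k \<in> Hom C z s" using k fa by (auto simp: is_kernel_def Hom_def z_def)
  have fk: "f \<cdot> k = nul C z t" using k fa by (auto simp: is_kernel_def z_def)
  have zo: "z \<in> obj C" "s \<in> obj C" "t \<in> obj C" using Hom_obj[OF kh] Hom_obj[OF f] by auto
  have univ: "\<exists>!u. u \<in> Hom C w z \<and> k \<cdot> u = h" if "h \<in> Hom C w s" "f \<cdot> h = nul C w t" for w h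
    using k that fa by (auto simp: is_kernel_def z_def)
  have "is_mono C k"
    unfolding is_mono_def
  proof (intro conjI allI ballI impI)
    fix w g h assume gh: "g \<in> Hom C w (src C k)" "h \<in> Hom C w (src C k)" "k \<cdot> g = k \<cdot> h"
    have "f \<cdot> (k \<cdot> g) = nul C w t"
      using cmp_assoc[OF _ kh f] gh(1) fk nul_cmp[OF _ zo(3)] by (metis z_def)
    moreover have "k \<cdot> g \<in> Hom C w s" using cmp_hom[OF _ kh] gh(1) z_def by simp
    ultimately show "g = h" using univ gh by (metis z_def)
  qed (use kh in \<open>auto simp: Hom_def\<close>)
  moreover have "trg C k = s" using kh by (auto simp: Hom_def)
  ultimately consider "zero_obj C z" | "is_iso C k" using s unfolding simple_obj_def z_def by blast
  thus ?thesis
  proof cases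
    case 1
    have "is_mono C f"
      unfolding is_mono_def fa
    proof (intro conjI allI ballI impI)
      fix w g h assume gh: "g \<in> Hom C w s" "h \<in> Hom C w s" "f \<cdot> g = f \<cdot> h"
      have h': "(- 1) \<triangleright> h \<in> Hom C w s" using scl_hom gh by blast
      have "f \<cdot> (g \<boxplus> (- 1) \<triangleright> h) = f \<cdot> g \<boxplus> (- 1) \<triangleright> (f \<cdot> h)"
        using cmp_plu[OF gh(1) h' f] cmp_scl[OF gh(2) f] by simp
      also have "\<dots> = nul C w t" using gh plu_neg[OF cmp_hom[OF gh(2) f]] by simp
      finally obtain u where u: "u \<in> Hom C w z" "k \<cdot> u = g \<boxplus> (- 1) \<triangleright> h" 
        using univ[OF plu_hom[OF gh(1) h']] by blast
      have "u = nul C w z" using hom_zero_obj[OF 1 u(1)] .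
      hence "g \<boxplus> (- 1) \<triangleright> h = nul C w s" using u cmp_nul[OF kh] Hom_obj[OF u(1)] by simp
      thus "g = h" by (rule eq_if_diff_nul[OF gh(1,2)])
    qed (rule fa)
    hence "zero_obj C s \<or> is_iso C f" using t fa unfolding simple_obj_def by blast
    thus ?thesis using s by (auto simp: simple_obj_def)
  next
    case 2
    then obtain k' where k': "k' \<in> Hom C s z" "k \<cdot> k' = idt C s"
      using kh by (auto simp: is_iso_def inverse_arrows_def Hom_def)
    have "f = f \<cdot> (k \<cdot> k')" using k' cmp_idt[OF f] by simp
    also have "\<dots> = (f \<cdot> k) \<cdot> k'" using cmp_assoc[OF k'(1) kh f] by simp
    also have "\<dots> = nul C s t" using fk nul_cmp[OF k'(1) zo(3)] by simp
    finally show ?thesis by simp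
  qed
qed

lemma alg_closed_eigenvector:
  fixes M :: "'k :: alg_closed_field mat"
  assumes M: "M \<in> carrier_mat n n" and n: "n > 0"
  obtains v e where "v \<in> carrier_vec n" "v \<noteq> 0\<^sub>v n" "M *\<^sub>v v = e \<cdot>\<^sub>v v"
proof -
  have "degree (char_poly M) > 0" using degree_monic_char_poly[OF M] n by auto
  then obtain e where "poly (char_poly M) e = 0" using alg_closed_imp_poly_has_root by blast
  thus ?thesis using that M unfolding eigenvalue_root_char_poly[OF M, symmetric] eigenvalue_def eigenvector_def
    by auto
qed

lemma (in linear_category) plu_interchange:
  assumes "f \<in> Hom C x y" "g \<in> Hom C x y" "f' \<in> Hom C x y" "g' \<in> Hom C x y"
  shows "(f \<boxplus> g) \<boxplus> (f' \<boxplus> g') = (f \<boxplus> f') \<boxplus> (g \<boxplus> g')"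
proof -
  interpret M: comm_monoid "hom_monoid x y" 
    using Hom_obj[OF assms(1)] by (rule comm_monoid_hom_monoid)
  show ?thesis using M.m_ac assms by (simp add: hom_monoid_def plu_hom)
qed

text \<open>Linear combinations of linear combinations are given by the matrix product of the coefficients.\<close>

lemma (in linear_category) hsum_lincomb:
  assumes x: "x \<in> obj C" "y \<in> obj C" and b: "\<And>i. i \<in> B \<Longrightarrow> b i \<in> Hom C x y"
  shows "hsum x y (\<lambda>j. c j \<triangleright> hsum x y (\<lambda>i. M i j \<triangleright> b i) B) A =
         hsum x y (\<lambda>i. (\<Sum>j\<in>A. c j * M i j) \<triangleright> b i) B"
proof (induction A rule: infinite_finite_induct)
  case (insert a A)
  have H: "hsum x y (\<lambda>i. d i \<triangleright> b i) B \<in> Hom C x y" for d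
    using x b scl_hom by (intro hsum_hom) auto
  have add: "hsum x y (\<lambda>i. d i \<triangleright> b i) B' \<boxplus> hsum x y (\<lambda>i. e i \<triangleright> b i) B' = hsum x y (\<lambda>i. (d i + e i) \<triangleright> b i) B'" 
    if "B' \<subseteq> B" for d e B' using that
  proof (induction B' rule: infinite_finite_induct)
    case (insert k B')
    have k: "d k \<triangleright> b k \<in> Hom C x y" "e k \<triangleright> b k \<in> Hom C x y" using insert.prems b scl_hom by auto
    have h: "hsum x y (\<lambda>i. d i \<triangleright> b i) B' \<in> Hom C x y" for d
      using x b scl_hom insert.prems by (intro hsum_hom) auto
    have s: "hsum x y (\<lambda>i. d i \<triangleright> b i) (insert k B') = d k \<triangleright> b k \<boxplus> hsum x y (\<lambda>i. d i \<triangleright> b i) B'" for d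
      using insert x b scl_hom by (intro hsum_insert) auto
    have IH: "hsum x y (\<lambda>i. d i \<triangleright> b i) B' \<boxplus> hsum x y (\<lambda>i. e i \<triangleright> b i) B' = hsum x y (\<lambda>i. (d i + e i) \<triangleright> b i) B'"
      using insert by auto
    have "(d k \<triangleright> b k \<boxplus> hsum x y (\<lambda>i. d i \<triangleright> b i) B') \<boxplus> (e k \<triangleright> b k \<boxplus> hsum x y (\<lambda>i. e i \<triangleright> b i) B') =
       (d k \<triangleright> b k \<boxplus> e k \<triangleright> b k) \<boxplus> (hsum x y (\<lambda>i. d i \<triangleright> b i) B' \<boxplus> hsum x y (\<lambda>i. e i \<triangleright> b i) B')"
      by (rule plu_interchange[OF k(1) h k(2) h])
    moreover have "(d k + e k) \<triangleright> b k = d k \<triangleright> b k \<boxplus> e k \<triangleright> b k"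
      using insert.prems b by (intro plus_scl) auto
    ultimately show ?case unfolding s IH by simp
  qed (use x in \<open>auto simp: hsum_infinite hsum_empty plu_nul nul_hom\<close>)
  have scl: "e \<triangleright> hsum x y (\<lambda>i. d i \<triangleright> b i) B' = hsum x y (\<lambda>i. (e * d i) \<triangleright> b i) B'" if "B' \<subseteq> B" for d e B'
    using that
  proof (induction B' rule: infinite_finite_induct)
    case (insert k B')
    have h: "hsum x y (\<lambda>i. d i \<triangleright> b i) B' \<in> Hom C x y" for d
      using x b scl_hom insert.prems by (intro hsum_hom) auto
    have s: "hsum x y (\<lambda>i. d i \<triangleright> b i) (insert k B') = d k \<triangleright> b k \<boxplus> hsum x y (\<lambda>i. d i \<triangleright> b i) B'" for d
      using insert x b scl_hom by (intro hsum_insert) auto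
    have "d k \<triangleright> b k \<in> Hom C x y" "b k \<in> Hom C x y" using insert.prems b scl_hom by auto
    thus ?case unfolding s using insert scl_plu[OF _ h, of "d k \<triangleright> b k" e d] scl_scl by auto
  qed (use x in \<open>auto simp: hsum_infinite hsum_empty scl_nul\<close>)
  have "hsum x y (\<lambda>j. c j \<triangleright> hsum x y (\<lambda>i. M i j \<triangleright> b i) B) (insert a A) =
    c a \<triangleright> hsum x y (\<lambda>i. M i a \<triangleright> b i) B \<boxplus> hsum x y (\<lambda>j. c j \<triangleright> hsum x y (\<lambda>i. M i j \<triangleright> b i) B) A"
    using insert x H scl_hom by (intro hsum_insert) auto
  thus ?case using insert by (simp add: scl add)
qed (use x in \<open>auto simp: hsum_infinite hsum_empty zero_scl b intro!: hsum_nul[symmetric]\<close>)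

lemma (in symmetric_fusion_category) finite_spanning_set:
  assumes "x \<in> obj C" "y \<in> obj C"
  obtains n b where "\<And>i. i < n \<Longrightarrow> b i \<in> Hom C x y"
    "\<And>f. f \<in> Hom C x y \<Longrightarrow> \<exists>c. f = hsum x y (\<lambda>i. c i \<triangleright> b i) {..<(n::nat)}"
proof -
  obtain bs where bs: "set bs \<subseteq> Hom C x y" "\<forall>f \<in> Hom C x y. \<exists>cs. length cs = length bs \<and>
        f = lincomb_sum C x y (map2 (scl C) cs bs)" using finite_dim_hom[OF assms] by blast
  have "\<exists>c. f = hsum x y (\<lambda>i. c i \<triangleright> bs ! i) {..<length bs}" if "f \<in> Hom C x y" for f
  proof -
    obtain cs where cs: "length cs = length bs" "f = lincomb_sum C x y (map2 (scl C) cs bs)"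
      using bs(2) \<open>f \<in> Hom C x y\<close> by blast
    have "map2 (scl C) cs bs = map (\<lambda>i. cs ! i \<triangleright> bs ! i) [0..<length bs]"
      using cs(1) by (intro nth_equalityI) auto
    moreover have "cs ! i \<triangleright> bs ! i \<in> Hom C x y" if "i < length bs" for i
      using bs(1) that scl_hom nth_mem by blast
    ultimately show ?thesis using cs(2) lincomb_sum_eq_hsum[OF assms, of "length bs" "\<lambda>i. cs ! i \<triangleright> bs ! i"] by auto
  qed
  thus thesis using bs(1) by (intro that[of "length bs" "nth bs"]) auto
qed

text \<open>The usual eigenvalue argument.  Composition with \<open>f\<close> acts on a minimal spanning set \<open>b\<close> of the endomorphisms by a
  matrix; an eigenvector of the matrix gives an endomorphism \<open>g\<close> with \<open>f g = e g\<close>.  Minimality of \<open>b\<close> ensures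
  \<open>g \<noteq> 0\<close>, so \<open>g\<close> is invertible and \<open>f = e\<close>.\<close>

lemma fusion_schur_End:
  fixes C :: "('o, 'm, 'k :: alg_closed_field) lin_mon_cat"
  assumes C: "symmetric_fusion_category C" and s: "simple_obj C s" and f: "f \<in> Hom C s s"
  shows "\<exists>c. f = scl C c (idt C s)"
proof -
  interpret symmetric_fusion_category C by (rule C)
  have so: "s \<in> obj C" using Hom_obj[OF f] by simp
  have i: "idt C s \<in> Hom C s s" by (rule idt_hom[OF so])
  define spans where "spans n b \<longleftrightarrow> (\<forall>i<n. b i \<in> Hom C s s) \<and> 
    (\<forall>f \<in> Hom C s s. \<exists>c. f = hsum s s (\<lambda>i. scl C (c i) (b i)) {..<n})" for n :: nat and b
  have ex: "\<exists>n b. spans n b" using finite_spanning_set[OF so so] unfolding spans_def by metis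
  define n where "n = (LEAST n. \<exists>b. spans n b)"
  have "\<exists>b. spans n b" unfolding n_def by (rule LeastI_ex[OF ex])
  then obtain b where b: "spans n b" by blast
  have bh: "b i \<in> Hom C s s" if "i < n" for i using b that by (simp add: spans_def)
  have min: "\<not> spans m b'" if "m < n" for m b' using not_less_Least[of m "\<lambda>n. \<exists>b. spans n b"] that n_def by blast
  have cb: "hsum s s (\<lambda>i. scl C (c i) (b i)) {..<n} \<in> Hom C s s" for c
    using bh so scl_hom by (intro hsum_hom) auto
  have n0: "n > 0"
  proof (rule ccontr)
    assume "\<not> n > 0"
    hence "idt C s = nul C s s" using b i so by (auto simp: spans_def hsum_empty)
    thus False using s by (auto simp: simple_obj_def zero_obj_def)
  qed
  have "\<forall>j\<in>{..<n}. \<exists>c. cmp C f (b j) = hsum s s (\<lambda>i. scl C (c i) (b i)) {..<n}"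
    using b cmp_hom[OF bh f] unfolding spans_def by blast
  then obtain m where m: "\<And>j. j < n \<Longrightarrow> cmp C f (b j) = hsum s s (\<lambda>i. scl C (m j i) (b i)) {..<n}" 
    by (metis lessThan_iff)
  define M where "M = mat n n (\<lambda>(i, j). m j i)"
  obtain v e where v: "v \<in> carrier_vec n" "v \<noteq> 0\<^sub>v n" "M *\<^sub>v v = e \<cdot>\<^sub>v v"
    using alg_closed_eigenvector[of M n] n0 by (auto simp: M_def)
  have Mv: "(\<Sum>j<n. v $ j * m j i) = e * v $ i" if "i < n" for i
  proof -
    have "(M *\<^sub>v v) $ i = (\<Sum>j<n. v $ j * m j i)"
      using that v(1) by (simp add: M_def scalar_prod_def atLeast0LessThan mult.commute)
    thus ?thesis using v that by simp
  qed
  define g where "g = hsum s s (\<lambda>i. scl C (v $ i) (b i)) {..<n}"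
  have gh: "g \<in> Hom C s s" unfolding g_def by (rule cb)
  have "cmp C f g = hsum s s (\<lambda>j. cmp C f (scl C (v $ j) (b j))) {..<n}"
    unfolding g_def using bh scl_hom so by (intro cmp_hsum[OF f]) auto
  also have "\<dots> = hsum s s (\<lambda>j. scl C (v $ j) (hsum s s (\<lambda>i. scl C (m j i) (b i)) {..<n})) {..<n}"
    using bh so cmp_scl[OF bh f] m scl_hom cb by (intro hsum_cong) auto
  also have "\<dots> = hsum s s (\<lambda>i. scl C (\<Sum>j<n. v $ j * m j i) (b i)) {..<n}"
    using bh so by (intro hsum_lincomb) auto
  also have "\<dots> = hsum s s (\<lambda>i. scl C (\<Sum>j\<in>{0::nat}. e * v $ i) (b i)) {..<n}"
    using bh so Mv scl_hom by (intro hsum_cong) auto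
  also have "\<dots> = hsum s s (\<lambda>j. scl C e g) {0::nat}"
    unfolding g_def using bh so by (subst hsum_lincomb[symmetric]) auto
  also have "\<dots> = scl C e g"
    using so scl_hom[OF gh] by (intro hsum_delta) auto
  finally have fg: "cmp C f g = scl C e g" .
  have "g \<noteq> nul C s s"
  proof
    assume g0: "g = nul C s s"
    obtain k where k: "k < n" "v $ k \<noteq> 0" using v by (metis eq_vecI carrier_vecD index_zero_vec)
    \<comment> \<open>the relation \<open>g = 0\<close> expresses \<open>b k\<close> through the other arrows, so \<open>n\<close> was not minimal\<close>
    define \<sigma> where "\<sigma> i = (if i = k then n - 1 else i)" for i
    have sg: "bij_betw \<sigma> {..<n-1} ({..<n} - {k})"
      using k by (intro bij_betw_byWitness[of _ "\<lambda>i. if i = n - 1 then k else i"]) (auto simp: \<sigma>_def)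
    have "spans (n - 1) (\<lambda>i. b (\<sigma> i))"
      unfolding spans_def
    proof (intro conjI allI impI ballI)
      fix i assume "i < n - 1" thus "b (\<sigma> i) \<in> Hom C s s" using bh k by (auto simp: \<sigma>_def)
    next
      fix h assume h: "h \<in> Hom C s s"
      then obtain c where c: "h = hsum s s (\<lambda>i. scl C (c i) (b i)) {..<n}" using b unfolding spans_def by blast
      define d where "d i = c i - c k / v $ k * v $ i" for i
      let ?x = "\<lambda>j::nat. if j = 0 then 1 else - (c k / v $ k)"
      let ?m = "\<lambda>i (j::nat). if j = 0 then c i else v $ i"
      let ?H = "\<lambda>j. scl C (?x j) (hsum s s (\<lambda>i. scl C (?m i j) (b i)) {..<n})"
      have H: "?H j \<in> Hom C s s" for j using cb by (rule scl_hom)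
      have "h = ?H 0 \<boxplus>\<^bsub>C\<^esub> ?H 1"
        using c g0 scl_one[OF h] h so scl_nul plu_nul by (simp add: g_def)
      also have "\<dots> = hsum s s ?H {0, 1}" 
        using so H plu_nul[OF H[of 1]] by (simp add: hsum_insert hsum_empty)
      also have "\<dots> = hsum s s (\<lambda>i. scl C (\<Sum>j\<in>{0,1}. ?x j * ?m i j) (b i)) {..<n}"
        using bh so by (intro hsum_lincomb) auto
      also have "\<dots> = hsum s s (\<lambda>i. scl C (d i) (b i)) (insert k ({..<n} - {k}))"
        using bh so k scl_hom by (intro hsum_cong) (auto simp: d_def)
      also have "\<dots> = scl C (d k) (b k) \<boxplus>\<^bsub>C\<^esub> hsum s s (\<lambda>i. scl C (d i) (b i)) ({..<n} - {k})"
        using bh so k scl_hom by (intro hsum_insert) auto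
      also have "scl C (d k) (b k) = nul C s s" using k zero_scl[OF bh] by (simp add: d_def)
      also have "nul C s s \<boxplus>\<^bsub>C\<^esub> hsum s s (\<lambda>i. scl C (d i) (b i)) ({..<n} - {k}) =
          hsum s s (\<lambda>i. scl C (d i) (b i)) ({..<n} - {k})"
        using bh so scl_hom by (intro nul_plu hsum_hom) auto
      also have "\<dots> = hsum s s (\<lambda>i. scl C (d (\<sigma> i)) (b (\<sigma> i))) {..<n - 1}"
        using hsum_reindex[OF so so sg, of "\<lambda>i. scl C (d i) (b i)"] bh scl_hom by auto
      finally show "\<exists>c. h = hsum s s (\<lambda>i. scl C (c i) (b (\<sigma> i))) {..<n - 1}" 
        by (rule exI[of _ "\<lambda>i. d (\<sigma> i)"])
    qed
    thus False using min[of "n - 1"] n0 by simp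
  qed
  hence "is_iso C g" using schur_abelian[OF s s gh] by blast
  then obtain g' where g': "g' \<in> Hom C s s" "cmp C g g' = idt C s"
    using gh by (auto simp: is_iso_def inverse_arrows_def Hom_def)
  have "f = cmp C f (cmp C g g')" using g' cmp_idt[OF f] by simp
  also have "\<dots> = cmp C (cmp C f g) g'" using cmp_assoc[OF g'(1) gh f] by simp
  also have "\<dots> = scl C e (idt C s)" unfolding fg using scl_cmp[OF g'(1) gh] g' by simp
  finally show ?thesis by blast
qed

lemma fusion_schur_category:
  fixes C :: "('o, 'm, 'k :: alg_closed_field) lin_mon_cat"
  assumes "symmetric_fusion_category C"
  shows "schur_category C"
proof -
  interpret symmetric_fusion_category C by (rule assms)
  show ?thesis
    using schur_abelian fusion_schur_End[OF assms] semisimple by unfold_locales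
qed

section \<open>Quotients of linear categories\<close>

text \<open>A two-sided ideal of arrows: what makes the quotient a linear category again, with composition computed on
  representatives.\<close>

locale linear_ideal = linear_category C
  for C :: "('o, 'm, 'k :: field) lin_mon_cat" (structure) +
  fixes N :: "'m \<Rightarrow> bool"
  assumes N_nul: "x \<in> obj C \<Longrightarrow> y \<in> obj C \<Longrightarrow> N (nul C x y)"
    and N_plu: "f \<in> Hom C x y \<Longrightarrow> g \<in> Hom C x y \<Longrightarrow> N f \<Longrightarrow> N g \<Longrightarrow> N (f \<boxplus> g)"
    and N_scl: "f \<in> Hom C x y \<Longrightarrow> N f \<Longrightarrow> N (c \<triangleright> f)"
    and N_cmp_left: "f \<in> Hom C x y \<Longrightarrow> g \<in> Hom C y z \<Longrightarrow> N f \<Longrightarrow> N (g \<cdot> f)"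
    and N_cmp_right: "f \<in> Hom C x y \<Longrightarrow> g \<in> Hom C y z \<Longrightarrow> N g \<Longrightarrow> N (g \<cdot> f)"
begin

abbreviation "cls \<equiv> ideal_class C N"
abbreviation "Q \<equiv> quotient_cat C N"

definition diff :: "'m \<Rightarrow> 'm \<Rightarrow> 'm" where "diff f g = f \<boxplus> (- 1) \<triangleright> g"

lemma diff_hom: "f \<in> Hom C x y \<Longrightarrow> g \<in> Hom C x y \<Longrightarrow> diff f g \<in> Hom C x y"
  unfolding diff_def by (intro plu_hom scl_hom)

lemma diff_self: "f \<in> Hom C x y \<Longrightarrow> diff f f = nul C x y"
  unfolding diff_def by (rule plu_neg(1))

lemma diff_trans:
  assumes f: "f \<in> Hom C x y" and g: "g \<in> Hom C x y" and h: "h \<in> Hom C x y"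
  shows "diff f h = diff f g \<boxplus> diff g h"
proof -
  note ng = scl_hom[OF g, of "- 1"] and nh = scl_hom[OF h, of "- 1"]
  have "diff f g \<boxplus> diff g h = f \<boxplus> ((- 1) \<triangleright> g \<boxplus> (g \<boxplus> (- 1) \<triangleright> h))"
    unfolding diff_def by (rule plu_assoc[OF f ng plu_hom[OF g nh]])
  also have "(- 1) \<triangleright> g \<boxplus> (g \<boxplus> (- 1) \<triangleright> h) = ((- 1) \<triangleright> g \<boxplus> g) \<boxplus> (- 1) \<triangleright> h"
    using plu_assoc[OF ng g nh] by simp
  also have "\<dots> = (- 1) \<triangleright> h" using plu_neg(2)[OF g] nul_plu[OF nh] by simp
  finally show ?thesis by (simp add: diff_def)
qed

lemma diff_sym:
  assumes f: "f \<in> Hom C x y" and g: "g \<in> Hom C x y"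
  shows "diff g f = (- 1) \<triangleright> diff f g"
proof -
  have "(- 1) \<triangleright> diff f g = (- 1) \<triangleright> f \<boxplus> g"
    unfolding diff_def using scl_plu[OF f scl_hom[OF g]] scl_scl[OF g, of "- 1" "- 1"] scl_one[OF g] by simp
  thus ?thesis unfolding diff_def using plu_comm[OF g scl_hom[OF f]] by simp
qed

lemma mem_cls: "f \<in> Hom C x y \<Longrightarrow> g \<in> cls f \<longleftrightarrow> g \<in> Hom C x y \<and> N (diff g f)"
  by (auto simp: ideal_class_def diff_def Hom_def)

lemma cls_eq_iff:
  assumes f: "f \<in> Hom C x y" and g: "g \<in> Hom C x y"
  shows "cls f = cls g \<longleftrightarrow> N (diff f g)"
proof
  assume "cls f = cls g"
  moreover have "f \<in> cls f" using mem_cls[OF f] f diff_self[OF f] N_nul Hom_obj[OF f] by simp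
  ultimately show "N (diff f g)" using mem_cls[OF g] by simp
next
  assume n: "N (diff f g)"
  hence n': "N (diff g f)" using diff_sym[OF f g] N_scl[OF diff_hom[OF f g]] by simp
  have "N (diff h f) \<longleftrightarrow> N (diff h g)" if h: "h \<in> Hom C x y" for h
    using diff_trans[OF h f g] diff_trans[OF h g f] N_plu[OF diff_hom[OF h f] diff_hom[OF f g]]
      N_plu[OF diff_hom[OF h g] diff_hom[OF g f]] n n' by auto
  thus "cls f = cls g" using mem_cls[OF f] mem_cls[OF g] by blast
qed

lemma class_rep:
  assumes f: "f \<in> Hom C x y"
  shows "class_rep (cls f) \<in> Hom C x y" "N (diff (class_rep (cls f)) f)"
proof -
  have "f \<in> cls f" using mem_cls[OF f] f diff_self[OF f] N_nul Hom_obj[OF f] by simp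
  hence "class_rep (cls f) \<in> cls f" unfolding class_rep_def by (rule someI)
  thus "class_rep (cls f) \<in> Hom C x y" "N (diff (class_rep (cls f)) f)" using mem_cls[OF f] by auto
qed

lemma Q_obj: "obj Q = obj C"
  by (simp add: quotient_cat_def)

lemma Q_Hom: "Hom Q x y = cls ` Hom C x y"
proof -
  have "src Q (cls f) = src C f" "trg Q (cls f) = trg C f" if "f \<in> arr C" for f
    using class_rep(1)[of f "src C f" "trg C f"] that by (auto simp: quotient_cat_def Hom_def)
  thus ?thesis by (auto simp: Hom_def) (auto simp: quotient_cat_def)
qed

lemma Q_idt: "idt Q x = cls (idt C x)"
  by (simp add: quotient_cat_def)

lemma Q_nul: "nul Q x y = cls (nul C x y)"
  by (simp add: quotient_cat_def)

text \<open>Representatives \<open>g'\<close>, \<open>f'\<close> of the classes satisfy \<open>g' f' - g f = (g' - g) f' + g (f' - f)\<close>, which lies in the ideal.\<close>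

lemma Q_cmp:
  assumes f: "f \<in> Hom C x y" and g: "g \<in> Hom C y z"
  shows "cmp Q (cls g) (cls f) = cls (g \<cdot> f)"
proof -
  let ?f = "class_rep (cls f)" and ?g = "class_rep (cls g)"
  note f' = class_rep[OF f] and g' = class_rep[OF g]
  have 1: "diff (?g \<cdot> ?f) (g \<cdot> ?f) = diff ?g g \<cdot> ?f"
    unfolding diff_def using plu_cmp[OF f'(1) g'(1) scl_hom[OF g]] scl_cmp[OF f'(1) g] by simp
  have 2: "diff (g \<cdot> ?f) (g \<cdot> f) = g \<cdot> diff ?f f"
    unfolding diff_def using cmp_plu[OF f'(1) scl_hom[OF f] g] cmp_scl[OF f g] by simp
  have "N (diff (?g \<cdot> ?f) (g \<cdot> f))"
    unfolding diff_trans[OF cmp_hom[OF f'(1) g'(1)] cmp_hom[OF f'(1) g] cmp_hom[OF f g]] 1 2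
    by (rule N_plu[OF cmp_hom[OF f'(1) diff_hom[OF g'(1) g]] cmp_hom[OF diff_hom[OF f'(1) f] g]
        N_cmp_right[OF f'(1) diff_hom[OF g'(1) g] g'(2)] N_cmp_left[OF diff_hom[OF f'(1) f] g f'(2)]])
  hence "cls (?g \<cdot> ?f) = cls (g \<cdot> f)" using cls_eq_iff[OF cmp_hom[OF f'(1) g'(1)] cmp_hom[OF f g]] by simp
  thus ?thesis by (simp add: quotient_cat_def)
qed

lemma Q_plu:
  assumes f: "f \<in> Hom C x y" and g: "g \<in> Hom C x y"
  shows "plu Q (cls f) (cls g) = cls (f \<boxplus> g)"
proof -
  let ?f = "class_rep (cls f)" and ?g = "class_rep (cls g)"
  note f' = class_rep[OF f] and g' = class_rep[OF g]
  have 1: "diff (?f \<boxplus> ?g) (f \<boxplus> g) = diff ?f f \<boxplus> diff ?g g"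
    unfolding diff_def using scl_plu[OF f g, of "- 1"] 
      plu_interchange[OF f'(1) g'(1) scl_hom[OF f] scl_hom[OF g], of "- 1" "- 1"] by simp
  have "cls (?f \<boxplus> ?g) = cls (f \<boxplus> g)" 
    unfolding cls_eq_iff[OF plu_hom[OF f'(1) g'(1)] plu_hom[OF f g]] 1
    by (rule N_plu[OF diff_hom[OF f'(1) f] diff_hom[OF g'(1) g] f'(2) g'(2)])
  thus ?thesis by (simp add: quotient_cat_def)
qed

lemma Q_scl:
  assumes f: "f \<in> Hom C x y"
  shows "scl Q c (cls f) = cls (c \<triangleright> f)"
proof -
  let ?f = "class_rep (cls f)"
  note f' = class_rep[OF f]
  have 1: "diff (c \<triangleright> ?f) (c \<triangleright> f) = c \<triangleright> diff ?f f"
    unfolding diff_def using scl_plu[OF f'(1) scl_hom[OF f], of c "- 1"] scl_scl[OF f, of c "- 1"] 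
      scl_scl[OF f, of "- 1" c] by simp
  have "cls (c \<triangleright> ?f) = cls (c \<triangleright> f)" 
    unfolding cls_eq_iff[OF scl_hom[OF f'(1)] scl_hom[OF f]] 1
    by (rule N_scl[OF diff_hom[OF f'(1) f] f'(2)])
  thus ?thesis by (simp add: quotient_cat_def)
qed

lemma linear_category_Q: "linear_category Q"
proof
  fix f assume "f \<in> arr Q"
  then obtain g where g: "g \<in> arr C" "f = cls g" by (auto simp: quotient_cat_def)
  have r: "class_rep f \<in> Hom C (src C g) (trg C g)" unfolding g(2) using g(1) by (intro class_rep(1)) (auto simp: Hom_def)
  show "src Q f \<in> obj Q" "trg Q f \<in> obj Q" using r Hom_obj[OF r] by (auto simp: quotient_cat_def Hom_def)
next
  fix x y f assume "f \<in> Hom Q x y"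
  then obtain g where g: "g \<in> Hom C x y" "f = cls g" using Q_Hom by auto
  obtain g' where g': "g' \<in> Hom C x y" "g \<boxplus> g' = nul C x y" using plu_inverse[OF g(1)] by blast
  have "plu Q f (cls g') = nul Q x y" using g g' Q_plu Q_nul by simp
  thus "\<exists>h \<in> Hom Q x y. plu Q f h = nul Q x y" using g' Q_Hom by blast
next
  fix f g x y z
  assume "f \<in> Hom Q x y" "g \<in> Hom Q y z"
  then obtain ff gg where h: "ff \<in> Hom C x y" "gg \<in> Hom C y z" and e: "f = cls ff" "g = cls gg"
    unfolding Q_Hom by blast
  show "cmp Q g f \<in> Hom Q x z"
    unfolding e Q_idt Q_nul using Q_cmp[OF h] cmp_hom[OF h] Q_Hom by simp
next
  fix f x y
  assume "f \<in> Hom Q x y"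
  then obtain ff where h: "ff \<in> Hom C x y" and e: "f = cls ff"
    unfolding Q_Hom by blast
  show "cmp Q f (idt Q x) = f"
    unfolding e Q_idt Q_nul using Q_cmp[OF idt_hom[OF Hom_obj(1)[OF h]] h] cmp_idt[OF h] by simp
next
  fix f x y
  assume "f \<in> Hom Q x y"
  then obtain ff where h: "ff \<in> Hom C x y" and e: "f = cls ff"
    unfolding Q_Hom by blast
  show "cmp Q (idt Q y) f = f"
    unfolding e Q_idt Q_nul using Q_cmp[OF h idt_hom[OF Hom_obj(2)[OF h]]] idt_cmp[OF h] by simp
next
  fix f g h w x y z
  assume "f \<in> Hom Q w x" "g \<in> Hom Q x y" "h \<in> Hom Q y z"
  then obtain ff gg hh where h: "ff \<in> Hom C w x" "gg \<in> Hom C x y" "hh \<in> Hom C y z" and e: "f = cls ff" "g = cls gg" "h = cls hh"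
    unfolding Q_Hom by blast
  show "cmp Q (cmp Q h g) f = cmp Q h (cmp Q g f)"
    unfolding e Q_idt Q_nul using Q_cmp[OF h(1,2)] Q_cmp[OF h(2,3)] Q_cmp[OF h(1) cmp_hom[OF h(2,3)]] Q_cmp[OF cmp_hom[OF h(1,2)] h(3)] cmp_assoc[OF h] by simp
next
  fix f g x y
  assume "f \<in> Hom Q x y" "g \<in> Hom Q x y"
  then obtain ff gg where h: "ff \<in> Hom C x y" "gg \<in> Hom C x y" and e: "f = cls ff" "g = cls gg"
    unfolding Q_Hom by blast
  show "plu Q f g \<in> Hom Q x y"
    unfolding e Q_idt Q_nul using Q_plu[OF h] plu_hom[OF h] Q_Hom by simp
next
  fix f x y c
  assume "f \<in> Hom Q x y"
  then obtain ff where h: "ff \<in> Hom C x y" and e: "f = cls ff"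
    unfolding Q_Hom by blast
  show "scl Q c f \<in> Hom Q x y"
    unfolding e Q_idt Q_nul using Q_scl[OF h] scl_hom[OF h] Q_Hom by simp
next
  fix f g h x y
  assume "f \<in> Hom Q x y" "g \<in> Hom Q x y" "h \<in> Hom Q x y"
  then obtain ff gg hh where h: "ff \<in> Hom C x y" "gg \<in> Hom C x y" "hh \<in> Hom C x y" and e: "f = cls ff" "g = cls gg" "h = cls hh"
    unfolding Q_Hom by blast
  show "plu Q (plu Q f g) h = plu Q f (plu Q g h)"
    unfolding e Q_idt Q_nul using Q_plu[OF h(1,2)] Q_plu[OF h(2,3)] Q_plu[OF plu_hom[OF h(1,2)] h(3)] Q_plu[OF h(1) plu_hom[OF h(2,3)]] plu_assoc[OF h] by simp
next
  fix f g x y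
  assume "f \<in> Hom Q x y" "g \<in> Hom Q x y"
  then obtain ff gg where h: "ff \<in> Hom C x y" "gg \<in> Hom C x y" and e: "f = cls ff" "g = cls gg"
    unfolding Q_Hom by blast
  show "plu Q f g = plu Q g f"
    unfolding e Q_idt Q_nul using Q_plu[OF h] Q_plu[OF h(2,1)] plu_comm[OF h] by simp
next
  fix f x y
  assume "f \<in> Hom Q x y"
  then obtain ff where h: "ff \<in> Hom C x y" and e: "f = cls ff"
    unfolding Q_Hom by blast
  show "plu Q f (nul Q x y) = f"
    unfolding e Q_idt Q_nul using Q_plu[OF h nul_hom[OF Hom_obj[OF h]]] plu_nul[OF h] by simp
next
  fix f x y
  assume "f \<in> Hom Q x y"
  then obtain ff where h: "ff \<in> Hom C x y" and e: "f = cls ff"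
    unfolding Q_Hom by blast
  show "scl Q 1 f = f"
    unfolding e Q_idt Q_nul using Q_scl[OF h] scl_one[OF h] by simp
next
  fix f x y a b
  assume "f \<in> Hom Q x y"
  then obtain ff where h: "ff \<in> Hom C x y" and e: "f = cls ff"
    unfolding Q_Hom by blast
  show "scl Q (a * b) f = scl Q a (scl Q b f)"
    unfolding e Q_idt Q_nul using Q_scl[OF h] Q_scl[OF scl_hom[OF h]] scl_scl[OF h] by simp
next
  fix f g x y a
  assume "f \<in> Hom Q x y" "g \<in> Hom Q x y"
  then obtain ff gg where h: "ff \<in> Hom C x y" "gg \<in> Hom C x y" and e: "f = cls ff" "g = cls gg"
    unfolding Q_Hom by blast
  show "scl Q a (plu Q f g) = plu Q (scl Q a f) (scl Q a g)"
    unfolding e Q_idt Q_nul using Q_plu[OF h] Q_scl[OF plu_hom[OF h]] Q_scl[OF h(1)] Q_scl[OF h(2)] Q_plu[OF scl_hom[OF h(1)] scl_hom[OF h(2)]] scl_plu[OF h] by simp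
next
  fix f x y a b
  assume "f \<in> Hom Q x y"
  then obtain ff where h: "ff \<in> Hom C x y" and e: "f = cls ff"
    unfolding Q_Hom by blast
  show "scl Q (a + b) f = plu Q (scl Q a f) (scl Q b f)"
    unfolding e Q_idt Q_nul using Q_scl[OF h] Q_plu[OF scl_hom[OF h] scl_hom[OF h]] plus_scl[OF h] by simp
next
  fix f k g x y z
  assume "f \<in> Hom Q x y" "k \<in> Hom Q x y" "g \<in> Hom Q y z"
  then obtain ff kk gg where h: "ff \<in> Hom C x y" "kk \<in> Hom C x y" "gg \<in> Hom C y z" and e: "f = cls ff" "k = cls kk" "g = cls gg"
    unfolding Q_Hom by blast
  show "cmp Q g (plu Q f k) = plu Q (cmp Q g f) (cmp Q g k)"
    unfolding e Q_idt Q_nul using Q_plu[OF h(1,2)] Q_cmp[OF plu_hom[OF h(1,2)] h(3)] Q_cmp[OF h(1,3)] Q_cmp[OF h(2,3)] Q_plu[OF cmp_hom[OF h(1,3)] cmp_hom[OF h(2,3)]] cmp_plu[OF h] by simp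
next
  fix f g k x y z
  assume "f \<in> Hom Q x y" "g \<in> Hom Q y z" "k \<in> Hom Q y z"
  then obtain ff gg kk where h: "ff \<in> Hom C x y" "gg \<in> Hom C y z" "kk \<in> Hom C y z" and e: "f = cls ff" "g = cls gg" "k = cls kk"
    unfolding Q_Hom by blast
  show "cmp Q (plu Q g k) f = plu Q (cmp Q g f) (cmp Q k f)"
    unfolding e Q_idt Q_nul using Q_plu[OF h(2,3)] Q_cmp[OF h(1) plu_hom[OF h(2,3)]] Q_cmp[OF h(1,2)] Q_cmp[OF h(1,3)] Q_plu[OF cmp_hom[OF h(1,2)] cmp_hom[OF h(1,3)]] plu_cmp[OF h] by simp
next
  fix f g x y z a
  assume "f \<in> Hom Q x y" "g \<in> Hom Q y z"
  then obtain ff gg where h: "ff \<in> Hom C x y" "gg \<in> Hom C y z" and e: "f = cls ff" "g = cls gg"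
    unfolding Q_Hom by blast
  show "cmp Q g (scl Q a f) = scl Q a (cmp Q g f)"
    unfolding e Q_idt Q_nul using Q_scl[OF h(1)] Q_cmp[OF h] Q_cmp[OF scl_hom[OF h(1)] h(2)] Q_scl[OF cmp_hom[OF h]] cmp_scl[OF h] by simp
next
  fix f g x y z a
  assume "f \<in> Hom Q x y" "g \<in> Hom Q y z"
  then obtain ff gg where h: "ff \<in> Hom C x y" "gg \<in> Hom C y z" and e: "f = cls ff" "g = cls gg"
    unfolding Q_Hom by blast
  show "cmp Q (scl Q a g) f = scl Q a (cmp Q g f)"
    unfolding e Q_idt Q_nul using Q_scl[OF h(2)] Q_cmp[OF h] Q_cmp[OF h(1) scl_hom[OF h(2)]] Q_scl[OF cmp_hom[OF h]] scl_cmp[OF h] by simp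
qed (auto simp: Q_obj Q_Hom Q_idt Q_nul idt_hom nul_hom)

lemma linear_functor_cls: "linear_functor C Q (\<lambda>x. x) cls"
proof -
  interpret Q: linear_category Q by (rule linear_category_Q)
  show ?thesis
    by unfold_locales (auto simp: Q_obj Q_Hom Q_idt Q_cmp Q_plu Q_scl)
qed

end

section \<open>Representations\<close>

lemma reps_mat:
  "V \<in> reps G \<Longrightarrow> g \<in> carrier G \<Longrightarrow> snd V g \<in> carrier_mat (fst V) (fst V)"
  unfolding reps_def hom_def units_of_def Units_def
  by (force simp: ring_mat_def)

lemma Hom_Rep: "f \<in> Hom (Rep G) V W \<longleftrightarrow> (\<exists>M. f = (V, W, M) \<and> (V, W, M) \<in> rep_arrs G)"
  by (cases f) (auto simp: Hom_def Rep_def)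

lemma rep_arrs_iff: "(V, W, A) \<in> rep_arrs G \<longleftrightarrow> V \<in> reps G \<and> W \<in> reps G \<and> A \<in> carrier_mat (fst W) (fst V) \<and>
     (\<forall>g \<in> carrier G. A * snd V g = snd W g * A)"
  by (simp add: rep_arrs_def)

lemma Rep_simps [simp]:
  "obj (Rep G) = reps G" "arr (Rep G) = rep_arrs G" "src (Rep G) (V, W, A) = V" "trg (Rep G) (V, W, A) = W"
  "idt (Rep G) V = (V, V, 1\<^sub>m (fst V))" "cmp (Rep G) (V', W', B) (V, W, A) = (V, W', B * A)"
  "nul (Rep G) V W = (V, W, 0\<^sub>m (fst W) (fst V))" "plu (Rep G) (V, W, A) (V', W', B) = (V, W, A + B)"
  "scl (Rep G) c (V, W, A) = (V, W, c \<cdot>\<^sub>m A)" "tno (Rep G) = rep_tensor G" "unt (Rep G) = rep_unit G"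
  by (simp_all add: Rep_def)

lemma rep_arrs_cmp:
  assumes "(V, W, A) \<in> rep_arrs G" "(W, U, B) \<in> rep_arrs G"
  shows "(V, U, B * A) \<in> rep_arrs G"
proof -
  note a = assms[unfolded rep_arrs_iff]
  have "B * A * snd V g = snd U g * (B * A)" if g: "g \<in> carrier G" for g
  proof -
    note m = reps_mat[OF _ g]
    have "B * A * snd V g = B * (A * snd V g)"
      using a m[of V] by (intro assoc_mult_mat) auto
    also have "\<dots> = B * (snd W g * A)" using a g by simp
    also have "\<dots> = B * snd W g * A" using a m[of W] by (intro assoc_mult_mat[symmetric]) auto
    also have "\<dots> = snd U g * B * A" using a g by simp
    also have "\<dots> = snd U g * (B * A)" using a m[of U] by (intro assoc_mult_mat) auto
    finally show ?thesis .
  qed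
  thus ?thesis using a by (auto simp: rep_arrs_iff)
qed

lemma rep_arrs_add:
  assumes "(V, W, A) \<in> rep_arrs G" "(V, W, B) \<in> rep_arrs G"
  shows "(V, W, A + B) \<in> rep_arrs G"
proof -
  note a = assms[unfolded rep_arrs_iff]
  have "(A + B) * snd V g = snd W g * (A + B)" if g: "g \<in> carrier G" for g
    using a g reps_mat[OF _ g, of V] reps_mat[OF _ g, of W] 
    by (simp add: add_mult_distrib_mat[of A "fst W" "fst V" B _ "fst V"] mult_add_distrib_mat[of _ "fst W" "fst W" A "fst V" B])
  thus ?thesis using a by (auto simp: rep_arrs_iff)
qed

lemma rep_arrs_smult:
  assumes "(V, W, A) \<in> rep_arrs G"
  shows "(V, W, c \<cdot>\<^sub>m A) \<in> rep_arrs G"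
proof -
  note a = assms[unfolded rep_arrs_iff]
  have "(c \<cdot>\<^sub>m A) * snd V g = snd W g * (c \<cdot>\<^sub>m A)" if g: "g \<in> carrier G" for g
    using a g reps_mat[OF _ g, of V] reps_mat[OF _ g, of W] 
    by (simp add: mult_smult_assoc_mat[of A "fst W" "fst V" _ "fst V"] mult_smult_distrib[of _ "fst W" "fst W" A "fst V"])
  thus ?thesis using a by (auto simp: rep_arrs_iff)
qed

lemma rep_arrs_one: "V \<in> reps G \<Longrightarrow> (V, V, 1\<^sub>m (fst V)) \<in> rep_arrs G"
  using left_mult_one_mat[OF reps_mat[of V G]] right_mult_one_mat[OF reps_mat[of V G]] by (simp add: rep_arrs_iff)

lemma rep_arrs_zero: "V \<in> reps G \<Longrightarrow> W \<in> reps G \<Longrightarrow> (V, W, 0\<^sub>m (fst W) (fst V)) \<in> rep_arrs G"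
  using right_mult_zero_mat[OF reps_mat[of W G]] left_mult_zero_mat[OF reps_mat[of V G]] by (simp add: rep_arrs_iff)

lemma rep_arrs_carrier: "(V, W, A) \<in> rep_arrs G \<Longrightarrow> A \<in> carrier_mat (fst W) (fst V)"
  by (simp add: rep_arrs_iff)

lemma linear_category_Rep: "linear_category (Rep G :: (('g, 'k :: field) rep, _, 'k) lin_mon_cat)" (is "linear_category ?C")
proof
  fix f :: "('g, 'k) rep_arr" and x y assume "f \<in> Hom (Rep G) x y"
  then obtain M where M: "f = (x, y, M)" "(x, y, M) \<in> rep_arrs G" by (auto simp: Hom_Rep)
  have c: "M + (- 1) \<cdot>\<^sub>m M = 0\<^sub>m (fst y) (fst x)" 
    using M(2) by (intro eq_matI) (auto dest: rep_arrs_carrier)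
  show "\<exists>g\<in>Hom (Rep G) x y. plu (Rep G) f g = nul (Rep G) x y"
    using M c rep_arrs_smult[OF M(2), of "- 1"] by (intro bexI[of _ "(x, y, (- 1) \<cdot>\<^sub>m M)"]) (auto simp: Hom_Rep)
next
  fix f g and V W U :: "('g, 'k) rep"
  assume "f \<in> Hom ?C V W" "g \<in> Hom ?C W U"
  then obtain Fm Gm where e: "f = (V, W, Fm)" "g = (W, U, Gm)"
    and h: "(V, W, Fm) \<in> rep_arrs G" "(W, U, Gm) \<in> rep_arrs G"
    by (auto simp: Hom_Rep)
  note c = h[THEN rep_arrs_carrier]
  show "cmp ?C g f \<in> Hom ?C V U"
    using rep_arrs_cmp[OF h] by (simp add: e Hom_Rep)
next
  fix f and V W :: "('g, 'k) rep"
  assume "f \<in> Hom ?C V W"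
  then obtain Fm where e: "f = (V, W, Fm)"
    and h: "(V, W, Fm) \<in> rep_arrs G"
    by (auto simp: Hom_Rep)
  note c = h[THEN rep_arrs_carrier]
  show "cmp ?C f (idt ?C V) = f"
    using right_mult_one_mat[OF c] by (simp add: e Hom_Rep)
next
  fix f and V W :: "('g, 'k) rep"
  assume "f \<in> Hom ?C V W"
  then obtain Fm where e: "f = (V, W, Fm)"
    and h: "(V, W, Fm) \<in> rep_arrs G"
    by (auto simp: Hom_Rep)
  note c = h[THEN rep_arrs_carrier]
  show "cmp ?C (idt ?C W) f = f"
    using left_mult_one_mat[OF c] by (simp add: e Hom_Rep)
next
  fix f g h and V W U Z :: "('g, 'k) rep"
  assume "f \<in> Hom ?C V W" "g \<in> Hom ?C W U" "h \<in> Hom ?C U Z"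
  then obtain Fm Gm Hm where e: "f = (V, W, Fm)" "g = (W, U, Gm)" "h = (U, Z, Hm)"
    and h: "(V, W, Fm) \<in> rep_arrs G" "(W, U, Gm) \<in> rep_arrs G" "(U, Z, Hm) \<in> rep_arrs G"
    by (auto simp: Hom_Rep)
  note c = h[THEN rep_arrs_carrier]
  show "cmp ?C (cmp ?C h g) f = cmp ?C h (cmp ?C g f)"
    using assoc_mult_mat[OF c(3,2,1)] by (simp add: e Hom_Rep)
next
  fix f g and V W :: "('g, 'k) rep"
  assume "f \<in> Hom ?C V W" "g \<in> Hom ?C V W"
  then obtain Fm Gm where e: "f = (V, W, Fm)" "g = (V, W, Gm)"
    and h: "(V, W, Fm) \<in> rep_arrs G" "(V, W, Gm) \<in> rep_arrs G"
    by (auto simp: Hom_Rep)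
  note c = h[THEN rep_arrs_carrier]
  show "plu ?C f g \<in> Hom ?C V W"
    using rep_arrs_add[OF h] by (simp add: e Hom_Rep)
next
  fix f and V W :: "('g, 'k) rep" and a :: 'k
  assume "f \<in> Hom ?C V W"
  then obtain Fm where e: "f = (V, W, Fm)"
    and h: "(V, W, Fm) \<in> rep_arrs G"
    by (auto simp: Hom_Rep)
  note c = h[THEN rep_arrs_carrier]
  show "scl ?C a f \<in> Hom ?C V W"
    using rep_arrs_smult[OF h] by (simp add: e Hom_Rep)
next
  fix f g h and V W :: "('g, 'k) rep"
  assume "f \<in> Hom ?C V W" "g \<in> Hom ?C V W" "h \<in> Hom ?C V W"
  then obtain Fm Gm Hm where e: "f = (V, W, Fm)" "g = (V, W, Gm)" "h = (V, W, Hm)"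
    and h: "(V, W, Fm) \<in> rep_arrs G" "(V, W, Gm) \<in> rep_arrs G" "(V, W, Hm) \<in> rep_arrs G"
    by (auto simp: Hom_Rep)
  note c = h[THEN rep_arrs_carrier]
  show "plu ?C (plu ?C f g) h = plu ?C f (plu ?C g h)"
    using assoc_add_mat[OF c] by (simp add: e Hom_Rep)
next
  fix f g and V W :: "('g, 'k) rep"
  assume "f \<in> Hom ?C V W" "g \<in> Hom ?C V W"
  then obtain Fm Gm where e: "f = (V, W, Fm)" "g = (V, W, Gm)"
    and h: "(V, W, Fm) \<in> rep_arrs G" "(V, W, Gm) \<in> rep_arrs G"
    by (auto simp: Hom_Rep)
  note c = h[THEN rep_arrs_carrier]
  show "plu ?C f g = plu ?C g f"
    using comm_add_mat[OF c] by (simp add: e Hom_Rep)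
next
  fix f and V W :: "('g, 'k) rep"
  assume "f \<in> Hom ?C V W"
  then obtain Fm where e: "f = (V, W, Fm)"
    and h: "(V, W, Fm) \<in> rep_arrs G"
    by (auto simp: Hom_Rep)
  note c = h[THEN rep_arrs_carrier]
  show "plu ?C f (nul ?C V W) = f"
    using right_add_zero_mat[OF c] by (simp add: e Hom_Rep)
next
  fix f and V W :: "('g, 'k) rep"
  assume "f \<in> Hom ?C V W"
  then obtain Fm where e: "f = (V, W, Fm)"
    and h: "(V, W, Fm) \<in> rep_arrs G"
    by (auto simp: Hom_Rep)
  note c = h[THEN rep_arrs_carrier]
  show "scl ?C 1 f = f"
    using c by (auto simp: e Hom_Rep)
next
  fix f and V W :: "('g, 'k) rep" and a b :: 'k
  assume "f \<in> Hom ?C V W"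
  then obtain Fm where e: "f = (V, W, Fm)"
    and h: "(V, W, Fm) \<in> rep_arrs G"
    by (auto simp: Hom_Rep)
  note c = h[THEN rep_arrs_carrier]
  show "scl ?C (a * b) f = scl ?C a (scl ?C b f)"
    using c by (auto simp: e Hom_Rep)
next
  fix f g and V W :: "('g, 'k) rep" and a :: 'k
  assume "f \<in> Hom ?C V W" "g \<in> Hom ?C V W"
  then obtain Fm Gm where e: "f = (V, W, Fm)" "g = (V, W, Gm)"
    and h: "(V, W, Fm) \<in> rep_arrs G" "(V, W, Gm) \<in> rep_arrs G"
    by (auto simp: Hom_Rep)
  note c = h[THEN rep_arrs_carrier]
  show "scl ?C a (plu ?C f g) = plu ?C (scl ?C a f) (scl ?C a g)"
    using add_smult_distrib_left_mat[OF c] by (simp add: e Hom_Rep)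
next
  fix f and V W :: "('g, 'k) rep" and a b :: 'k
  assume "f \<in> Hom ?C V W"
  then obtain Fm where e: "f = (V, W, Fm)"
    and h: "(V, W, Fm) \<in> rep_arrs G"
    by (auto simp: Hom_Rep)
  note c = h[THEN rep_arrs_carrier]
  show "scl ?C (a + b) f = plu ?C (scl ?C a f) (scl ?C b f)"
    using add_smult_distrib_right_mat[OF c] by (simp add: e Hom_Rep)
next
  fix f k g and V W U :: "('g, 'k) rep"
  assume "f \<in> Hom ?C V W" "k \<in> Hom ?C V W" "g \<in> Hom ?C W U"
  then obtain Fm Km Gm where e: "f = (V, W, Fm)" "k = (V, W, Km)" "g = (W, U, Gm)"
    and h: "(V, W, Fm) \<in> rep_arrs G" "(V, W, Km) \<in> rep_arrs G" "(W, U, Gm) \<in> rep_arrs G"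
    by (auto simp: Hom_Rep)
  note c = h[THEN rep_arrs_carrier]
  show "cmp ?C g (plu ?C f k) = plu ?C (cmp ?C g f) (cmp ?C g k)"
    using mult_add_distrib_mat[OF c(3,1,2)] by (simp add: e Hom_Rep)
next
  fix f g k and V W U :: "('g, 'k) rep"
  assume "f \<in> Hom ?C V W" "g \<in> Hom ?C W U" "k \<in> Hom ?C W U"
  then obtain Fm Gm Km where e: "f = (V, W, Fm)" "g = (W, U, Gm)" "k = (W, U, Km)"
    and h: "(V, W, Fm) \<in> rep_arrs G" "(W, U, Gm) \<in> rep_arrs G" "(W, U, Km) \<in> rep_arrs G"
    by (auto simp: Hom_Rep)
  note c = h[THEN rep_arrs_carrier]
  show "cmp ?C (plu ?C g k) f = plu ?C (cmp ?C g f) (cmp ?C k f)"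
    using add_mult_distrib_mat[OF c(2,3,1)] by (simp add: e Hom_Rep)
next
  fix f g and V W U :: "('g, 'k) rep" and a :: 'k
  assume "f \<in> Hom ?C V W" "g \<in> Hom ?C W U"
  then obtain Fm Gm where e: "f = (V, W, Fm)" "g = (W, U, Gm)"
    and h: "(V, W, Fm) \<in> rep_arrs G" "(W, U, Gm) \<in> rep_arrs G"
    by (auto simp: Hom_Rep)
  note c = h[THEN rep_arrs_carrier]
  show "cmp ?C g (scl ?C a f) = scl ?C a (cmp ?C g f)"
    using mult_smult_distrib[OF c(2,1)] by (simp add: e Hom_Rep)
next
  fix f g and V W U :: "('g, 'k) rep" and a :: 'k
  assume "f \<in> Hom ?C V W" "g \<in> Hom ?C W U"
  then obtain Fm Gm where e: "f = (V, W, Fm)" "g = (W, U, Gm)"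
    and h: "(V, W, Fm) \<in> rep_arrs G" "(W, U, Gm) \<in> rep_arrs G"
    by (auto simp: Hom_Rep)
  note c = h[THEN rep_arrs_carrier]
  show "cmp ?C (scl ?C a g) f = scl ?C a (cmp ?C g f)"
    using mult_smult_assoc_mat[OF c(2,1)] by (simp add: e Hom_Rep)
next
  fix f assume "f \<in> arr ?C"
  thus "src ?C f \<in> obj ?C" "trg ?C f \<in> obj ?C" by (cases f; simp add: rep_arrs_iff)+
qed (auto simp: Hom_Rep rep_arrs_one rep_arrs_zero)

lemma mat_trace_mult_comm:
  fixes A :: "'k :: comm_semiring_0 mat"
  assumes "A \<in> carrier_mat m n" "B \<in> carrier_mat n m"
  shows "mat_trace (A * B) = mat_trace (B * A)"
proof -
  have "mat_trace (A * B) = (\<Sum>i<m. \<Sum>j<n. A $$ (i, j) * B $$ (j, i))"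
    using assms by (simp add: mat_trace_def scalar_prod_def atLeast0LessThan)
  also have "\<dots> = (\<Sum>j<n. \<Sum>i<m. B $$ (j, i) * A $$ (i, j))"
    by (subst sum.swap) (simp add: mult.commute)
  also have "\<dots> = mat_trace (B * A)"
    using assms by (simp add: mat_trace_def scalar_prod_def atLeast0LessThan)
  finally show ?thesis .
qed

lemma mat_trace_add:
  "A \<in> carrier_mat n n \<Longrightarrow> B \<in> carrier_mat n n \<Longrightarrow> mat_trace (A + B) = mat_trace A + (mat_trace B :: 'k :: comm_monoid_add)"
  by (simp add: mat_trace_def sum.distrib)

lemma mat_trace_smult:
  "A \<in> carrier_mat n n \<Longrightarrow> mat_trace (c \<cdot>\<^sub>m A) = c * (mat_trace A :: 'k :: comm_semiring_0)"
  by (simp add: mat_trace_def sum_distrib_left)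

lemma Hom_Rep_image: "Hom (Rep G) V W = (\<lambda>M. (V, W, M)) ` {M. (V, W, M) \<in> rep_arrs G}"
  by (auto simp: Hom_Rep)

lemma negligible_iff:
  "negligible G (V, W, M) \<longleftrightarrow> (V, W, M) \<in> rep_arrs G \<and>
    (\<forall>K. (W, V, K) \<in> rep_arrs G \<longrightarrow> mat_trace (M * K) = 0)"
  by (simp add: negligible_def Hom_Rep_image)

text \<open>Negligible arrows form an ideal because the trace is cyclic: \<open>Tr (h f g) = Tr (f g h)\<close>.\<close>

lemma linear_ideal_negligible: 
  "linear_ideal (Rep G :: (('g, 'k :: field) rep, _, 'k) lin_mon_cat) (negligible G)"
proof -
  interpret linear_category "Rep G :: (('g, 'k :: field) rep, _, 'k) lin_mon_cat" by (rule linear_category_Rep)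
  show ?thesis
  proof
    fix V W :: "('g, 'k) rep" assume VW: "V \<in> obj (Rep G)" "W \<in> obj (Rep G)"
    have "mat_trace (0\<^sub>m (fst W) (fst V) * K) = 0" if "(W, V, K) \<in> rep_arrs G" for K :: "'k mat"
      using rep_arrs_carrier[OF that] by (simp add: mat_trace_def)
    thus "negligible G (nul (Rep G) V W)" using VW by (simp add: negligible_iff rep_arrs_zero)
  next
    fix f g and V W :: "('g, 'k) rep" assume "f \<in> Hom (Rep G) V W" "g \<in> Hom (Rep G) V W" "negligible G f" "negligible G g"
    then obtain A B where *: "f = (V, W, A)" "g = (V, W, B)" "negligible G (V, W, A)" "negligible G (V, W, B)"
      by (auto simp: Hom_Rep)
    have "mat_trace ((A + B) * K) = 0" if K: "(W, V, K) \<in> rep_arrs G" for K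
    proof -
      have c: "A \<in> carrier_mat (fst W) (fst V)" "B \<in> carrier_mat (fst W) (fst V)" "K \<in> carrier_mat (fst V) (fst W)"
        using * K by (auto simp: negligible_iff dest: rep_arrs_carrier)
      have "mat_trace ((A + B) * K) = mat_trace (A * K) + mat_trace (B * K)"
        using c by (simp add: add_mult_distrib_mat[OF c] mat_trace_add[of _ "fst W"])
      thus ?thesis using * K by (simp add: negligible_iff)
    qed
    thus "negligible G (plu (Rep G) f g)" using * by (simp add: negligible_iff rep_arrs_add)
  next
    fix f c and V W :: "('g, 'k) rep" assume "f \<in> Hom (Rep G) V W" "negligible G f"
    then obtain A where *: "f = (V, W, A)" "negligible G (V, W, A)"
      by (auto simp: Hom_Rep)
    have "mat_trace ((c \<cdot>\<^sub>m A) * K) = 0" if K: "(W, V, K) \<in> rep_arrs G" for K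
    proof -
      have cc: "A \<in> carrier_mat (fst W) (fst V)" "K \<in> carrier_mat (fst V) (fst W)"
        using * K by (auto simp: negligible_iff dest: rep_arrs_carrier)
      have "mat_trace ((c \<cdot>\<^sub>m A) * K) = c * mat_trace (A * K)"
        using cc by (simp add: mult_smult_assoc_mat[OF cc] mat_trace_smult[of _ "fst W"])
      thus ?thesis using * K by (simp add: negligible_iff)
    qed
    thus "negligible G (scl (Rep G) c f)" using * by (simp add: negligible_iff rep_arrs_smult)
  next
    fix f g and V W U :: "('g, 'k) rep" assume "f \<in> Hom (Rep G) V W" "g \<in> Hom (Rep G) W U" "negligible G f"
    then obtain A B where *: "f = (V, W, A)" "g = (W, U, B)" "negligible G (V, W, A)" "(W, U, B) \<in> rep_arrs G"
      by (auto simp: Hom_Rep)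
    have "mat_trace ((B * A) * K) = 0" if K: "(U, V, K) \<in> rep_arrs G" for K
    proof -
      have c: "A \<in> carrier_mat (fst W) (fst V)" "B \<in> carrier_mat (fst U) (fst W)" "K \<in> carrier_mat (fst V) (fst U)"
        using * K by (auto simp: negligible_iff dest: rep_arrs_carrier)
      have "mat_trace ((B * A) * K) = mat_trace (B * (A * K))" using c by (simp add: assoc_mult_mat[OF c(2,1,3)])
      also have "\<dots> = mat_trace ((A * K) * B)" using c by (intro mat_trace_mult_comm) auto
      also have "\<dots> = mat_trace (A * (K * B))" using c by (simp add: assoc_mult_mat[OF c(1,3,2)])
      also have "\<dots> = 0" using * rep_arrs_cmp[OF *(4) K] by (simp add: negligible_iff)
      finally show ?thesis .
    qed
    thus "negligible G (cmp (Rep G) g f)" using * by (auto simp: negligible_iff intro: rep_arrs_cmp)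
  next
    fix f g and V W U :: "('g, 'k) rep" assume "f \<in> Hom (Rep G) V W" "g \<in> Hom (Rep G) W U" "negligible G g"
    then obtain A B where *: "f = (V, W, A)" "g = (W, U, B)" "(V, W, A) \<in> rep_arrs G" "negligible G (W, U, B)"
      by (auto simp: Hom_Rep)
    have "mat_trace ((B * A) * K) = 0" if K: "(U, V, K) \<in> rep_arrs G" for K
    proof -
      have c: "A \<in> carrier_mat (fst W) (fst V)" "B \<in> carrier_mat (fst U) (fst W)" "K \<in> carrier_mat (fst V) (fst U)"
        using * K by (auto simp: negligible_iff dest: rep_arrs_carrier)
      have "mat_trace ((B * A) * K) = mat_trace (B * (A * K))" using c by (simp add: assoc_mult_mat[OF c(2,1,3)])
      also have "\<dots> = 0" using * rep_arrs_cmp[OF K *(3)] by (simp add: negligible_iff)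
      finally show ?thesis .
    qed
    thus "negligible G (cmp (Rep G) g f)" using * by (auto simp: negligible_iff intro: rep_arrs_cmp)
  qed
qed

section \<open>Jordan normal form over an algebraically closed field\<close>

text \<open>Induction on the size.  An eigenvector \<open>v\<close> is made the first vector of a basis, which leaves a smaller square block.\<close>

lemma similar_upper_triangular:
  fixes A :: "'k :: alg_closed_field mat"
  assumes "A \<in> carrier_mat n n"
  shows "\<exists>B. B \<in> carrier_mat n n \<and> upper_triangular B \<and> similar_mat A B"
  using assms
proof (induction n arbitrary: A)
  case 0
  thus ?case by (intro exI[of _ A]) (auto intro: similar_mat_refl)
next
  case (Suc m)
  let ?n = "Suc m"
  note A = Suc.prems
  obtain v e where v: "v \<in> carrier_vec ?n" "v \<noteq> 0\<^sub>v ?n" "A *\<^sub>v v = e \<cdot>\<^sub>v v"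
    using alg_closed_eigenvector[OF A] by auto
  obtain i where i: "i < ?n" "v $ i \<noteq> 0" using v by (metis eq_vecI carrier_vecD index_zero_vec)
  \<comment> \<open>the columns form a basis: \<open>v\<close> replaces the unit vector \<open>e\<^sub>i\<close>, as \<open>v\<close> has a nonzero coordinate at \<open>i\<close>, and the
    vector \<open>e\<^sub>0\<close> moves to column \<open>i\<close> to make room for \<open>v\<close> in column \<open>0\<close>\<close>
  define W where "W = mat ?n ?n (\<lambda>(r, c). if c = 0 then v $ r else if r = (if c = i then 0 else c) then 1 else 0)"
  have W: "W \<in> carrier_mat ?n ?n" by (simp add: W_def)
  have "det W \<noteq> 0"
    unfolding det_0_iff_vec_prod_zero_field[OF W]
  proof clarify
    fix x assume x: "x \<in> carrier_vec ?n" "x \<noteq> 0\<^sub>v ?n" "W *\<^sub>v x = 0\<^sub>v ?n"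
    have row: "(\<Sum>c<?n. W $$ (r, c) * x $ c) = 0" if "r < ?n" for r
    proof -
      have "(W *\<^sub>v x) $ r = (\<Sum>c<?n. W $$ (r, c) * x $ c)"
        using that W x(1) by (simp add: scalar_prod_def atLeast0LessThan)
      thus ?thesis using x(3) that by simp
    qed
    have row': "v $ r * x $ 0 + (\<Sum>c\<in>{1..<?n}. (if r = (if c = i then 0 else c) then x $ c else 0)) = 0" if "r < ?n" for r
    proof -
      have "(\<Sum>c<?n. W $$ (r, c) * x $ c) = W $$ (r, 0) * x $ 0 + (\<Sum>c\<in>{1..<?n}. W $$ (r, c) * x $ c)"
        by (simp add: sum.atLeast_Suc_lessThan lessThan_atLeast0)
      also have "(\<Sum>c\<in>{1..<?n}. W $$ (r, c) * x $ c) = (\<Sum>c\<in>{1..<?n}. (if r = (if c = i then 0 else c) then x $ c else 0))"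
        using that by (intro sum.cong) (auto simp: W_def)
      finally show ?thesis using row[OF that] that by (simp add: W_def)
    qed
    have "(\<Sum>c\<in>{1..<?n}. (if i = (if c = i then 0 else c) then x $ c else 0)) = 0"
      by (intro sum.neutral) auto
    hence x0: "x $ 0 = 0" using row'[OF i(1)] i(2) by simp
    have "x $ c = 0" if c: "c < ?n" for c
    proof (cases "c = 0")
      case False
      define r where "r = (if c = i then 0 else c)"
      have "(\<Sum>c'\<in>{1..<?n}. (if r = (if c' = i then 0 else c') then x $ c' else 0)) = 
            (\<Sum>c'\<in>{1..<?n}. if c' = c then x $ c' else 0)"
        using False by (intro sum.cong) (auto simp: r_def)
      also have "\<dots> = x $ c" using c False by simp
      finally show ?thesis using row'[of r] x0 c by (simp add: r_def split: if_splits)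
    qed (use x0 in simp)
    thus False using x by (metis eq_vecI carrier_vecD index_zero_vec)
  qed
  from det_non_zero_imp_unit[OF W this, of "()"]
  obtain W' where W': "W' \<in> carrier_mat ?n ?n" "W * W' = 1\<^sub>m ?n" "W' * W = 1\<^sub>m ?n"
    by (auto simp: Units_def ring_mat_def)
  define A' where "A' = W' * A * W"
  have A': "A' \<in> carrier_mat ?n ?n" using A W W' by (simp add: A'_def)
  have "W * A' * W' = W * (W' * (A * W)) * W'"
    unfolding A'_def using W W' A by (simp add: assoc_mult_mat[of W' ?n ?n A ?n W ?n])
  also have "W * (W' * (A * W)) = W * W' * (A * W)"
    using W W' A by (intro assoc_mult_mat[symmetric]) auto
  also have "\<dots> = A * W" using W' W A by simp
  also have "A * W * W' = A * (W * W')" using W W' A by (intro assoc_mult_mat) auto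
  also have "\<dots> = A" using W' A by simp
  finally have "A = W * A' * W'" ..
  hence sim: "similar_mat A A'"
    unfolding similar_mat_def using W W' A A'
    by (intro exI[of _ W] exI[of _ W'] similar_mat_witI[of _ _ ?n]) auto
  have Wv: "col W 0 = v" using v(1) by (intro eq_vecI) (auto simp: W_def)
  have W'v: "W' *\<^sub>v v = unit_vec ?n 0"
  proof -
    have "col (W' * W) 0 = W' *\<^sub>v col W 0" using W W' by (intro col_mult2) auto
    thus ?thesis using W' Wv by simp
  qed
  have "col A' 0 = (W' * A) *\<^sub>v v" using col_mult2[of "W' * A" ?n ?n W ?n 0] Wv W W' A by (simp add: A'_def)
  also have "\<dots> = W' *\<^sub>v (A *\<^sub>v v)" using W' A v(1) by (intro assoc_mult_mat_vec) auto
  also have "\<dots> = e \<cdot>\<^sub>v unit_vec ?n 0" unfolding v(3) using mult_mat_vec[OF W'(1) v(1)] W'v by simp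
  finally have col0: "A' $$ (r, 0) = (if r = 0 then e else 0)" if "r < ?n" for r
    using that A' by (metis (no_types, lifting) carrier_matD(1) carrier_matD(2) index_col index_smult_vec(1) index_unit_vec(1) index_unit_vec(3) mult.right_neutral mult_zero_right zero_less_Suc)
  obtain A1 A2 A3 A4 where s: "split_block A' 1 1 = (A1, A2, A3, A4)" by (cases "split_block A' 1 1") auto
  from split_block[OF s, of m m] A' have S: "A1 \<in> carrier_mat 1 1" "A2 \<in> carrier_mat 1 m"
    "A3 \<in> carrier_mat m 1" "A4 \<in> carrier_mat m m" "A' = four_block_mat A1 A2 A3 A4" by auto
  have "A3 = 0\<^sub>m m 1"
  proof (rule eq_matI)
    fix a b assume ab: "a < dim_row (0\<^sub>m m 1 :: 'k mat)" "b < dim_col (0\<^sub>m m 1 :: 'k mat)"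
    have "A' $$ (Suc a, 0) = A3 $$ (a, 0)" unfolding S(5) using S(1-4) ab by simp
    thus "A3 $$ (a, b) = 0\<^sub>m m 1 $$ (a, b)" using col0[of "Suc a"] ab by simp
  qed (use S in auto)
  hence A'4: "A' = four_block_mat A1 A2 (0\<^sub>m m 1) A4" using S by simp
  obtain B4 where B4: "B4 \<in> carrier_mat m m" "upper_triangular B4" "similar_mat A4 B4"
    using Suc.IH[OF S(4)] by blast
  obtain B0 where B0: "B0 \<in> carrier_mat 1 m" "similar_mat A' (four_block_mat A1 B0 (0\<^sub>m m 1) B4)"
    using similar_mat_four_block_0_ex[OF similar_mat_refl[OF S(1)] B4(3) S(2) S(1) S(4)] A'4 by auto
  let ?B = "four_block_mat A1 B0 (0\<^sub>m m 1) B4"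
  have "upper_triangular ?B"
    using S(1) B4 B0(1) unfolding upper_triangular_def by (auto simp: less_Suc_eq_0_disj) 
  moreover have "?B \<in> carrier_mat ?n ?n" using S(1) B4(1) B0(1) by auto
  ultimately show ?case using similar_mat_trans[OF sim B0(2)] by blast
qed

lemma jordan_nf_alg_closed:
  fixes A :: "'k :: alg_closed_field mat"
  assumes A: "A \<in> carrier_mat n n"
  obtains n_as where "jordan_nf A n_as"
proof -
  obtain B where B: "B \<in> carrier_mat n n" "upper_triangular B" "similar_mat A B"
    using similar_upper_triangular[OF A] by blast
  have "jordan_nf B (triangular_to_jnf_vector B)" by (rule triangular_to_jnf_vector[OF B(1,2)])
  hence "jordan_nf A (triangular_to_jnf_vector B)" 
    unfolding jordan_nf_def using similar_mat_trans[OF B(3)] by blast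
  thus thesis by (rule that)
qed

lemma pow_mat_add:
  assumes A: "A \<in> carrier_mat n n"
  shows "A ^\<^sub>m (i + j) = A ^\<^sub>m i * A ^\<^sub>m j"
proof (induction j)
  case 0
  show ?case using A right_mult_one_mat[OF pow_carrier_mat[OF A]] by simp
next
  case (Suc j)
  have "A ^\<^sub>m i * A ^\<^sub>m j * A = A ^\<^sub>m i * (A ^\<^sub>m j * A)" using A by (intro assoc_mult_mat) auto
  thus ?case using Suc by simp
qed

lemma one_pow_mat: "(1\<^sub>m n :: 'k :: semiring_1 mat) ^\<^sub>m k = 1\<^sub>m n"
  by (induction k) auto

lemma pow_mat_mult:
  assumes A: "A \<in> carrier_mat n n"
  shows "A ^\<^sub>m (i * j) = (A ^\<^sub>m i) ^\<^sub>m j"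
proof (induction j)
  case (Suc j)
  have "A ^\<^sub>m (i * Suc j) = A ^\<^sub>m (i * j + i)" by (simp add: add.commute)
  thus ?case using Suc pow_mat_add[OF A] by simp
qed (use A in auto)

lemma pow_mat_mod:
  assumes A: "A \<in> carrier_mat n n" and p: "A ^\<^sub>m p = 1\<^sub>m n"
  shows "A ^\<^sub>m (k mod p) = A ^\<^sub>m k"
proof -
  have "A ^\<^sub>m k = A ^\<^sub>m (p * (k div p) + k mod p)" by simp
  also have "\<dots> = (A ^\<^sub>m p) ^\<^sub>m (k div p) * A ^\<^sub>m (k mod p)" 
    unfolding pow_mat_add[OF A] pow_mat_mult[OF A] ..
  also have "\<dots> = A ^\<^sub>m (k mod p)" unfolding p one_pow_mat using left_mult_one_mat[OF pow_carrier_mat[OF A]] .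
  finally show ?thesis by simp
qed

lemma jordan_matrix_pow_one:
  "(jordan_matrix n_as) ^\<^sub>m p = 1\<^sub>m (sum_list (map fst n_as)) \<Longrightarrow> (n, a) \<in> set n_as \<Longrightarrow>
    jordan_block n (a :: 'k :: comm_ring_1) ^\<^sub>m p = 1\<^sub>m n"
proof (induction n_as)
  case (Cons na n_as)
  obtain m b where na: "na = (m, b)" by (cases na)
  let ?s = "sum_list (map fst n_as)"
  let ?X = "jordan_block m b ^\<^sub>m p" and ?Y = "jordan_matrix n_as ^\<^sub>m p"
  have c: "jordan_matrix n_as \<in> carrier_mat ?s ?s" by auto
  have X: "?X \<in> carrier_mat m m" "?Y \<in> carrier_mat ?s ?s" using c by auto
  have eq: "four_block_mat ?X (0\<^sub>m m ?s) (0\<^sub>m ?s m) ?Y = 1\<^sub>m (m + ?s)"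
    using Cons.prems(1) pow_four_block_mat[OF _ c, of "jordan_block m b" m p] by (simp add: na jordan_matrix_Cons)
  have "?X = 1\<^sub>m m"
  proof (rule eq_matI)
    fix i j assume ij: "i < dim_row (1\<^sub>m m :: 'k mat)" "j < dim_col (1\<^sub>m m :: 'k mat)"
    have "four_block_mat ?X (0\<^sub>m m ?s) (0\<^sub>m ?s m) ?Y $$ (i, j) = ?X $$ (i, j)"
      using ij X by simp
    thus "?X $$ (i, j) = 1\<^sub>m m $$ (i, j)" using ij unfolding eq by simp
  qed (use X in auto)
  moreover have "?Y = 1\<^sub>m ?s"
  proof (rule eq_matI)
    fix i j assume ij: "i < dim_row (1\<^sub>m ?s :: 'k mat)" "j < dim_col (1\<^sub>m ?s :: 'k mat)"
    have "four_block_mat ?X (0\<^sub>m m ?s) (0\<^sub>m ?s m) ?Y $$ (m + i, m + j) = ?Y $$ (i, j)"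
      using ij X by simp
    thus "?Y $$ (i, j) = 1\<^sub>m ?s $$ (i, j)" using ij unfolding eq by simp
  qed (use X in auto)
  ultimately show ?case using Cons by (auto simp: na)
qed simp

section \<open>Representations of a cyclic group of prime order in its characteristic\<close>

text \<open>The type argument only fixes the field of scalars \<open>'k\<close>.\<close>

locale modular_cyclic =
  fixes p :: nat and scalars :: "'k :: alg_closed_field itself"
  assumes char: "CHAR('k) = p" and p_gt_2: "p > 2"
begin

abbreviation "G \<equiv> integer_mod_group p"
abbreviation "RepP \<equiv> Rep G :: ((int, 'k) rep, (int, 'k) rep_arr, 'k) lin_mon_cat"
abbreviation "VerP \<equiv> Ver p :: ('k ver_obj, 'k ver_arr, 'k) lin_mon_cat"
abbreviation gen :: "(int, 'k) rep \<Rightarrow> 'k mat" where "gen V \<equiv> snd V 1"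

text \<open>The representation in which the generator \<open>1\<close> of \<open>\<int>/p\<int>\<close> acts by \<open>A\<close>; it is a representation when \<open>A\<^sup>p = 1\<close>.\<close>

definition cyc :: "'k mat \<Rightarrow> (int, 'k) rep" where
  "cyc A = (dim_row A, restrict (\<lambda>g. A ^\<^sub>m nat g) (carrier G))"

lemma prime_p: "prime p"
  using prime_CHAR_semidom[where ?'a = 'k] char p_gt_2 by simp

lemma of_nat_eq_0_iff_p: "(of_nat n :: 'k) = 0 \<longleftrightarrow> p dvd n"
  using of_nat_eq_0_iff_char_dvd[where ?'a = 'k] char by simp

lemma carrier_G: "carrier G = {0..<int p}"
  using p_gt_2 by (simp add: carrier_integer_mod_group)

lemma one_in_G: "1 \<in> carrier G" 
  using p_gt_2 by (simp add: carrier_G)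

lemma cyc_reps:
  assumes A: "A \<in> carrier_mat n n" and Ap: "A ^\<^sub>m p = 1\<^sub>m n"
  shows "cyc A \<in> reps G" "fst (cyc A) = n" "gen (cyc A) = A"
proof -
  have d: "dim_row A = n" using A by auto
  have U: "A ^\<^sub>m i \<in> Units (ring_mat TYPE('k) n ())" for i
  proof -
    have e: "i + (p - 1) * i = p * i" "(p - 1) * i + i = p * i" using p_gt_2 by (cases p; simp)+
    have "A ^\<^sub>m (p * i) = 1\<^sub>m n" unfolding pow_mat_mult[OF A] Ap one_pow_mat ..
    hence "A ^\<^sub>m i * A ^\<^sub>m ((p - 1) * i) = 1\<^sub>m n" "A ^\<^sub>m ((p - 1) * i) * A ^\<^sub>m i = 1\<^sub>m n"
      unfolding pow_mat_add[OF A, symmetric] e by simp_all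
    thus ?thesis unfolding Units_def using A by (auto simp: ring_mat_def intro!: bexI[of _ "A ^\<^sub>m ((p - 1) * i)"])
  qed
  have mult: "A ^\<^sub>m nat ((x + y) mod int p) = A ^\<^sub>m nat x * A ^\<^sub>m nat y" if "x \<in> carrier G" "y \<in> carrier G" for x y
  proof -
    have "nat ((x + y) mod int p) = (nat x + nat y) mod p"
      using that by (simp add: carrier_G nat_mod_distrib nat_add_distrib)
    thus ?thesis using pow_mat_mod[OF A Ap] pow_mat_add[OF A] by simp
  qed
  have cl: "(x + y) mod int p \<in> carrier G" for x y using p_gt_2 by (simp add: carrier_G)
  have "restrict (\<lambda>g. A ^\<^sub>m nat g) (carrier G) \<in> hom G (units_of (ring_mat TYPE('k) n ()))"
    using U mult cl by (intro homI) (auto simp: units_of_def ring_mat_def)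
  thus "cyc A \<in> reps G" by (simp add: cyc_def reps_def d)
  show "fst (cyc A) = n" by (simp add: cyc_def d)
  show "gen (cyc A) = A" using one_in_G A by (simp add: cyc_def)
qed

lemma reps_gen:
  assumes V: "V \<in> reps G"
  shows "gen V \<in> carrier_mat (fst V) (fst V)" "gen V ^\<^sub>m p = 1\<^sub>m (fst V)" "V = cyc (gen V)"
    "i < p \<Longrightarrow> snd V (int i) = gen V ^\<^sub>m i"
proof -
  let ?n = "fst V" and ?\<rho> = "snd V"
  let ?H = "units_of (ring_mat TYPE('k) ?n ())"
  show c: "gen V \<in> carrier_mat ?n ?n" by (rule reps_mat[OF V one_in_G])
  have h: "?\<rho> \<in> hom G ?H" "?\<rho> \<in> extensional (carrier G)" using V by (auto simp: reps_def)
  have m: "?\<rho> ((x + y) mod int p) = ?\<rho> x * ?\<rho> y" if "x \<in> carrier G" "y \<in> carrier G" for x y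
    using hom_mult[OF h(1) that] by (simp add: units_of_def ring_mat_def)
  interpret R: ring "ring_mat TYPE('k) ?n ()" by (rule ring_mat)
  have "?\<rho> \<one>\<^bsub>G\<^esub> = \<one>\<^bsub>?H\<^esub>" 
    using hom_one[OF h(1)] R.units_group by simp
  hence z: "?\<rho> 0 = 1\<^sub>m ?n" by (simp add: units_of_def ring_mat_def)
  have pw: "?\<rho> (int i) = gen V ^\<^sub>m i" if "i < p" for i
    using that
  proof (induction i)
    case (Suc i)
    have "?\<rho> ((int i + 1) mod int p) = ?\<rho> (int i) * gen V"
      using Suc.prems by (intro m) (auto simp: carrier_G)
    thus ?case using Suc by (simp add: add.commute)
  qed (use z c in auto)
  show "i < p \<Longrightarrow> snd V (int i) = gen V ^\<^sub>m i" by (rule pw)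
  have "?\<rho> ((int (p - 1) + 1) mod int p) = ?\<rho> (int (p - 1)) * gen V"
    using p_gt_2 by (intro m) (auto simp: carrier_G)
  moreover have "int (p - 1) + 1 = int p" using p_gt_2 by simp
  ultimately have "1\<^sub>m ?n = gen V ^\<^sub>m (p - 1) * gen V" using z pw[of "p - 1"] p_gt_2 by simp
  also have "\<dots> = gen V ^\<^sub>m p" using p_gt_2 pow_mat.simps(2)[of "gen V" "p - 1"] by simp
  finally show "gen V ^\<^sub>m p = 1\<^sub>m ?n" ..
  have "?\<rho> g = restrict (\<lambda>g. gen V ^\<^sub>m nat g) (carrier G) g" for g
  proof (cases "g \<in> carrier G")
    case True
    thus ?thesis using pw[of "nat g"] by (simp add: carrier_G nat_less_iff)
  next
    case False
    thus ?thesis by (simp add: restrict_def extensional_arb[OF h(2)])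
  qed
  hence *: "?\<rho> = restrict (\<lambda>g. gen V ^\<^sub>m nat g) (carrier G)" by (intro ext)
  show "V = cyc (gen V)"
  proof (rule prod_eqI)
    show "fst V = fst (cyc (gen V))" using c by (simp add: cyc_def)
    show "snd V = snd (cyc (gen V))" unfolding cyc_def snd_conv by (rule *)
  qed
qed

text \<open>It suffices to commute with the generator.\<close>

lemma rep_arrs_gen:
  "(V, W, M) \<in> rep_arrs G \<longleftrightarrow> V \<in> reps G \<and> W \<in> reps G \<and> M \<in> carrier_mat (fst W) (fst V) \<and> M * gen V = gen W * M"
proof
  assume "(V, W, M) \<in> rep_arrs G"
  thus "V \<in> reps G \<and> W \<in> reps G \<and> M \<in> carrier_mat (fst W) (fst V) \<and> M * gen V = gen W * M"
    using one_in_G by (auto simp: rep_arrs_iff)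
next
  assume *: "V \<in> reps G \<and> W \<in> reps G \<and> M \<in> carrier_mat (fst W) (fst V) \<and> M * gen V = gen W * M"
  hence V: "V \<in> reps G" and W: "W \<in> reps G" and M: "M \<in> carrier_mat (fst W) (fst V)" and eq: "M * gen V = gen W * M" by auto
  note a = reps_gen(1)[OF V] and b = reps_gen(1)[OF W]
  have pw: "M * gen V ^\<^sub>m i = gen W ^\<^sub>m i * M" for i
  proof (induction i)
    case 0
    thus ?case using M a b by simp
  next
    case (Suc i)
    have "M * gen V ^\<^sub>m Suc i = (M * gen V ^\<^sub>m i) * gen V" 
      using M a by (simp add: assoc_mult_mat[of M _ _ _ "fst V" _ "fst V"])
    also have "\<dots> = gen W ^\<^sub>m i * (M * gen V)"
      unfolding Suc.IH using M a b by (simp add: assoc_mult_mat[of _ "fst W" "fst W" M "fst V" _ "fst V"])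
    also have "\<dots> = gen W ^\<^sub>m Suc i * M"
      unfolding eq using M b by (simp add: assoc_mult_mat[of _ "fst W" "fst W" _ "fst W" M "fst V"])
    finally show ?case .
  qed
  have "M * snd V g = snd W g * M" if "g \<in> carrier G" for g
    using reps_gen(4)[OF V, of "nat g"] reps_gen(4)[OF W, of "nat g"] pw that by (auto simp: carrier_G nat_less_iff)
  thus "(V, W, M) \<in> rep_arrs G" using * by (simp add: rep_arrs_iff)
qed

sublocale R: linear_category RepP
  by (rule linear_category_Rep)

sublocale I: linear_ideal RepP "negligible G"
  by (rule linear_ideal_negligible)

lemma Ver_eq: "VerP = quotient_cat RepP (negligible G)"
  by (simp add: Ver_def)

sublocale V: linear_category VerP
  unfolding Ver_eq by (rule I.linear_category_Q)

sublocale F: linear_functor RepP VerP "\<lambda>x. x" "ideal_class RepP (negligible G)"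
  unfolding Ver_eq by (rule I.linear_functor_cls)

lemma similar_isomorphic:
  assumes A: "A \<in> carrier_mat n n" "A ^\<^sub>m p = 1\<^sub>m n" and B: "B ^\<^sub>m p = 1\<^sub>m n"
    and sim: "similar_mat A B"
  shows "isomorphic RepP (cyc A) (cyc B)"
proof -
  obtain P Q where "similar_mat_wit A B P Q" using sim by (auto simp: similar_mat_def)
  note w = similar_mat_witD2[OF A(1) this]
  note rA = cyc_reps[OF A] and rB = cyc_reps[OF w(5) B]
  have q: "Q * A = B * Q"
  proof -
    have "Q * A = Q * (P * (B * Q))" unfolding w(3) using w by (simp add: assoc_mult_mat[of P n n B n Q n])
    also have "\<dots> = (Q * P) * (B * Q)" using w by (intro assoc_mult_mat[symmetric]) auto
    finally show ?thesis using w by simp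
  qed
  have r: "P * B = A * P"
  proof -
    have "A * P = (P * B) * (Q * P)" 
      unfolding w(3) using w(5-7) by (intro assoc_mult_mat) auto
    thus ?thesis using w(2,5,6) by simp
  qed
  show ?thesis
    using q r w(1,2,4-7) rA rB
    by (intro R.isomorphicI[of "(cyc A, cyc B, Q)" _ _ "(cyc B, cyc A, P)"]) (auto simp: Hom_Rep rep_arrs_gen)
qed

text \<open>The coordinate inclusions and projections of a block diagonal matrix are arrows of representations.\<close>

lemma biproduct_cyc:
  assumes A: "A \<in> carrier_mat n n" "A ^\<^sub>m p = 1\<^sub>m n" and B: "B \<in> carrier_mat m m" "B ^\<^sub>m p = 1\<^sub>m m"
  defines "D \<equiv> four_block_mat A (0\<^sub>m n m) (0\<^sub>m m n) B"
  shows "D \<in> carrier_mat (n + m) (n + m)" "D ^\<^sub>m p = 1\<^sub>m (n + m)" "is_direct_sum RepP (cyc D) [cyc A, cyc B]"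
proof -
  show D: "D \<in> carrier_mat (n + m) (n + m)" using A B by (simp add: D_def)
  show Dp: "D ^\<^sub>m p = 1\<^sub>m (n + m)" unfolding D_def pow_four_block_mat[OF A(1) B(1)] A(2) B(2) 
    by (intro eq_matI) auto
  note rA = cyc_reps[OF A] and rB = cyc_reps[OF B] and rD = cyc_reps[OF D Dp]
  let ?d = "\<lambda>a b i (j::nat). if i + a = j + b then (1::'k) else 0"
  define I0 where "I0 = mat (n + m) n (\<lambda>(i, j). if i = j then (1::'k) else 0)"
  define I1 where "I1 = mat (n + m) m (\<lambda>(i, j). if i = n + j then (1::'k) else 0)"
  define P0 where "P0 = mat n (n + m) (\<lambda>(i, j). if j = i then (1::'k) else 0)"
  define P1 where "P1 = mat m (n + m) (\<lambda>(i, j). if j = n + i then (1::'k) else 0)"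
  have sel: "(\<Sum>i\<in>{0..<l}. (if c i then (1::'k) else 0) * f i) = (if a < l then f a else 0)" 
    "(\<Sum>i\<in>{0..<l}. f i * (if c i then (1::'k) else 0)) = (if a < l then f a else 0)" 
    if "\<And>i. i < l \<Longrightarrow> c i \<longleftrightarrow> i = a" for l a c and f :: "nat \<Rightarrow> 'k"
  proof -
    have "(\<Sum>i\<in>{0..<l}. (if c i then (1::'k) else 0) * f i) = (\<Sum>i\<in>{0..<l}. if i = a then f i else 0)"
      using that by (intro sum.cong) auto
    thus "(\<Sum>i\<in>{0..<l}. (if c i then (1::'k) else 0) * f i) = (if a < l then f a else 0)" by simp
    thus "(\<Sum>i\<in>{0..<l}. f i * (if c i then (1::'k) else 0)) = (if a < l then f a else 0)" 
      by (simp add: mult.commute)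
  qed
  have c: "I0 \<in> carrier_mat (n + m) n" "I1 \<in> carrier_mat (n + m) m" "P0 \<in> carrier_mat n (n + m)" "P1 \<in> carrier_mat m (n + m)"
    by (auto simp: I0_def I1_def P0_def P1_def)
  have rowP0: "(P0 * X) $$ (i, j) = X $$ (i, j)" if "X \<in> carrier_mat (n + m) l" "i < n" "j < l" for X i j l
    using that c by (simp add: scalar_prod_def P0_def sel(1)[of _ _ i])
  have rowP1: "(P1 * X) $$ (i, j) = X $$ (n + i, j)" if "X \<in> carrier_mat (n + m) l" "i < m" "j < l" for X i j l
    using that c by (simp add: scalar_prod_def P1_def sel(1)[of _ _ "n + i"])
  have colI0: "(X * I0) $$ (i, j) = X $$ (i, j)" if "X \<in> carrier_mat l (n + m)" "i < l" "j < n" for X i j l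
    using that c by (simp add: scalar_prod_def I0_def sel(2)[of _ _ j])
  have colI1: "(X * I1) $$ (i, j) = X $$ (i, n + j)" if "X \<in> carrier_mat l (n + m)" "i < l" "j < m" for X i j l
    using that c by (simp add: scalar_prod_def I1_def sel(2)[of _ _ "n + j"])
  have "I0 * A = D * I0"
  proof (rule eq_matI)
    fix i j assume "i < dim_row (D * I0)" "j < dim_col (D * I0)"
    hence ij: "i < n + m" "j < n" using D c by auto
    have "(I0 * A) $$ (i, j) = (\<Sum>l = 0..<n. (if l = i then 1 else 0) * A $$ (l, j))"
      using ij A c by (auto simp: scalar_prod_def I0_def intro: sum.cong)
    also have "\<dots> = (if i < n then A $$ (i, j) else 0)" by (subst sel(1)[of _ _ i]) auto
    finally show "(I0 * A) $$ (i, j) = (D * I0) $$ (i, j)"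
      using colI0[OF D ij] ij A B by (simp add: D_def)
  qed (use A D c in auto)
  moreover have "I1 * B = D * I1"
  proof (rule eq_matI)
    fix i j assume "i < dim_row (D * I1)" "j < dim_col (D * I1)"
    hence ij: "i < n + m" "j < m" using D c by auto
    have "(I1 * B) $$ (i, j) = (\<Sum>l = 0..<m. (if i = n + l then 1 else 0) * B $$ (l, j))"
      using ij B c by (auto simp: scalar_prod_def I1_def intro: sum.cong)
    also have "\<dots> = (if i < n then 0 else B $$ (i - n, j))"
    proof (cases "i < n")
      case False
      thus ?thesis using ij by (subst sel(1)[of _ _ "i - n"]) auto
    qed auto
    finally show "(I1 * B) $$ (i, j) = (D * I1) $$ (i, j)"
      using colI1[OF D ij] ij A B by (simp add: D_def)
  qed (use B D c in auto)
  moreover have "P0 * D = A * P0"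
  proof (rule eq_matI)
    fix i j assume "i < dim_row (A * P0)" "j < dim_col (A * P0)"
    hence ij: "i < n" "j < n + m" using A c by auto
    have "(A * P0) $$ (i, j) = (\<Sum>l = 0..<n. A $$ (i, l) * (if l = j then 1 else 0))"
      using ij A c by (auto simp: scalar_prod_def P0_def intro: sum.cong)
    also have "\<dots> = (if j < n then A $$ (i, j) else 0)" by (subst sel(2)[of _ _ j]) auto
    finally show "(P0 * D) $$ (i, j) = (A * P0) $$ (i, j)"
      using rowP0[OF D ij] ij A B by (simp add: D_def)
  qed (use A D c in auto)
  moreover have "P1 * D = B * P1"
  proof (rule eq_matI)
    fix i j assume "i < dim_row (B * P1)" "j < dim_col (B * P1)"
    hence ij: "i < m" "j < n + m" using B c by auto
    have "(B * P1) $$ (i, j) = (\<Sum>l = 0..<m. B $$ (i, l) * (if j = n + l then 1 else 0))"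
      using ij B c by (auto simp: scalar_prod_def P1_def intro: sum.cong)
    also have "\<dots> = (if j < n then 0 else B $$ (i, j - n))"
    proof (cases "j < n")
      case False
      thus ?thesis using ij by (subst sel(2)[of _ _ "j - n"]) auto
    qed auto
    finally show "(P1 * D) $$ (i, j) = (B * P1) $$ (i, j)"
      using rowP1[OF D ij] ij A B by (simp add: D_def)
  qed (use B D c in auto)
  ultimately have arrs: "(cyc A, cyc D, I0) \<in> rep_arrs G" "(cyc B, cyc D, I1) \<in> rep_arrs G"
    "(cyc D, cyc A, P0) \<in> rep_arrs G" "(cyc D, cyc B, P1) \<in> rep_arrs G"
    using rA rB rD c by (auto simp: rep_arrs_gen)
  have PI: "P0 * I0 = 1\<^sub>m n" "P1 * I1 = 1\<^sub>m m" "P0 * I1 = 0\<^sub>m n m" "P1 * I0 = 0\<^sub>m m n"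
    using c by (auto intro!: eq_matI simp: rowP0 rowP1 colI0 colI1 simp del: index_mult_mat(1)) (auto simp: I0_def I1_def P0_def P1_def)
  let ?I = "\<lambda>a. if a = 0 then (cyc A, cyc D, I0) else (cyc B, cyc D, I1)"
  let ?P = "\<lambda>a. if a = (0::nat) then (cyc D, cyc A, P0) else (cyc D, cyc B, P1)"
  have "R.biproduct (cyc D) [cyc A, cyc B] ?I ?P"
  proof (rule R.biproductI)
    fix f g assume fg: "f \<in> Hom RepP (cyc D) (cyc D)" "g \<in> Hom RepP (cyc D) (cyc D)"
      and eq: "\<And>a. a < length [cyc A, cyc B] \<Longrightarrow> cmp RepP (?P a) f = cmp RepP (?P a) g"
    from fg obtain X Y where "f = (cyc D, cyc D, X)" "(cyc D, cyc D, X) \<in> rep_arrs G" 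
      "g = (cyc D, cyc D, Y)" "(cyc D, cyc D, Y) \<in> rep_arrs G" 
      by (auto simp: Hom_Rep)
    hence XY: "f = (cyc D, cyc D, X)" "X \<in> carrier_mat (n + m) (n + m)" 
      "g = (cyc D, cyc D, Y)" "Y \<in> carrier_mat (n + m) (n + m)" 
      using rD(2) by (auto dest: rep_arrs_carrier)
    have e: "P0 * X = P0 * Y" "P1 * X = P1 * Y" using eq[of 0] eq[of 1] XY by auto
    have "X = Y"
    proof (rule eq_matI)
      fix i j assume "i < dim_row Y" "j < dim_col Y"
      hence ij: "i < n + m" "j < n + m" using XY by auto
      show "X $$ (i, j) = Y $$ (i, j)"
      proof (cases "i < n")
        case True
        thus ?thesis using rowP0[OF XY(2) True ij(2)] rowP0[OF XY(4) True ij(2)] e by simp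
      next
        case False
        hence im: "i - n < m" "n + (i - n) = i" using ij by auto
        show ?thesis using rowP1[OF XY(2) im(1) ij(2)] rowP1[OF XY(4) im(1) ij(2)] e im by simp
      qed
    qed (use XY in auto)
    thus "f = g" using XY by simp
  qed (use arrs PI rA rB rD in \<open>auto simp: Hom_Rep less_Suc_eq numeral_2_eq_2\<close>)
  thus "is_direct_sum RepP (cyc D) [cyc A, cyc B]" using R.is_direct_sum_iff_biproduct by blast
qed

lemma zero_obj_Rep: "V \<in> reps G \<Longrightarrow> zero_obj RepP V \<longleftrightarrow> fst V = 0"
proof -
  assume V: "V \<in> reps G"
  have "(1\<^sub>m (fst V) :: 'k mat) = 0\<^sub>m (fst V) (fst V) \<longleftrightarrow> fst V = 0"
  proof
    assume eq: "(1\<^sub>m (fst V) :: 'k mat) = 0\<^sub>m (fst V) (fst V)"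
    show "fst V = 0"
    proof (rule ccontr)
      assume "fst V \<noteq> 0"
      thus False using arg_cong[OF eq, of "\<lambda>M. M $$ (0, 0)"] by simp
    qed
  qed auto
  thus ?thesis using V by (simp add: zero_obj_def)
qed

text \<open>The unipotent Jordan block, a representation for \<open>n \<le> p\<close>.  The value \<open>n = 0\<close> gives a zero object, which closes
  the recursion for tensor products at its lower end.\<close>

definition J :: "nat \<Rightarrow> (int, 'k) rep" where "J n = cyc (jordan_block n 1)"

text \<open>The entries above the diagonal are the binomial coefficients \<open>p choose (j - i)\<close>, which vanish in characteristic \<open>p\<close>.\<close>

lemma jordan_block_pow_p: "n \<le> p \<Longrightarrow> jordan_block n (1::'k) ^\<^sub>m p = 1\<^sub>m n"
proof -
  assume n: "n \<le> p"
  have "(of_nat (p choose (j - i)) :: 'k) = 0" if "i < j" "j < n" for i j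
    using dvd_choose_prime[of "j - i" p] prime_p that n of_nat_eq_0_iff_p by auto
  thus ?thesis unfolding jordan_block_pow by (intro eq_matI) auto
qed

lemma J_reps:
  assumes "n \<le> p"
  shows "J n \<in> reps G" "fst (J n) = n" "gen (J n) = jordan_block n 1"
  unfolding J_def using cyc_reps[OF _ jordan_block_pow_p[OF assms]] by auto

lemma jordan_matrix_sum:
  assumes "set ns \<subseteq> {..p}"
  defines "A \<equiv> jordan_matrix (map (\<lambda>n. (n, 1::'k)) ns)"
  shows "A ^\<^sub>m p = 1\<^sub>m (sum_list ns) \<and> is_direct_sum RepP (cyc A) (map J ns)"
  using assms(1) unfolding A_def
proof (induction ns)
  case Nil
  let ?A = "jordan_matrix (map (\<lambda>n. (n, 1::'k)) [])"
  have c: "?A \<in> carrier_mat 0 0" by (auto intro: carrier_matI)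
  have p: "?A ^\<^sub>m p = 1\<^sub>m 0" using pow_carrier_mat[OF c, of p] by (intro eq_matI) auto
  thus ?case using zero_obj_Rep cyc_reps[OF c p] by (simp add: R.is_direct_sum_Nil)
next
  case (Cons n ns)
  let ?A = "jordan_matrix (map (\<lambda>n. (n, 1::'k)) ns)"
  have fs: "map fst (map (\<lambda>n. (n, 1::'k)) ns) = ns" by (induction ns) auto
  have fs': "map (fst \<circ> (\<lambda>n. (n, 1::'k))) ns = ns" by (induction ns) auto
  have c: "?A \<in> carrier_mat (sum_list ns) (sum_list ns)" using fs by (auto intro: carrier_matI)
  have IH: "?A ^\<^sub>m p = 1\<^sub>m (sum_list ns)" "is_direct_sum RepP (cyc ?A) (map J ns)" using Cons by auto
  have n: "n \<le> p" using Cons by simp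
  have "jordan_block n (1::'k) \<in> carrier_mat n n" by auto
  note b = biproduct_cyc[OF this jordan_block_pow_p[OF n] c IH(1), folded J_def]
  show ?case using b(2) R.is_direct_sum_append[OF b(3) _ IH(2), of "[J n]"] J_reps[OF n]
    by (simp add: jordan_matrix_Cons fs' R.is_direct_sum_singleton R.isomorphic_refl)
qed

text \<open>Jordan normal form.  From \<open>A\<^sup>p = 1\<close> every eigenvalue satisfies \<open>(a - 1)\<^sup>p = a\<^sup>p - 1 = 0\<close>, and a block of size above
  \<open>p\<close> would have the entry \<open>p choose p = 1\<close> at \<open>(0, p)\<close> in its \<open>p\<close>-th power.\<close>

lemma jordan_decomposition:
  assumes V: "V \<in> reps G"
  obtains ns where "set ns \<subseteq> {1..p}" "sum_list ns = fst V" "is_direct_sum RepP V (map J ns)"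
proof -
  note g = reps_gen[OF V]
  obtain n_as where "jordan_nf (gen V) n_as" using jordan_nf_alg_closed[OF g(1)] .
  hence j: "0 \<notin> fst ` set n_as" "similar_mat (gen V) (jordan_matrix n_as)" by (auto simp: jordan_nf_def)
  obtain P Q where w: "similar_mat_wit (jordan_matrix n_as) (gen V) P Q" 
    using similar_mat_sym[OF j(2)] by (auto simp: similar_mat_def)
  have dim: "sum_list (map fst n_as) = fst V" 
    using similar_mat_witD(4,5)[OF refl w] g(1) by auto
  have c: "jordan_matrix n_as \<in> carrier_mat (fst V) (fst V)" using dim by auto
  have Ap: "jordan_matrix n_as ^\<^sub>m p = 1\<^sub>m (sum_list (map fst n_as))"
    unfolding similar_mat_wit_pow_id[OF w] g(2) using similar_mat_witD2[OF c w] dim by simp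
  have blocks: "a = 1 \<and> n \<in> {1..p}" if "(n, a) \<in> set n_as" for n a
  proof -
    have n0: "n > 0" using j(1) that by force
    note e = jordan_matrix_pow_one[OF Ap that]
    \<comment> \<open>the corner entry of the block, raised to the power \<open>p\<close>\<close>
    have "a ^ p = 1" using arg_cong[OF e, of "\<lambda>M. M $$ (0, 0)"] n0 by (simp add: jordan_block_pow)
    moreover have "(a - 1 + 1) ^ p = (a - 1) ^ p + 1 ^ p"
      by (rule freshmans_dream[OF prime_p[folded char] char[symmetric]])
    ultimately have a: "a = 1" using p_gt_2 by simp
    have "n \<le> p"
    proof (rule ccontr)
      assume "\<not> n \<le> p"
      thus False using arg_cong[OF e, of "\<lambda>M. M $$ (0, p)"] p_gt_2 by (simp add: jordan_block_pow)
    qed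
    thus ?thesis using a n0 by simp
  qed
  define ns where "ns = map fst n_as"
  have ns: "n_as = map (\<lambda>n. (n, 1)) ns" "set ns \<subseteq> {1..p}"
  proof -
    have "map (\<lambda>n. (n, 1)) ns = map (\<lambda>x. x) n_as"
      unfolding ns_def map_map using blocks by (intro map_cong) auto
    thus "n_as = map (\<lambda>n. (n, 1)) ns" by simp
    show "set ns \<subseteq> {1..p}" unfolding ns_def using blocks by auto
  qed
  hence "set ns \<subseteq> {..p}" by auto
  note js = jordan_matrix_sum[OF this, folded ns(1)]
  have "isomorphic RepP V (cyc (jordan_matrix n_as))"
    by (subst g(3), rule similar_isomorphic[OF g(1,2) _ j(2)]) (use js dim in \<open>simp add: ns_def\<close>)
  hence "is_direct_sum RepP V (map J ns)" using js R.is_direct_sum_iso by blast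
  thus thesis using that ns(2) dim ns_def by blast
qed

section \<open>Arrows between Jordan blocks\<close>

text \<open>Commuting with the shift makes the matrix constant along diagonals and forces the first column to vanish below
  its first entry.\<close>

lemma J_arrow_upper:
  assumes mn: "m \<le> p" "n \<le> p" and M: "(J m, J n, M) \<in> rep_arrs G"
  shows "M \<in> carrier_mat n m" "j < m \<Longrightarrow> i < n \<Longrightarrow> j < i \<Longrightarrow> M $$ (i, j) = 0"
    "i < m \<Longrightarrow> i < n \<Longrightarrow> M $$ (i, i) = M $$ (0, 0)"
proof -
  have c: "M \<in> carrier_mat n m" and eq: "M * jordan_block m 1 = jordan_block n 1 * M"
    using M J_reps[OF mn(1)] J_reps[OF mn(2)] by (auto simp: rep_arrs_gen)
  show "M \<in> carrier_mat n m" by (rule c)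
  have rel: "(if j > 0 then M $$ (i, j - 1) else 0) = (if Suc i < n then M $$ (Suc i, j) else 0)" if ij: "i < n" "j < m" for i j
  proof -
    have "(M * jordan_block m 1) $$ (i, j) = (\<Sum>l = 0..<m. M $$ (i, l) * (if l = j then 1 else if Suc l = j then 1 else 0))"
      using ij c by (auto simp: scalar_prod_def intro: sum.cong)
    also have "\<dots> = (\<Sum>l = 0..<m. (if l = j then M $$ (i, l) else 0) + (if j > 0 \<and> l = j - 1 then M $$ (i, l) else 0))"
      by (intro sum.cong) auto
    also have "\<dots> = M $$ (i, j) + (if j > 0 then M $$ (i, j - 1) else 0)"
      using ij by (cases "j > 0") (simp_all add: sum.distrib)
    finally have 1: "(M * jordan_block m 1) $$ (i, j) = M $$ (i, j) + (if j > 0 then M $$ (i, j - 1) else 0)" .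
    have "(jordan_block n 1 * M) $$ (i, j) = (\<Sum>l = 0..<n. (if i = l then 1 else if Suc i = l then 1 else 0) * M $$ (l, j))"
      using ij c by (auto simp: scalar_prod_def intro: sum.cong)
    also have "\<dots> = (\<Sum>l = 0..<n. (if l = i then M $$ (l, j) else 0) + (if l = Suc i then M $$ (l, j) else 0))"
      by (intro sum.cong) auto
    also have "\<dots> = M $$ (i, j) + (if Suc i < n then M $$ (Suc i, j) else 0)"
      using ij by (simp add: sum.distrib)
    finally show ?thesis using 1 eq by simp
  qed
  show "j < m \<Longrightarrow> i < n \<Longrightarrow> j < i \<Longrightarrow> M $$ (i, j) = 0"
  proof (induction j arbitrary: i)
    case 0
    thus ?case using rel[of "i - 1" 0] by simp
  next
    case (Suc j)
    have "M $$ (i - 1, j) = 0" using Suc.prems by (intro Suc.IH) auto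
    thus ?case using Suc.prems rel[of "i - 1" "Suc j"] by simp
  qed
  show "i < m \<Longrightarrow> i < n \<Longrightarrow> M $$ (i, i) = M $$ (0, 0)"
  proof (induction i)
    case (Suc i)
    thus ?case using rel[of i "Suc i"] by simp
  qed simp
qed

lemma J_endo_trace:
  assumes "n \<le> p" "(J n, J n, M) \<in> rep_arrs G"
  shows "mat_trace M = of_nat n * M $$ (0, 0)"
proof -
  note u = J_arrow_upper[OF assms(1,1,2)]
  have "mat_trace M = (\<Sum>i<n. M $$ (i, i))" using u(1) by (simp add: mat_trace_def)
  also have "\<dots> = (\<Sum>i<n. M $$ (0, 0))" by (intro sum.cong refl u(3)) auto
  finally show ?thesis by simp
qed

text \<open>The last row of \<open>M\<close> vanishes because \<open>M\<close> has fewer columns than rows and is zero below the diagonal.  Hence the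
  constant diagonal of the endomorphism \<open>M K\<close> vanishes.\<close>

lemma J_arrow_less:
  assumes mn: "m < n" "n \<le> p" and M: "(J m, J n, M) \<in> rep_arrs G" and K: "(J n, J m, K) \<in> rep_arrs G"
  shows "mat_trace (M * K) = 0"
proof -
  note u = J_arrow_upper[OF _ _ M] and v = J_arrow_upper[OF _ _ K]
  have mp: "m \<le> p" using mn by simp
  have MK: "(J n, J n, M * K) \<in> rep_arrs G" by (rule rep_arrs_cmp[OF K M])
  have "(M * K) $$ (n - 1, n - 1) = (\<Sum>l = 0..<m. M $$ (n - 1, l) * K $$ (l, n - 1))"
    using u(1)[OF mp mn(2)] v(1)[OF mn(2) mp] mn by (simp add: scalar_prod_def)
  also have "\<dots> = 0" using u(2)[OF mp mn(2)] mn by (intro sum.neutral) auto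
  finally have "(M * K) $$ (0, 0) = 0" using J_arrow_upper(3)[OF mn(2) mn(2) MK, of "n - 1"] mn by simp
  thus ?thesis using J_endo_trace[OF mn(2) MK] by simp
qed

text \<open>By cyclicity of the trace one may go around through the larger of the two blocks.\<close>

lemma J_arrow_negligible:
  assumes mn: "m \<noteq> n" "m \<le> p" "n \<le> p" and M: "(J m, J n, M) \<in> rep_arrs G"
  shows "negligible G (J m, J n, M)"
  unfolding negligible_iff
proof (intro conjI allI impI)
  fix K assume K: "(J n, J m, K) \<in> rep_arrs G"
  have "mat_trace (M * K) = mat_trace (K * M)"
    using J_arrow_upper(1)[OF mn(2,3) M] J_arrow_upper(1)[OF mn(3,2) K] by (rule mat_trace_mult_comm)
  thus "mat_trace (M * K) = 0" 
    using J_arrow_less[OF _ mn(3) M K] J_arrow_less[OF _ mn(2) K M] mn(1) by (cases "m < n") auto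
qed (rule M)

text \<open>An endomorphism has the constant \<open>c = M\<^sub>0\<^sub>0\<close> on its diagonal, so its trace is \<open>n c\<close>, and \<open>n = 0\<close> in the field only for
  \<open>n = p\<close>.  So modulo negligible arrows the endomorphisms of a block are the scalars for \<open>n < p\<close> and zero for
  \<open>n = p\<close>.\<close>

lemma J_endo_negligible_iff:
  assumes n: "n > 0" "n \<le> p" and M: "(J n, J n, M) \<in> rep_arrs G"
  shows "negligible G (J n, J n, M) \<longleftrightarrow> n = p \<or> M $$ (0, 0) = 0"
proof -
  have tr: "mat_trace (M * K) = of_nat n * (M $$ (0, 0) * K $$ (0, 0))" if K: "(J n, J n, K) \<in> rep_arrs G" for K
  proof -
    note u = J_arrow_upper[OF n(2,2) M] and v = J_arrow_upper[OF n(2,2) K]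
    have "(M * K) $$ (0, 0) = (\<Sum>l = 0..<n. M $$ (0, l) * K $$ (l, 0))"
      using u(1) v(1) n by (simp add: scalar_prod_def)
    also have "\<dots> = (\<Sum>l\<in>{0}. M $$ (0, l) * K $$ (l, 0))"
      using v(2)[of 0] n by (intro sum.mono_neutral_right) auto
    finally show ?thesis using J_endo_trace[OF n(2) rep_arrs_cmp[OF K M]] by simp
  qed
  have one: "(J n, J n, 1\<^sub>m n) \<in> rep_arrs G" using rep_arrs_one[OF J_reps(1)[OF n(2)]] J_reps(2)[OF n(2)] by simp
  have "p dvd n \<longleftrightarrow> n = p" using n by (auto dest: dvd_imp_le)
  hence n0: "(of_nat n :: 'k) = 0 \<longleftrightarrow> n = p" by (simp only: of_nat_eq_0_iff_p)
  show ?thesis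
  proof
    assume "negligible G (J n, J n, M)"
    hence "mat_trace (M * 1\<^sub>m n) = 0" using one unfolding negligible_iff by blast
    thus "n = p \<or> M $$ (0, 0) = 0" unfolding tr[OF one] using n0 n(1) by simp
  next
    assume *: "n = p \<or> M $$ (0, 0) = 0"
    have "mat_trace (M * K) = 0" if K: "(J n, J n, K) \<in> rep_arrs G" for K
      unfolding tr[OF K] using * n0 by auto
    thus "negligible G (J n, J n, M)" unfolding negligible_iff using M by blast
  qed
qed

end

section \<open>Categories generated by bricks\<close>

text \<open>Objects \<open>L n\<close> with only scalar endomorphisms and no other arrows between them, which generate all objects by direct
  sums.  They turn out to be exactly the simple objects.\<close>

locale brick_category = linear_category C
  for C :: "('o, 'm, 'k :: field) lin_mon_cat" (structure) +
  fixes S :: "nat set" and L :: "nat \<Rightarrow> 'o"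
  assumes L_obj: "n \<in> S \<Longrightarrow> L n \<in> obj C"
    and L_hom: "m \<in> S \<Longrightarrow> n \<in> S \<Longrightarrow> m \<noteq> n \<Longrightarrow> f \<in> Hom C (L m) (L n) \<Longrightarrow> f = nul C (L m) (L n)"
    and L_end: "n \<in> S \<Longrightarrow> f \<in> Hom C (L n) (L n) \<Longrightarrow> \<exists>c. f = c \<triangleright> idt C (L n)"
    and L_nonzero: "n \<in> S \<Longrightarrow> \<not> zero_obj C (L n)"
    and L_decomp: "x \<in> obj C \<Longrightarrow> \<exists>ns. set ns \<subseteq> S \<and> is_direct_sum C x (map L ns)"
begin

lemma L_idt: "n \<in> S \<Longrightarrow> idt C (L n) \<in> Hom C (L n) (L n)" "n \<in> S \<Longrightarrow> idt C (L n) \<noteq> nul C (L n) (L n)"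
  using L_nonzero L_obj by (auto simp: zero_obj_def intro: idt_hom)

text \<open>A subobject of \<open>L n\<close> is a direct sum of bricks, and some injection of a summand composes to a nonzero arrow into \<open>L n\<close>;
  this arrow is a nonzero scalar, so the monomorphism splits.\<close>

lemma L_simple:
  assumes n: "n \<in> S"
  shows "simple_obj C (L n)"
  unfolding simple_obj_def
proof (intro conjI allI impI)
  fix f assume f: "is_mono C f \<and> trg C f = L n"
  define x where "x = src C f"
  have fh: "f \<in> Hom C x (L n)" using f by (auto simp: is_mono_def Hom_def x_def)
  obtain ns where ns: "set ns \<subseteq> S" "is_direct_sum C x (map L ns)" using L_decomp Hom_obj(1)[OF fh] by blast
  show "zero_obj C (src C f) \<or> is_iso C f"
  proof (cases ns)
    case Nil
    thus ?thesis using ns(2) by (simp add: is_direct_sum_Nil x_def)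
  next
    case (Cons m ns')
    have m: "m \<in> S" using ns(1) Cons by simp
    obtain I P where b: "biproduct x (map L ns) I P" using ns(2) is_direct_sum_iff_biproduct by blast
    have IP: "I 0 \<in> Hom C (L m) x" "P 0 \<in> Hom C x (L m)" "P 0 \<cdot> I 0 = idt C (L m)"
      using biproductD(4,5,6)[OF b, of 0] Cons by auto
    have I0: "I 0 \<noteq> nul C (L m) x"
      using IP cmp_nul[OF IP(2) L_obj[OF m]] L_idt(2)[OF m] by auto
    have mono: "g = h" if "g \<in> Hom C w x" "h \<in> Hom C w x" "f \<cdot> g = f \<cdot> h" for w g h
      using f that unfolding is_mono_def x_def by blast
    have fI: "f \<cdot> I 0 \<noteq> nul C (L m) (L n)"
    proof
      assume "f \<cdot> I 0 = nul C (L m) (L n)"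
      hence "f \<cdot> I 0 = f \<cdot> nul C (L m) x" using cmp_nul[OF fh L_obj[OF m]] by simp
      thus False using mono[OF IP(1) nul_hom[OF L_obj[OF m] Hom_obj(1)[OF fh]]] I0 by simp
    qed
    have fIh: "f \<cdot> I 0 \<in> Hom C (L m) (L n)" by (rule cmp_hom[OF IP(1) fh])
    hence mn: "m = n" using L_hom[OF m n] fI by blast
    then obtain c where c: "f \<cdot> I 0 = c \<triangleright> idt C (L n)" using L_end[OF n] fIh by blast
    have "c \<noteq> 0" using c fI zero_scl[OF L_idt(1)[OF n]] mn by auto
    \<comment> \<open>a section of \<open>f\<close>, hence its inverse, as \<open>f\<close> is a monomorphism\<close>
    define h where "h = inverse c \<triangleright> I 0"
    have h: "h \<in> Hom C (L n) x" using IP(1) mn by (simp add: h_def scl_hom)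
    have fh1: "f \<cdot> h = idt C (L n)"
      using cmp_scl[OF IP(1) fh] c scl_scl[OF L_idt(1)[OF n], of "inverse c" c] scl_one[OF L_idt(1)[OF n]] \<open>c \<noteq> 0\<close>
      by (simp add: h_def)
    have "h \<cdot> f = idt C x"
    proof (rule mono[OF cmp_hom[OF fh h] idt_hom[OF Hom_obj(1)[OF fh]]])
      show "f \<cdot> (h \<cdot> f) = f \<cdot> idt C x"
        using cmp_assoc[OF fh h fh] fh1 idt_cmp[OF fh] cmp_idt[OF fh] by simp
    qed
    thus ?thesis using is_isoI[OF fh h] fh1 by blast
  qed
qed (use L_obj L_nonzero n in auto)

lemma simple_iso_L:
  assumes x: "simple_obj C x"
  shows "\<exists>n \<in> S. isomorphic C x (L n)"
proof -
  have xo: "x \<in> obj C" "\<not> zero_obj C x" using x by (auto simp: simple_obj_def)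
  obtain ns where ns: "set ns \<subseteq> S" "is_direct_sum C x (map L ns)" using L_decomp xo(1) by blast
  obtain n ns' where Cons: "ns = n # ns'" using ns(2) xo(2) by (cases ns) (auto simp: is_direct_sum_Nil)
  have n: "n \<in> S" using ns(1) Cons by simp
  obtain I P where b: "biproduct x (map L ns) I P" using ns(2) is_direct_sum_iff_biproduct by blast
  have IP: "I 0 \<in> Hom C (L n) x" "P 0 \<in> Hom C x (L n)" "P 0 \<cdot> I 0 = idt C (L n)"
    using biproductD(4,5,6)[OF b, of 0] Cons by auto
  have s: "src C (I 0) = L n" "trg C (I 0) = x" "I 0 \<in> arr C" using IP(1) by (auto simp: Hom_def)
  have "is_mono C (I 0)"
    unfolding is_mono_def s
  proof (intro conjI allI ballI impI s)
    fix w g h assume gh: "g \<in> Hom C w (L n)" "h \<in> Hom C w (L n)" "I 0 \<cdot> g = I 0 \<cdot> h"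
    have "g = P 0 \<cdot> (I 0 \<cdot> g)" using cmp_assoc[OF gh(1) IP(1,2)] IP(3) idt_cmp[OF gh(1)] by simp
    also have "\<dots> = h" unfolding gh(3) using cmp_assoc[OF gh(2) IP(1,2)] IP(3) idt_cmp[OF gh(2)] by simp
    finally show "g = h" .
  qed
  hence "zero_obj C (L n) \<or> is_iso C (I 0)" using x s unfolding simple_obj_def by metis
  hence "isomorphic C (L n) x" using L_nonzero[OF n] IP(1) unfolding isomorphic_def by blast
  thus ?thesis using isomorphic_sym n by blast
qed

lemma L_iso_eq:
  assumes "m \<in> S" "n \<in> S" "isomorphic C (L m) (L n)"
  shows "m = n"
proof (rule ccontr)
  assume ne: "m \<noteq> n"
  obtain f g where f: "f \<in> Hom C (L m) (L n)" "g \<in> Hom C (L n) (L m)" "g \<cdot> f = idt C (L m)" "f \<cdot> g = idt C (L n)"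
    using isomorphicE[OF assms(3)] .
  have "f = nul C (L m) (L n)" using L_hom[OF assms(1,2) ne f(1)] .
  hence "idt C (L m) = nul C (L m) (L m)" using f cmp_nul[OF f(2)] L_obj assms by simp
  thus False using L_idt(2)[OF assms(1)] by simp
qed

text \<open>Arrows between objects isomorphic to bricks are computed by conjugating with the isomorphisms.\<close>

lemma simple_hom:
  assumes s: "m \<in> S" "\<phi> \<in> Hom C s (L m)" "\<phi>' \<in> Hom C (L m) s" "\<phi>' \<cdot> \<phi> = idt C s" "\<phi> \<cdot> \<phi>' = idt C (L m)"
    and t: "n \<in> S" "\<psi> \<in> Hom C t (L n)" "\<psi>' \<in> Hom C (L n) t" "\<psi>' \<cdot> \<psi> = idt C t" "\<psi> \<cdot> \<psi>' = idt C (L n)"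
    and f: "f \<in> Hom C s t"
  shows "f = nul C s t \<or> (m = n \<and> (\<exists>c. c \<noteq> 0 \<and> f = c \<triangleright> (\<psi>' \<cdot> \<phi>)))"
proof -
  define g where "g = \<psi> \<cdot> (f \<cdot> \<phi>')"
  have fp: "f \<cdot> \<phi>' \<in> Hom C (L m) t" by (rule cmp_hom[OF s(3) f])
  have g: "g \<in> Hom C (L m) (L n)" unfolding g_def by (rule cmp_hom[OF fp t(2)])
  have "\<psi>' \<cdot> g = f \<cdot> \<phi>'" unfolding g_def using cmp_assoc[OF fp t(2,3)] t(4) idt_cmp[OF fp] by simp
  hence "(\<psi>' \<cdot> g) \<cdot> \<phi> = f" using cmp_assoc[OF s(2,3) f] s(4) cmp_idt[OF f] by simp
  hence fe: "f = \<psi>' \<cdot> (g \<cdot> \<phi>)" using cmp_assoc[OF s(2) g t(3)] by simp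
  have so: "s \<in> obj C" "t \<in> obj C" using Hom_obj[OF f] by auto
  show ?thesis
  proof (cases "g = nul C (L m) (L n)")
    case True
    thus ?thesis using fe nul_cmp[OF s(2) L_obj[OF t(1)]] cmp_nul[OF t(3) so(1)] by simp
  next
    case False
    hence mn: "m = n" using L_hom[OF s(1) t(1)] g by blast
    then obtain c where c: "g = c \<triangleright> idt C (L m)" using L_end[OF s(1)] g by blast
    have "f = c \<triangleright> (\<psi>' \<cdot> \<phi>)"
      unfolding fe c scl_cmp[OF s(2) L_idt(1)[OF s(1)]] idt_cmp[OF s(2)] 
      using cmp_scl[OF s(2), of \<psi>' t c] t(3) mn by simp
    moreover have "c \<noteq> 0" using False c zero_scl[OF L_idt(1)[OF s(1)]] mn by auto
    ultimately show ?thesis using mn by blast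
  qed
qed

sublocale schur_category C
proof
  fix s t f assume s: "simple_obj C s" and t: "simple_obj C t" and f: "f \<in> Hom C s t"
  obtain m where m: "m \<in> S" "isomorphic C s (L m)" using simple_iso_L[OF s] by blast
  obtain n where n: "n \<in> S" "isomorphic C t (L n)" using simple_iso_L[OF t] by blast
  obtain \<phi> \<phi>' where p: "\<phi> \<in> Hom C s (L m)" "\<phi>' \<in> Hom C (L m) s" "\<phi>' \<cdot> \<phi> = idt C s" "\<phi> \<cdot> \<phi>' = idt C (L m)"
    using isomorphicE[OF m(2)] .
  obtain \<psi> \<psi>' where q: "\<psi> \<in> Hom C t (L n)" "\<psi>' \<in> Hom C (L n) t" "\<psi>' \<cdot> \<psi> = idt C t" "\<psi> \<cdot> \<psi>' = idt C (L n)"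
    using isomorphicE[OF n(2)] .
  consider "f = nul C s t" | c where "m = n" "c \<noteq> 0" "f = c \<triangleright> (\<psi>' \<cdot> \<phi>)"
    using simple_hom[OF m(1) p n(1) q f] by blast
  thus "f = nul C s t \<or> is_iso C f"
  proof cases
    case 2
    note q' = q[folded 2(1)]
    let ?h = "\<psi>' \<cdot> \<phi>" and ?k = "\<phi>' \<cdot> \<psi>"
    have h: "?h \<in> Hom C s t" and k: "?k \<in> Hom C t s" using cmp_hom[OF p(1) q'(2)] cmp_hom[OF q'(1) p(2)] by auto
    have "?k \<cdot> ?h = \<phi>' \<cdot> (\<psi> \<cdot> (\<psi>' \<cdot> \<phi>))" by (rule cmp_assoc[OF h q'(1) p(2)])
    also have "\<psi> \<cdot> (\<psi>' \<cdot> \<phi>) = \<phi>" using cmp_assoc[OF p(1) q'(2,1)] q'(4) idt_cmp[OF p(1)] by simp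
    finally have kh: "?k \<cdot> ?h = idt C s" using p(3) by simp
    have "?h \<cdot> ?k = \<psi>' \<cdot> (\<phi> \<cdot> (\<phi>' \<cdot> \<psi>))" by (rule cmp_assoc[OF k p(1) q'(2)])
    also have "\<phi> \<cdot> (\<phi>' \<cdot> \<psi>) = \<psi>" using cmp_assoc[OF q'(1) p(2,1)] p(4) idt_cmp[OF q'(1)] by simp
    finally have hk: "?h \<cdot> ?k = idt C t" using q'(3) by simp
    let ?k' = "inverse c \<triangleright> ?k"
    have k': "?k' \<in> Hom C t s" by (rule scl_hom[OF k])
    have inv: "inverse c \<triangleright> (c \<triangleright> idt C x) = idt C x" if "x \<in> obj C" for x
      using scl_scl[OF idt_hom[OF that], of "inverse c" c] scl_one[OF idt_hom[OF that]] 2(2) by simp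
    have "?k' \<cdot> f = idt C s"
      using scl_cmp[OF f k] cmp_scl[OF h k] kh 2(3) inv Hom_obj[OF f] by simp
    moreover have "f \<cdot> ?k' = idt C t"
      using cmp_scl[OF k f] scl_cmp[OF k h] hk 2(3) inv Hom_obj[OF f] by simp
    ultimately show ?thesis using is_isoI[OF f k'] by blast
  qed simp
next
  fix s f assume s: "simple_obj C s" and f: "f \<in> Hom C s s"
  obtain m where m: "m \<in> S" "isomorphic C s (L m)" using simple_iso_L[OF s] by blast
  obtain \<phi> \<phi>' where p: "\<phi> \<in> Hom C s (L m)" "\<phi>' \<in> Hom C (L m) s" "\<phi>' \<cdot> \<phi> = idt C s" "\<phi> \<cdot> \<phi>' = idt C (L m)"
    using isomorphicE[OF m(2)] .
  show "\<exists>c. f = c \<triangleright> idt C s"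
    using simple_hom[OF m(1) p m(1) p f] p(3) zero_scl[OF idt_hom[OF Hom_obj(1)[OF f]]] by metis
next
  fix x assume "x \<in> obj C"
  then obtain ns where "set ns \<subseteq> S" "is_direct_sum C x (map L ns)" using L_decomp by blast
  thus "\<exists>xs. (\<forall>s \<in> set xs. simple_obj C s) \<and> is_direct_sum C x xs"
    using L_simple by (intro exI[of _ "map L ns"]) auto
qed

lemma multiplicity_of_L:
  assumes n: "n \<in> S" and ns: "set ns \<subseteq> S" and x: "is_direct_sum C x (map L ns)"
  shows "multiplicity_of C (L n) x = count_list ns n"
proof -
  have "multiplicity_of C (L n) x = length (filter (isomorphic C (L n)) (map L ns))"
    using n ns x L_simple by (intro multiplicity_of_eq) auto
  also have "\<dots> = length (filter (\<lambda>m. isomorphic C (L n) (L m)) ns)" by (simp add: filter_map o_def)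
  also have "filter (\<lambda>m. isomorphic C (L n) (L m)) ns = filter ((=) n) ns"
    using L_iso_eq[OF n] isomorphic_refl[OF L_obj[OF n]] ns by (intro filter_cong) auto
  also have "length \<dots> = count_list ns n" by (simp add: count_list_eq_length_filter eq_commute)
  finally show ?thesis .
qed

end

lemma (in linear_category) is_direct_sum_drop_zeros:
  assumes "is_direct_sum C x xs"
  shows "is_direct_sum C x (filter (\<lambda>z. \<not> zero_obj C z) xs)"
proof -
  have "list_all2 (is_direct_sum C) xs (map (\<lambda>z. if zero_obj C z then [] else [z]) xs)"
    using is_direct_sum_obj(2)[OF assms]
    by (auto simp: list_all2_conv_all_nth is_direct_sum_Nil is_direct_sum_singleton intro!: isomorphic_refl)
  from is_direct_sum_concat[OF assms this]
  have "is_direct_sum C x (concat (map (\<lambda>z. if zero_obj C z then [] else [z]) xs))" .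
  also have "concat (map (\<lambda>z. if zero_obj C z then [] else [z]) xs) = filter (\<lambda>z. \<not> zero_obj C z) xs"
    by (induction xs) auto
  finally show ?thesis .
qed

section \<open>The Verlinde category\<close>

context modular_cyclic
begin

abbreviation "cl \<equiv> ideal_class RepP (negligible G)"

lemma Ver_Hom: "Hom VerP V W = cl ` Hom RepP V W"
  unfolding Ver_eq by (rule I.Q_Hom)

lemma Ver_obj: "obj VerP = reps G"
  unfolding Ver_eq I.Q_obj by simp

lemma zero_obj_Ver: "zero_obj RepP V \<Longrightarrow> zero_obj VerP V"
  using F.is_direct_sum_map[of V "[]"] by (simp add: R.is_direct_sum_Nil V.is_direct_sum_Nil)

lemma cl_endo_eq_iff:
  assumes n: "n > 0" "n \<le> p" and M: "(J n, J n, M) \<in> rep_arrs G" and K: "(J n, J n, K) \<in> rep_arrs G"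
  shows "cl (J n, J n, M) = cl (J n, J n, K) \<longleftrightarrow> n = p \<or> M $$ (0, 0) = K $$ (0, 0)"
proof -
  have h: "(J n, J n, M) \<in> Hom RepP (J n) (J n)" "(J n, J n, K) \<in> Hom RepP (J n) (J n)" using M K by (auto simp: Hom_Rep)
  have c: "M \<in> carrier_mat n n" "K \<in> carrier_mat n n" 
    using J_arrow_upper(1)[OF n(2,2)] M K by auto
  have "cl (J n, J n, M) = cl (J n, J n, K) \<longleftrightarrow> negligible G (J n, J n, M + (- 1) \<cdot>\<^sub>m K)"
    unfolding I.cls_eq_iff[OF h] by (simp add: I.diff_def)
  also have "\<dots> \<longleftrightarrow> n = p \<or> (M + (- 1) \<cdot>\<^sub>m K) $$ (0, 0) = 0"
    by (rule J_endo_negligible_iff[OF n rep_arrs_add[OF M rep_arrs_smult[OF K]]])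
  also have "(M + (- 1) \<cdot>\<^sub>m K) $$ (0, 0) = M $$ (0, 0) - K $$ (0, 0)" using c n(1) by simp
  finally show ?thesis by simp
qed

lemma J_one: "n \<le> p \<Longrightarrow> (J n, J n, 1\<^sub>m n) \<in> rep_arrs G" "n \<le> p \<Longrightarrow> (J n, J n, 0\<^sub>m n n) \<in> rep_arrs G"
  using rep_arrs_one[OF J_reps(1)] rep_arrs_zero[OF J_reps(1) J_reps(1)] J_reps(2) by auto

text \<open>The identity of \<open>J p\<close> has trace \<open>p = 0\<close>: this block is killed in the Verlinde category.\<close>

lemma zero_obj_Ver_J: "n > 0 \<Longrightarrow> n \<le> p \<Longrightarrow> zero_obj VerP (J n) \<longleftrightarrow> n = p"
  using cl_endo_eq_iff[OF _ _ J_one] J_reps[of n]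
  unfolding zero_obj_def Ver_eq I.Q_obj I.Q_idt I.Q_nul by simp

lemma Ver_decomposition:
  assumes "V \<in> reps G"
  shows "\<exists>ns. set ns \<subseteq> {1..<p} \<and> is_direct_sum VerP V (map J ns)"
proof -
  obtain ns where ns: "set ns \<subseteq> {1..p}" "is_direct_sum RepP V (map J ns)" 
    by (rule jordan_decomposition[OF assms])
  have "is_direct_sum VerP V (map J ns)" using F.is_direct_sum_map[OF ns(2)] by simp
  from V.is_direct_sum_drop_zeros[OF this]
  have "is_direct_sum VerP V (map J (filter (\<lambda>n. \<not> zero_obj VerP (J n)) ns))" by (simp add: filter_map o_def)
  moreover have "set (filter (\<lambda>n. \<not> zero_obj VerP (J n)) ns) \<subseteq> {1..<p}"
  proof
    fix n assume "n \<in> set (filter (\<lambda>n. \<not> zero_obj VerP (J n)) ns)"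
    hence "n \<in> {1..p}" "\<not> zero_obj VerP (J n)" using ns(1) by auto
    thus "n \<in> {1..<p}" using zero_obj_Ver_J[of n] by (cases "n = p") auto
  qed
  ultimately show ?thesis by blast
qed

sublocale B: brick_category VerP "{1..<p}" J
proof
  fix m n f assume mn: "m \<in> {1..<p}" "n \<in> {1..<p}" "m \<noteq> n" and "f \<in> Hom VerP (J m) (J n)"
  then obtain M where M: "f = cl (J m, J n, M)" "(J m, J n, M) \<in> rep_arrs G" unfolding Ver_Hom by (auto simp: Hom_Rep)
  have h: "(J m, J n, M) \<in> Hom RepP (J m) (J n)" "nul RepP (J m) (J n) \<in> Hom RepP (J m) (J n)" 
    using M mn J_reps(1) R.nul_hom by (auto simp: Hom_Rep)
  have "negligible G (J m, J n, M + (- 1) \<cdot>\<^sub>m 0\<^sub>m n m)"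
    using mn M(2) J_reps rep_arrs_zero[of "J m" G "J n"]
    by (intro J_arrow_negligible rep_arrs_add rep_arrs_smult) auto
  hence "cl (J m, J n, M) = cl (nul RepP (J m) (J n))"
    unfolding I.cls_eq_iff[OF h] using mn J_reps(2) by (simp add: I.diff_def)
  thus "f = nul VerP (J m) (J n)" unfolding M(1) Ver_eq I.Q_nul .
next
  fix n f assume n: "n \<in> {1..<p}" and "f \<in> Hom VerP (J n) (J n)"
  then obtain M where M: "f = cl (J n, J n, M)" "(J n, J n, M) \<in> rep_arrs G" unfolding Ver_Hom by (auto simp: Hom_Rep)
  have n': "n > 0" "n \<le> p" using n by auto
  let ?c = "M $$ (0, 0)"
  have "cl (J n, J n, M) = cl (J n, J n, ?c \<cdot>\<^sub>m 1\<^sub>m n)"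
    unfolding cl_endo_eq_iff[OF n' M(2) rep_arrs_smult[OF J_one(1)[OF n'(2)]]] using n' by simp
  also have "\<dots> = scl VerP ?c (idt VerP (J n))"
    unfolding Ver_eq I.Q_idt using I.Q_scl[OF R.idt_hom, of "J n" ?c] J_reps[OF n'(2)] by simp
  finally show "\<exists>c. f = scl VerP c (idt VerP (J n))" unfolding M(1) by blast
next
  fix n assume "n \<in> {1..<p}"
  thus "J n \<in> obj VerP" "\<not> zero_obj VerP (J n)" using zero_obj_Ver_J[of n] J_reps(1)[of n] Ver_obj by auto
next
  fix V assume "V \<in> obj VerP"
  thus "\<exists>ns. set ns \<subseteq> {1..<p} \<and> is_direct_sum VerP V (map J ns)" using Ver_decomposition Ver_obj by simp
qed

section \<open>Quantum dimensions of representations\<close>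

text \<open>The quantum integer \<open>[r]\<close> at \<open>q = e\<^bsup>\<pi>i/p\<^esup>\<close>.\<close>

definition qnum :: "nat \<Rightarrow> real" where "qnum r = sin (pi * r / p) / sin (pi / p)"

text \<open>Multiplicities are taken in the Verlinde category, so that \<open>qdim\<close> is invariant under isomorphism there; blocks of size
  \<open>p\<close> count zero, in agreement with \<open>[p] = 0\<close>.\<close>

definition qdim :: "(int, 'k) rep \<Rightarrow> real" where
  "qdim V = (\<Sum>r\<in>{1..<p}. qnum r * multiplicity_of VerP (J r) V)"

lemma sin_pi_p: "sin (pi / p) > 0"
  using p_gt_2 by (intro sin_gt_zero) (auto simp: field_simps)

lemma qnum_0: "qnum 0 = 0" and qnum_1: "qnum 1 = 1" and qnum_p: "qnum p = 0"
  using sin_pi_p p_gt_2 by (auto simp: qnum_def)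

lemma qnum_pos: "r \<in> {1..<p} \<Longrightarrow> qnum r > 0"
  unfolding qnum_def using sin_pi_p p_gt_2 by (intro divide_pos_pos sin_gt_zero) (auto simp: field_simps)

lemma qnum_rec: "r \<ge> 1 \<Longrightarrow> qnum 2 * qnum r = qnum (r + 1) + qnum (r - 1)"
proof -
  assume r: "r \<ge> 1"
  have "sin (pi * real (r + 1) / p) = sin (pi * r / p + pi / p)" 
    by (simp add: add_divide_distrib distrib_left add.commute)
  moreover have "sin (pi * real (r - 1) / p) = sin (pi * r / p - pi / p)" 
    using r by (simp add: diff_divide_distrib right_diff_distrib of_nat_diff)
  moreover have "sin (pi * real 2 / p) = 2 * sin (pi / p) * cos (pi / p)" 
    using sin_double[of "pi / p"] by (simp add: field_simps)
  ultimately show ?thesis using sin_pi_p by (simp add: qnum_def sin_add sin_diff field_simps)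
qed

lemma sum_list_count:
  fixes f :: "nat \<Rightarrow> real"
  assumes "finite A" "set ns \<subseteq> A"
  shows "(\<Sum>r\<in>A. f r * count_list ns r) = sum_list (map f ns)"
  using assms(2)
proof (induction ns)
  case (Cons n ns)
  have "(\<Sum>r\<in>A. f r * count_list (n # ns) r) = (\<Sum>r\<in>A. (if r = n then f r else 0) + f r * count_list ns r)"
    by (intro sum.cong) (auto simp: algebra_simps)
  thus ?case using Cons assms(1) by (simp add: sum.distrib)
qed simp

lemma qdim_sum:
  assumes V: "is_direct_sum VerP V (map J ns)" and ns: "set ns \<subseteq> {..p}"
  shows "qdim V = sum_list (map qnum ns)"
proof -
  have z: "zero_obj VerP (J n) \<longleftrightarrow> n = 0 \<or> n = p" if "n \<le> p" for n
    using zero_obj_Ver_J[of n] that zero_obj_Ver[of "J 0"] zero_obj_Rep[of "J 0"] J_reps[of 0] by (cases "n = 0") auto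
  define ms where "ms = filter (\<lambda>n. n \<noteq> 0 \<and> n \<noteq> p) ns"
  have ms: "set ms \<subseteq> {1..<p}" using ns by (fastforce simp: ms_def)
  have "is_direct_sum VerP V (map J (filter (\<lambda>n. \<not> zero_obj VerP (J n)) ns))"
    using V.is_direct_sum_drop_zeros[OF V] by (simp add: filter_map o_def)
  also have "filter (\<lambda>n. \<not> zero_obj VerP (J n)) ns = ms"
    unfolding ms_def using ns z by (intro filter_cong) auto
  finally have m: "is_direct_sum VerP V (map J ms)" .
  have "qdim V = (\<Sum>r\<in>{1..<p}. qnum r * count_list ms r)"
    unfolding qdim_def using B.multiplicity_of_L[OF _ ms m] by (intro sum.cong) auto
  also have "\<dots> = sum_list (map qnum ms)" using ms by (intro sum_list_count) auto
  also have "\<dots> = sum_list (map qnum ns)"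
    unfolding ms_def by (induction ns) (auto simp: qnum_0 qnum_p)
  finally show ?thesis .
qed

lemma qdim_J: "n \<le> p \<Longrightarrow> qdim (J n) = qnum n"
  using qdim_sum[of "J n" "[n]"] V.is_direct_sum_singleton[of "J n" "J n"] V.isomorphic_refl[of "J n"]
    J_reps(1)[of n] Ver_obj by auto

lemma qdim_add:
  assumes V: "is_direct_sum VerP V xs"
  shows "qdim V = sum_list (map qdim xs)"
proof -
  have "\<forall>x\<in>set xs. \<exists>ns. set ns \<subseteq> {1..<p} \<and> is_direct_sum VerP x (map J ns)"
    using V.is_direct_sum_obj(2)[OF V] B.L_decomp by blast
  then obtain f where f: "\<And>x. x \<in> set xs \<Longrightarrow> set (f x) \<subseteq> {1..<p} \<and> is_direct_sum VerP x (map J (f x))"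
    by metis
  have "list_all2 (is_direct_sum VerP) xs (map (\<lambda>x. map J (f x)) xs)"
    using f by (auto simp: list_all2_conv_all_nth)
  from V.is_direct_sum_concat[OF V this]
  have "is_direct_sum VerP V (map J (concat (map f xs)))" by (simp add: map_concat o_def)
  moreover have "set (concat (map f xs)) \<subseteq> {..p}" using f by fastforce
  ultimately have "qdim V = sum_list (map qnum (concat (map f xs)))" by (rule qdim_sum)
  also have "\<dots> = sum_list (map (\<lambda>x. sum_list (map qnum (f x))) xs)"
    by (induction xs) auto
  also have "map (\<lambda>x. sum_list (map qnum (f x))) xs = map qdim xs"
  proof (rule map_cong)
    fix x assume "x \<in> set xs"
    from f[OF this] have "qdim x = sum_list (map qnum (f x))" by (intro qdim_sum) auto
    thus "sum_list (map qnum (f x)) = qdim x" ..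
  qed simp
  finally show ?thesis .
qed

lemma qdim_add_Rep: "is_direct_sum RepP V xs \<Longrightarrow> qdim V = sum_list (map qdim xs)"
  using qdim_add F.is_direct_sum_map[of V xs] by simp

lemma qdim_iso: "isomorphic VerP V W \<Longrightarrow> qdim V = qdim W"
  using qdim_add[of V "[W]"] by (simp add: V.is_direct_sum_singleton)

lemma qdim_simple_pos: "simple_obj VerP V \<Longrightarrow> qdim V > 0"
proof -
  assume "simple_obj VerP V"
  then obtain n where n: "n \<in> {1..<p}" "isomorphic VerP V (J n)" using B.simple_iso_L by blast
  have "qdim V = qnum n" using qdim_iso[OF n(2)] qdim_J[of n] n(1) by simp
  thus ?thesis using qnum_pos[OF n(1)] by simp
qed

lemma qdim_pos:
  assumes "V \<in> reps G" "\<not> zero_obj VerP V"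
  shows "qdim V > 0"
proof -
  obtain ns where ns: "set ns \<subseteq> {1..<p}" "is_direct_sum VerP V (map J ns)"
    using Ver_decomposition[OF assms(1)] by blast
  obtain n ms where "ns = n # ms" using ns(2) assms(2) by (cases ns) (auto simp: V.is_direct_sum_Nil)
  moreover have "qdim V = sum_list (map qnum ns)" using ns by (intro qdim_sum) auto
  moreover have "sum_list (map qnum ms) \<ge> 0" if "set ms \<subseteq> {1..<p}" for ms
  proof (rule sum_list_nonneg)
    fix x assume "x \<in> set (map qnum ms)"
    then obtain m where "m \<in> set ms" "x = qnum m" by auto
    thus "x \<ge> 0" using qnum_pos[of m] that by auto
  qed
  ultimately show ?thesis using qnum_pos[of n] ns(1) by (auto intro: add_pos_nonneg)
qed

section \<open>Counting Jordan blocks\<close>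

text \<open>Each Jordan block contributes one independent vector fixed by the generator.  The assumption says that a fixed
  vector \<open>w\<close> is determined linearly by its coordinates at \<open>\<phi> t\<close>, \<open>t \<in> T\<close>, that is, the fixed space has dimension at most
  \<open>card T\<close>; the fixed vectors of the blocks and the corresponding coordinate functionals then give matrices with
  product the identity.\<close>

lemma blocks_le_dim_kernel:
  assumes V: "V \<in> reps G" and ns: "set ns \<subseteq> {1..p}" and ds: "is_direct_sum RepP V (map J ns)"
    and T: "finite T" and \<phi>: "\<And>t. t \<in> T \<Longrightarrow> \<phi> t < fst V"
    and ker: "\<And>w i. w \<in> carrier_vec (fst V) \<Longrightarrow> gen V *\<^sub>v w = w \<Longrightarrow> i < fst V \<Longrightarrow> w $ i = (\<Sum>t\<in>T. w $ \<phi> t * \<beta> t i)"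
  shows "length ns \<le> card T"
proof -
  let ?d = "fst V"
  obtain I P where b: "R.biproduct V (map J ns) I P" using ds R.is_direct_sum_iff_biproduct by blast
  note B = R.biproductD[OF b]
  have nsp: "ns ! a \<le> p" "ns ! a > 0" if "a < length ns" for a using nth_mem[OF that] ns by auto
  define Im where "Im a = snd (snd (I a))" for a
  define Pm where "Pm a = snd (snd (P a))" for a
  have I: "I a = (J (ns ! a), V, Im a)" "(J (ns ! a), V, Im a) \<in> rep_arrs G" 
    and P: "P a = (V, J (ns ! a), Pm a)" "(V, J (ns ! a), Pm a) \<in> rep_arrs G" if "a < length ns" for a
    using B(4,5)[of a] that by (auto simp: Hom_Rep Im_def Pm_def)
  have Ic: "Im a \<in> carrier_mat ?d (ns ! a)" "gen V * Im a = Im a * jordan_block (ns ! a) 1" 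
    and Pc: "Pm a \<in> carrier_mat (ns ! a) ?d" if "a < length ns" for a
    using I(2)[OF that] P(2)[OF that] J_reps[OF nsp(1)[OF that]] by (auto simp: rep_arrs_gen)
  have PI: "(Pm a * Im c) $$ (0, 0) = (if a = c then 1 else 0)" if ac: "a < length ns" "c < length ns" for a c
    using B(6)[of a] B(7)[of a c] ac I(1) P(1) J_reps[OF nsp(1)[OF ac(1)]] J_reps[OF nsp(1)[OF ac(2)]] nsp(2) by auto
  note gV = reps_gen(1)[OF V]
  have "card {..<length ns} \<le> card T"
  proof (rule card_le_of_right_inverse[where A = "\<lambda>a t. \<Sum>i<?d. Pm a $$ (0, i) * \<beta> t i" and B = "\<lambda>t c. Im c $$ (\<phi> t, 0)"])
    fix a c assume "a \<in> {..<length ns}" "c \<in> {..<length ns}"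
    hence a: "a < length ns" and c: "c < length ns" by auto
    \<comment> \<open>the image of the first basis vector of the block, which is fixed by the generator\<close>
    let ?w = "col (Im c) 0"
    have w: "?w \<in> carrier_vec ?d" using Ic(1)[OF c] by (intro carrier_vecI) simp
    have wi: "?w $ i = Im c $$ (i, 0)" if "i < ?d" for i using Ic(1)[OF c] nsp(2)[OF c] that by simp
    have "gen V *\<^sub>v ?w = col (gen V * Im c) 0"
      using col_mult2[OF gV Ic(1)[OF c]] nsp(2)[OF c] by simp
    also have "\<dots> = Im c *\<^sub>v col (jordan_block (ns ! c) 1) 0"
      unfolding Ic(2)[OF c] using nsp(2)[OF c] by (intro col_mult2[OF Ic(1)[OF c]]) auto
    also have "col (jordan_block (ns ! c) 1) 0 = unit_vec (ns ! c) 0"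
      using nsp(2)[OF c] by (intro eq_vecI) auto
    also have "Im c *\<^sub>v unit_vec (ns ! c) 0 = ?w"
      using Ic(1)[OF c] nsp(2)[OF c] by (intro eq_vecI) auto
    finally have fixed: "gen V *\<^sub>v ?w = ?w" .
    have "(\<Sum>t\<in>T. (\<Sum>i<?d. Pm a $$ (0, i) * \<beta> t i) * Im c $$ (\<phi> t, 0)) = 
          (\<Sum>i<?d. Pm a $$ (0, i) * (\<Sum>t\<in>T. ?w $ \<phi> t * \<beta> t i))"
      unfolding sum_distrib_left sum_distrib_right
      by (subst sum.swap) (intro sum.cong refl, simp add: wi \<phi> mult.assoc mult.left_commute mult.commute)
    also have "\<dots> = (\<Sum>i<?d. Pm a $$ (0, i) * Im c $$ (i, 0))"
      using ker[OF w fixed] wi by (intro sum.cong) auto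
    also have "\<dots> = (Pm a * Im c) $$ (0, 0)"
      using Pc[OF a] Ic(1)[OF c] nsp(2)[OF a] nsp(2)[OF c] by (simp add: scalar_prod_def atLeast0LessThan)
    also have "\<dots> = (if a = c then 1 else 0)" by (rule PI[OF a c])
    finally show "(\<Sum>t\<in>T. (\<Sum>i<?d. Pm a $$ (0, i) * \<beta> t i) * Im c $$ (\<phi> t, 0)) = (if a = c then 1 else 0)" .
  qed (use T in auto)
  thus ?thesis by simp
qed

lemma jordan_block_row_sum:
  assumes "i < n"
  shows "(\<Sum>l<n. jordan_block n (a :: 'k) $$ (i, l) * x l) = a * x i + (if Suc i < n then x (Suc i) else 0)"
proof -
  have "(\<Sum>l<n. jordan_block n a $$ (i, l) * x l) = 
     (\<Sum>l<n. (if l = i then a * x l else 0) + (if l = Suc i then x l else 0))"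
    using assms by (intro sum.cong) auto
  thus ?thesis using assms by (simp add: sum.distrib)
qed

text \<open>The fixed space of a single Jordan block is a line, so a decomposition has at most one nonzero summand.\<close>

lemma J_indecomposable:
  assumes n: "n \<in> {1..p}"
  shows "indecomposable_obj RepP (J n)"
  unfolding indecomposable_obj_def
proof (intro conjI allI impI)
  note Jn = J_reps[of n]
  have Jr: "J n \<in> reps G" "fst (J n) = n" "gen (J n) = jordan_block n 1" using Jn n by auto
  show "J n \<in> obj RepP" using Jr by simp
  show "\<not> zero_obj RepP (J n)" using zero_obj_Rep[OF Jr(1)] Jr(2) n by simp
  fix y z assume yz: "is_direct_sum RepP (J n) [y, z]"
  have r: "y \<in> reps G" "z \<in> reps G" using R.is_direct_sum_obj(2)[OF yz] by auto
  obtain ns where ns: "set ns \<subseteq> {1..p}" "is_direct_sum RepP y (map J ns)" by (rule jordan_decomposition[OF r(1)])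
  obtain ms where ms: "set ms \<subseteq> {1..p}" "is_direct_sum RepP z (map J ms)" by (rule jordan_decomposition[OF r(2)])
  have "length (ns @ ms) \<le> card {0::nat}"
  proof (rule blocks_le_dim_kernel[where \<phi> = "\<lambda>_. 0" and \<beta> = "\<lambda>_ i. if i = 0 then 1 else 0"])
    show "is_direct_sum RepP (J n) (map J (ns @ ms))" using R.is_direct_sum_append[OF yz ns(2) ms(2)] by simp
    fix w i assume w: "w \<in> carrier_vec (fst (J n))" "gen (J n) *\<^sub>v w = w" and i: "i < fst (J n)"
    show "w $ i = (\<Sum>t\<in>{0::nat}. w $ 0 * (if i = 0 then 1 else 0))"
    proof (cases i)
      case (Suc j)
      have j: "j < n" "Suc j < n" using Suc i Jr by auto
      have "(gen (J n) *\<^sub>v w) $ j = (\<Sum>l<n. jordan_block n 1 $$ (j, l) * w $ l)"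
        using j(1) Jr w(1) by (simp add: scalar_prod_def atLeast0LessThan)
      also have "\<dots> = w $ j + w $ Suc j" using jordan_block_row_sum[OF j(1), of 1 "\<lambda>l. w $ l"] j(2) by simp
      finally show ?thesis using w(2) Suc by simp
    qed simp
  qed (use Jr n ns ms in auto)
  hence "ns = [] \<or> ms = []" by (cases ns; cases ms) auto
  thus "zero_obj RepP y \<or> zero_obj RepP z" using ns(2) ms(2) by (auto simp: R.is_direct_sum_Nil)
qed

text \<open>Split off the first block from a Jordan decomposition; the rest must be zero.\<close>

lemma indecomposable_iso_J:
  assumes V: "indecomposable_obj RepP V"
  shows "isomorphic RepP V (J (fst V))"
proof -
  have Vr: "V \<in> reps G" "\<not> zero_obj RepP V" using V by (auto simp: indecomposable_obj_def)
  obtain ns where ns: "set ns \<subseteq> {1..p}" "sum_list ns = fst V" "is_direct_sum RepP V (map J ns)" 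
    by (rule jordan_decomposition[OF Vr(1)])
  obtain n ms where nm: "ns = n # ms" using ns(3) Vr(2) by (cases ns) (auto simp: R.is_direct_sum_Nil)
  have n: "n \<in> {1..p}" "set ms \<subseteq> {..p}" "set ms \<subseteq> {1..p}" using ns(1) nm by auto
  let ?A = "jordan_matrix (map (\<lambda>n. (n, 1::'k)) ms)"
  note js = jordan_matrix_sum[OF n(2)]
  have fs: "map (fst \<circ> (\<lambda>n. (n, 1::'k))) ms = ms" by (induction ms) auto
  have Ac: "?A \<in> carrier_mat (sum_list ms) (sum_list ms)" by (auto intro!: carrier_matI simp: fs)
  have jc: "jordan_block n (1::'k) \<in> carrier_mat n n" by auto
  have np: "n \<le> p" using n by simp
  note bp = biproduct_cyc[OF jc jordan_block_pow_p[OF np] Ac conjunct1[OF js], folded J_def]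
  let ?D = "cyc (four_block_mat (jordan_block n 1) (0\<^sub>m n (sum_list ms)) (0\<^sub>m (sum_list ms) n) ?A)"
  have "is_direct_sum RepP ?D ([J n] @ map J ms)"
    using R.is_direct_sum_append[OF bp(3) _ conjunct2[OF js], of "[J n]"] J_reps(1)[OF np]
    by (simp add: R.is_direct_sum_singleton R.isomorphic_refl)
  hence "isomorphic RepP V ?D" using R.is_direct_sum_unique[OF ns(3)] nm by simp
  hence "is_direct_sum RepP V [J n, cyc ?A]" using R.is_direct_sum_iso bp(3) by blast
  hence "zero_obj RepP (J n) \<or> zero_obj RepP (cyc ?A)" using V unfolding indecomposable_obj_def by blast
  moreover have "\<not> zero_obj RepP (J n)" using zero_obj_Rep J_reps[OF np] n by simp
  ultimately have "sum_list ms = 0"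
    using zero_obj_Rep cyc_reps[OF Ac conjunct1[OF js]] by simp
  hence "ms = []" using n(3) by (cases ms) auto
  thus ?thesis using ns nm by (simp add: R.is_direct_sum_singleton)
qed

lemma Ver_L_iso_J:
  assumes "r \<in> {1..p}"
  shows "isomorphic VerP (Ver_L p r) (J r)"
proof -
  have "indecomposable_obj RepP (Ver_L p r) \<and> fst (Ver_L p r :: 'k ver_obj) = r"
    unfolding Ver_L_def by (rule someI[of _ "J r"]) (use J_indecomposable[OF assms] J_reps(2)[of r] assms in auto)
  hence "isomorphic RepP (Ver_L p r) (J r)" using indecomposable_iso_J by metis
  thus ?thesis by (rule F.isomorphic_map)
qed

end

section \<open>Tensor products with Jordan blocks\<close>

lemma sum_div_mod:
  fixes f :: "nat \<Rightarrow> nat \<Rightarrow> 'a :: comm_monoid_add"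
  shows "(\<Sum>k<m * n. f (k div n) (k mod n)) = (\<Sum>a<m. \<Sum>b<n. f a b)"
proof (cases "n = 0")
  case False
  have "a * n + b < m * n" if "a < m" "b < n" for a b
  proof -
    have "a * n + b < (a + 1) * n" using that by (simp add: algebra_simps)
    also have "\<dots> \<le> m * n" using that by (intro mult_right_mono) auto
    finally show ?thesis .
  qed
  hence "(\<Sum>k<m * n. f (k div n) (k mod n)) = (\<Sum>(a, b)\<in>{..<m} \<times> {..<n}. f a b)"
    using False
    by (intro sum.reindex_bij_witness[of _ "\<lambda>(a, b). a * n + b" "\<lambda>k. (k div n, k mod n)"])
       (auto simp: less_mult_imp_div_less)
  thus ?thesis by (simp add: sum.cartesian_product)
qed auto

lemma kronecker_carrier:
  "A \<in> carrier_mat m n \<Longrightarrow> B \<in> carrier_mat m' n' \<Longrightarrow> kronecker A B \<in> carrier_mat (m * m') (n * n')"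
  by (simp add: kronecker_def)

lemma kronecker_index:
  "A \<in> carrier_mat m n \<Longrightarrow> B \<in> carrier_mat m' n' \<Longrightarrow> i < m * m' \<Longrightarrow> j < n * n' \<Longrightarrow>
   kronecker A B $$ (i, j) = A $$ (i div m', j div n') * B $$ (i mod m', j mod n')"
  by (simp add: kronecker_def)

lemma div_mod_bounds: "(i :: nat) < m * n \<Longrightarrow> i div n < m \<and> i mod n < n"
  by (metis less_mult_imp_div_less mod_less_divisor mult_0_right not_less_zero gr0I)

lemma kronecker_mult:
  fixes A B C D :: "'k :: comm_semiring_0 mat"
  assumes A: "A \<in> carrier_mat m n" and C: "C \<in> carrier_mat n l"
    and B: "B \<in> carrier_mat m' n'" and D: "D \<in> carrier_mat n' l'"
  shows "kronecker A B * kronecker C D = kronecker (A * C) (B * D)"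
proof (rule eq_matI)
  note AB = kronecker_carrier[OF A B] and CD = kronecker_carrier[OF C D]
  have AC: "A * C \<in> carrier_mat m l" "B * D \<in> carrier_mat m' l'" using A B C D by auto
  note ABCD = kronecker_carrier[OF AC]
  fix i j assume "i < dim_row (kronecker (A * C) (B * D))" "j < dim_col (kronecker (A * C) (B * D))"
  hence i: "i < m * m'" and j: "j < l * l'" using ABCD by auto
  have id: "i div m' < m" "i mod m' < m'" and jd: "j div l' < l" "j mod l' < l'" using div_mod_bounds i j by blast+
  have "(kronecker A B * kronecker C D) $$ (i, j) = (\<Sum>k<n * n'. kronecker A B $$ (i, k) * kronecker C D $$ (k, j))"
    using AB CD i j by (simp add: scalar_prod_def atLeast0LessThan)
  also have "\<dots> = (\<Sum>k<n * n'. (A $$ (i div m', k div n') * B $$ (i mod m', k mod n')) *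
        (C $$ (k div n', j div l') * D $$ (k mod n', j mod l')))"
    using kronecker_index[OF A B i] kronecker_index[OF C D _ j] by (intro sum.cong) auto
  also have "\<dots> = (\<Sum>a<n. \<Sum>b<n'. (A $$ (i div m', a) * B $$ (i mod m', b)) * (C $$ (a, j div l') * D $$ (b, j mod l')))"
    by (rule sum_div_mod)
  also have "\<dots> = (\<Sum>a<n. A $$ (i div m', a) * C $$ (a, j div l')) * (\<Sum>b<n'. B $$ (i mod m', b) * D $$ (b, j mod l'))"
    by (simp add: sum_product mult.assoc mult.left_commute)
  also have "\<dots> = (A * C) $$ (i div m', j div l') * (B * D) $$ (i mod m', j mod l')"
    using A B C D id jd by (simp add: scalar_prod_def atLeast0LessThan)
  also have "\<dots> = kronecker (A * C) (B * D) $$ (i, j)" using kronecker_index[OF AC i j] by simp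
  finally show "(kronecker A B * kronecker C D) $$ (i, j) = kronecker (A * C) (B * D) $$ (i, j)" .
qed (auto simp: kronecker_def)

lemma kronecker_one: "kronecker (1\<^sub>m m) (1\<^sub>m n) = (1\<^sub>m (m * n) :: 'k :: semiring_1 mat)"
proof (rule eq_matI)
  fix i j assume "i < dim_row (1\<^sub>m (m * n) :: 'k mat)" "j < dim_col (1\<^sub>m (m * n) :: 'k mat)"
  hence ij: "i < m * n" "j < m * n" by auto
  have "i = j \<longleftrightarrow> i div n = j div n \<and> i mod n = j mod n" by (metis div_mult_mod_eq)
  thus "kronecker (1\<^sub>m m) (1\<^sub>m n) $$ (i, j) = (1\<^sub>m (m * n) :: 'k mat) $$ (i, j)"
    using ij div_mod_bounds[of i m n] div_mod_bounds[of j m n] by (auto simp: kronecker_def)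
qed (auto simp: kronecker_def)

lemma kronecker_assoc:
  fixes A B C :: "'k :: comm_semiring_0 mat"
  assumes A: "A \<in> carrier_mat a a'" and B: "B \<in> carrier_mat b b'" and C: "C \<in> carrier_mat c c'"
  shows "kronecker (kronecker A B) C = kronecker A (kronecker B C)"
proof (rule eq_matI)
  note AB = kronecker_carrier[OF A B] and BC = kronecker_carrier[OF B C]
  fix i j assume "i < dim_row (kronecker A (kronecker B C))" "j < dim_col (kronecker A (kronecker B C))"
  hence i: "i < a * (b * c)" and j: "j < a' * (b' * c')" using kronecker_carrier[OF A BC] by auto
  have dm: "(x mod (n * k)) mod k = x mod k" "(x mod (n * k)) div k = (x div k) mod n" "x div k div n = x div (n * k)" 
    for x n k :: nat
    by (simp_all add: mod_mod_cancel div_mult2_eq[symmetric] mult.commute[of n] mod_mult2_eq)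
       (cases "k = 0"; simp)
  have i': "i < (a * b) * c" "i div c < a * b" "i mod (b * c) < b * c" 
    and j': "j < (a' * b') * c'" "j div c' < a' * b'" "j mod (b' * c') < b' * c'" 
    using i j div_mod_bounds[of i "a * b" c] div_mod_bounds[of j "a' * b'" c'] div_mod_bounds[of i a "b * c"]
      div_mod_bounds[of j a' "b' * c'"] by (auto simp: mult.assoc)
  have "kronecker (kronecker A B) C $$ (i, j) = 
      A $$ (i div c div b, j div c' div b') * B $$ (i div c mod b, j div c' mod b') * C $$ (i mod c, j mod c')"
    using kronecker_index[OF AB C i'(1) j'(1)] kronecker_index[OF A B i'(2) j'(2)] by simp
  also have "\<dots> = kronecker A (kronecker B C) $$ (i, j)"
    using kronecker_index[OF A BC i j] kronecker_index[OF B C i'(3) j'(3)] by (simp add: dm mult.assoc)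
  finally show "kronecker (kronecker A B) C $$ (i, j) = kronecker A (kronecker B C) $$ (i, j)" .
qed (auto simp: kronecker_def mult.assoc)

lemma kronecker_add_left:
  fixes A A' B :: "'k :: semiring_0 mat"
  assumes "A \<in> carrier_mat m n" "A' \<in> carrier_mat m n" "B \<in> carrier_mat m' n'"
  shows "kronecker (A + A') B = kronecker A B + kronecker A' B"
  using assms div_mod_bounds by (intro eq_matI) (auto simp: kronecker_def distrib_right)

lemma kronecker_add_right:
  fixes A B B' :: "'k :: semiring_0 mat"
  assumes "A \<in> carrier_mat m n" "B \<in> carrier_mat m' n'" "B' \<in> carrier_mat m' n'"
  shows "kronecker A (B + B') = kronecker A B + kronecker A B'"
  using assms div_mod_bounds by (intro eq_matI) (auto simp: kronecker_def distrib_left)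

lemma kronecker_smult:
  fixes A B :: "'k :: comm_semiring_0 mat"
  assumes "A \<in> carrier_mat m n" "B \<in> carrier_mat m' n'"
  shows "kronecker (c \<cdot>\<^sub>m A) B = c \<cdot>\<^sub>m kronecker A B" "kronecker A (c \<cdot>\<^sub>m B) = c \<cdot>\<^sub>m kronecker A B"
  using assms div_mod_bounds by (auto intro!: eq_matI simp: kronecker_def mult.assoc mult.left_commute)

lemma kronecker_pow:
  fixes A B :: "'k :: comm_semiring_1 mat"
  assumes A: "A \<in> carrier_mat m m" and B: "B \<in> carrier_mat n n"
  shows "kronecker A B ^\<^sub>m k = kronecker (A ^\<^sub>m k) (B ^\<^sub>m k)"
proof (induction k)
  case 0
  thus ?case using A B kronecker_carrier[OF A B] by (simp add: kronecker_one)
next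
  case (Suc k)
  thus ?case using kronecker_mult[OF pow_carrier_mat[OF A] A pow_carrier_mat[OF B] B] by simp
qed

lemma kronecker_jordan_block_2:
  fixes B :: "'k :: comm_ring_1 mat"
  assumes B: "B \<in> carrier_mat n n"
  shows "kronecker (jordan_block 2 1) B = four_block_mat B B (0\<^sub>m n n) B"
proof (rule eq_matI)
  fix i j assume "i < dim_row (four_block_mat B B (0\<^sub>m n n) B)" "j < dim_col (four_block_mat B B (0\<^sub>m n n) B)"
  hence ij: "i < 2 * n" "j < 2 * n" using B by auto
  have J: "jordan_block 2 (1::'k) \<in> carrier_mat 2 2" by simp
  have dm: "x div n = (if x < n then 0 else 1)" "x mod n = (if x < n then x else x - n)" if "x < 2 * n" for x
  proof -
    have "x = n + (x - n)" "x - n < n" if "\<not> x < n" using \<open>x < 2 * n\<close> that by auto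
    thus "x div n = (if x < n then 0 else 1)" "x mod n = (if x < n then x else x - n)"
      by (cases "x < n"; simp add: div_if mod_if)+
  qed
  show "kronecker (jordan_block 2 1) B $$ (i, j) = four_block_mat B B (0\<^sub>m n n) B $$ (i, j)"
    unfolding kronecker_index[OF J B ij] using ij B by (auto simp: dm)
qed (use B in \<open>auto simp: kronecker_def\<close>)

context modular_cyclic
begin

lemma rep_tensor_cyc:
  assumes V: "V \<in> reps G" and W: "W \<in> reps G"
  shows "rep_tensor G V W = cyc (kronecker (gen V) (gen W))" "rep_tensor G V W \<in> reps G"
    "fst (rep_tensor G V W) = fst V * fst W" "gen (rep_tensor G V W) = kronecker (gen V) (gen W)"
proof -
  note v = reps_gen[OF V] and w = reps_gen[OF W]
  note kc = kronecker_carrier[OF v(1) w(1)]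
  have kp: "kronecker (gen V) (gen W) ^\<^sub>m p = 1\<^sub>m (fst V * fst W)"
    unfolding kronecker_pow[OF v(1) w(1)] v(2) w(2) by (rule kronecker_one)
  have "kronecker (snd V g) (snd W g) = kronecker (gen V) (gen W) ^\<^sub>m nat g" if "g \<in> carrier G" for g
    using v(4)[of "nat g"] w(4)[of "nat g"] that kronecker_pow[OF v(1) w(1)] by (auto simp: carrier_G nat_less_iff)
  thus eq: "rep_tensor G V W = cyc (kronecker (gen V) (gen W))"
    unfolding rep_tensor_def cyc_def using kc by auto
  show "rep_tensor G V W \<in> reps G" "fst (rep_tensor G V W) = fst V * fst W" 
    "gen (rep_tensor G V W) = kronecker (gen V) (gen W)"
    unfolding eq using cyc_reps[OF kc kp] by auto
qed

lemma rep_tensor_assoc: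
  fixes U V W :: "(int, 'k) rep"
  assumes U: "U \<in> reps G" and V: "V \<in> reps G" and W: "W \<in> reps G"
  shows "rep_tensor G (rep_tensor G U V) W = rep_tensor G U (rep_tensor G V W)"
  unfolding rep_tensor_cyc(1)[OF rep_tensor_cyc(2)[OF U V] W] rep_tensor_cyc(1)[OF U rep_tensor_cyc(2)[OF V W]]
    rep_tensor_cyc(4)[OF U V] rep_tensor_cyc(4)[OF V W]
  by (simp add: kronecker_assoc[OF reps_gen(1)[OF U] reps_gen(1)[OF V] reps_gen(1)[OF W]])

lemma rep_tensor_J_1:
  assumes V: "V \<in> reps G"
  shows "rep_tensor G (J 1) V = V"
proof -
  have J1: "J 1 \<in> reps G" "gen (J 1) = jordan_block 1 1" using J_reps[of 1] p_gt_2 by auto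
  have "kronecker (jordan_block 1 (1::'k)) (gen V) = gen V"
    using reps_gen(1)[OF V] by (intro eq_matI) (auto simp: kronecker_def)
  thus ?thesis using rep_tensor_cyc(1)[OF J1(1) V] J1(2) reps_gen(3)[OF V] by simp
qed

lemma rep_arrs_tensor:
  fixes M N :: "'k mat"
  assumes M: "(V, V', M) \<in> rep_arrs G" and N: "(W, W', N) \<in> rep_arrs G"
  shows "(rep_tensor G V W, rep_tensor G V' W', kronecker M N) \<in> rep_arrs G"
proof -
  have r: "V \<in> reps G" "V' \<in> reps G" "M \<in> carrier_mat (fst V') (fst V)" "M * gen V = gen V' * M"
    "W \<in> reps G" "W' \<in> reps G" "N \<in> carrier_mat (fst W') (fst W)" "N * gen W = gen W' * N"
    using M N by (auto simp: rep_arrs_gen)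
  have "kronecker M N * kronecker (gen V) (gen W) = kronecker (gen V') (gen W') * kronecker M N"
    unfolding kronecker_mult[OF r(3) reps_gen(1)[OF r(1)] r(7) reps_gen(1)[OF r(5)]]
      kronecker_mult[OF reps_gen(1)[OF r(2)] r(3) reps_gen(1)[OF r(6)] r(7)] using r by simp
  thus ?thesis using r rep_tensor_cyc kronecker_carrier[OF r(3,7)] by (simp add: rep_arrs_gen)
qed

lemma linear_functor_tensor_right:
  assumes W: "W \<in> reps G"
  shows "linear_functor RepP RepP (\<lambda>V. rep_tensor G V W) 
    (\<lambda>(V, V', M). (rep_tensor G V W, rep_tensor G V' W, kronecker M (1\<^sub>m (fst W))))"
proof -
  let ?F = "\<lambda>(V, V', M). (rep_tensor G V W, rep_tensor G V' W, kronecker M (1\<^sub>m (fst W)))"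
  have 1: "1\<^sub>m (fst W) * 1\<^sub>m (fst W) = (1\<^sub>m (fst W) :: 'k mat)" "(1\<^sub>m (fst W) :: 'k mat) \<in> carrier_mat (fst W) (fst W)" by auto
  show ?thesis
  proof
    fix f g x y z assume "f \<in> Hom RepP x y" "g \<in> Hom RepP y z"
    then obtain A B where e: "f = (x, y, A)" "(x, y, A) \<in> rep_arrs G" "g = (y, z, B)" "(y, z, B) \<in> rep_arrs G" 
      by (auto simp: Hom_Rep)
    show "?F (cmp RepP g f) =
       cmp RepP (?F g)
         (?F f)"
      using kronecker_mult[OF rep_arrs_carrier[OF e(4)] rep_arrs_carrier[OF e(2)] 1(2) 1(2)] e 1 by simp
  next
    fix f g x y assume "f \<in> Hom RepP x y" "g \<in> Hom RepP x y"
    then obtain A B where e: "f = (x, y, A)" "(x, y, A) \<in> rep_arrs G" "g = (x, y, B)" "(x, y, B) \<in> rep_arrs G" 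
      by (auto simp: Hom_Rep)
    show "?F (plu RepP f g) =
       plu RepP (?F f)
         (?F g)"
      using kronecker_add_left[OF rep_arrs_carrier[OF e(2)] rep_arrs_carrier[OF e(4)] 1(2)] e by simp
  next
    fix f c x y assume "f \<in> Hom RepP x y"
    then obtain A where e: "f = (x, y, A)" "(x, y, A) \<in> rep_arrs G" by (auto simp: Hom_Rep)
    show "?F (scl RepP c f) =
       scl RepP c (?F f)"
      using kronecker_smult(1)[OF rep_arrs_carrier[OF e(2)] 1(2)] e by simp
  qed (use W rep_tensor_cyc rep_arrs_tensor[OF _ rep_arrs_one[OF W]] in \<open>auto simp: Hom_Rep kronecker_one\<close>)
qed

lemma linear_functor_tensor_left:
  assumes W: "W \<in> reps G"
  shows "linear_functor RepP RepP (\<lambda>V. rep_tensor G W V) 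
    (\<lambda>(V, V', M). (rep_tensor G W V, rep_tensor G W V', kronecker (1\<^sub>m (fst W)) M))"
proof -
  let ?F = "\<lambda>(V, V', M). (rep_tensor G W V, rep_tensor G W V', kronecker (1\<^sub>m (fst W)) M)"
  have 1: "1\<^sub>m (fst W) * 1\<^sub>m (fst W) = (1\<^sub>m (fst W) :: 'k mat)" "(1\<^sub>m (fst W) :: 'k mat) \<in> carrier_mat (fst W) (fst W)" by auto
  show ?thesis
  proof
    fix f g x y z assume "f \<in> Hom RepP x y" "g \<in> Hom RepP y z"
    then obtain A B where e: "f = (x, y, A)" "(x, y, A) \<in> rep_arrs G" "g = (y, z, B)" "(y, z, B) \<in> rep_arrs G" 
      by (auto simp: Hom_Rep)
    show "?F (cmp RepP g f) =
       cmp RepP (?F g)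
         (?F f)"
      using kronecker_mult[OF 1(2) 1(2) rep_arrs_carrier[OF e(4)] rep_arrs_carrier[OF e(2)]] e 1 by simp
  next
    fix f g x y assume "f \<in> Hom RepP x y" "g \<in> Hom RepP x y"
    then obtain A B where e: "f = (x, y, A)" "(x, y, A) \<in> rep_arrs G" "g = (x, y, B)" "(x, y, B) \<in> rep_arrs G" 
      by (auto simp: Hom_Rep)
    show "?F (plu RepP f g) =
       plu RepP (?F f)
         (?F g)"
      using kronecker_add_right[OF 1(2) rep_arrs_carrier[OF e(2)] rep_arrs_carrier[OF e(4)]] e by simp
  next
    fix f c x y assume "f \<in> Hom RepP x y"
    then obtain A where e: "f = (x, y, A)" "(x, y, A) \<in> rep_arrs G" by (auto simp: Hom_Rep)
    show "?F (scl RepP c f) =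
       scl RepP c (?F f)"
      using kronecker_smult(2)[OF 1(2) rep_arrs_carrier[OF e(2)]] e by simp
  qed (use W rep_tensor_cyc rep_arrs_tensor[OF rep_arrs_one[OF W]] in \<open>auto simp: Hom_Rep kronecker_one\<close>)
qed

lemma tensor_sum_left:
  "W \<in> reps G \<Longrightarrow> is_direct_sum RepP V xs \<Longrightarrow> is_direct_sum RepP (rep_tensor G W V) (map (rep_tensor G W) xs)"
  by (rule linear_functor.is_direct_sum_map[OF linear_functor_tensor_left])

lemma tensor_sum_right:
  "W \<in> reps G \<Longrightarrow> is_direct_sum RepP V xs \<Longrightarrow> is_direct_sum RepP (rep_tensor G V W) (map (\<lambda>x. rep_tensor G x W) xs)"
  by (rule linear_functor.is_direct_sum_map[OF linear_functor_tensor_right])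

lemma jordan_block_minus_one: "jordan_block n (1::'k) = jordan_block n 0 + 1\<^sub>m n"
  by (intro eq_matI) auto

text \<open>The block matrix is \<open>A - 1\<close>, where \<open>A\<close> is the matrix of the generator on \<open>J 2 \<otimes> J r\<close>.  Its powers show the
  nilpotency index of the tensor product: the upper right block of the \<open>r\<close>-th power is \<open>r N\<^bsup>r-1\<^esup> B\<close>, which is nonzero
  exactly when \<open>p\<close> does not divide \<open>r\<close>.\<close>

lemma J2_nilpotent_pow:
  fixes r :: nat
  defines "N \<equiv> jordan_block r (0::'k)" and "B \<equiv> jordan_block r (1::'k)"
  shows "four_block_mat N B (0\<^sub>m r r) N ^\<^sub>m Suc k =
    four_block_mat (N ^\<^sub>m Suc k) (of_nat (Suc k) \<cdot>\<^sub>m (N ^\<^sub>m k * B)) (0\<^sub>m r r) (N ^\<^sub>m Suc k)"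
proof -
  have c: "N \<in> carrier_mat r r" "B \<in> carrier_mat r r" by (auto simp: N_def B_def)
  note Nc = pow_carrier_mat[OF c(1)]
  have comm: "N * B = B * N"
    unfolding B_def N_def jordan_block_minus_one
    by (simp add: mult_add_distrib_mat[of _ r r _ r] add_mult_distrib_mat[of _ r r _ _ r])
  show ?thesis
  proof (induction k)
    case 0
    have "1 \<cdot>\<^sub>m B = B" by (intro eq_matI) auto
    thus ?case using c by simp
  next
    case (Suc k)
    let ?P = "of_nat (Suc k) \<cdot>\<^sub>m (N ^\<^sub>m k * B)"
    have P: "?P \<in> carrier_mat r r" using c Nc by auto
    have Z: "(0\<^sub>m r r :: 'k mat) \<in> carrier_mat r r" by simp
    have "?P * N = of_nat (Suc k) \<cdot>\<^sub>m (N ^\<^sub>m k * B * N)"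
      using c Nc by (intro mult_smult_assoc_mat) auto
    also have "N ^\<^sub>m k * B * N = N ^\<^sub>m k * (N * B)"
      unfolding comm using c Nc by (intro assoc_mult_mat) auto
    also have "\<dots> = N ^\<^sub>m Suc k * B" using assoc_mult_mat[OF Nc c(1) c(2)] by simp
    finally have PN: "?P * N = of_nat (Suc k) \<cdot>\<^sub>m (N ^\<^sub>m Suc k * B)" .
    have "four_block_mat N B (0\<^sub>m r r) N ^\<^sub>m Suc (Suc k) =
      four_block_mat (N ^\<^sub>m Suc k) ?P (0\<^sub>m r r) (N ^\<^sub>m Suc k) * four_block_mat N B (0\<^sub>m r r) N"
      unfolding Suc.IH[symmetric] by simp
    also have "\<dots> = four_block_mat (N ^\<^sub>m Suc k * N + ?P * 0\<^sub>m r r) (N ^\<^sub>m Suc k * B + ?P * N)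
        (0\<^sub>m r r * N + N ^\<^sub>m Suc k * 0\<^sub>m r r) (0\<^sub>m r r * B + N ^\<^sub>m Suc k * N)"
      by (rule mult_four_block_mat[OF Nc P Z Nc c Z c(1)])
    also have "\<dots> = four_block_mat (N ^\<^sub>m Suc (Suc k)) (of_nat (Suc (Suc k)) \<cdot>\<^sub>m (N ^\<^sub>m Suc k * B)) (0\<^sub>m r r) (N ^\<^sub>m Suc (Suc k))"
    proof (rule cong_four_block_mat)
      show "N ^\<^sub>m Suc k * N + ?P * 0\<^sub>m r r = N ^\<^sub>m Suc (Suc k)" 
        using right_mult_zero_mat[OF P] right_add_zero_mat[OF Nc[of "Suc (Suc k)"]] by simp
      show "0\<^sub>m r r * N + N ^\<^sub>m Suc k * 0\<^sub>m r r = 0\<^sub>m r r" 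
        using right_mult_zero_mat[OF Nc[of "Suc k"]] left_mult_zero_mat[OF c(1)] by simp
      show "0\<^sub>m r r * B + N ^\<^sub>m Suc k * N = N ^\<^sub>m Suc (Suc k)" 
        using left_mult_zero_mat[OF c(2)] left_add_zero_mat[OF Nc[of "Suc (Suc k)"]] by simp
      show "N ^\<^sub>m Suc k * B + ?P * N = of_nat (Suc (Suc k)) \<cdot>\<^sub>m (N ^\<^sub>m Suc k * B)"
        unfolding PN using c Nc[of "Suc k"] by (intro eq_matI) (auto simp: algebra_simps)
    qed
    finally show ?case .
  qed
qed

lemma jordan_block_0_pow_eq_0: "n \<le> k \<Longrightarrow> jordan_block n (0::'k) ^\<^sub>m k = 0\<^sub>m n n"
  unfolding jordan_block_zero_pow by (intro eq_matI) auto

lemma jordan_block_0_pow_nonzero: 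
  assumes "k < n" shows "jordan_block n (0::'k) ^\<^sub>m k \<noteq> 0\<^sub>m n n"
proof
  assume "jordan_block n (0::'k) ^\<^sub>m k = 0\<^sub>m n n"
  from arg_cong[OF this, of "\<lambda>M. M $$ (0, k)"] show False using assms unfolding jordan_block_zero_pow by simp
qed

lemma arrow_nilpotent_pow:
  assumes n: "n \<le> p" and M: "(J n, V, M) \<in> rep_arrs G" and X: "X \<in> carrier_mat (fst V) (fst V)" "gen V = X + 1\<^sub>m (fst V)"
  shows "X ^\<^sub>m k * M = M * jordan_block n 0 ^\<^sub>m k"
proof -
  let ?N = "jordan_block n (0::'k)"
  have Mc: "M \<in> carrier_mat (fst V) n" and eq: "M * jordan_block n 1 = gen V * M"
    using M J_reps[OF n] by (auto simp: rep_arrs_gen)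
  have N: "?N \<in> carrier_mat n n" by simp
  have eqM: "M * ?N + M = X * M + M"
    using eq unfolding X(2) jordan_block_minus_one mult_add_distrib_mat[OF Mc N one_carrier_mat] 
      add_mult_distrib_mat[OF X(1) one_carrier_mat Mc] using Mc by simp
  have cancel: "A = B" if "A + M = B + M" "A \<in> carrier_mat (fst V) n" "B \<in> carrier_mat (fst V) n" for A B :: "'k mat"
  proof (rule eq_matI)
    fix i j assume "i < dim_row B" "j < dim_col B"
    thus "A $$ (i, j) = B $$ (i, j)" using arg_cong[OF that(1), of "\<lambda>Y. Y $$ (i, j)"] that(2,3) Mc by simp
  qed (use that(2,3) in auto)
  have e: "M * ?N = X * M" using Mc N X(1) by (intro cancel[OF eqM]) auto
  show ?thesis
  proof (induction k)
    case 0
    show ?case using Mc X(1) by simp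
  next
    case (Suc k)
    have "X ^\<^sub>m Suc k * M = X ^\<^sub>m k * (X * M)" 
      using assoc_mult_mat[OF pow_carrier_mat[OF X(1)] X(1) Mc] by simp
    also have "\<dots> = X ^\<^sub>m k * M * ?N" unfolding e[symmetric] 
      using assoc_mult_mat[OF pow_carrier_mat[OF X(1)] Mc N] by simp
    also have "\<dots> = M * ?N ^\<^sub>m k * ?N" unfolding Suc.IH ..
    also have "\<dots> = M * ?N ^\<^sub>m Suc k" using assoc_mult_mat[OF Mc pow_carrier_mat[OF N] N] by simp
    finally show ?case .
  qed
qed

text \<open>Both directions transport the power of (generator minus one) through the injections of the blocks.\<close>

lemma block_sizes_of_nilpotency:
  assumes ds: "is_direct_sum RepP V (map J ns)" and ns: "set ns \<subseteq> {1..p}"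
    and X: "X \<in> carrier_mat (fst V) (fst V)" "gen V = X + 1\<^sub>m (fst V)"
  shows "X ^\<^sub>m k = 0\<^sub>m (fst V) (fst V) \<longleftrightarrow> (\<forall>n\<in>set ns. n \<le> k)"
proof
  obtain I P where b: "R.biproduct V (map J ns) I P" using ds R.is_direct_sum_iff_biproduct by blast
  note B = R.biproductD[OF b]
  have nsp: "ns ! a \<le> p" "ns ! a > 0" if "a < length ns" for a using nth_mem[OF that] ns by auto
  define Im where "Im a = snd (snd (I a))" for a
  define Pm where "Pm a = snd (snd (P a))" for a
  have I: "I a = (J (ns ! a), V, Im a)" "(J (ns ! a), V, Im a) \<in> rep_arrs G" 
    and P: "P a = (V, J (ns ! a), Pm a)" "(V, J (ns ! a), Pm a) \<in> rep_arrs G" if "a < length ns" for a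
    using B(4,5)[of a] that by (auto simp: Hom_Rep Im_def Pm_def)
  have Ic: "Im a \<in> carrier_mat (fst V) (ns ! a)" and Pc: "Pm a \<in> carrier_mat (ns ! a) (fst V)" if "a < length ns" for a
    using I(2)[OF that] P(2)[OF that] J_reps[OF nsp(1)[OF that]] by (auto simp: rep_arrs_gen)
  have V: "V \<in> reps G" using B(1) by simp
  note Xk = pow_carrier_mat[OF X(1), of k]
  note arr = arrow_nilpotent_pow[OF nsp(1) I(2) X, of _ k]
  {
    assume X0: "X ^\<^sub>m k = 0\<^sub>m (fst V) (fst V)"
    show "\<forall>n\<in>set ns. n \<le> k"
    proof (rule ccontr)
      assume "\<not> (\<forall>n\<in>set ns. n \<le> k)"
      then obtain a where a: "a < length ns" "k < ns ! a" by (metis in_set_conv_nth not_le)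
      let ?N = "jordan_block (ns ! a) (0::'k)"
      have N: "?N ^\<^sub>m k \<in> carrier_mat (ns ! a) (ns ! a)" by simp
      have PI: "Pm a * Im a = 1\<^sub>m (ns ! a)"
        using B(6)[of a] a I(1) P(1) J_reps[OF nsp(1)[OF a(1)]] by auto
      have "?N ^\<^sub>m k = Pm a * Im a * ?N ^\<^sub>m k" unfolding PI using left_mult_one_mat[OF N] by simp
      also have "\<dots> = Pm a * (Im a * ?N ^\<^sub>m k)" by (rule assoc_mult_mat[OF Pc[OF a(1)] Ic[OF a(1)] N])
      also have "Im a * ?N ^\<^sub>m k = X ^\<^sub>m k * Im a" using arr[OF a(1) a(1)] by simp
      also have "\<dots> = 0\<^sub>m (fst V) (ns ! a)" unfolding X0 using left_mult_zero_mat[OF Ic[OF a(1)]] by simp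
      also have "Pm a * \<dots> = 0\<^sub>m (ns ! a) (ns ! a)" using right_mult_zero_mat[OF Pc[OF a(1)]] by simp
      finally show False using jordan_block_0_pow_nonzero[OF a(2)] by simp
    qed
  next
    assume le: "\<forall>n\<in>set ns. n \<le> k"
    have XV: "X * gen V = gen V * X"
      unfolding X(2) mult_add_distrib_mat[OF X(1) X(1) one_carrier_mat] add_mult_distrib_mat[OF X(1) one_carrier_mat X(1)]
      using X(1) by simp
    have "(V, V, X) \<in> rep_arrs G" using V X(1) XV by (simp add: rep_arrs_gen)
    hence "(V, V, X ^\<^sub>m k) \<in> rep_arrs G"
    proof (induction k)
      case 0
      thus ?case using rep_arrs_one[OF V] X(1) by simp
    next
      case (Suc k)
      thus ?case using rep_arrs_cmp[of V V X G V "X ^\<^sub>m k"] by simp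
    qed
    hence h: "(V, V, X ^\<^sub>m k) \<in> Hom RepP V V" by (simp add: Hom_Rep)
    have z: "cmp RepP (V, V, X ^\<^sub>m k) (I a) = nul RepP (J (ns ! a)) V" if a: "a < length ns" for a
    proof -
      have "X ^\<^sub>m k * Im a = Im a * 0\<^sub>m (ns ! a) (ns ! a)"
        unfolding arr[OF a a] using jordan_block_0_pow_eq_0[of "ns ! a" k] le a by simp
      also have "\<dots> = 0\<^sub>m (fst V) (ns ! a)" using right_mult_zero_mat[OF Ic[OF a]] by simp
      finally show ?thesis unfolding I(1)[OF a] using J_reps[OF nsp(1)[OF a]] by simp
    qed
    have "(V, V, X ^\<^sub>m k) = cmp RepP (V, V, X ^\<^sub>m k) (idt RepP V)" using R.cmp_idt[OF h] by simp
    also have "\<dots> = R.hsum V V (\<lambda>a. cmp RepP (V, V, X ^\<^sub>m k) (cmp RepP (I a) (P a))) {..<length (map J ns)}"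
      unfolding B(8)[symmetric] using R.cmp_hom[OF B(5) B(4)] by (intro R.cmp_hsum[OF h B(1)]) auto
    also have "\<dots> = nul RepP V V"
    proof (rule R.hsum_nul[OF B(1) B(1)])
      fix a assume "a \<in> {..<length (map J ns)}"
      hence a: "a < length ns" "a < length (map J ns)" by auto
      show "cmp RepP (V, V, X ^\<^sub>m k) (cmp RepP (I a) (P a)) = nul RepP V V"
        using R.cmp_assoc[OF B(5)[OF a(2)] B(4)[OF a(2)] h] z[OF a(1)] R.nul_cmp[OF B(5)[OF a(2)] B(1)] a by simp
    qed
    finally show "X ^\<^sub>m k = 0\<^sub>m (fst V) (fst V)" by simp
  }
qed

text \<open>The Clebsch-Gordan rule \<open>J 2 \<otimes> J r = J (r + 1) \<oplus> J (r - 1)\<close> for \<open>r < p\<close>, which becomes \<open>J p \<oplus> J p\<close> for \<open>r = p\<close>.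
  The block sizes are pinned down without exhibiting an isomorphism: they sum to \<open>2 r\<close>, there are at most two of them
  because the fixed space is at most two-dimensional, all are at most \<open>r + 1\<close> and at most \<open>p\<close>, and for \<open>r < p\<close> one of
  them exceeds \<open>r\<close> by the nilpotency index.\<close>

lemma J2_tensor_J:
  assumes r: "r \<in> {1..p}"
  shows "\<exists>ns. is_direct_sum RepP (rep_tensor G (J 2) (J r)) (map J ns) \<and>
    (r = p \<longrightarrow> ns = [p, p]) \<and> (r < p \<longrightarrow> r \<ge> 2 \<longrightarrow> mset ns = {#r + 1, r - 1#}) \<and> (r = 1 \<longrightarrow> ns = [2])"
proof -
  let ?V = "rep_tensor G (J 2) (J r)"
  have rp: "r \<le> p" "r > 0" "2 \<le> p" using r p_gt_2 by auto
  note Jr = J_reps[OF rp(1)] and J2 = J_reps[OF rp(3)]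
  note V = rep_tensor_cyc[OF J2(1) Jr(1)]
  define B where "B = jordan_block r (1::'k)"
  define N where "N = jordan_block r (0::'k)"
  have c: "B \<in> carrier_mat r r" "N \<in> carrier_mat r r" by (auto simp: B_def N_def)
  have dV: "fst ?V = 2 * r" using V(3) Jr(2) J2(2) by simp
  have gV: "gen ?V = four_block_mat B B (0\<^sub>m r r) B"
    using V(4) Jr(3) J2(3) kronecker_jordan_block_2[OF c(1)] by (simp add: B_def)
  define X where "X = four_block_mat N B (0\<^sub>m r r) N"
  have X: "X \<in> carrier_mat (fst ?V) (fst ?V)" using c unfolding dV X_def by (auto simp: mult_2)
  have gX: "gen ?V = X + 1\<^sub>m (fst ?V)"
    unfolding gV dV using c by (intro eq_matI) (auto simp: X_def B_def N_def mult_2)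
  obtain ns where ns: "set ns \<subseteq> {1..p}" "sum_list ns = fst ?V" "is_direct_sum RepP ?V (map J ns)" 
    by (rule jordan_decomposition[OF V(2)])
  have Nr: "N ^\<^sub>m r = 0\<^sub>m r r" "N ^\<^sub>m Suc r = 0\<^sub>m r r" unfolding N_def by (rule jordan_block_0_pow_eq_0; simp)+
  have "X ^\<^sub>m Suc r = four_block_mat (0\<^sub>m r r) (of_nat (Suc r) \<cdot>\<^sub>m (N ^\<^sub>m r * B)) (0\<^sub>m r r) (0\<^sub>m r r)"
    unfolding X_def N_def B_def J2_nilpotent_pow Nr(2)[unfolded N_def] ..
  also have "\<dots> = 0\<^sub>m (fst ?V) (fst ?V)"
    unfolding Nr(1) dV using left_mult_zero_mat[OF c(1)] by (intro eq_matI) auto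
  finally have le: "\<forall>n\<in>set ns. n \<le> Suc r" using block_sizes_of_nilpotency[OF ns(3,1) X gX, of "Suc r"] by (rule_tac iffD1)
  have ex: "\<exists>n\<in>set ns. n > r" if "r < p"
  proof -
    have "X ^\<^sub>m r \<noteq> 0\<^sub>m (fst ?V) (fst ?V)"
    proof
      assume X0: "X ^\<^sub>m r = 0\<^sub>m (fst ?V) (fst ?V)"
      have sr: "Suc (r - 1) = r" using rp by simp
      have "X ^\<^sub>m r = four_block_mat (N ^\<^sub>m r) (of_nat r \<cdot>\<^sub>m (N ^\<^sub>m (r - 1) * B)) (0\<^sub>m r r) (N ^\<^sub>m r)"
        using J2_nilpotent_pow[of r "r - 1"] unfolding sr by (simp add: X_def N_def B_def)
      \<comment> \<open>the top right entry of the matrix, which is \<open>r\<close>\<close>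
      hence "(X ^\<^sub>m r) $$ (0, r + (r - 1)) = of_nat r * (N ^\<^sub>m (r - 1) * B) $$ (0, r - 1)"
        using c rp less_le_not_le[of "r + r - Suc 0" r] by auto
      also have "(N ^\<^sub>m (r - 1) * B) $$ (0, r - 1) = (\<Sum>l<r. (N ^\<^sub>m (r - 1)) $$ (0, l) * B $$ (l, r - 1))"
        using c rp pow_carrier_mat[OF c(2), of "r - 1"] by (simp add: scalar_prod_def atLeast0LessThan)
      also have "\<dots> = (\<Sum>l<r. if l = r - 1 then B $$ (l, r - 1) else 0)"
        unfolding N_def jordan_block_zero_pow using rp by (intro sum.cong) auto
      also have "\<dots> = 1" using rp by (simp add: B_def)
      finally have "(of_nat r :: 'k) = 0" using X0 dV rp by simp
      thus False using of_nat_eq_0_iff_p[of r] rp that by (auto dest: dvd_imp_le)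
    qed
    thus ?thesis using block_sizes_of_nilpotency[OF ns(3,1) X gX] by (metis not_le)
  qed
  \<comment> \<open>a fixed vector vanishes except at \<open>0\<close>, \<open>1\<close> and \<open>r\<close>, and \<open>w\<^sub>1 = - w\<^sub>r\<close>, so its coordinates at \<open>0 * r\<close> and
    \<open>1 * r\<close> determine it\<close>
  have len: "length ns \<le> card {0, 1::nat}"
  proof (rule blocks_le_dim_kernel[OF V(2) ns(1,3), where \<phi> = "\<lambda>t. t * r" and 
        \<beta> = "\<lambda>t i. if t = 0 then (if i = 0 then 1 else 0) else (if i = r then 1 else if i = 1 then -1 else 0)"])
    show "t * r < fst ?V" if "t \<in> {0, 1}" for t using that rp dV by auto
    fix w i assume w: "w \<in> carrier_vec (fst ?V)" "gen ?V *\<^sub>v w = w" and i: "i < fst ?V"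
    have w0: "w \<in> carrier_vec (r + r)" using w(1) dV by (simp add: mult_2)
    have split: "(\<Sum>l<r + r. f l) = (\<Sum>l<r. f l) + (\<Sum>l<r. f (r + l))" for f :: "nat \<Rightarrow> 'k"
      by (simp add: sum.nat_group sum.atLeastLessThan_concat[of 0 r "r + r" f, symmetric] lessThan_atLeast0
        sum.shift_bounds_nat_ivl[of f 0 r r, simplified] add.commute)
    have row: "(\<Sum>l<r. gen ?V $$ (a, l) * w $ l) + (\<Sum>l<r. gen ?V $$ (a, r + l) * w $ (r + l)) = w $ a" if "a < r + r" for a
    proof -
      have "(gen ?V *\<^sub>v w) $ a = (\<Sum>l<r + r. gen ?V $$ (a, l) * w $ l)"
        using that w0 c unfolding gV by (simp add: scalar_prod_def atLeast0LessThan)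
      thus ?thesis unfolding split w(2) by simp
    qed
    \<comment> \<open>row \<open>r + j\<close> of \<open>gen V w = w\<close>\<close>
    have low: "w $ (r + Suc j) = 0" if "Suc j < r" for j
    proof -
      have "(\<Sum>l<r. gen ?V $$ (r + j, l) * w $ l) = 0" unfolding gV using c that by (intro sum.neutral) auto
      moreover have "(\<Sum>l<r. gen ?V $$ (r + j, r + l) * w $ (r + l)) = (\<Sum>l<r. B $$ (j, l) * w $ (r + l))"
        unfolding gV using c that by (intro sum.cong) auto
      moreover have "\<dots> = w $ (r + j) + w $ (r + Suc j)"
        unfolding B_def using that jordan_block_row_sum[of j r 1 "\<lambda>l. w $ (r + l)"] by simp
      ultimately show ?thesis using row[of "r + j"] that by simp
    qed
    \<comment> \<open>row \<open>j\<close> of \<open>gen V w = w\<close>\<close>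
    have up: "w $ Suc j + w $ (r + j) + w $ (r + Suc j) = 0" if "Suc j < r" for j
    proof -
      have "(\<Sum>l<r. gen ?V $$ (j, l) * w $ l) = (\<Sum>l<r. B $$ (j, l) * w $ l)"
        unfolding gV using c that by (intro sum.cong) auto
      moreover have "(\<Sum>l<r. gen ?V $$ (j, r + l) * w $ (r + l)) = (\<Sum>l<r. B $$ (j, l) * w $ (r + l))"
        unfolding gV using c that by (intro sum.cong) auto
      moreover have "(\<Sum>l<r. B $$ (j, l) * w $ (r + l)) = w $ (r + j) + w $ (r + Suc j)"
        unfolding B_def using that jordan_block_row_sum[of j r 1 "\<lambda>l. w $ (r + l)"] by simp
      moreover have "(\<Sum>l<r. B $$ (j, l) * w $ l) = w $ j + w $ Suc j"
        unfolding B_def using that jordan_block_row_sum[of j r 1 "\<lambda>l. w $ l"] by simp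
      ultimately show ?thesis using row[of j] that by (simp add: add.assoc)
    qed
    have "w $ i = (if i = 0 then w $ 0 else if i = r then w $ r else if i = 1 then - w $ r else 0)"
    proof -
      consider "i = 0" | "i = r" | "i > r" | "i = 1" "i < r" | "i \<ge> 2" "i < r" by linarith
      thus ?thesis
      proof cases
        case 3
        hence "i = r + Suc (i - r - 1)" "Suc (i - r - 1) < r" using i dV by auto
        thus ?thesis using low[of "i - r - 1"] rp 3 by auto
      next
        case 4
        thus ?thesis using up[of 0] low[of 0] by (simp add: eq_neg_iff_add_eq_0)
      next
        case 5
        define j where "j = i - 2"
        have "i = Suc (Suc j)" using 5 by (simp add: j_def)
        thus ?thesis using up[of "Suc j"] low[of "Suc j"] low[of j] 5 by simp
      qed (use rp in auto)
    qed
    thus "w $ i = (\<Sum>t\<in>{0, 1}. w $ (t * r) * (if t = 0 then (if i = 0 then 1 else 0) else (if i = r then 1 else if i = 1 then -1 else 0)))"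
      using rp by auto
  qed simp
  hence len2: "length ns \<le> 2" by simp
  have sum: "sum_list ns = 2 * r" using ns(2) dV by simp
  consider "ns = []" | a where "ns = [a]" | a b where "ns = [a, b]"
    using len2 by (cases ns rule: remdups_adj.cases) auto
  note shape = this
  have "ns = [p, p]" if "r = p"
    using shape
  proof cases
    case (3 a b)
    have "a \<le> p" "b \<le> p" "a + b = 2 * p" using ns(1) sum that 3 by auto
    thus ?thesis using 3 by simp
  qed (use sum ns(1) that rp in auto)
  moreover have "mset ns = {#r + 1, r - 1#}" if "r < p" "r \<ge> 2"
  proof -
    from ex[OF that(1)] obtain n where n: "n \<in> set ns" "n > r" by blast
    hence n1: "n = r + 1" using le by force
    show ?thesis using shape
    proof cases
      case (3 a b)
      have "a + b = 2 * r" "a = r + 1 \<or> b = r + 1" using sum n(1) n1 3 by auto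
      hence "(a = r + 1 \<and> b = r - 1) \<or> (b = r + 1 \<and> a = r - 1)" by auto
      thus ?thesis using 3 by (auto simp: add_mset_commute)
    qed (use sum n n1 that in auto)
  qed
  moreover have "ns = [2]" if "r = 1"
  proof -
    have "r < p" using that p_gt_2 by simp
    from ex[OF this] obtain n where n: "n \<in> set ns" "n > r" by blast
    hence n2: "n = 2" using le that by force
    show ?thesis using shape
    proof cases
      case (3 a b)
      have "a + b = 2" "a = 2 \<or> b = 2" "a > 0" "b > 0" using sum n(1) n2 3 that ns(1) by auto
      thus ?thesis by simp
    qed (use sum n n2 that in auto)
  qed
  ultimately show ?thesis using ns(3) by blast
qed

text \<open>Reduces to blocks by additivity; there it is the recursion \<open>[2] [r] = [r + 1] + [r - 1]\<close>, and \<open>[p] = 0\<close> for \<open>r = p\<close>.\<close>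

lemma qdim_J2_tensor:
  assumes M: "M \<in> reps G"
  shows "qdim (rep_tensor G (J 2) M) = qnum 2 * qdim M"
proof -
  have J2: "J 2 \<in> reps G" using J_reps(1)[of 2] p_gt_2 by simp
  have J: "qdim (rep_tensor G (J 2) (J r)) = qnum 2 * qnum r" if r: "r \<in> {1..p}" for r
  proof -
    obtain ns where ns: "is_direct_sum RepP (rep_tensor G (J 2) (J r)) (map J ns)"
      "r = p \<Longrightarrow> ns = [p, p]" "r < p \<Longrightarrow> r \<ge> 2 \<Longrightarrow> mset ns = {#r + 1, r - 1#}" "r = 1 \<Longrightarrow> ns = [2]"
      using J2_tensor_J[OF r] by blast
    have V: "is_direct_sum VerP (rep_tensor G (J 2) (J r)) (map J ns)" using F.is_direct_sum_map[OF ns(1)] by simp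
    consider "r = p" | "r < p" "r \<ge> 2" | "r = 1" using r by fastforce
    thus ?thesis
    proof cases
      case 1
      thus ?thesis using qdim_sum[OF V] ns(2) by (simp add: qnum_p)
    next
      case 2
      have sns: "set ns = {r + 1, r - 1}" using ns(3)[OF 2] by (metis set_mset_mset set_mset_add_mset_insert set_mset_empty)
      have "qdim (rep_tensor G (J 2) (J r)) = sum_list (map qnum ns)" using 2 sns by (intro qdim_sum[OF V]) auto
      also have "\<dots> = sum_mset (image_mset qnum (mset ns))" by (simp add: sum_mset_sum_list[symmetric])
      also have "\<dots> = qnum (r + 1) + qnum (r - 1)" using ns(3)[OF 2] by simp
      finally show ?thesis using qnum_rec[of r] 2 by simp
    next
      case 3
      thus ?thesis using qdim_sum[OF V] ns(4) p_gt_2 qnum_1 by simp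
    qed
  qed
  obtain ns where ns: "set ns \<subseteq> {1..p}" "is_direct_sum RepP M (map J ns)" 
    by (rule jordan_decomposition[OF M])
  have "qdim (rep_tensor G (J 2) M) = sum_list (map (\<lambda>n. qdim (rep_tensor G (J 2) (J n))) ns)"
    using qdim_add_Rep[OF tensor_sum_left[OF J2 ns(2)]] by (simp add: o_def)
  also have "\<dots> = sum_list (map (\<lambda>n. qnum 2 * qnum n) ns)"
    using J ns(1) by (intro arg_cong[of _ _ sum_list] map_cong) auto
  also have "\<dots> = qnum 2 * sum_list (map qdim (map J ns))"
    using ns(1) qdim_J by (simp add: sum_list_const_mult o_def) (intro disjI2 arg_cong[of _ _ sum_list] map_cong; auto)
  also have "\<dots> = qnum 2 * qdim M" using qdim_add_Rep[OF ns(2)] by simp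
  finally show ?thesis .
qed

text \<open>Since \<open>J (s + 1) \<oplus> J (s - 1) = J 2 \<otimes> J s\<close>, additivity and associativity give the same recursion in \<open>s\<close> for
  \<open>qdim (J s \<otimes> M)\<close> as for \<open>[s]\<close>.  The induction reaches \<open>r = p\<close>, where the value is zero.\<close>

lemma qdim_J_tensor:
  assumes M: "M \<in> reps G" and "r \<in> {1..p}"
  shows "qdim (rep_tensor G (J r) M) = qnum r * qdim M"
  using assms(2)
proof (induction r rule: less_induct)
  case (less r)
  have J2: "J 2 \<in> reps G" using J_reps(1)[of 2] p_gt_2 by simp
  consider "r = 1" | "r = 2" | "r > 2" using less.prems by fastforce
  thus ?case
  proof cases
    case 1
    thus ?thesis using rep_tensor_J_1[OF M] qnum_1 by simp
  next
    case 2
    thus ?thesis using qdim_J2_tensor[OF M] by simp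
  next
    case r3: 3
    define s where "s = r - 1"
    have 3: "r = s + 1" "s \<ge> 2" "s < p" using r3 less.prems by (auto simp: s_def)
    have s: "s \<in> {1..p}" using 3 by simp
    have Js: "J s \<in> reps G" using J_reps(1)[of s] 3 by simp
    obtain ns where ns: "is_direct_sum RepP (rep_tensor G (J 2) (J s)) (map J ns)"
      "s = p \<Longrightarrow> ns = [p, p]" "s < p \<Longrightarrow> s \<ge> 2 \<Longrightarrow> mset ns = {#s + 1, s - 1#}" "s = 1 \<Longrightarrow> ns = [2]"
      using J2_tensor_J[OF s] by blast
    have "mset (map J ns) = mset [J (s + 1), J (s - 1)]" using ns(3) 3 by simp
    hence "is_direct_sum RepP (rep_tensor G (J 2) (J s)) [J (s + 1), J (s - 1)]"
      by (rule R.is_direct_sum_perm[OF ns(1)])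
    from qdim_add_Rep[OF tensor_sum_right[OF M this]]
    have "qdim (rep_tensor G (rep_tensor G (J 2) (J s)) M) = qdim (rep_tensor G (J (s + 1)) M) + qdim (rep_tensor G (J (s - 1)) M)"
      by simp
    moreover have "qdim (rep_tensor G (rep_tensor G (J 2) (J s)) M) = qnum 2 * (qnum s * qdim M)"
      unfolding rep_tensor_assoc[OF J2 Js M] using qdim_J2_tensor[OF rep_tensor_cyc(2)[OF Js M]] less.IH[of s] 3 s by simp
    moreover have "qdim (rep_tensor G (J (s - 1)) M) = qnum (s - 1) * qdim M" using less.IH[of "s - 1"] 3 by simp
    ultimately have "qdim (rep_tensor G (J (s + 1)) M) = (qnum 2 * qnum s - qnum (s - 1)) * qdim M"
      by (simp add: algebra_simps)
    thus ?thesis using qnum_rec[of s] 3 by simp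
  qed
qed

lemma qdim_tensor:
  assumes V: "V \<in> reps G" and W: "W \<in> reps G"
  shows "qdim (rep_tensor G V W) = qdim V * qdim W"
proof -
  obtain ns where ns: "set ns \<subseteq> {1..p}" "is_direct_sum RepP V (map J ns)" 
    by (rule jordan_decomposition[OF V])
  have "qdim (rep_tensor G V W) = sum_list (map (\<lambda>n. qdim (rep_tensor G (J n) W)) ns)"
    using qdim_add_Rep[OF tensor_sum_right[OF W ns(2)]] by (simp add: o_def)
  also have "\<dots> = sum_list (map (\<lambda>n. qdim (J n) * qdim W) ns)"
    using ns(1) qdim_J_tensor[OF W] qdim_J by (intro arg_cong[of _ _ sum_list] map_cong) auto
  also have "\<dots> = sum_list (map qdim (map J ns)) * qdim W"
    by (simp add: sum_list_mult_const o_def)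
  also have "\<dots> = qdim V * qdim W" using qdim_add_Rep[OF ns(2)] by simp
  finally show ?thesis .
qed

lemma finitely_many_simples_Ver:
  "\<exists>ss. finite ss \<and> (\<forall>x. simple_obj VerP x \<longrightarrow> (\<exists>s \<in> ss. simple_obj VerP s \<and> isomorphic VerP x s))"
  using B.simple_iso_L B.L_simple by (intro exI[of _ "J ` {1..<p}"]) blast

lemma FPdim_Ver:
  assumes "V \<in> reps G"
  shows "FPdim VerP V = qdim V"
proof (rule B.FPdim_eq_character[OF finitely_many_simples_Ver])
  show "\<exists>s. simple_obj VerP s" using B.L_simple[of 1] p_gt_2 by (intro exI[of _ "J 1"]) simp
  have t: "tno VerP = rep_tensor G" by (simp add: Ver_eq quotient_cat_def)
  show "tno VerP x y \<in> obj VerP" if "x \<in> obj VerP" "y \<in> obj VerP" for x y 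
    using that rep_tensor_cyc(2) by (simp add: t Ver_obj)
  show "qdim (tno VerP x y) = qdim x * qdim y" if "x \<in> obj VerP" "y \<in> obj VerP" for x y 
    using that qdim_tensor by (simp add: t Ver_obj)
qed (use qdim_add qdim_simple_pos assms Ver_obj in auto)

end

section \<open>Irreducibility of the cyclotomic polynomial of prime order\<close>

hide_const (open) module.smult

definition ev :: "rat poly \<Rightarrow> complex \<Rightarrow> complex" where
  "ev f z = poly (map_poly of_rat f) z"

interpretation rat_poly_hom: map_poly_comm_ring_hom "of_rat :: rat \<Rightarrow> complex" ..

lemma map_poly_pCons_zero: "h 0 = 0 \<Longrightarrow> map_poly h (pCons a f) = pCons (h a) (map_poly h f)"
  by (intro poly_eqI) (simp add: coeff_map_poly coeff_pCons split: nat.splits)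

lemma ev_simps [simp]:
  "ev 0 z = 0" "ev 1 z = 1" "ev (f + g) z = ev f z + ev g z" "ev (f - g) z = ev f z - ev g z"
  "ev (- f) z = - ev f z" "ev (f * g) z = ev f z * ev g z" "ev (pCons a f) z = of_rat a + z * ev f z"
  "ev (smult a f) z = of_rat a * ev f z" "ev (monom a n) z = of_rat a * z ^ n"
  by (simp_all add: ev_def rat_poly_hom.hom_add rat_poly_hom.hom_minus rat_poly_hom.hom_uminus rat_poly_hom.hom_mult
     map_poly_pCons_zero map_poly_monom poly_monom of_rat_hom.map_poly_hom_smult)

lemma ev_sum: "ev (\<Sum>i\<in>A. f i) z = (\<Sum>i\<in>A. ev (f i) z)"
  by (induction A rule: infinite_finite_induct) auto

lemma ev_pcompose: "ev (pcompose f g) z = ev f (ev g z)"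
  by (induction f) (simp_all add: pcompose_pCons)

abbreviation ri :: "int poly \<Rightarrow> rat poly" where "ri \<equiv> map_poly of_int"

lemma ri_simps: "ri (f + g) = ri f + ri g" "ri (f * g) = ri f * ri g" "ri (smult c f) = smult (of_int c) (ri f)"
  "ri f = 0 \<longleftrightarrow> f = 0" "degree (ri f) = degree f" "coeff (ri f) i = of_int (coeff f i)"
  "ri (pCons a f) = pCons (of_int a) (ri f)"
  by (simp_all add: map_poly_pCons_zero of_int_poly_hom.hom_add of_int_poly_hom.hom_mult of_int_hom.map_poly_hom_smult coeff_map_poly)

text \<open>The cyclotomic polynomial \<open>((1 + y)\<^sup>p - 1) / y\<close> of order \<open>p\<close> at \<open>1 + y\<close>, which is Eisenstein at \<open>p\<close>.\<close>

definition shifted_cyclotomic :: "nat \<Rightarrow> int poly" where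
  "shifted_cyclotomic p = (\<Sum>i<p. monom (int (p choose Suc i)) i)"

lemma coeff_shifted_cyclotomic:
  "coeff (shifted_cyclotomic p) i = (if i < p then int (p choose Suc i) else 0)"
  by (simp add: shifted_cyclotomic_def coeff_sum)

lemma degree_shifted_cyclotomic: 
  assumes "p > 0" 
  shows "degree (shifted_cyclotomic p) = p - 1" "coeff (shifted_cyclotomic p) (p - 1) = 1"
proof -
  show 1: "coeff (shifted_cyclotomic p) (p - 1) = 1" using assms by (simp add: coeff_shifted_cyclotomic)
  show "degree (shifted_cyclotomic p) = p - 1"
    using 1 assms by (intro antisym degree_le le_degree) (auto simp: coeff_shifted_cyclotomic)
qed

lemma ev_shifted_cyclotomic: "y * ev (ri (shifted_cyclotomic p)) y = (1 + y) ^ p - 1"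
proof -
  have "ri (shifted_cyclotomic p) = (\<Sum>i<p. monom (of_nat (p choose Suc i)) i)"
    by (intro poly_eqI) (simp add: coeff_map_poly coeff_shifted_cyclotomic coeff_sum)
  hence "y * ev (ri (shifted_cyclotomic p)) y = (\<Sum>i<p. of_nat (p choose Suc i) * y ^ Suc i)"
    by (simp add: ev_sum sum_distrib_left mult.left_commute)
  moreover have "(y + 1) ^ p = (\<Sum>i\<le>p. of_nat (p choose i) * y ^ i)"
    by (simp add: binomial_ring)
  moreover have "\<dots> = 1 + (\<Sum>i<p. of_nat (p choose Suc i) * y ^ Suc i)"
    by (subst sum.atMost_shift) simp
  ultimately show ?thesis by (simp add: add.commute)
qed

text \<open>The lowest coefficient of \<open>u\<close> not divisible by \<open>p\<close> sits at an index \<open>i\<close> where the product has a coefficient not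
  divisible by \<open>p\<close>; the only such index is the degree \<open>p - 1\<close>.\<close>

lemma eisenstein_factor:
  fixes u v :: "int poly"
  assumes p: "prime p" and uv: "u * v = shifted_cyclotomic p" 
    and u0: "int p dvd coeff u 0" and v0: "\<not> int p dvd coeff v 0"
  shows "degree v = 0"
proof -
  have p0: "p > 0" using p prime_gt_0_nat by blast
  have nz: "u \<noteq> 0" "v \<noteq> 0" using uv degree_shifted_cyclotomic(2)[OF p0] by auto
  have deg: "degree u + degree v = p - 1" 
    using degree_mult_eq[OF nz] uv degree_shifted_cyclotomic(1)[OF p0] by simp
  have "lead_coeff u * lead_coeff v = 1"
    using lead_coeff_mult[of u v] uv degree_shifted_cyclotomic[OF p0] by simp
  hence "lead_coeff u dvd 1" by (metis dvd_triv_left)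
  moreover have "\<not> int p dvd 1" using p by auto
  ultimately have "\<not> int p dvd lead_coeff u" using dvd_trans by blast
  hence ex: "\<exists>i. \<not> int p dvd coeff u i" by blast
  define i where "i = (LEAST i. \<not> int p dvd coeff u i)"
  have i: "\<not> int p dvd coeff u i" unfolding i_def by (rule LeastI_ex[OF ex])
  have less: "int p dvd coeff u j" if "j < i" for j using not_less_Least[of j] that i_def by blast
  have "coeff (u * v) i = coeff u i * coeff v 0 + (\<Sum>j<i. coeff u j * coeff v (i - j))"
    unfolding coeff_mult by (simp add: lessThan_Suc_atMost[symmetric])
  moreover have "int p dvd (\<Sum>j<i. coeff u j * coeff v (i - j))" using less by (intro dvd_sum) auto
  moreover have "\<not> int p dvd coeff u i * coeff v 0" 
    using i v0 p by (metis prime_dvd_mult_iff prime_nat_int_transfer)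
  ultimately have nd: "\<not> int p dvd coeff (u * v) i" by (simp add: dvd_add_left_iff)
  have "i \<ge> p - 1"
  proof (rule ccontr)
    assume "\<not> i \<ge> p - 1"
    hence "p dvd (p choose Suc i)" using p by (intro dvd_choose_prime) auto
    hence "int p dvd int (p choose Suc i)" by (simp only: int_dvd_int_iff)
    hence "int p dvd coeff (u * v) i" unfolding uv coeff_shifted_cyclotomic by simp
    thus False using nd by blast
  qed
  moreover have "i \<le> degree u" using i by (metis coeff_eq_0 dvd_0_right not_le)
  ultimately show ?thesis using deg by simp
qed

text \<open>A primitive integer polynomial of minimal degree vanishing at \<open>y\<close> divides the Eisenstein polynomial over the
  rationals by pseudo-division, and over the integers by Gauss's lemma on contents.  Eisenstein's argument leaves no
  degree below \<open>p - 1\<close> for it.\<close>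

lemma shifted_cyclotomic_minimal:
  fixes y :: complex
  assumes p: "prime p" and y: "ev (ri (shifted_cyclotomic p)) y = 0" 
    and g: "g \<noteq> 0" "ev (ri g) y = 0"
  shows "degree g \<ge> p - 1"
proof -
  let ?E = "shifted_cyclotomic p"
  have p0: "p > 0" using p prime_gt_0_nat by blast
  define R where "R d \<longleftrightarrow> (\<exists>g. g \<noteq> 0 \<and> ev (ri g) y = 0 \<and> degree g = d)" for d
  have "R (degree g)" using g R_def by blast
  define d where "d = (LEAST d. R d)"
  have "R d" unfolding d_def by (rule LeastI[of R]) fact
  then obtain g0 where g0: "g0 \<noteq> 0" "ev (ri g0) y = 0" "degree g0 = d" using R_def by blast
  define h where "h = primitive_part g0"
  have h0: "g0 = smult (content g0) h" by (simp add: h_def)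
  have c0: "content g0 \<noteq> 0" using g0 by simp
  have "ev (ri g0) y = of_rat (of_int (content g0)) * ev (ri h) y"
    by (subst h0) (simp only: ri_simps ev_simps)
  hence h: "h \<noteq> 0" "ev (ri h) y = 0" "degree h = d" "content h = 1"
    using g0 c0 by (simp_all add: h_def)
  have min: "f = 0" if "ev (ri f) y = 0" "degree f < d" for f
    using that not_less_Least[of "degree f" R] unfolding d_def R_def by blast
  obtain qq r where "pseudo_divmod ?E h = (qq, r)" by (cases "pseudo_divmod ?E h")
  note pd = pseudo_divmod[OF h(1) this]
  define c where "c = coeff h (degree h) ^ (Suc (degree ?E) - degree h)"
  have c: "c \<noteq> 0" using h(1) by (simp add: c_def)
  have eq: "smult c ?E = h * qq + r" using pd(1) by (simp add: c_def)
  have "ev (ri (smult c ?E)) y = ev (ri (h * qq + r)) y" unfolding eq ..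
  hence "ev (ri r) y = 0" using y h(2) by (simp add: ri_simps)
  hence "r = 0" using pd(2) min h(3) by auto
  hence eq: "smult c ?E = h * qq" using eq by simp
  have "content ?E dvd coeff ?E (p - 1)" by (rule content_dvd_coeff)
  hence "content ?E dvd 1" unfolding degree_shifted_cyclotomic(2)[OF p0] .
  hence "normalize (content ?E) = 1" by (rule is_unit_normalize)
  hence "content ?E = 1" by (simp only: normalize_content)
  hence "normalize c = content qq" using arg_cong[OF eq, of content] h(4) by (simp add: content_mult)
  define h' where "h' = smult (sgn c) (primitive_part qq)"
  have "smult (abs c) (h * primitive_part qq) = smult c ?E"
    unfolding eq using \<open>normalize c = content qq\<close> content_times_primitive_part[of qq] by (metis mult_smult_right normalize_int_def)
  hence "smult (abs c) (h * h') = smult (abs c) ?E"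
    using c by (simp add: h'_def) (metis abs_mult_sgn abs_sgn mult.commute mult_sgn_abs sgn_mult_abs smult_smult)
  hence hh: "h * h' = ?E" using c by (metis abs_eq_0_iff smult_cancel)
  have ab: "coeff h 0 * coeff h' 0 = int p"
    using arg_cong[OF hh, of "\<lambda>f. coeff f 0"] p0 by (simp add: coeff_mult coeff_shifted_cyclotomic)
  have nz: "h \<noteq> 0" "h' \<noteq> 0" using hh degree_shifted_cyclotomic(2)[OF p0] by auto
  have deg: "degree h + degree h' = p - 1" 
    using degree_mult_eq[OF nz] hh degree_shifted_cyclotomic(1)[OF p0] by simp
  have "d = p - 1"
  proof (cases "int p dvd coeff h 0")
    case True
    have "\<not> int p dvd coeff h' 0"
    proof
      assume "int p dvd coeff h' 0"
      hence "int p * int p dvd int p" using True ab by (metis mult_dvd_mono)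
      thus False using p p0 by (metis dvd_mult_cancel_left mult.right_neutral not_prime_unit of_nat_0_eq_iff not_gr_zero prime_nat_int_transfer)
    qed
    thus ?thesis using eisenstein_factor[OF p hh True] deg h(3) by simp
  next
    case False
    have "int p dvd coeff h 0 * coeff h' 0" unfolding ab by simp
    hence "int p dvd coeff h' 0" using False p by (metis prime_dvd_mult_iff prime_nat_int_transfer)
    hence "degree h = 0" using eisenstein_factor[OF p _ _ False, of h'] hh by (simp add: mult.commute)
    then obtain a where "h = [:a:]" by (rule degree_eq_zeroE)
    thus ?thesis using h(1,2) by (simp add: ri_simps)
  qed
  moreover have "d \<le> degree g" unfolding d_def by (rule Least_le) fact
  ultimately show ?thesis by simp
qed

lemma clear_denominators:
  fixes f :: "rat poly"
  obtains D g where "D \<noteq> 0" "ri g = smult (of_int D) f"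
proof -
  have "\<exists>D g. D \<noteq> 0 \<and> ri g = smult (of_int D) f"
  proof (induction f)
    case 0
    show ?case by (intro exI[of _ 1] exI[of _ 0]) simp
  next
    case (pCons a f)
    then obtain D g where D: "D \<noteq> 0" "ri g = smult (of_int D) f" by blast
    obtain n d where a: "a = of_int n / of_int d" "d \<noteq> 0"
      by (cases a) (metis Fract_of_int_quotient less_numeral_extra(3))
    have "ri (pCons (D * n) (smult d g)) = smult (of_int (D * d)) (pCons a f)"
      using D a by (simp add: ri_simps mult.commute)
    thus ?case using D a by (intro exI[of _ "D * d"] exI) auto
  qed
  thus thesis using that by blast
qed

text \<open>All nontrivial \<open>p\<close>-th roots of unity are conjugate: the remainder of \<open>f\<close> modulo the cyclotomic polynomial vanishes at
  \<open>z\<close> and has degree below \<open>p - 1\<close>, so it is zero.\<close>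

lemma root_of_unity_conjugate:
  assumes p: "prime p" and z: "z ^ p = 1" "z \<noteq> 1" and w: "w ^ p = 1" "w \<noteq> 1" and f: "ev f z = 0"
  shows "ev f w = 0"
proof -
  let ?E = "ri (shifted_cyclotomic p)"
  have p0: "p > 0" using p prime_gt_0_nat by blast
  have E: "ev ?E (x - 1) = 0" if "x ^ p = 1" "x \<noteq> 1" for x
    using ev_shifted_cyclotomic[of "x - 1" p] that by simp
  define g where "g = pcompose f [:1, 1:]"
  have g: "ev g (x - 1) = ev f x" for x by (simp add: g_def ev_pcompose)
  define r where "r = g mod ?E"
  have gr: "g = ?E * (g div ?E) + r" by (simp add: r_def)
  have "ev g (z - 1) = ev (?E * (g div ?E) + r) (z - 1)" using gr by simp
  hence rz: "ev r (z - 1) = 0" using g f E[OF z] by simp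
  have "r = 0"
  proof (rule ccontr)
    assume r0: "r \<noteq> 0"
    have E0: "?E \<noteq> 0" using degree_shifted_cyclotomic(2)[OF p0] by (auto simp: ri_simps)
    have "degree r < degree ?E" using degree_mod_less[OF E0, of g] r0 by (auto simp: r_def)
    hence dr: "degree r < p - 1" using degree_shifted_cyclotomic(1)[OF p0] by (simp add: ri_simps)
    obtain D h where h: "D \<noteq> 0" "ri h = smult (of_int D) r" by (rule clear_denominators)
    have "h \<noteq> 0" using h r0 ri_simps(4)[of h] by auto
    moreover have "ev (ri h) (z - 1) = 0" unfolding h(2) using rz by simp
    ultimately have "degree h \<ge> p - 1" by (rule shifted_cyclotomic_minimal[OF p E[OF z]])
    moreover have "degree h = degree r" using ri_simps(5)[of h] h by simp
    ultimately show False using dr by simp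
  qed
  hence "ev g (w - 1) = 0" using gr E[OF w] by (metis add.right_neutral ev_simps(6) mult_zero_left)
  thus ?thesis using g by simp
qed

section \<open>Galois automorphisms of the cyclotomic field\<close>

lemma rat_adjoin_iff: "x \<in> rat_adjoin z \<longleftrightarrow> (\<exists>f g. x = ev f z / ev g z \<and> ev g z \<noteq> 0)"
proof
  assume "x \<in> rat_adjoin z"
  then obtain f g where fg: "x = poly f z / poly g z" "\<And>i. coeff f i \<in> \<rat>" "\<And>i. coeff g i \<in> \<rat>" "poly g z \<noteq> 0"
    unfolding rat_adjoin_def by blast
  obtain f' g' where "f = map_poly of_rat f'" "g = map_poly of_rat g'" using ratpolyE[of f] ratpolyE[of g] fg by metis
  thus "\<exists>f g. x = ev f z / ev g z \<and> ev g z \<noteq> 0" using fg unfolding ev_def by blast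
next
  assume "\<exists>f g. x = ev f z / ev g z \<and> ev g z \<noteq> 0"
  then obtain f g where "x = ev f z / ev g z" "ev g z \<noteq> 0" by blast
  moreover have "coeff (map_poly of_rat f) i \<in> \<rat>" for f i by (simp add: coeff_map_poly)
  ultimately show "x \<in> rat_adjoin z" unfolding rat_adjoin_def ev_def by blast
qed

lemma ev_in_rat_adjoin: "ev f z \<in> rat_adjoin z"
  unfolding rat_adjoin_iff by (intro exI[of _ f] exI[of _ 1]) simp

locale odd_prime =
  fixes p :: nat
  assumes prime_p: "prime p" and p_gt_2: "p > 2"
begin

abbreviation "q \<equiv> root_q p"

lemma odd_p: "odd p" using prime_p p_gt_2 prime_odd_nat by blast

lemma q_cis: "q = cis (pi / p)"
  by (simp add: root_q_def cis_conv_exp mult.commute)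

lemma q_pow_p: "q ^ p = - 1"
  using p_gt_2 by (simp add: q_cis DeMoivre)

lemma q_pow_2p: "q ^ (2 * p) = 1"
  by (metis mult.commute power_mult q_pow_p power2_eq_square mult_minus_left mult_1 minus_minus power2_minus one_power2)

lemma q_nonzero: "q \<noteq> 0" by (simp add: q_cis)

lemma q_ne_minus_one: "q \<noteq> - 1"
proof
  assume "q = - 1"
  hence "sin (pi / p) = 0" by (simp add: q_cis complex_eq_iff)
  moreover have "sin (pi / p) > 0" using p_gt_2 by (intro sin_gt_zero) (auto simp: field_simps)
  ultimately show False by simp
qed

text \<open>The same for \<open>2p\<close>-th roots of unity, since \<open>z\<close> is primitive of order \<open>2 p\<close> if and only if \<open>-z\<close> is primitive of
  order \<open>p\<close>.\<close>

lemma conjugate_root: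
  assumes z: "z ^ p = - 1" "z \<noteq> - 1" and w: "w ^ p = - 1" "w \<noteq> - 1" and f: "ev f z = 0"
  shows "ev f w = 0"
proof -
  have m: "(- x) ^ p = 1" "- x \<noteq> 1" if "x ^ p = - 1" "x \<noteq> - 1" for x :: complex
    using that odd_p by (auto simp: power_minus_odd) (metis minus_minus)
  have "ev (pcompose f [:0, - 1:]) (- z) = 0" using f by (simp add: ev_pcompose)
  hence "ev (pcompose f [:0, - 1:]) (- w) = 0" by (rule root_of_unity_conjugate[OF prime_p m[OF z] m[OF w]])
  thus ?thesis by (simp add: ev_pcompose)
qed

text \<open>The automorphism \<open>f(q) / g(q) \<mapsto> f(q\<^sup>k) / g(q\<^sup>k)\<close>.  It is undefined outside the field because automorphisms are taken
  to be extensional functions.\<close>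

definition transport :: "nat \<Rightarrow> complex \<Rightarrow> complex" where
  "transport k x = (if x \<in> rat_adjoin q then
     (THE y. \<exists>f g. x = ev f q / ev g q \<and> ev g q \<noteq> 0 \<and> y = ev f (q ^ k) / ev g (q ^ k)) else undefined)"

context
  fixes k :: nat
  assumes k: "odd k" "\<not> p dvd k"
begin

lemma inverse_exponent:
  obtains l where "(q ^ k) ^ l = q" "(q ^ l) ^ k = q"
proof -
  have "coprime k p" using k(2) prime_p prime_imp_coprime coprime_commute by blast
  hence "coprime k (2 * p)" using k(1) by simp
  then obtain l where l: "[k * l = Suc 0] (mod (2 * p))" using cong_solve_coprime_nat by blast
  hence "(k * l) mod (2 * p) = 1" using p_gt_2 by (simp add: cong_def)
  hence "k * l = 2 * p * ((k * l) div (2 * p)) + 1" by (metis mult_div_mod_eq)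
  hence "q ^ (k * l) = (q ^ (2 * p)) ^ ((k * l) div (2 * p)) * q" by (metis power_add power_mult power_one_right)
  hence "q ^ (k * l) = q" by (simp add: q_pow_2p)
  thus thesis using that[of l] by (simp add: power_mult[symmetric] mult.commute)
qed

lemma q_pow_conj: "(q ^ k) ^ p = - 1" "q ^ k \<noteq> - 1"
proof -
  have "(q ^ k) ^ p = (q ^ p) ^ k" by (simp add: power_mult[symmetric] mult.commute)
  thus c: "(q ^ k) ^ p = - 1" using k(1) by (simp add: q_pow_p)
  show "q ^ k \<noteq> - 1"
  proof
    assume m: "q ^ k = - 1"
    obtain l where l: "(q ^ k) ^ l = q" using inverse_exponent by blast
    hence "q = 1 \<or> q = - 1" unfolding m by (metis power_minus1_even power_minus1_odd evenE oddE uminus_power_if power_one)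
    thus False using q_ne_minus_one q_pow_p by (metis one_neq_neg_one power_one)
  qed
qed

lemma ev_q_iff: "ev f q = 0 \<longleftrightarrow> ev f (q ^ k) = 0"
  using conjugate_root[OF q_pow_p q_ne_minus_one q_pow_conj] conjugate_root[OF q_pow_conj q_pow_p q_ne_minus_one] by blast

lemma transport_eq:
  assumes g: "ev g q \<noteq> 0"
  shows "transport k (ev f q / ev g q) = ev f (q ^ k) / ev g (q ^ k)"
proof -
  have in_A: "ev f q / ev g q \<in> rat_adjoin q" using g rat_adjoin_iff by blast
  have "(THE y. \<exists>f' g'. ev f q / ev g q = ev f' q / ev g' q \<and> ev g' q \<noteq> 0 \<and> y = ev f' (q ^ k) / ev g' (q ^ k)) = 
      ev f (q ^ k) / ev g (q ^ k)"
  proof (rule the_equality)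
    fix y assume "\<exists>f' g'. ev f q / ev g q = ev f' q / ev g' q \<and> ev g' q \<noteq> 0 \<and> y = ev f' (q ^ k) / ev g' (q ^ k)"
    then obtain f' g' where h: "ev f q / ev g q = ev f' q / ev g' q" "ev g' q \<noteq> 0" "y = ev f' (q ^ k) / ev g' (q ^ k)" by blast
    have "ev (f * g' - f' * g) q = 0" using h g by (simp add: frac_eq_eq)
    hence "ev (f * g' - f' * g) (q ^ k) = 0" using ev_q_iff by blast
    moreover have "ev g (q ^ k) \<noteq> 0" "ev g' (q ^ k) \<noteq> 0" using g h(2) ev_q_iff by auto
    ultimately show "y = ev f (q ^ k) / ev g (q ^ k)" unfolding h(3) by (simp add: frac_eq_eq)
  qed (use g in blast)
  thus ?thesis using in_A by (simp add: transport_def)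
qed

lemma transport_ev: "transport k (ev f q) = ev f (q ^ k)"
  using transport_eq[of 1 f] by simp

lemma transport_field_aut: "transport k \<in> field_auts (rat_adjoin q)" "transport k q = q ^ k"
proof -
  show "transport k q = q ^ k" using transport_ev[of "monom 1 1"] by simp
  let ?A = "rat_adjoin q"
  have hom: "transport k (x + y) = transport k x + transport k y" "transport k (x * y) = transport k x * transport k y"
    if xy: "x \<in> ?A" "y \<in> ?A" for x y
  proof -
    obtain f g where x: "x = ev f q / ev g q" "ev g q \<noteq> 0" using xy(1) rat_adjoin_iff by blast
    obtain f' g' where y: "y = ev f' q / ev g' q" "ev g' q \<noteq> 0" using xy(2) rat_adjoin_iff by blast
    have nz: "ev g (q ^ k) \<noteq> 0" "ev g' (q ^ k) \<noteq> 0" "ev (g * g') q \<noteq> 0" using x y ev_q_iff by auto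
    have "x + y = ev (f * g' + f' * g) q / ev (g * g') q" using x y by (simp add: add_frac_eq)
    hence "transport k (x + y) = ev (f * g' + f' * g) (q ^ k) / ev (g * g') (q ^ k)" by (simp only: transport_eq[OF nz(3)])
    also have "\<dots> = transport k x + transport k y"
      unfolding x(1) y(1) transport_eq[OF x(2)] transport_eq[OF y(2)] using nz by (simp add: add_frac_eq)
    finally show "transport k (x + y) = transport k x + transport k y" .
    have "x * y = ev (f * f') q / ev (g * g') q" using x y by simp
    hence "transport k (x * y) = ev (f * f') (q ^ k) / ev (g * g') (q ^ k)" by (simp only: transport_eq[OF nz(3)])
    also have "\<dots> = transport k x * transport k y"
      unfolding x(1) y(1) transport_eq[OF x(2)] transport_eq[OF y(2)] by simp
    finally show "transport k (x * y) = transport k x * transport k y" .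
  qed
  obtain l where l: "(q ^ k) ^ l = q" "(q ^ l) ^ k = q" by (rule inverse_exponent)
  have pl: "(q ^ l) ^ p = - 1" "q ^ l \<noteq> - 1"
  proof -
    show "q ^ l \<noteq> - 1" using l(2) k(1) q_ne_minus_one by auto
    have e: "(q ^ l) ^ p = (- 1) ^ l" by (metis mult.commute power_mult q_pow_p)
    have "((q ^ l) ^ p) ^ k = q ^ p" by (metis l(2) mult.commute power_mult)
    hence "(q ^ l) ^ p \<noteq> 1" using q_pow_p by auto
    thus "(q ^ l) ^ p = - 1" unfolding e by (cases "even l") auto
  qed
  have inj: "inj_on (transport k) ?A"
  proof (rule inj_onI)
    fix x y assume xy: "x \<in> ?A" "y \<in> ?A" "transport k x = transport k y"
    obtain f g where x: "x = ev f q / ev g q" "ev g q \<noteq> 0" using xy(1) rat_adjoin_iff by blast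
    obtain f' g' where y: "y = ev f' q / ev g' q" "ev g' q \<noteq> 0" using xy(2) rat_adjoin_iff by blast
    have nz: "ev g (q ^ k) \<noteq> 0" "ev g' (q ^ k) \<noteq> 0" using x y ev_q_iff by auto
    have "ev (f * g' - f' * g) (q ^ k) = 0"
      using xy(3) nz unfolding x(1) y(1) transport_eq[OF x(2)] transport_eq[OF y(2)] by (simp add: frac_eq_eq)
    hence "ev (f * g' - f' * g) q = 0" using ev_q_iff by blast
    thus "x = y" using x y by (simp add: frac_eq_eq)
  qed
  have into: "transport k ` ?A \<subseteq> ?A"
  proof
    fix y assume "y \<in> transport k ` ?A"
    then obtain x' where x': "x' \<in> ?A" "y = transport k x'" by blast
    then obtain f g where "x' = ev f q / ev g q" "ev g q \<noteq> 0" using rat_adjoin_iff by blast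
    hence x: "y = transport k (ev f q / ev g q)" "ev g q \<noteq> 0" using x'(2) by simp_all
    have "y = ev (pcompose f (monom 1 k)) q / ev (pcompose g (monom 1 k)) q"
      unfolding x(1) transport_eq[OF x(2)] by (simp add: ev_pcompose)
    moreover have "ev (pcompose g (monom 1 k)) q \<noteq> 0" using x(2) ev_q_iff by (simp add: ev_pcompose)
    ultimately show "y \<in> ?A" using rat_adjoin_iff by blast
  qed
  have onto: "?A \<subseteq> transport k ` ?A"
  proof
    fix y assume "y \<in> ?A"
    then obtain f g where y: "y = ev f q / ev g q" "ev g q \<noteq> 0" using rat_adjoin_iff by blast
    let ?f = "pcompose f (monom 1 l)" and ?g = "pcompose g (monom 1 l)"
    have g: "ev ?g q \<noteq> 0" using y(2) conjugate_root[OF pl q_pow_p q_ne_minus_one] by (auto simp: ev_pcompose)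
    have "transport k (ev ?f q / ev ?g q) = y"
      unfolding transport_eq[OF g] y(1) by (simp add: ev_pcompose l(1))
    moreover have "ev ?f q / ev ?g q \<in> ?A" using g rat_adjoin_iff by blast
    ultimately show "y \<in> transport k ` ?A" by blast
  qed
  have "bij_betw (transport k) ?A ?A" using inj into onto unfolding bij_betw_def by blast
  moreover have "transport k \<in> extensional ?A" by (auto simp: extensional_def transport_def)
  ultimately show "transport k \<in> field_auts ?A" using hom unfolding field_auts_def by blast
qed

text \<open>An automorphism fixes the rationals, so it is determined by its value at \<open>q\<close>.\<close>

lemma field_aut_unique:
  assumes \<sigma>: "\<sigma> \<in> field_auts (rat_adjoin q)" "\<sigma> q = q ^ k"
  shows "\<sigma> = transport k"
proof
  let ?A = "rat_adjoin q"
  have bij: "bij_betw \<sigma> ?A ?A" and ext: "\<sigma> \<in> extensional ?A" 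
    and add: "\<And>x y. x \<in> ?A \<Longrightarrow> y \<in> ?A \<Longrightarrow> \<sigma> (x + y) = \<sigma> x + \<sigma> y"
    and mult: "\<And>x y. x \<in> ?A \<Longrightarrow> y \<in> ?A \<Longrightarrow> \<sigma> (x * y) = \<sigma> x * \<sigma> y"
    using \<sigma>(1) unfolding field_auts_def by auto
  have c: "of_rat a \<in> ?A" for a using ev_in_rat_adjoin[of "[:a:]" q] by simp
  have c0: "0 \<in> ?A" "1 \<in> ?A" and ci: "of_int n \<in> ?A" and cn: "of_nat m \<in> ?A" for n m 
    using c[of 0] c[of 1] c[of "of_int n"] c[of "of_nat m"] by auto
  have qA: "q \<in> ?A" using ev_in_rat_adjoin[of "monom 1 1" q] by simp
  have s0: "\<sigma> 0 = 0" using add[OF c0(1) c0(1)] by simp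
  have "\<sigma> 1 \<noteq> \<sigma> 0" by (simp add: inj_on_eq_iff[OF bij_betw_imp_inj_on[OF bij] c0(2,1)])
  moreover have "\<sigma> 1 * \<sigma> 1 = \<sigma> 1" using mult[OF c0(2) c0(2)] by simp
  ultimately have s1: "\<sigma> 1 = 1" using s0 by simp
  have sn: "\<sigma> (of_nat m) = of_nat m" for m
  proof (induction m)
    case (Suc m)
    thus ?case using add[OF c0(2) cn[of m]] s1 by simp
  qed (simp add: s0)
  have si: "\<sigma> (of_int n) = of_int n" for n
  proof (cases n)
    case (nonneg m)
    thus ?thesis using sn by simp
  next
    case (neg m)
    have "\<sigma> (of_int n + of_nat (Suc m)) = \<sigma> (of_int n) + of_nat (Suc m)" unfolding add[OF ci cn] sn ..
    thus ?thesis using neg s0 by (simp add: add_eq_0_iff2)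
  qed
  have sr: "\<sigma> (of_rat a) = of_rat a" for a
  proof -
    obtain n d where a: "a = of_int n / of_int d" "d \<noteq> 0"
      by (cases a) (metis Fract_of_int_quotient less_numeral_extra(3))
    have e: "of_rat a * of_int d = (of_int n :: complex)" using a by (simp add: of_rat_divide)
    have "\<sigma> (of_rat a) * of_int d = of_int n" using mult[OF c ci, of a d] unfolding e si by simp
    thus ?thesis using e a(2) by (metis mult_cancel_right of_int_eq_0_iff)
  qed
  have se: "\<sigma> (ev f q) = ev f (q ^ k)" for f
  proof (induction f)
    case (pCons a f)
    have "q * ev f q \<in> ?A" using ev_in_rat_adjoin[of "pCons 0 f" q] by simp
    thus ?case using pCons add[OF c, of "q * ev f q" a] mult[OF qA ev_in_rat_adjoin] sr \<sigma>(2) by simp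
  qed (simp add: s0)
  fix x
  show "\<sigma> x = transport k x"
  proof (cases "x \<in> ?A")
    case True
    then obtain f g where x: "x = ev f q / ev g q" "ev g q \<noteq> 0" using rat_adjoin_iff by blast
    have "x * ev g q = ev f q" using x by simp
    hence "\<sigma> x * ev g (q ^ k) = ev f (q ^ k)" using mult[OF True ev_in_rat_adjoin[of g]] se by metis
    moreover have "ev g (q ^ k) \<noteq> 0" using x(2) ev_q_iff by simp
    ultimately show ?thesis unfolding x(1) transport_eq[OF x(2)] by (simp add: field_simps)
  next
    case False
    thus ?thesis using extensional_arb[OF ext False] by (simp add: transport_def)
  qed
qed

end

text \<open>The exponents \<open>2 s + 1 \<le> p - 2\<close> are odd and prime to \<open>p\<close>, so the defining description of the automorphism is met
  exactly by \<open>transport\<close>.\<close>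

lemma galois_g_ev:
  assumes s: "s \<le> (p - 3) div 2" and real: "ev f q \<in> \<real>"
  shows "galois_g p s (ev f q) = ev f (q ^ (2 * s + 1))"
proof -
  let ?k = "2 * s + 1"
  have "?k < p" using s p_gt_2 by linarith
  hence k: "odd ?k" "\<not> p dvd ?k" using nat_dvd_not_less[of ?k p] by auto
  have "(THE \<sigma>. \<sigma> \<in> field_auts (rat_adjoin q) \<and> \<sigma> q = q ^ ?k) = transport ?k"
  proof (rule the_equality)
    show "transport ?k \<in> field_auts (rat_adjoin q) \<and> transport ?k q = q ^ ?k"
      by (rule conjI[OF transport_field_aut[OF k]])
    show "\<sigma> = transport ?k" if "\<sigma> \<in> field_auts (rat_adjoin q) \<and> \<sigma> q = q ^ ?k" for \<sigma>
      using field_aut_unique[OF k] that by blast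
  qed
  moreover have "ev f q \<in> field_K p" using real ev_in_rat_adjoin by (simp add: field_K_def)
  ultimately show ?thesis using transport_ev[OF k] by (simp add: galois_g_def)
qed

section \<open>Orthogonality of the trace form\<close>

text \<open>With \<open>z\<^sup>p = 1\<close> the inverse of an odd power is an even power, so the sum runs over all \<open>z\<^sup>j\<close> with \<open>1 \<le> j < p\<close>.\<close>

lemma root_of_unity_half_sum:
  fixes z :: complex
  assumes "z ^ p = 1"
  shows "(\<Sum>s = 0..(p - 3) div 2. z ^ (2 * s + 1) + inverse z ^ (2 * s + 1)) = (if z = 1 then of_nat p - 1 else - 1)"
proof -
  obtain h where h: "p = 2 * h + 1" using odd_p by (auto elim: oddE)
  have "(p - 3) div 2 = h - 1" "h \<ge> 1" using h p_gt_2 by simp_all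
  hence h1: "{0..(p - 3) div 2} = {..<h}" by auto
  have z0: "z \<noteq> 0" using assms p_gt_2 by (auto simp: power_0_left)
  have inv: "inverse z ^ n = z ^ (p - n)" if "n \<le> p" for n
  proof -
    have "z ^ n * z ^ (p - n) = 1" using that assms by (simp add: power_add[symmetric])
    thus ?thesis by (metis inverse_unique power_inverse)
  qed
  have "(\<Sum>s<h. z ^ (2 * s + 1) + inverse z ^ (2 * s + 1)) = (\<Sum>s<h. z ^ (2 * s + 1)) + (\<Sum>s<h. z ^ (2 * (h - 1 - s) + 2))"
    unfolding sum.distrib
  proof (intro arg_cong2[of _ _ _ _ "(+)"] refl sum.cong)
    fix s assume "s \<in> {..<h}"
    hence "2 * s + 1 \<le> p" "p - (2 * s + 1) = 2 * (h - 1 - s) + 2" using h by auto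
    thus "inverse z ^ (2 * s + 1) = z ^ (2 * (h - 1 - s) + 2)" using inv[of "2 * s + 1"] by simp
  qed
  also have "(\<Sum>s<h. z ^ (2 * (h - 1 - s) + 2)) = (\<Sum>s<h. z ^ (2 * s + 2))"
    using sum.nat_diff_reindex[of "\<lambda>s. z ^ (2 * s + 2)" h] by simp
  finally have e: "(\<Sum>s<h. z ^ (2 * s + 1) + inverse z ^ (2 * s + 1)) = (\<Sum>s<h. z ^ (2 * s + 1)) + (\<Sum>s<h. z ^ (2 * s + 2))" .
  have "(\<Sum>s<h. z ^ (2 * s + 1)) + (\<Sum>s<h. z ^ (2 * s + 2)) = (\<Sum>j<2 * h. z ^ Suc j)"
    by (induction h) (simp_all add: algebra_simps)
  also have "\<dots> = (if z = 1 then of_nat p - 1 else - 1)"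
  proof (cases "z = 1")
    case False
    have "(z - 1) * (\<Sum>j<2 * h. z ^ Suc j) = z * (z ^ (2 * h) - 1)"
      using power_diff_1_eq[of z "2 * h"] by (simp add: sum_distrib_left mult.left_commute mult.assoc)
    also have "\<dots> = z ^ p - z" by (simp add: h algebra_simps)
    also have "\<dots> = (z - 1) * (- 1)" using assms by simp
    finally show ?thesis using False by (metis mult_cancel_left right_minus_eq)
  qed (simp add: h)
  finally show ?thesis using e h1 by simp
qed

lemma q_powi_eq_1:
  assumes "\<bar>e\<bar> < 2 * int p"
  shows "q powi e = 1 \<longleftrightarrow> e = 0"
proof
  assume "q powi e = 1"
  hence "cis (of_int e * (pi / p)) = 1" by (simp add: q_cis cis_power_int)
  hence "cos (of_int e * (pi / p)) = 1" by (simp add: complex_eq_iff)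
  then obtain n :: int where "of_int e * (pi / p) = of_int n * 2 * pi" 
    using cos_one_2pi_int by blast
  hence "real_of_int e = real_of_int (n * (2 * int p))" using p_gt_2 by (simp add: field_simps)
  hence n: "e = n * (2 * int p)" by linarith
  have "n = 0"
  proof (rule ccontr)
    assume "n \<noteq> 0"
    hence "\<bar>e\<bar> \<ge> 1 * (2 * int p)" unfolding n abs_mult by (intro mult_mono) auto
    thus False using assms by simp
  qed
  thus "e = 0" using n by simp
qed simp

text \<open>The polynomial form of \<open>q\<^sup>m - q\<^bsup>-m\<^esup>\<close>, with the negative power written as \<open>q\<^bsup>2p - m\<^esup>\<close> to make the Galois action visible.\<close>

definition qpoly :: "nat \<Rightarrow> rat poly" where "qpoly m = monom 1 m - monom 1 (2 * p - m)"

lemma ev_qpoly: "m < 2 * p \<Longrightarrow> ev (qpoly m) (q ^ k) = (q ^ k) powi int m - (q ^ k) powi (- int m)"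
proof -
  assume m: "m < 2 * p"
  have "(q ^ k) ^ m * (q ^ k) ^ (2 * p - m) = (q ^ k) ^ (2 * p)"
    unfolding power_add[symmetric] using m by simp
  also have "\<dots> = (q ^ (2 * p)) ^ k" by (metis mult.commute power_mult)
  finally have "(q ^ k) ^ m * (q ^ k) ^ (2 * p - m) = (q ^ (2 * p)) ^ k" .
  hence "(q ^ k) ^ (2 * p - m) = inverse ((q ^ k) ^ m)" by (metis inverse_unique power_one q_pow_2p)
  thus ?thesis by (simp add: qpoly_def power_int_minus)
qed

lemma q_powi_sin: "q powi int m - q powi (- int m) = 2 * \<i> * of_real (sin (pi * m / p))"
proof -
  have "q powi e = cis (of_int e * (pi / p))" for e by (simp add: q_cis cis_power_int)
  thus ?thesis by (simp only:) (simp add: complex_eq_iff mult.commute)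
qed

text \<open>Multiplying \<open>[m]\<close> by \<open>q - q\<^sup>-\<^sup>1\<close> gives \<open>q\<^sup>m - q\<^bsup>-m\<^esup>\<close>.  The trace of \<open>(q\<^bsup>-r\<^esup> - q\<^sup>r) (q\<^sup>m - q\<^bsup>-m\<^esup>)\<close> is the difference of two sums
  of odd powers of the \<open>p\<close>-th roots of unity \<open>q\<^bsup>r-m\<^esup>\<close> and \<open>q\<^bsup>r+m\<^esup>\<close> and their inverses.  Each sum is \<open>-1\<close>, except that
  the first one is \<open>p - 1\<close> for \<open>m = r\<close>.  Equal parity of \<open>m\<close> and \<open>r\<close> is what makes these \<open>p\<close>-th roots of unity.\<close>

lemma trace_orthogonality:
  fixes a :: "nat \<Rightarrow> nat" and r :: nat and S :: "nat set"
  assumes S: "S \<subseteq> {1..<p}" "\<And>m. m \<in> S \<Longrightarrow> even (m + r)" and r: "r \<in> {1..<p}"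
  shows "Tr_K p ((q powi (- int r) - q powi (int r)) * (q - q powi (- 1)) *
     of_real (\<Sum>m\<in>S. a m * (sin (pi * m / p) / sin (pi / p)))) = (if r \<in> S then of_nat p * of_nat (a r) else 0)"
proof -
  have finS: "finite S" using S(1) finite_subset by blast
  define f where "f = - (qpoly r * (\<Sum>m\<in>S. smult (of_nat (a m)) (qpoly m)))"
  have Sp: "m < 2 * p" if "m \<in> S" for m using S(1) that by auto
  have rp: "r < 2 * p" using r by simp
  have evf: "ev f (q ^ k) = (\<Sum>m\<in>S. of_nat (a m) * 
      (((q ^ k) powi (- int r) - (q ^ k) powi int r) * ((q ^ k) powi int m - (q ^ k) powi (- int m))))" for k
  proof -
    have "ev f (q ^ k) = (\<Sum>m\<in>S. of_nat (a m) * (- ev (qpoly r) (q ^ k) * ev (qpoly m) (q ^ k)))"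
      by (simp add: f_def ev_sum sum_distrib_left sum_negf[symmetric] mult_ac)
    also have "\<dots> = (\<Sum>m\<in>S. of_nat (a m) * 
      (((q ^ k) powi (- int r) - (q ^ k) powi int r) * ((q ^ k) powi int m - (q ^ k) powi (- int m))))"
      by (intro sum.cong refl) (simp only: ev_qpoly[OF Sp] ev_qpoly[OF rp] minus_diff_eq)
    finally show ?thesis .
  qed
  have sp: "sin (pi / p) > 0" using p_gt_2 by (intro sin_gt_zero) (auto simp: field_simps)
  have x: "(q powi (- int r) - q powi (int r)) * (q - q powi (- 1)) *
     of_real (\<Sum>m\<in>S. a m * (sin (pi * m / p) / sin (pi / p))) = ev f q"
  proof -
    have q1: "q - q powi (- 1) = 2 * \<i> * of_real (sin (pi / p))" using q_powi_sin[of 1] by simp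
    define D where "D = q powi (- int r) - q powi int r"
    have "ev f q = (\<Sum>m\<in>S. of_nat (a m) * (D * (2 * \<i> * of_real (sin (pi * m / p)))))"
      using evf[of 1] unfolding power_one_right q_powi_sin D_def .
    thus ?thesis unfolding q1 D_def[symmetric] of_real_sum sum_distrib_left using sp 
      by (simp only:) (intro sum.cong refl, simp add: field_simps)
  qed
  have "ev f q = of_real (\<Sum>m\<in>S. a m * (4 * sin (pi * r / p) * sin (pi * m / p)))"
  proof -
    have "q powi (- int r) - q powi int r = - (2 * \<i> * of_real (sin (pi * r / p)))"
      using q_powi_sin[of r] by (simp add: algebra_simps)
    thus ?thesis using evf[of 1] q_powi_sin by (simp add: algebra_simps)
  qed
  \<comment> \<open>as a product of two sines the argument lies in \<open>K\<close>, the domain of the Galois action in the trace\<close>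
  hence real: "ev f q \<in> \<real>" by simp
  \<comment> \<open>the automorphisms act on \<open>f(q)\<close> by replacing \<open>q\<close> with its odd powers\<close>
  have "Tr_K p (ev f q) = (\<Sum>s = 0..(p - 3) div 2. ev f (q ^ (2 * s + 1)))"
    unfolding Tr_K_def using galois_g_ev[OF _ real] by (intro sum.cong) auto
  also have "\<dots> = (\<Sum>m\<in>S. of_nat (a m) * (\<Sum>s = 0..(p - 3) div 2. 
      ((q ^ (2 * s + 1)) powi (- int r) - (q ^ (2 * s + 1)) powi int r) * 
      ((q ^ (2 * s + 1)) powi int m - (q ^ (2 * s + 1)) powi (- int m))))"
    unfolding evf sum_distrib_left by (rule sum.swap)
  also have "\<dots> = (\<Sum>m\<in>S. of_nat (a m) * (if m = r then of_nat p else 0))"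
  proof (intro sum.cong refl arg_cong2[of _ _ _ _ "(*)"])
    fix m assume m: "m \<in> S"
    define c where "c z = (\<Sum>s = 0..(p - 3) div 2. z ^ (2 * s + 1) + inverse z ^ (2 * s + 1))" for z :: complex
    let ?z = "q powi (int r - int m)" and ?w = "q powi (int r + int m)"
    have rm: "\<bar>int r - int m\<bar> < 2 * int p" using Sp[OF m] rp by linarith
    have ev: "even (int r - int m)" "even (int r + int m)" using S(2)[OF m] by auto
    have pow: "(q powi e) ^ p = 1" if "even e" for e :: int
    proof -
      have "(q powi e) ^ p = (q ^ p) powi e" 
        by (metis mult.commute power_int_mult power_int_of_nat)
      thus ?thesis using that by (simp add: q_pow_p)
    qed
    have "(\<Sum>s = 0..(p - 3) div 2. 
      ((q ^ (2 * s + 1)) powi (- int r) - (q ^ (2 * s + 1)) powi int r) * 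
      ((q ^ (2 * s + 1)) powi int m - (q ^ (2 * s + 1)) powi (- int m))) = c ?z - c ?w"
      unfolding c_def sum_subtractf[symmetric]
    proof (intro sum.cong refl)
      fix s
      let ?Q = "q ^ (2 * s + 1)"
      have Q0: "?Q \<noteq> 0" using q_nonzero by simp
      have pw: "(q powi e) ^ (2 * s + 1) = ?Q powi e" for e :: int
        by (metis mult.commute power_int_mult power_int_of_nat)
      have "?z ^ (2 * s + 1) = ?Q powi int r * ?Q powi (- int m)" "?w ^ (2 * s + 1) = ?Q powi int r * ?Q powi int m"
        unfolding pw by (simp_all only: diff_conv_add_uminus power_int_add[OF disjI1[OF Q0]])
      moreover have "inverse ?z ^ (2 * s + 1) = ?Q powi (- int r) * ?Q powi int m" 
        "inverse ?w ^ (2 * s + 1) = ?Q powi (- int r) * ?Q powi (- int m)"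
      proof -
        have "inverse ?z = q powi (- int r + int m)" "inverse ?w = q powi (- int r + - int m)" 
          by (simp_all add: power_int_minus[symmetric])
        thus "inverse ?z ^ (2 * s + 1) = ?Q powi (- int r) * ?Q powi int m" 
          "inverse ?w ^ (2 * s + 1) = ?Q powi (- int r) * ?Q powi (- int m)"
          unfolding pw by (simp_all only: pw power_int_add[OF disjI1[OF Q0]])
      qed
      ultimately show "(?Q powi (- int r) - ?Q powi int r) * (?Q powi int m - ?Q powi (- int m)) =
         ?z ^ (2 * s + 1) + inverse ?z ^ (2 * s + 1) - (?w ^ (2 * s + 1) + inverse ?w ^ (2 * s + 1))"
        by (simp add: algebra_simps)
    qed
    also have "c ?z = (if m = r then of_nat p - 1 else - 1)"
      unfolding c_def root_of_unity_half_sum[OF pow[OF ev(1)]] 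
      using q_powi_eq_1[of "int r - int m"] rm by auto
    also have "c ?w = - 1"
    proof -
      have "int r + int m \<noteq> 0" "\<bar>int r + int m\<bar> < 2 * int p" using r S(1) m by auto
      thus ?thesis unfolding c_def root_of_unity_half_sum[OF pow[OF ev(2)]] using q_powi_eq_1[of "int r + int m"] by simp
    qed
    finally show "(\<Sum>s = 0..(p - 3) div 2. 
      ((q ^ (2 * s + 1)) powi (- int r) - (q ^ (2 * s + 1)) powi int r) * 
      ((q ^ (2 * s + 1)) powi int m - (q ^ (2 * s + 1)) powi (- int m))) = (if m = r then of_nat p else 0)"
      by (simp split: if_splits)
  qed
  also have "\<dots> = (\<Sum>m\<in>S. if m = r then of_nat p * of_nat (a r) else 0)"
    by (intro sum.cong) auto
  also have "\<dots> = (if r \<in> S then of_nat p * of_nat (a r) else 0)" using finS by (simp add: sum.delta)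
  finally show ?thesis unfolding x .
qed

end

section \<open>Frobenius-Perron dimensions through the Verlinde fiber functor\<close>

context modular_cyclic
begin

text \<open>\<open>x \<mapsto> qdim (F x)\<close> is a character of the fusion category.  It is multiplicative because \<open>F\<close> is monoidal, and positive on
  simple objects because a faithful functor does not kill them.\<close>

lemma FPdim_fiber_functor:
  fixes C :: "('o, 'm, 'k) lin_mon_cat"
  assumes F: "symmetric_tensor_functor C VerP Fo Fm K \<epsilon>" and X: "X \<in> obj C"
  shows "FPdim C X = qdim (Fo X)"
proof -
  interpret F: symmetric_tensor_functor C VerP Fo Fm K \<epsilon> by (rule F)
  interpret S: schur_category C by (rule fusion_schur_category[OF F.C.symmetric_fusion_category_axioms])
  interpret L: linear_functor C VerP Fo Fm
    using F.Fo_obj F.Fm_hom F.Fm_idt F.Fm_cmp F.Fm_plu F.Fm_scl by unfold_locales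
  have tno: "tno VerP = rep_tensor G" by (simp add: Ver_eq quotient_cat_def)
  have Fo_reps: "Fo x \<in> reps G" if "x \<in> obj C" for x using F.Fo_obj[OF that] Ver_obj by simp
  have unit: "\<not> zero_obj C (unt C)"
  proof
    assume "zero_obj C (unt C)"
    hence "idt C (unt C) = nul C (unt C) (unt C)" by (simp add: zero_obj_def)
    hence "scl C 0 (idt C (unt C)) = scl C 1 (idt C (unt C))"
      using F.C.scl_nul[OF F.C.unt_obj F.C.unt_obj] by simp
    thus False using injD[OF bij_betw_imp_inj_on[OF F.C.End_unit], of 0 1] by simp
  qed
  show ?thesis
  proof (rule S.FPdim_eq_character[where d = "\<lambda>x. qdim (Fo x)"])
    show "\<exists>ss. finite ss \<and> (\<forall>x. simple_obj C x \<longrightarrow> (\<exists>s\<in>ss. simple_obj C s \<and> isomorphic C x s))"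
      by (rule F.C.finitely_many_simples)
    obtain xs where xs: "\<forall>s\<in>set xs. simple_obj C s" "is_direct_sum C (unt C) xs"
      using F.C.semisimple[OF F.C.unt_obj] by blast
    show "\<exists>s. simple_obj C s" using xs unit by (cases xs) (auto simp: F.C.is_direct_sum_Nil)
    show "qdim (Fo x) = sum_list (map (\<lambda>x. qdim (Fo x)) xs)" if "is_direct_sum C x xs" for x xs
      using qdim_add[OF L.is_direct_sum_map[OF that]] by (simp add: o_def)
    show "qdim (Fo (tno C x y)) = qdim (Fo x) * qdim (Fo y)" if "x \<in> obj C" "y \<in> obj C" for x y
    proof -
      have "isomorphic VerP (rep_tensor G (Fo x) (Fo y)) (Fo (tno C x y))"
        using F.J_hom[OF that] F.J_iso[OF that] unfolding isomorphic_def tno by blast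
      hence "qdim (rep_tensor G (Fo x) (Fo y)) = qdim (Fo (tno C x y))" by (rule qdim_iso)
      thus ?thesis using qdim_tensor[OF Fo_reps[OF that(1)] Fo_reps[OF that(2)]] by simp
    qed
    show "qdim (Fo s) > 0" if s: "simple_obj C s" for s
    proof -
      have so: "s \<in> obj C" "idt C s \<noteq> nul C s s" using S.simple_idt[OF s] by auto
      \<comment> \<open>faithfulness keeps \<open>F s\<close> nonzero\<close>
      have "Fm (idt C s) \<noteq> Fm (nul C s s)"
        using F.faithful[OF so(1) so(1)] F.C.idt_hom[OF so(1)] F.C.nul_hom[OF so(1) so(1)] so(2) by (auto simp: inj_on_def)
      hence "\<not> zero_obj VerP (Fo s)" using F.Fm_idt[OF so(1)] L.Fm_nul[OF so(1) so(1)] by (simp add: zero_obj_def)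
      thus ?thesis using qdim_pos[OF Fo_reps[OF so(1)]] by blast
    qed
  qed (use X F.C.tno_obj in auto)
qed

lemma Ver_L_sum_iff_J_sum:
  assumes "set rs \<subseteq> {1..<p}"
  shows "is_direct_sum VerP Y (map (Ver_L p) rs) \<longleftrightarrow> is_direct_sum VerP Y (map J rs)"
proof -
  have iso: "isomorphic VerP (Ver_L p n) (J n)" if "n \<in> set rs" for n
    using subsetD[OF assms that] by (intro Ver_L_iso_J) auto
  have "list_all2 (isomorphic VerP) (map (Ver_L p) rs) (map J rs)" 
    unfolding list.rel_map by (intro list.rel_refl_strong iso)
  moreover have "list_all2 (isomorphic VerP) (map J rs) (map (Ver_L p) rs)" 
    unfolding list.rel_map by (intro list.rel_refl_strong V.isomorphic_sym[OF iso])
  ultimately show ?thesis using V.is_direct_sum_iso_summands by blast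
qed

text \<open>The parts exist because a direct sum of blocks is again a representation, and whichever parts are chosen, the
  multiplicities of their simple summands are determined by those of \<open>Y\<close>.\<close>

lemma Ver_parts_dims:
  assumes Y: "is_direct_sum VerP Y (map (Ver_L p) rs)" and rs: "set rs \<subseteq> {1..<p}"
  shows "FPdim VerP (fst (Ver_parts p Y)) = (\<Sum>m\<in>{m \<in> {1..<p}. odd m}. qnum m * count_list rs m)"
    "FPdim VerP (snd (Ver_parts p Y)) = (\<Sum>m\<in>{m \<in> {1..<p}. even m}. qnum m * count_list rs m)"
proof -
  have rs': "1 \<le> m \<and> m \<le> p - 1" if "m \<in> set rs" for m using subsetD[OF rs that] by auto
  have YJ: "is_direct_sum VerP Y (map J rs)" using Y Ver_L_sum_iff_J_sum[OF rs] by blast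
  \<comment> \<open>the predicate under the choice operator in the definition of \<open>Ver_parts\<close>\<close>
  define R where "R Y1 Y2 \<longleftrightarrow> Y1 \<in> Ver_plus p \<and> Y2 \<in> Ver_minus p \<and> is_direct_sum VerP Y [Y1, Y2]" for Y1 Y2
  have "\<exists>Y1 Y2. R Y1 Y2"
  proof -
    let ?o = "filter odd rs" and ?e = "filter even rs"
    let ?A = "jordan_matrix (map (\<lambda>n. (n, 1::'k)) ?o)" and ?B = "jordan_matrix (map (\<lambda>n. (n, 1::'k)) ?e)"
    have s: "set ?o \<subseteq> {..p}" "set ?e \<subseteq> {..p}" using rs by auto
    note o = jordan_matrix_sum[OF s(1)] and e = jordan_matrix_sum[OF s(2)]
    have fs: "map (fst \<circ> (\<lambda>n. (n, 1::'k))) ms = ms" for ms :: "nat list" by (induction ms) auto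
    have c: "?A \<in> carrier_mat (sum_list ?o) (sum_list ?o)" "?B \<in> carrier_mat (sum_list ?e) (sum_list ?e)" 
      by (auto intro!: carrier_matI simp: fs)
    note bp = biproduct_cyc(3)[OF c(1) conjunct1[OF o] c(2) conjunct1[OF e]]
    \<comment> \<open>a concrete model of \<open>Y\<close> in which the two parts are visible\<close>
    define Z where "Z = cyc (four_block_mat ?A (0\<^sub>m (sum_list ?o) (sum_list ?e)) (0\<^sub>m (sum_list ?e) (sum_list ?o)) ?B)"
    have Z: "is_direct_sum VerP Z [cyc ?A, cyc ?B]" using F.is_direct_sum_map[OF bp] by (simp add: Z_def)
    have A: "is_direct_sum VerP (cyc ?A) (map J ?o)" using F.is_direct_sum_map[OF conjunct2[OF o]] by simp
    have B: "is_direct_sum VerP (cyc ?B) (map J ?e)" using F.is_direct_sum_map[OF conjunct2[OF e]] by simp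
    have "is_direct_sum VerP Z (map J ?o @ map J ?e)" by (rule V.is_direct_sum_append[OF Z A B])
    moreover have "mset ?o + mset ?e = mset rs" by (induction rs) auto
    hence "mset (map J ?o @ map J ?e) = mset (map J rs)" by (metis map_append mset_append mset_map)
    ultimately have "is_direct_sum VerP Z (map J rs)" by (rule V.is_direct_sum_perm)
    hence "isomorphic VerP Y Z" by (rule V.is_direct_sum_unique[OF YJ])
    hence "is_direct_sum VerP Y [cyc ?A, cyc ?B]" using V.is_direct_sum_iso Z by blast
    moreover have "cyc ?A \<in> Ver_plus p"
    proof -
      have "is_direct_sum VerP (cyc ?A) (map (Ver_L p) ?o)" using A rs by (subst Ver_L_sum_iff_J_sum) auto
      moreover have "set ?o \<subseteq> {r \<in> {1..p - 1}. odd r}" using rs' by auto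
      ultimately show ?thesis unfolding Ver_plus_def by blast
    qed
    moreover have "cyc ?B \<in> Ver_minus p"
    proof -
      have "is_direct_sum VerP (cyc ?B) (map (Ver_L p) ?e)" using B rs by (subst Ver_L_sum_iff_J_sum) auto
      moreover have "set ?e \<subseteq> {r \<in> {1..p - 1}. even r}" using rs' by auto
      ultimately show ?thesis unfolding Ver_minus_def by blast
    qed
    ultimately show ?thesis unfolding R_def by blast
  qed
  hence "\<exists>z. case_prod R z" by auto
  hence "case_prod R (SOME z. case_prod R z)" by (rule someI_ex)
  moreover have "Ver_parts p Y = (SOME z. case_prod R z)" unfolding Ver_parts_def R_def[abs_def] ..
  ultimately have "case Ver_parts p Y of (Y1, Y2) \<Rightarrow> R Y1 Y2" by simp
  then obtain Y1 Y2 where parts: "Ver_parts p Y = (Y1, Y2)" and R: "R Y1 Y2" by (cases "Ver_parts p Y") auto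
  obtain os where os: "set os \<subseteq> {r \<in> {1..p - 1}. odd r}" "is_direct_sum VerP Y1 (map (Ver_L p) os)"
    using R unfolding R_def Ver_plus_def by blast
  obtain es where es: "set es \<subseteq> {r \<in> {1..p - 1}. even r}" "is_direct_sum VerP Y2 (map (Ver_L p) es)"
    using R unfolding R_def Ver_minus_def by blast
  have os1: "set os \<subseteq> {1..<p}" and es1: "set es \<subseteq> {1..<p}" using os(1) es(1) by force+
  have Y1: "is_direct_sum VerP Y1 (map J os)" and Y2: "is_direct_sum VerP Y2 (map J es)"
    using os(2) es(2) Ver_L_sum_iff_J_sum[OF os1] Ver_L_sum_iff_J_sum[OF es1] by blast+
  have "is_direct_sum VerP Y (map J (os @ es))"
    using V.is_direct_sum_append[OF _ Y1 Y2] R unfolding R_def by simp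
  hence count: "count_list rs m = count_list os m + count_list es m" if "m \<in> {1..<p}" for m
    using B.multiplicity_of_L[OF that rs YJ] B.multiplicity_of_L[OF that, of "os @ es" Y] os1 es1 by simp
  have zero: "count_list os m = 0" if "even m" for m using os(1) that by (intro count_notin) auto
  have zero': "count_list es m = 0" if "odd m" for m using es(1) that by (intro count_notin) auto
  have "FPdim VerP Y1 = sum_list (map qnum os)"
    using FPdim_Ver[of Y1] qdim_sum[OF Y1] os1 V.is_direct_sum_obj(1)[OF Y1] Ver_obj by fastforce
  also have "\<dots> = (\<Sum>m\<in>{1..<p}. qnum m * count_list os m)" using os1 by (intro sum_list_count[symmetric]) auto
  also have "\<dots> = (\<Sum>m\<in>{m \<in> {1..<p}. odd m}. qnum m * count_list rs m)"
    using count zero zero' by (intro sum.mono_neutral_cong_right) auto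
  finally show "FPdim VerP (fst (Ver_parts p Y)) = (\<Sum>m\<in>{m \<in> {1..<p}. odd m}. qnum m * count_list rs m)"
    by (simp add: parts)
  have "FPdim VerP Y2 = sum_list (map qnum es)"
    using FPdim_Ver[of Y2] qdim_sum[OF Y2] es1 V.is_direct_sum_obj(1)[OF Y2] Ver_obj by fastforce
  also have "\<dots> = (\<Sum>m\<in>{1..<p}. qnum m * count_list es m)" using es1 by (intro sum_list_count[symmetric]) auto
  also have "\<dots> = (\<Sum>m\<in>{m \<in> {1..<p}. even m}. qnum m * count_list rs m)"
    using count zero zero' by (intro sum.mono_neutral_cong_right) auto
  finally show "FPdim VerP (snd (Ver_parts p Y)) = (\<Sum>m\<in>{m \<in> {1..<p}. even m}. qnum m * count_list rs m)"
    by (simp add: parts)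
qed

end

lemma count_list_concat_replicate:
  "distinct xs \<Longrightarrow> count_list (concat (map (\<lambda>s. replicate (a s) s) xs)) m = (if m \<in> set xs then a m else 0)"
proof (induction xs)
  case (Cons x xs)
  have "count_list (replicate n x) m = (if m = x then n else 0)" for n by (induction n) auto
  thus ?case using Cons by auto
qed simp

text \<open>The three equations express that the trace form picks out the coefficient of \<open>[r]\<close>.  The combination
  \<open>FPdim X - (-1)\<^sup>r SFPdim X\<close> is twice \<open>d\<^sub>+\<close> or twice \<open>d\<^sub>-\<close>, according to the parity of \<open>r\<close>, whence the factor \<open>1 / 2p\<close>.\<close>

theorem theorem5p1:
  fixes C :: "('o, 'm, 'k :: alg_closed_field) lin_mon_cat"
    and Fo :: "'o \<Rightarrow> 'k ver_obj" and Fm :: "'m \<Rightarrow> 'k ver_arr"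
    and J :: "'o \<Rightarrow> 'o \<Rightarrow> 'k ver_arr" and \<epsilon> :: "'k ver_arr"
    and p :: nat and X :: 'o and a :: "nat \<Rightarrow> nat" and r :: nat and q :: complex
  assumes "CHAR('k) = p" and "p > 2"
    and "symmetric_fusion_category C"
    and "symmetric_tensor_functor C (Ver p) Fo Fm J \<epsilon>"
    and "X \<in> obj C"
    and "is_direct_sum (Ver p) (Fo X) (concat (map (\<lambda>s. replicate (a s) (Ver_L p s)) [1..<p]))"
    and "1 \<le> r" and "r \<le> p - 1"
    and "q = root_q p"
  shows "of_nat (a r) = 1 / (2 * of_nat p) *
           Tr_K p ((q powi (- int r) - q powi (int r)) * (q - q powi (- 1)) *
             of_real (FPdim C X - (- 1) ^ r * SFPdim p Fo X)) \<and>
         (odd r \<longrightarrow> of_nat (a r) = 1 / of_nat p *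
           Tr_K p ((q powi (- int r) - q powi (int r)) * (q - q powi (- 1)) *
             of_real (d_plus p Fo X))) \<and>
         (even r \<longrightarrow> of_nat (a r) = 1 / of_nat p *
           Tr_K p ((q powi (- int r) - q powi (int r)) * (q - q powi (- 1)) *
             of_real (d_minus p Fo X)))"
proof -
  interpret M: modular_cyclic p "TYPE('k)" using assms(1,2) by unfold_locales
  interpret P: odd_prime p using M.prime_p assms(2) by unfold_locales
  define rs where "rs = concat (map (\<lambda>s. replicate (a s) s) [1..<p])"
  have rs: "set rs \<subseteq> {1..<p}" by (auto simp: rs_def)
  have count: "count_list rs m = a m" if "m \<in> {1..<p}" for m
    using that unfolding rs_def by (subst count_list_concat_replicate) auto
  have "concat (map (\<lambda>s. replicate (a s) (Ver_L p s)) [1..<p]) = (map (Ver_L p) rs :: 'k ver_obj list)"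
    by (simp add: rs_def map_concat o_def)
  hence Y: "is_direct_sum (Ver p) (Fo X) (map (Ver_L p) rs)" using assms(6) by (simp only:)
  define Od where "Od = {m \<in> {1..<p}. odd m}"
  define E where "E = {m \<in> {1..<p}. even m}"
  define dim where "dim b S = (\<Sum>m\<in>S. real (b m) * (sin (pi * m / p) / sin (pi / p)))" for b :: "nat \<Rightarrow> nat" and S
  have plus: "d_plus p Fo X = dim a Od"
    unfolding d_plus_def M.Ver_parts_dims(1)[OF Y rs] dim_def Od_def
    using count by (intro sum.cong) (auto simp: M.qnum_def)
  have minus: "d_minus p Fo X = dim a E"
    unfolding d_minus_def M.Ver_parts_dims(2)[OF Y rs] dim_def E_def
    using count by (intro sum.cong) (auto simp: M.qnum_def)
  have "FPdim C X = M.qdim (Fo X)" by (rule M.FPdim_fiber_functor[OF assms(4,5)])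
  also have "\<dots> = sum_list (map M.qnum rs)"
    using Y M.Ver_L_sum_iff_J_sum[OF rs] rs by (intro M.qdim_sum) auto
  also have "\<dots> = (\<Sum>m\<in>{1..<p}. M.qnum m * count_list rs m)" 
    using rs by (intro M.sum_list_count[symmetric]) auto
  also have "\<dots> = dim a {1..<p}" unfolding dim_def using count by (intro sum.cong) (auto simp: M.qnum_def)
  also have "{1..<p} = Od \<union> E" by (auto simp: Od_def E_def)
  also have "dim a (Od \<union> E) = dim a Od + dim a E" 
    unfolding dim_def by (rule sum.union_disjoint) (auto simp: Od_def E_def)
  finally have total: "FPdim C X = d_plus p Fo X + d_minus p Fo X" using plus minus by simp
  have r: "r \<in> {1..<p}" using assms(2,7,8) by auto
  have double: "2 * dim a S = dim (\<lambda>m. 2 * a m) S" for S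
    by (simp add: dim_def sum_distrib_left mult.assoc)
  note trace = P.trace_orthogonality[where r = r, OF _ _ r, folded dim_def assms(9)]
  have p0: "(of_nat p :: complex) \<noteq> 0" using assms(2) by simp
  show ?thesis
  proof (cases "odd r")
    case True
    have S: "Od \<subseteq> {1..<p}" "\<And>m. m \<in> Od \<Longrightarrow> even (m + r)" "r \<in> Od" using True r by (auto simp: Od_def)
    have "FPdim C X - (- 1) ^ r * SFPdim p Fo X = dim (\<lambda>m. 2 * a m) Od"
      using True total plus by (simp add: SFPdim_def double[symmetric])
    thus ?thesis using True trace[OF S(1,2), of a] trace[OF S(1,2), of "\<lambda>m. 2 * a m"] S(3) plus p0 by simp
  next
    case False
    have S: "E \<subseteq> {1..<p}" "\<And>m. m \<in> E \<Longrightarrow> even (m + r)" "r \<in> E" using False r by (auto simp: E_def)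
    have "FPdim C X - (- 1) ^ r * SFPdim p Fo X = dim (\<lambda>m. 2 * a m) E"
      using False total minus by (simp add: SFPdim_def double[symmetric])
    thus ?thesis using False trace[OF S(1,2), of a] trace[OF S(1,2), of "\<lambda>m. 2 * a m"] S(3) minus p0 by simp
  qed
qed

end
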